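(* Let $H$ be a finite dimensional Hopf algebra over a field $k$, and let $G=\mathrm{Aut}_{Hopf}(H)\times \mathrm{Aut}_{Hopf}(H)$ with multiplication $(\alpha,\beta)*(\gamma,\delta)=(\alpha\gamma,\ \delta\gamma^{-1}\beta\gamma)$. Then the braided T-category $\mathrm{Rep}(DT(H))$ of representations of the quasitriangular T-coalgebra $DT(H)$ and the braided T-category $\mathcal{YD}(H)$ are isomorphic as braided T-categories over $G$.
   Context: $\otimes=\otimes_k$; $S$ is the antipode of $H$ (bijective); $\Delta(h)=h_1\otimes h_2$ is Sweedler notation. $\mathrm{Aut}_{Hopf}(H)$ is the group of Hopf algebra automorphisms of $H$. $(G,* )$ is a group with unit $(\mathrm{id},\mathrm{id})$ and $(\alpha,\beta)^{-1}=(\alpha^{-1},\alpha\beta^{-1}\alpha^{-1})$. **Braided T-categories.** A braided T-category over a group $G$ is a (strict, up to the usual identifications of vector spaces) monoidal category $\mathcal T$ that is a disjoint union of subcategories $\mathcal T_a$ ($a\in G$), with $U\otimes V\in\mathcal T_{ab}$ for $U\in\mathcal T_a$, $V\in\mathcal T_b$ and unit object in $\mathcal T_1$; together with a group homomorphism $\varphi$ from $G$ to the group of invertible strict monoidal endofunctors of $\mathcal T$ with $\varphi_b(\mathcal T_a)=\mathcal T_{bab^{-1}}$; and a natural family of isomorphisms $c_{U,V}:U\otimes V\to{}^UV\otimes U$ (where ${}^UV=\varphi_a(V)$ for $U\in\mathcal T_a$) with $c_{U\otimes V,W}=(c_{U,{}^VW}\otimes\mathrm{id}_V)(\mathrm{id}_U\otimes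 c_{V,W})$, $c_{U,V\otimes W}=(\mathrm{id}_{{}^UV}\otimes c_{U,W})(c_{U,V}\otimes\mathrm{id}_W)$ and $\varphi_b(c_{U,V})=c_{\varphi_b(U),\varphi_b(V)}$. An isomorphism of braided T-categories over $G$ is an invertible strict monoidal functor that maps the component of index $a$ onto the component of index $a$ for each $a\in G$, commutes with the functors $\varphi_b$, and carries the braiding to the braiding. **The category $\mathcal{YD}(H)$.** For $\alpha,\beta\in \mathrm{Aut}_{Hopf}(H)$, ${}_H\mathcal{YD}^H(\alpha,\beta)$ is the category of vector spaces $M$ that are left $H$-modules and right $H$-comodules ($m\mapsto m_{(0)}\otimes m_{(1)}$) with $$(h\cdot m)_{(0)}\otimes (h\cdot m)_{(1)}=h_2\cdot m_{(0)}\otimes \beta(h_3)\,m_{(1)}\,\alpha(S^{-1}(h_1)),$$ with $H$-linear $H$-colinear maps as morphisms. $\mathcal{YD}(H)$ is the disjoint union of these categories over $(\alpha,\beta)\in G$. For $M\in{}_H\mathcal{YD}^H(\alpha,\beta)$, $N\in{}_H\mathcal{YD}^H(\gamma,\delta)$: $M\otimes N\in{}_H\mathcal{YD}^H((\alpha,\beta)*(\gamma,\delta))$ with $h\cdot(m\otimes n)=\gamma(h_1)\cdot m\otimes\gamma^{-1}\beta\gamma(h_2)\cdot n$ and $m\otimes n\mapsto(m_{(0)}\otimes n_{(0)})\otimes n_{(1)}m_{(1)}$; the unit is $k$ with trivial structures; $\varphi_{(\alpha,\beta)}(N)={}^{(\alpha,\beta)}N\in {}_H\mathcal{YD}^H((\alpha,\beta)*(\gamma,\delta)*(\alpha,\beta)^{-1})$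 is $N$ with $h\rightharpoonup n=\gamma^{-1}\beta\gamma\alpha^{-1}(h)\cdot n$ and $n\mapsto n_{(0)}\otimes\alpha\beta^{-1}(n_{(1)})$ (identity on morphisms); the braiding is $c_{M,N}:M\otimes N\to{}^{(\alpha,\beta)}N\otimes M$, $c_{M,N}(m\otimes n)=n_{(0)}\otimes\beta^{-1}(n_{(1)})\cdot m$. **The T-coalgebra $DT(H)$.** $H^*$ has convolution product, coproduct $p\mapsto p_1\otimes p_2$ with $p(hl)=p_1(h)p_2(l)$, $S^{*-1}(p)=p\circ S^{-1}$, and $H$ acts by $(h\rightharpoonup p)(l)=p(lh)$, $(p\leftharpoonup h)(l)=p(hl)$. The component $DT(H)_{(\alpha,\beta)}$ is the algebra $H^*\bowtie H(\alpha,\beta)$ with underlying space $H^*\otimes H$, unit $\varepsilon\bowtie1$ and multiplication $$(p\bowtie h)(q\bowtie l)=p\big(\alpha(h_1)\rightharpoonup q\leftharpoonup S^{-1}(\beta(h_3))\big)\bowtie h_2l.$$ Its structure maps are: $\Delta_{(\alpha,\beta),(\gamma,\delta)}(p\bowtie h)=(p_2\bowtie\gamma(h_1))\otimes(p_1\bowtie\gamma^{-1}\beta\gamma(h_2))$, from $DT(H)_{(\alpha,\beta)*(\gamma,\delta)}$ to $DT(H)_{(\alpha,\beta)}\otimes DT(H)_{(\gamma,\delta)}$; $\varepsilon(p\bowtie h)=p(1)\varepsilon(h)$ on $DT(H)_{(\mathrm{id},\mathrm{id})}=D(H)$; $\varphi_{(\alpha,\beta)}^{(\gamma,\delta)}(p\bowtie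 h)=p\circ\beta\alpha^{-1}\bowtie\alpha\gamma^{-1}\beta^{-1}\gamma(h)$, from $DT(H)_{(\gamma,\delta)}$ to $DT(H)_{(\alpha,\beta)*(\gamma,\delta)*(\alpha,\beta)^{-1}}$; antipode $S_{(\alpha,\beta)}(p\bowtie h)=(\varepsilon\bowtie\alpha\beta(S(h)))\cdot(S^{*-1}(p)\bowtie1)$, product in $DT(H)_{(\alpha,\beta)^{-1}}$; $R_{(\alpha,\beta),(\gamma,\delta)}=\sum_i(\varepsilon\bowtie\beta^{-1}(e_i))\otimes(e^i\bowtie1)\in DT(H)_{(\alpha,\beta)}\otimes DT(H)_{(\gamma,\delta)}$, with $\{e_i\},\{e^i\}$ dual bases of $H$, $H^*$. **Representations.** For a quasitriangular T-coalgebra $A=\{A_a\}_{a\in G}$ with structure $\Delta_{a,b},\varepsilon,\varphi_b,R_{a,b}$, $\mathrm{Rep}(A)$ is the disjoint union over $a\in G$ of the categories of left $A_a$-modules. For an $A_a$-module $U$ and an $A_b$-module $V$, $U\otimes V$ is an $A_{ab}$-module through $\Delta_{a,b}$; the unit is $k$ with $A_1$ acting through $\varepsilon$; $\varphi_b(U)$ is $U$ as vector space with $x\in A_{bab^{-1}}$ acting as $\varphi_{b^{-1}}(x)\in A_a$ (identity on morphisms); the braiding is $c_{U,V}(u\otimes v)=\tau\big(R_{a,b}\cdot(u\otimes v)\big)$ with $\tau$ the flip. *)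

theory Defs
  imports
    "HOL-Library.FuncSet"
    "HOL-Algebra.Group"
    "Jordan_Normal_Form.Missing_VectorSpace"
    "Jordan_Normal_Form.VS_Connect"
begin

section \<open>Monoidal categories and braided T-categories\<close>

record ('o, 'm) monoidal_cat =
  Obj :: "'o set"
  Arr :: "'m set"
  Dom :: "'m \<Rightarrow> 'o"
  Cod :: "'m \<Rightarrow> 'o"
  Ide :: "'o \<Rightarrow> 'm"
  Cmp :: "'m \<Rightarrow> 'm \<Rightarrow> 'm"
  TenO :: "'o \<Rightarrow> 'o \<Rightarrow> 'o"
  TenA :: "'m \<Rightarrow> 'm \<Rightarrow> 'm"
  UnitO :: "'o"
  Assoc :: "'o \<Rightarrow> 'o \<Rightarrow> 'o \<Rightarrow> 'm"
  LUnit :: "'o \<Rightarrow> 'm"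
  RUnit :: "'o \<Rightarrow> 'm"

text \<open>\<open>Cmp C g f\<close> is the composite ``g after f''.\<close>

definition arrow :: "('o, 'm, 'z) monoidal_cat_scheme \<Rightarrow> 'o \<Rightarrow> 'o \<Rightarrow> 'm \<Rightarrow> bool" where
  "arrow C a b f \<longleftrightarrow> f \<in> Arr C \<and> Dom C f = a \<and> Cod C f = b"

locale category =
  fixes C :: "('o, 'm, 'z) monoidal_cat_scheme"
  assumes dom_cod: "f \<in> Arr C \<Longrightarrow> Dom C f \<in> Obj C \<and> Cod C f \<in> Obj C"
    and ide: "a \<in> Obj C \<Longrightarrow> arrow C a a (Ide C a)"
    and cmp: "arrow C a b f \<Longrightarrow> arrow C b c g \<Longrightarrow> arrow C a c (Cmp C g f)"
    and cmp_ide: "arrow C a b f \<Longrightarrow> Cmp C f (Ide C a) = f"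
    and ide_cmp: "arrow C a b f \<Longrightarrow> Cmp C (Ide C b) f = f"
    and cmp_assoc: "arrow C a b f \<Longrightarrow> arrow C b c g \<Longrightarrow> arrow C c d h \<Longrightarrow>
      Cmp C h (Cmp C g f) = Cmp C (Cmp C h g) f"

definition inverse_arrows :: "('o, 'm, 'z) monoidal_cat_scheme \<Rightarrow> 'm \<Rightarrow> 'm \<Rightarrow> bool" where
  "inverse_arrows C f g \<longleftrightarrow> f \<in> Arr C \<and> g \<in> Arr C \<and> Dom C g = Cod C f \<and> Cod C g = Dom C f \<and>
     Cmp C g f = Ide C (Dom C f) \<and> Cmp C f g = Ide C (Cod C f)"

definition iso_arrow :: "('o, 'm, 'z) monoidal_cat_scheme \<Rightarrow> 'o \<Rightarrow> 'o \<Rightarrow> 'm \<Rightarrow> bool" where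
  "iso_arrow C a b f \<longleftrightarrow> arrow C a b f \<and> (\<exists>g. inverse_arrows C f g)"

definition inv_arrow :: "('o, 'm, 'z) monoidal_cat_scheme \<Rightarrow> 'm \<Rightarrow> 'm" where
  "inv_arrow C f = (THE g. inverse_arrows C f g)"

locale monoidal_category = category +
  assumes tenO: "a \<in> Obj C \<Longrightarrow> b \<in> Obj C \<Longrightarrow> TenO C a b \<in> Obj C"
    and tenA: "arrow C a b f \<Longrightarrow> arrow C a' b' f' \<Longrightarrow>
      arrow C (TenO C a a') (TenO C b b') (TenA C f f')"
    and tenA_ide: "a \<in> Obj C \<Longrightarrow> b \<in> Obj C \<Longrightarrow> TenA C (Ide C a) (Ide C b) = Ide C (TenO C a b)"
    and tenA_cmp: "arrow C a b f \<Longrightarrow> arrow C b c g \<Longrightarrow> arrow C a' b' f' \<Longrightarrow> arrow C b' c' g' \<Longrightarrow>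
      TenA C (Cmp C g f) (Cmp C g' f') = Cmp C (TenA C g g') (TenA C f f')"
    and unitO: "UnitO C \<in> Obj C"
    and assoc_iso: "a \<in> Obj C \<Longrightarrow> b \<in> Obj C \<Longrightarrow> c \<in> Obj C \<Longrightarrow>
      iso_arrow C (TenO C (TenO C a b) c) (TenO C a (TenO C b c)) (Assoc C a b c)"
    and assoc_natural: "arrow C a a' f \<Longrightarrow> arrow C b b' g \<Longrightarrow> arrow C c c' h \<Longrightarrow>
      Cmp C (Assoc C a' b' c') (TenA C (TenA C f g) h) =
      Cmp C (TenA C f (TenA C g h)) (Assoc C a b c)"
    and lunit_iso: "a \<in> Obj C \<Longrightarrow> iso_arrow C (TenO C (UnitO C) a) a (LUnit C a)"
    and lunit_natural: "arrow C a b f \<Longrightarrow>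
      Cmp C (LUnit C b) (TenA C (Ide C (UnitO C)) f) = Cmp C f (LUnit C a)"
    and runit_iso: "a \<in> Obj C \<Longrightarrow> iso_arrow C (TenO C a (UnitO C)) a (RUnit C a)"
    and runit_natural: "arrow C a b f \<Longrightarrow>
      Cmp C (RUnit C b) (TenA C f (Ide C (UnitO C))) = Cmp C f (RUnit C a)"
    and pentagon: "a \<in> Obj C \<Longrightarrow> b \<in> Obj C \<Longrightarrow> c \<in> Obj C \<Longrightarrow> d \<in> Obj C \<Longrightarrow>
      Cmp C (Assoc C a b (TenO C c d)) (Assoc C (TenO C a b) c d) =
      Cmp C (TenA C (Ide C a) (Assoc C b c d))
        (Cmp C (Assoc C a (TenO C b c) d) (TenA C (Assoc C a b c) (Ide C d)))"
    and triangle: "a \<in> Obj C \<Longrightarrow> b \<in> Obj C \<Longrightarrow>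
      Cmp C (TenA C (Ide C a) (LUnit C b)) (Assoc C a (UnitO C) b) =
      TenA C (RUnit C a) (Ide C b)"

definition is_functor :: "('o, 'm, 'z) monoidal_cat_scheme \<Rightarrow> ('p, 'n, 'y) monoidal_cat_scheme \<Rightarrow>
    ('o \<Rightarrow> 'p) \<Rightarrow> ('m \<Rightarrow> 'n) \<Rightarrow> bool" where
  "is_functor C D FO FA \<longleftrightarrow>
     (\<forall>a\<in>Obj C. FO a \<in> Obj D) \<and>
     (\<forall>f\<in>Arr C. arrow D (FO (Dom C f)) (FO (Cod C f)) (FA f)) \<and>
     (\<forall>a\<in>Obj C. FA (Ide C a) = Ide D (FO a)) \<and>
     (\<forall>f\<in>Arr C. \<forall>g\<in>Arr C. Dom C g = Cod C f \<longrightarrow> FA (Cmp C g f) = Cmp D (FA g) (FA f))"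

definition strict_monoidal_functor ::
    "('o, 'm, 'z) monoidal_cat_scheme \<Rightarrow> ('p, 'n, 'y) monoidal_cat_scheme \<Rightarrow>
      ('o \<Rightarrow> 'p) \<Rightarrow> ('m \<Rightarrow> 'n) \<Rightarrow> bool" where
  "strict_monoidal_functor C D FO FA \<longleftrightarrow>
     is_functor C D FO FA \<and>
     (\<forall>a\<in>Obj C. \<forall>b\<in>Obj C. FO (TenO C a b) = TenO D (FO a) (FO b)) \<and>
     (\<forall>f\<in>Arr C. \<forall>g\<in>Arr C. FA (TenA C f g) = TenA D (FA f) (FA g)) \<and>
     FO (UnitO C) = UnitO D \<and>
     (\<forall>a\<in>Obj C. \<forall>b\<in>Obj C. \<forall>c\<in>Obj C.
        FA (Assoc C a b c) = Assoc D (FO a) (FO b) (FO c)) \<and>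
     (\<forall>a\<in>Obj C. FA (LUnit C a) = LUnit D (FO a) \<and> FA (RUnit C a) = RUnit D (FO a))"

definition invertible_strict_monoidal_functor ::
    "('o, 'm, 'z) monoidal_cat_scheme \<Rightarrow> ('p, 'n, 'y) monoidal_cat_scheme \<Rightarrow>
      ('o \<Rightarrow> 'p) \<Rightarrow> ('m \<Rightarrow> 'n) \<Rightarrow> bool" where
  "invertible_strict_monoidal_functor C D FO FA \<longleftrightarrow>
     strict_monoidal_functor C D FO FA \<and>
     bij_betw FO (Obj C) (Obj D) \<and> bij_betw FA (Arr C) (Arr D)"

text \<open>A category graded by a group: \<open>Part C a\<close> is the set of objects of the component of index
  \<open>a\<close>, and the arrows of that component are the arrows between those objects.\<close>

record ('g, 'o, 'm) T_cat = "('o, 'm) monoidal_cat" +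
  Part :: "'g \<Rightarrow> 'o set"
  PhiO :: "'g \<Rightarrow> 'o \<Rightarrow> 'o"
  PhiA :: "'g \<Rightarrow> 'm \<Rightarrow> 'm"
  Braid :: "'o \<Rightarrow> 'o \<Rightarrow> 'm"

definition part_arrows :: "('g, 'o, 'm, 'z) T_cat_scheme \<Rightarrow> 'g \<Rightarrow> 'm set" where
  "part_arrows C a = {f \<in> Arr C. Dom C f \<in> Part C a \<and> Cod C f \<in> Part C a}"

text \<open>The monoidal structure of vector spaces is not literally strict, so the two hexagon
  identities carry the associativity constraints.\<close>

locale braided_T_category = group G + monoidal_category C
  for G :: "('g, 'y) monoid_scheme" and C :: "('g, 'o, 'm, 'z) T_cat_scheme" +
  assumes obj_union: "Obj C = (\<Union>a\<in>carrier G. Part C a)"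
    and obj_disjoint: "a \<in> carrier G \<Longrightarrow> b \<in> carrier G \<Longrightarrow> a \<noteq> b \<Longrightarrow> Part C a \<inter> Part C b = {}"
    and arr_union: "Arr C = (\<Union>a\<in>carrier G. part_arrows C a)"
    and part_ten: "a \<in> carrier G \<Longrightarrow> b \<in> carrier G \<Longrightarrow> U \<in> Part C a \<Longrightarrow> V \<in> Part C b \<Longrightarrow>
      TenO C U V \<in> Part C (a \<otimes>\<^bsub>G\<^esub> b)"
    and part_unit: "UnitO C \<in> Part C \<one>\<^bsub>G\<^esub>"
    and phi_functor: "a \<in> carrier G \<Longrightarrow>
      invertible_strict_monoidal_functor C C (PhiO C a) (PhiA C a)"
    and phi_hom_obj: "a \<in> carrier G \<Longrightarrow> b \<in> carrier G \<Longrightarrow> U \<in> Obj C \<Longrightarrow>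
      PhiO C (a \<otimes>\<^bsub>G\<^esub> b) U = PhiO C a (PhiO C b U)"
    and phi_hom_arr: "a \<in> carrier G \<Longrightarrow> b \<in> carrier G \<Longrightarrow> f \<in> Arr C \<Longrightarrow>
      PhiA C (a \<otimes>\<^bsub>G\<^esub> b) f = PhiA C a (PhiA C b f)"
    and phi_part_obj: "a \<in> carrier G \<Longrightarrow> b \<in> carrier G \<Longrightarrow>
      PhiO C b ` Part C a = Part C (b \<otimes>\<^bsub>G\<^esub> a \<otimes>\<^bsub>G\<^esub> inv\<^bsub>G\<^esub> b)"
    and phi_part_arr: "a \<in> carrier G \<Longrightarrow> b \<in> carrier G \<Longrightarrow>
      PhiA C b ` part_arrows C a = part_arrows C (b \<otimes>\<^bsub>G\<^esub> a \<otimes>\<^bsub>G\<^esub> inv\<^bsub>G\<^esub> b)"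
    and braid_iso: "a \<in> carrier G \<Longrightarrow> U \<in> Part C a \<Longrightarrow> V \<in> Obj C \<Longrightarrow>
      iso_arrow C (TenO C U V) (TenO C (PhiO C a V) U) (Braid C U V)"
    and braid_natural: "a \<in> carrier G \<Longrightarrow> U \<in> Part C a \<Longrightarrow> arrow C U U' f \<Longrightarrow> arrow C V V' g \<Longrightarrow>
      Cmp C (Braid C U' V') (TenA C f g) = Cmp C (TenA C (PhiA C a g) f) (Braid C U V)"
    and braid_ten_left: "a \<in> carrier G \<Longrightarrow> b \<in> carrier G \<Longrightarrow>
      U \<in> Part C a \<Longrightarrow> V \<in> Part C b \<Longrightarrow> W \<in> Obj C \<Longrightarrow>
      Braid C (TenO C U V) W =
        Cmp C (Assoc C (PhiO C a (PhiO C b W)) U V)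
        (Cmp C (TenA C (Braid C U (PhiO C b W)) (Ide C V))
        (Cmp C (inv_arrow C (Assoc C U (PhiO C b W) V))
        (Cmp C (TenA C (Ide C U) (Braid C V W))
          (Assoc C U V W))))"
    and braid_ten_right: "a \<in> carrier G \<Longrightarrow> U \<in> Part C a \<Longrightarrow> V \<in> Obj C \<Longrightarrow> W \<in> Obj C \<Longrightarrow>
      Braid C U (TenO C V W) =
        Cmp C (inv_arrow C (Assoc C (PhiO C a V) (PhiO C a W) U))
        (Cmp C (TenA C (Ide C (PhiO C a V)) (Braid C U W))
        (Cmp C (Assoc C (PhiO C a V) U W)
        (Cmp C (TenA C (Braid C U V) (Ide C W))
          (inv_arrow C (Assoc C U V W)))))"
    and braid_phi: "b \<in> carrier G \<Longrightarrow> U \<in> Obj C \<Longrightarrow> V \<in> Obj C \<Longrightarrow>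
      PhiA C b (Braid C U V) = Braid C (PhiO C b U) (PhiO C b V)"

definition braided_T_iso ::
    "('g, 'y) monoid_scheme \<Rightarrow> ('g, 'o, 'm, 'z) T_cat_scheme \<Rightarrow> ('g, 'p, 'n, 'x) T_cat_scheme \<Rightarrow>
      ('o \<Rightarrow> 'p) \<Rightarrow> ('m \<Rightarrow> 'n) \<Rightarrow> bool" where
  "braided_T_iso G C D FO FA \<longleftrightarrow>
     invertible_strict_monoidal_functor C D FO FA \<and>
     (\<forall>a\<in>carrier G. FO ` Part C a = Part D a \<and> FA ` part_arrows C a = part_arrows D a) \<and>
     (\<forall>b\<in>carrier G. (\<forall>U\<in>Obj C. FO (PhiO C b U) = PhiO D b (FO U)) \<and>
                     (\<forall>f\<in>Arr C. FA (PhiA C b f) = PhiA D b (FA f))) \<and>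
     (\<forall>U\<in>Obj C. \<forall>V\<in>Obj C. FA (Braid C U V) = Braid D (FO U) (FO V))"

definition isomorphic_braided_T_categories ::
    "('g, 'y) monoid_scheme \<Rightarrow> ('g, 'o, 'm, 'z) T_cat_scheme \<Rightarrow> ('g, 'p, 'n, 'x) T_cat_scheme \<Rightarrow> bool"
  where
  "isomorphic_braided_T_categories G C D \<longleftrightarrow>
     braided_T_category G C \<and> braided_T_category G D \<and> (\<exists>FO FA. braided_T_iso G C D FO FA)"


section \<open>Tensor products of vector spaces\<close>

text \<open>A \<open>k\<close>-vector space is a \<open>vectorspace class_ring V\<close>, where \<open>class_ring\<close> is the field \<open>'k\<close>
  viewed as a ring record. The record type \<open>module\<close> also has multiplicative fields; they carry the
  product of an algebra and are \<open>undefined\<close> for a mere vector space.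

  An element of \<open>tensor V W\<close> is a list \<open>[(v1, w1), ..., (vn, wn)]\<close>, read as the sum of the
  \<open>vi \<otimes> wi\<close>: namely the chosen representative of its class modulo the relations of the tensor
  product. Hence a sum in Sweedler notation is a list comprehension over the given tensor.\<close>

inductive tensor_eq ::
    "('k::field, 'a) module \<Rightarrow> ('k, 'b) module \<Rightarrow> ('a \<times> 'b) list \<Rightarrow> ('a \<times> 'b) list \<Rightarrow> bool"
  for V W where
  refl: "set xs \<subseteq> carrier V \<times> carrier W \<Longrightarrow> tensor_eq V W xs xs"
| sym: "tensor_eq V W xs ys \<Longrightarrow> tensor_eq V W ys xs"
| trans: "tensor_eq V W xs ys \<Longrightarrow> tensor_eq V W ys zs \<Longrightarrow> tensor_eq V W xs zs"
| append: "tensor_eq V W xs xs' \<Longrightarrow> tensor_eq V W ys ys' \<Longrightarrow> tensor_eq V W (xs @ ys) (xs' @ ys')"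
| commute: "set xs \<subseteq> carrier V \<times> carrier W \<Longrightarrow> set ys \<subseteq> carrier V \<times> carrier W \<Longrightarrow>
    tensor_eq V W (xs @ ys) (ys @ xs)"
| zero: "w \<in> carrier W \<Longrightarrow> tensor_eq V W [(\<zero>\<^bsub>V\<^esub>, w)] []"
| add_left: "v \<in> carrier V \<Longrightarrow> v' \<in> carrier V \<Longrightarrow> w \<in> carrier W \<Longrightarrow>
    tensor_eq V W [(v \<oplus>\<^bsub>V\<^esub> v', w)] [(v, w), (v', w)]"
| add_right: "v \<in> carrier V \<Longrightarrow> w \<in> carrier W \<Longrightarrow> w' \<in> carrier W \<Longrightarrow>
    tensor_eq V W [(v, w \<oplus>\<^bsub>W\<^esub> w')] [(v, w), (v, w')]"
| smult: "v \<in> carrier V \<Longrightarrow> w \<in> carrier W \<Longrightarrow>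
    tensor_eq V W [(c \<odot>\<^bsub>V\<^esub> v, w)] [(v, c \<odot>\<^bsub>W\<^esub> w)]"

definition tcls ::
    "('k::field, 'a) module \<Rightarrow> ('k, 'b) module \<Rightarrow> ('a \<times> 'b) list \<Rightarrow> ('a \<times> 'b) list" where
  "tcls V W xs = (SOME ys. tensor_eq V W xs ys)"

definition tensor ::
    "('k::field, 'a) module \<Rightarrow> ('k, 'b) module \<Rightarrow> ('k, ('a \<times> 'b) list) module" where
  "tensor V W =
    (let T = tcls V W ` lists (carrier V \<times> carrier W) in
     \<lparr>carrier = T, mult = undefined, one = undefined, zero = tcls V W [],
      add = (\<lambda>x y. if x \<in> T \<and> y \<in> T then tcls V W (x @ y) else undefined),
      smult = (\<lambda>c x. if x \<in> T then tcls V W [(c \<odot>\<^bsub>V\<^esub> v, w). (v, w) \<leftarrow> x] else undefined)\<rparr>)"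

text \<open>The universe in which the vector spaces underlying the objects of the categories live. It
  contains the field, an arbitrary type of atoms, and is closed under tensor products.\<close>

datatype ('k, 'a) vuniv =
    Scalar (the_scalar: 'k)
  | Atom 'a
  | Tens (summands: "(('k, 'a) vuniv \<times> ('k, 'a) vuniv) list")

type_synonym ('k, 'a) vspace = "('k, ('k, 'a) vuniv) module"

text \<open>The operations of a vector space are normalised off the carrier, so that equality of records
  is equality of vector spaces.\<close>

definition is_vspace :: "('k::field, 'a) vspace \<Rightarrow> bool" where
  "is_vspace V \<longleftrightarrow> vectorspace class_ring V \<and> mult V = undefined \<and> one V = undefined \<and>
     (\<forall>x y. \<not> (x \<in> carrier V \<and> y \<in> carrier V) \<longrightarrow> x \<oplus>\<^bsub>V\<^esub> y = undefined) \<and>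
     (\<forall>c x. x \<notin> carrier V \<longrightarrow> c \<odot>\<^bsub>V\<^esub> x = undefined)"

definition unit_space :: "('k::field, 'a) vspace" where
  "unit_space =
    (let K = range Scalar in
     \<lparr>carrier = K, mult = undefined, one = undefined, zero = Scalar 0,
      add = (\<lambda>x y. if x \<in> K \<and> y \<in> K then Scalar (the_scalar x + the_scalar y) else undefined),
      smult = (\<lambda>c x. if x \<in> K then Scalar (c * the_scalar x) else undefined)\<rparr>)"

definition utens ::
    "('k::field, 'a) vspace \<Rightarrow> ('k, 'a) vspace \<Rightarrow> (('k, 'a) vuniv \<times> ('k, 'a) vuniv) list \<Rightarrow>
      ('k, 'a) vuniv" where
  "utens V W xs = Tens (tcls V W xs)"

definition tensor_space :: "('k::field, 'a) vspace \<Rightarrow> ('k, 'a) vspace \<Rightarrow> ('k, 'a) vspace" where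
  "tensor_space V W =
    (let T = Tens ` carrier (tensor V W) in
     \<lparr>carrier = T, mult = undefined, one = undefined, zero = Tens \<zero>\<^bsub>tensor V W\<^esub>,
      add = (\<lambda>x y. if x \<in> T \<and> y \<in> T then Tens (summands x \<oplus>\<^bsub>tensor V W\<^esub> summands y) else undefined),
      smult = (\<lambda>c x. if x \<in> T then Tens (c \<odot>\<^bsub>tensor V W\<^esub> summands x) else undefined)\<rparr>)"

definition tensor_map ::
    "('k::field, 'a) vspace \<Rightarrow> ('k, 'a) vspace \<Rightarrow> ('k, 'a) vspace \<Rightarrow> ('k, 'a) vspace \<Rightarrow>
      (('k, 'a) vuniv \<Rightarrow> ('k, 'a) vuniv) \<Rightarrow> (('k, 'a) vuniv \<Rightarrow> ('k, 'a) vuniv) \<Rightarrow>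
      ('k, 'a) vuniv \<Rightarrow> ('k, 'a) vuniv" where
  "tensor_map V W V' W' f g =
    (\<lambda>x\<in>carrier (tensor_space V W). utens V' W' [(f v, g w). (v, w) \<leftarrow> summands x])"

definition assoc_map ::
    "('k::field, 'a) vspace \<Rightarrow> ('k, 'a) vspace \<Rightarrow> ('k, 'a) vspace \<Rightarrow>
      ('k, 'a) vuniv \<Rightarrow> ('k, 'a) vuniv" where
  "assoc_map U V W =
    (\<lambda>x\<in>carrier (tensor_space (tensor_space U V) W).
       utens U (tensor_space V W) [(u, utens V W [(v, w)]). (t, w) \<leftarrow> summands x, (u, v) \<leftarrow> summands t])"

definition lunit_map :: "('k::field, 'a) vspace \<Rightarrow> ('k, 'a) vuniv \<Rightarrow> ('k, 'a) vuniv" where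
  "lunit_map V = (\<lambda>x\<in>carrier (tensor_space unit_space V).
     abelian_monoid.sumlist V [the_scalar s \<odot>\<^bsub>V\<^esub> v. (s, v) \<leftarrow> summands x])"

definition runit_map :: "('k::field, 'a) vspace \<Rightarrow> ('k, 'a) vuniv \<Rightarrow> ('k, 'a) vuniv" where
  "runit_map V = (\<lambda>x\<in>carrier (tensor_space V unit_space).
     abelian_monoid.sumlist V [the_scalar s \<odot>\<^bsub>V\<^esub> v. (v, s) \<leftarrow> summands x])"

text \<open>Both categories consist of vector spaces with extra structure; their arrows are triples
  (source, structure-preserving linear map, target), their associativity and unit constraints are
  those of vector spaces, and the functors \<open>\<phi>\<^sub>b\<close> are the identity on the underlying maps. The
  parameters are the objects, the hom-sets, the underlying spaces, the indices in the group, the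
  tensor product of objects, the unit object, \<open>\<phi>\<close> on objects, and the maps underlying the
  braiding.\<close>

definition T_cat_over_vspaces ::
    "'o set \<Rightarrow> ('o \<Rightarrow> 'o \<Rightarrow> (('k::field, 'a) vuniv \<Rightarrow> ('k, 'a) vuniv) set) \<Rightarrow>
      ('o \<Rightarrow> ('k, 'a) vspace) \<Rightarrow> ('o \<Rightarrow> 'g) \<Rightarrow> ('o \<Rightarrow> 'o \<Rightarrow> 'o) \<Rightarrow> 'o \<Rightarrow> ('g \<Rightarrow> 'o \<Rightarrow> 'o) \<Rightarrow>
      ('o \<Rightarrow> 'o \<Rightarrow> ('k, 'a) vuniv \<Rightarrow> ('k, 'a) vuniv) \<Rightarrow>
      ('g, 'o, 'o \<times> (('k, 'a) vuniv \<Rightarrow> ('k, 'a) vuniv) \<times> 'o) T_cat" where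
  "T_cat_over_vspaces objs homs space index ten unit phi braid =
    \<lparr>Obj = objs,
     Arr = {(M, f, N). M \<in> objs \<and> N \<in> objs \<and> f \<in> homs M N},
     Dom = (\<lambda>(M, f, N). M),
     Cod = (\<lambda>(M, f, N). N),
     Ide = (\<lambda>M. (M, \<lambda>x\<in>carrier (space M). x, M)),
     Cmp = (\<lambda>(M', g, N') (M, f, N). (M, compose (carrier (space M)) g f, N')),
     TenO = ten,
     TenA = (\<lambda>(M, f, N) (M', f', N').
        (ten M M', tensor_map (space M) (space M') (space N) (space N') f f', ten N N')),
     UnitO = unit,
     Assoc = (\<lambda>L M N. (ten (ten L M) N, assoc_map (space L) (space M) (space N), ten L (ten M N))),
     LUnit = (\<lambda>M. (ten unit M, lunit_map (space M), M)),
     RUnit = (\<lambda>M. (ten M unit, runit_map (space M), M)),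
     Part = (\<lambda>a. {M \<in> objs. index M = a}),
     PhiO = phi,
     PhiA = (\<lambda>b (M, f, N). (phi b M, f, phi b N)),
     Braid = (\<lambda>M N. (ten M N, braid M N, ten (phi (index M) N) M))\<rparr>"

definition left_module ::
    "('k::field, 'x) module \<Rightarrow> ('k, 'a) vspace \<Rightarrow> ('x \<Rightarrow> ('k, 'a) vuniv \<Rightarrow> ('k, 'a) vuniv) \<Rightarrow> bool"
  where
  "left_module A V act \<longleftrightarrow>
     is_vspace V \<and> act \<in> extensional (carrier A) \<and>
     (\<forall>x\<in>carrier A. act x \<in> extensional (carrier V) \<and> act x \<in> LinearCombinations.module_hom class_ring V V) \<and>
     (\<forall>x\<in>carrier A. \<forall>y\<in>carrier A. \<forall>v\<in>carrier V. act (x \<oplus>\<^bsub>A\<^esub> y) v = act x v \<oplus>\<^bsub>V\<^esub> act y v) \<and>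
     (\<forall>c. \<forall>x\<in>carrier A. \<forall>v\<in>carrier V. act (c \<odot>\<^bsub>A\<^esub> x) v = c \<odot>\<^bsub>V\<^esub> act x v) \<and>
     (\<forall>x\<in>carrier A. \<forall>y\<in>carrier A. \<forall>v\<in>carrier V. act (x \<otimes>\<^bsub>A\<^esub> y) v = act x (act y v)) \<and>
     (\<forall>v\<in>carrier V. act \<one>\<^bsub>A\<^esub> v = v)"


section \<open>Hopf algebras\<close>

text \<open>The function inverse; the notation \<open>inv\<close> is taken by the inverse in a group.\<close>

abbreviation finv :: "('b \<Rightarrow> 'c) \<Rightarrow> 'c \<Rightarrow> 'b" where
  "finv \<equiv> inv_into UNIV"

record ('k, 'h) hopf_data =
  scl :: "'k \<Rightarrow> 'h \<Rightarrow> 'h"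
  comul :: "'h \<Rightarrow> ('h \<times> 'h) list"
  counit :: "'h \<Rightarrow> 'k"
  antipode :: "'h \<Rightarrow> 'h"

definition alg :: "('k::field, 'h::ring_1) hopf_data \<Rightarrow> ('k, 'h) module" where
  "alg H = \<lparr>carrier = UNIV, mult = (*), one = 1, zero = 0, add = (+), smult = scl H\<rparr>"

locale hopf_algebra =
  fixes H :: "('k::field, 'h::ring_1) hopf_data"
  assumes vector_space: "vector_space (scl H)"
    and scl_mult_left: "scl H c x * y = scl H c (x * y)"
    and scl_mult_right: "x * scl H c y = scl H c (x * y)"
    and comul_linear: "comul H \<in> LinearCombinations.module_hom class_ring (alg H) (tensor (alg H) (alg H))"
    and coassoc:
      "tcls (alg H) (tensor (alg H) (alg H))
         [(a1, tcls (alg H) (alg H) [(a2, b)]). (a, b) \<leftarrow> comul H x, (a1, a2) \<leftarrow> comul H a] =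
       tcls (alg H) (tensor (alg H) (alg H)) [(a, comul H b). (a, b) \<leftarrow> comul H x]"
    and counit_linear: "Vector_Spaces.linear (scl H) (*) (counit H)"
    and counit_left: "(\<Sum>(a, b)\<leftarrow>comul H x. scl H (counit H a) b) = x"
    and counit_right: "(\<Sum>(a, b)\<leftarrow>comul H x. scl H (counit H b) a) = x"
    and comul_mult: "comul H (x * y) =
      tcls (alg H) (alg H) [(a * c, b * d). (a, b) \<leftarrow> comul H x, (c, d) \<leftarrow> comul H y]"
    and comul_one: "comul H 1 = tcls (alg H) (alg H) [(1, 1)]"
    and counit_mult: "counit H (x * y) = counit H x * counit H y"
    and counit_one: "counit H 1 = 1"
    and antipode_linear: "Vector_Spaces.linear (scl H) (scl H) (antipode H)"
    and antipode_left: "(\<Sum>(a, b)\<leftarrow>comul H x. antipode H a * b) = scl H (counit H x) 1"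
    and antipode_right: "(\<Sum>(a, b)\<leftarrow>comul H x. a * antipode H b) = scl H (counit H x) 1"

definition hopf_aut :: "('k::field, 'h::ring_1) hopf_data \<Rightarrow> ('h \<Rightarrow> 'h) set" where
  "hopf_aut H = {\<alpha>. bij \<alpha> \<and> Vector_Spaces.linear (scl H) (scl H) \<alpha> \<and>
     (\<forall>x y. \<alpha> (x * y) = \<alpha> x * \<alpha> y) \<and> \<alpha> 1 = 1 \<and>
     (\<forall>x. comul H (\<alpha> x) = tcls (alg H) (alg H) [(\<alpha> a, \<alpha> b). (a, b) \<leftarrow> comul H x]) \<and>
     (\<forall>x. counit H (\<alpha> x) = counit H x) \<and>
     (\<forall>x. antipode H (\<alpha> x) = \<alpha> (antipode H x))}"

type_synonym 'h aut_pair = "('h \<Rightarrow> 'h) \<times> ('h \<Rightarrow> 'h)"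

definition aut_group :: "('k::field, 'h::ring_1) hopf_data \<Rightarrow> 'h aut_pair monoid" where
  "aut_group H =
    \<lparr>carrier = hopf_aut H \<times> hopf_aut H,
     mult = (\<lambda>(\<alpha>, \<beta>) (\<gamma>, \<delta>). (\<alpha> \<circ> \<gamma>, \<delta> \<circ> finv \<gamma> \<circ> \<beta> \<circ> \<gamma>)),
     one = (id, id)\<rparr>"


section \<open>Yetter-Drinfeld modules\<close>

record ('k, 'h, 'a) yd_obj =
  yd_index :: "'h aut_pair"
  yd_space :: "('k, 'a) vspace"
  yd_act :: "'h \<Rightarrow> ('k, 'a) vuniv \<Rightarrow> ('k, 'a) vuniv"
  yd_coact :: "('k, 'a) vuniv \<Rightarrow> (('k, 'a) vuniv \<times> 'h) list"

definition right_comodule ::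
    "('k::field, 'h::ring_1) hopf_data \<Rightarrow> ('k, 'a) vspace \<Rightarrow>
      (('k, 'a) vuniv \<Rightarrow> (('k, 'a) vuniv \<times> 'h) list) \<Rightarrow> bool" where
  "right_comodule H V \<rho> \<longleftrightarrow>
     is_vspace V \<and> \<rho> \<in> extensional (carrier V) \<and>
     \<rho> \<in> LinearCombinations.module_hom class_ring V (tensor V (alg H)) \<and>
     (\<forall>m\<in>carrier V.
        tcls V (tensor (alg H) (alg H))
          [(m00, tcls (alg H) (alg H) [(m01, m1)]). (m0, m1) \<leftarrow> \<rho> m, (m00, m01) \<leftarrow> \<rho> m0] =
        tcls V (tensor (alg H) (alg H)) [(m0, comul H m1). (m0, m1) \<leftarrow> \<rho> m]) \<and>
     (\<forall>m\<in>carrier V. abelian_monoid.sumlist V [counit H m1 \<odot>\<^bsub>V\<^esub> m0. (m0, m1) \<leftarrow> \<rho> m] = m)"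

definition yd_module ::
    "('k::field, 'h::ring_1) hopf_data \<Rightarrow> 'h aut_pair \<Rightarrow> ('k, 'h, 'a) yd_obj \<Rightarrow> bool" where
  "yd_module H = (\<lambda>(\<alpha>, \<beta>) M.
     left_module (alg H) (yd_space M) (yd_act M) \<and>
     right_comodule H (yd_space M) (yd_coact M) \<and>
     (\<forall>h. \<forall>m\<in>carrier (yd_space M).
        yd_coact M (yd_act M h m) =
        tcls (yd_space M) (alg H)
          [(yd_act M h2 m0, \<beta> h3 * m1 * \<alpha> (finv (antipode H) h1)).
             (h1, h') \<leftarrow> comul H h, (h2, h3) \<leftarrow> comul H h', (m0, m1) \<leftarrow> yd_coact M m]))"

definition yd_objects :: "('k::field, 'h::ring_1) hopf_data \<Rightarrow> ('k, 'h, 'a) yd_obj set" where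
  "yd_objects H = {M. yd_index M \<in> carrier (aut_group H) \<and> yd_module H (yd_index M) M}"

definition yd_homs ::
    "('k::field, 'h::ring_1) hopf_data \<Rightarrow> ('k, 'h, 'a) yd_obj \<Rightarrow> ('k, 'h, 'a) yd_obj \<Rightarrow>
      (('k, 'a) vuniv \<Rightarrow> ('k, 'a) vuniv) set" where
  "yd_homs H M N = {f. yd_index M = yd_index N \<and>
     f \<in> extensional (carrier (yd_space M)) \<and>
     f \<in> LinearCombinations.module_hom class_ring (yd_space M) (yd_space N) \<and>
     (\<forall>h. \<forall>m\<in>carrier (yd_space M). f (yd_act M h m) = yd_act N h (f m)) \<and>
     (\<forall>m\<in>carrier (yd_space M).
        yd_coact N (f m) = tcls (yd_space N) (alg H) [(f m0, m1). (m0, m1) \<leftarrow> yd_coact M m])}"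

definition yd_tensor ::
    "('k::field, 'h::ring_1) hopf_data \<Rightarrow> ('k, 'h, 'a) yd_obj \<Rightarrow> ('k, 'h, 'a) yd_obj \<Rightarrow>
      ('k, 'h, 'a) yd_obj" where
  "yd_tensor H M N =
    (let (\<alpha>, \<beta>) = yd_index M; (\<gamma>, \<delta>) = yd_index N;
         V = yd_space M; W = yd_space N; T = tensor_space V W in
     \<lparr>yd_index = yd_index M \<otimes>\<^bsub>aut_group H\<^esub> yd_index N,
      yd_space = T,
      yd_act = (\<lambda>h. \<lambda>x\<in>carrier T.
        utens V W [(yd_act M (\<gamma> h1) m, yd_act N (finv \<gamma> (\<beta> (\<gamma> h2))) n).
                     (m, n) \<leftarrow> summands x, (h1, h2) \<leftarrow> comul H h]),
      yd_coact = (\<lambda>x\<in>carrier T.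
        tcls T (alg H) [(utens V W [(m0, n0)], n1 * m1).
                          (m, n) \<leftarrow> summands x, (m0, m1) \<leftarrow> yd_coact M m, (n0, n1) \<leftarrow> yd_coact N n])\<rparr>)"

definition yd_unit :: "('k::field, 'h::ring_1) hopf_data \<Rightarrow> ('k, 'h, 'a) yd_obj" where
  "yd_unit H =
    \<lparr>yd_index = (id, id),
     yd_space = unit_space,
     yd_act = (\<lambda>h. \<lambda>s\<in>carrier unit_space. counit H h \<odot>\<^bsub>unit_space\<^esub> s),
     yd_coact = (\<lambda>s\<in>carrier unit_space. tcls unit_space (alg H) [(s, 1)])\<rparr>"

definition yd_phi ::
    "('k::field, 'h::ring_1) hopf_data \<Rightarrow> 'h aut_pair \<Rightarrow> ('k, 'h, 'a) yd_obj \<Rightarrow>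
      ('k, 'h, 'a) yd_obj" where
  "yd_phi H = (\<lambda>(\<alpha>, \<beta>) N.
    (let (\<gamma>, \<delta>) = yd_index N; V = yd_space N in
     \<lparr>yd_index = (\<alpha>, \<beta>) \<otimes>\<^bsub>aut_group H\<^esub> (\<gamma>, \<delta>) \<otimes>\<^bsub>aut_group H\<^esub> inv\<^bsub>aut_group H\<^esub> (\<alpha>, \<beta>),
      yd_space = V,
      yd_act = (\<lambda>h. \<lambda>n\<in>carrier V. yd_act N (finv \<gamma> (\<beta> (\<gamma> (finv \<alpha> h)))) n),
      yd_coact = (\<lambda>n\<in>carrier V.
        tcls V (alg H) [(n0, \<alpha> (finv \<beta> n1)). (n0, n1) \<leftarrow> yd_coact N n])\<rparr>))"

definition yd_braid ::
    "('k::field, 'h::ring_1) hopf_data \<Rightarrow> ('k, 'h, 'a) yd_obj \<Rightarrow> ('k, 'h, 'a) yd_obj \<Rightarrow>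
      ('k, 'a) vuniv \<Rightarrow> ('k, 'a) vuniv" where
  "yd_braid H M N =
    (let (\<alpha>, \<beta>) = yd_index M in
     (\<lambda>x\<in>carrier (tensor_space (yd_space M) (yd_space N)).
       utens (yd_space N) (yd_space M)
         [(n0, yd_act M (finv \<beta> n1) m). (m, n) \<leftarrow> summands x, (n0, n1) \<leftarrow> yd_coact N n]))"

definition YD ::
    "('k::field, 'h::ring_1) hopf_data \<Rightarrow>
      ('h aut_pair, ('k, 'h, 'a) yd_obj,
       ('k, 'h, 'a) yd_obj \<times> (('k, 'a) vuniv \<Rightarrow> ('k, 'a) vuniv) \<times> ('k, 'h, 'a) yd_obj) T_cat" where
  "YD H = T_cat_over_vspaces (yd_objects H) (yd_homs H) yd_space yd_index
            (yd_tensor H) (yd_unit H) (yd_phi H) (yd_braid H)"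


section \<open>T-coalgebras and their representations\<close>

text \<open>\<open>crossing A b a\<close> is \<open>\<phi>\<^sub>b\<close> on the component of index \<open>a\<close>.\<close>

record ('g, 'k, 'x) T_coalgebra =
  component :: "'g \<Rightarrow> ('k, 'x) module"
  coproduct :: "'g \<Rightarrow> 'g \<Rightarrow> 'x \<Rightarrow> ('x \<times> 'x) list"
  T_counit :: "'x \<Rightarrow> 'k"
  crossing :: "'g \<Rightarrow> 'g \<Rightarrow> 'x \<Rightarrow> 'x"
  T_antipode :: "'g \<Rightarrow> 'x \<Rightarrow> 'x"
  R_matrix :: "'g \<Rightarrow> 'g \<Rightarrow> ('x \<times> 'x) list"

record ('g, 'k, 'x, 'a) rep_obj =
  rep_index :: 'g
  rep_space :: "('k, 'a) vspace"
  rep_act :: "'x \<Rightarrow> ('k, 'a) vuniv \<Rightarrow> ('k, 'a) vuniv"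

definition rep_objects ::
    "'g monoid \<Rightarrow> ('g, 'k::field, 'x) T_coalgebra \<Rightarrow> ('g, 'k, 'x, 'a) rep_obj set" where
  "rep_objects G A = {U. rep_index U \<in> carrier G \<and>
     left_module (component A (rep_index U)) (rep_space U) (rep_act U)}"

definition rep_homs ::
    "('g, 'k::field, 'x) T_coalgebra \<Rightarrow> ('g, 'k, 'x, 'a) rep_obj \<Rightarrow> ('g, 'k, 'x, 'a) rep_obj \<Rightarrow>
      (('k, 'a) vuniv \<Rightarrow> ('k, 'a) vuniv) set" where
  "rep_homs A U V = {f. rep_index U = rep_index V \<and>
     f \<in> extensional (carrier (rep_space U)) \<and>
     f \<in> LinearCombinations.module_hom class_ring (rep_space U) (rep_space V) \<and>
     (\<forall>x\<in>carrier (component A (rep_index U)). \<forall>u\<in>carrier (rep_space U).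
        f (rep_act U x u) = rep_act V x (f u))}"

definition rep_tensor ::
    "'g monoid \<Rightarrow> ('g, 'k::field, 'x) T_coalgebra \<Rightarrow> ('g, 'k, 'x, 'a) rep_obj \<Rightarrow>
      ('g, 'k, 'x, 'a) rep_obj \<Rightarrow> ('g, 'k, 'x, 'a) rep_obj" where
  "rep_tensor G A U V =
    (let a = rep_index U; b = rep_index V; T = tensor_space (rep_space U) (rep_space V) in
     \<lparr>rep_index = a \<otimes>\<^bsub>G\<^esub> b,
      rep_space = T,
      rep_act = (\<lambda>x\<in>carrier (component A (a \<otimes>\<^bsub>G\<^esub> b)). \<lambda>t\<in>carrier T.
        utens (rep_space U) (rep_space V)
          [(rep_act U x1 u, rep_act V x2 v). (u, v) \<leftarrow> summands t, (x1, x2) \<leftarrow> coproduct A a b x])\<rparr>)"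

definition rep_unit ::
    "'g monoid \<Rightarrow> ('g, 'k::field, 'x) T_coalgebra \<Rightarrow> ('g, 'k, 'x, 'a) rep_obj" where
  "rep_unit G A =
    \<lparr>rep_index = \<one>\<^bsub>G\<^esub>,
     rep_space = unit_space,
     rep_act = (\<lambda>x\<in>carrier (component A \<one>\<^bsub>G\<^esub>). \<lambda>s\<in>carrier unit_space.
       T_counit A x \<odot>\<^bsub>unit_space\<^esub> s)\<rparr>"

definition rep_phi ::
    "'g monoid \<Rightarrow> ('g, 'k::field, 'x) T_coalgebra \<Rightarrow> 'g \<Rightarrow> ('g, 'k, 'x, 'a) rep_obj \<Rightarrow>
      ('g, 'k, 'x, 'a) rep_obj" where
  "rep_phi G A b U =
    (let c = b \<otimes>\<^bsub>G\<^esub> rep_index U \<otimes>\<^bsub>G\<^esub> inv\<^bsub>G\<^esub> b in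
     \<lparr>rep_index = c,
      rep_space = rep_space U,
      rep_act = (\<lambda>x\<in>carrier (component A c). rep_act U (crossing A (inv\<^bsub>G\<^esub> b) c x))\<rparr>)"

definition rep_braid ::
    "('g, 'k::field, 'x) T_coalgebra \<Rightarrow> ('g, 'k, 'x, 'a) rep_obj \<Rightarrow> ('g, 'k, 'x, 'a) rep_obj \<Rightarrow>
      ('k, 'a) vuniv \<Rightarrow> ('k, 'a) vuniv" where
  "rep_braid A U V =
    (\<lambda>t\<in>carrier (tensor_space (rep_space U) (rep_space V)).
       utens (rep_space V) (rep_space U)
         [(rep_act V r2 v, rep_act U r1 u).
            (u, v) \<leftarrow> summands t, (r1, r2) \<leftarrow> R_matrix A (rep_index U) (rep_index V)])"

definition Rep ::
    "'g monoid \<Rightarrow> ('g, 'k::field, 'x) T_coalgebra \<Rightarrow>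
      ('g, ('g, 'k, 'x, 'a) rep_obj,
       ('g, 'k, 'x, 'a) rep_obj \<times> (('k, 'a) vuniv \<Rightarrow> ('k, 'a) vuniv) \<times> ('g, 'k, 'x, 'a) rep_obj) T_cat"
  where
  "Rep G A = T_cat_over_vspaces (rep_objects G A) (rep_homs A) rep_space rep_index
               (rep_tensor G A) (rep_unit G A) (rep_phi G A) (rep_braid A)"


section \<open>The T-coalgebra \<open>DT(H)\<close>\<close>

definition convolution ::
    "('k::field, 'h::ring_1) hopf_data \<Rightarrow> ('h \<Rightarrow> 'k) \<Rightarrow> ('h \<Rightarrow> 'k) \<Rightarrow> 'h \<Rightarrow> 'k" where
  "convolution H p q = (\<lambda>h. \<Sum>(a, b)\<leftarrow>comul H h. p a * q b)"

definition dual :: "('k::field, 'h::ring_1) hopf_data \<Rightarrow> ('k, 'h \<Rightarrow> 'k) module" where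
  "dual H =
    \<lparr>carrier = {p. Vector_Spaces.linear (scl H) (*) p},
     mult = convolution H, one = counit H,
     zero = (\<lambda>h. 0), add = (\<lambda>p q h. p h + q h), smult = (\<lambda>c p h. c * p h)\<rparr>"

definition dual_comul ::
    "('k::field, 'h::ring_1) hopf_data \<Rightarrow> ('h \<Rightarrow> 'k) \<Rightarrow> (('h \<Rightarrow> 'k) \<times> ('h \<Rightarrow> 'k)) list" where
  "dual_comul H p = (THE t. t \<in> carrier (tensor (dual H) (dual H)) \<and>
     (\<forall>h l. p (h * l) = (\<Sum>(p1, p2)\<leftarrow>t. p1 h * p2 l)))"

definition lharp :: "'h::ring_1 \<Rightarrow> ('h \<Rightarrow> 'k) \<Rightarrow> 'h \<Rightarrow> 'k" where
  "lharp h p = (\<lambda>l. p (l * h))"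

definition rharp :: "('h \<Rightarrow> 'k) \<Rightarrow> 'h::ring_1 \<Rightarrow> 'h \<Rightarrow> 'k" where
  "rharp p h = (\<lambda>l. p (h * l))"

type_synonym ('k, 'h) dt = "(('h \<Rightarrow> 'k) \<times> 'h) list"

abbreviation dcls :: "('k::field, 'h::ring_1) hopf_data \<Rightarrow> (('h \<Rightarrow> 'k) \<times> 'h) list \<Rightarrow> ('k, 'h) dt" where
  "dcls H \<equiv> tcls (dual H) (alg H)"

abbreviation bow :: "('k::field, 'h::ring_1) hopf_data \<Rightarrow> ('h \<Rightarrow> 'k) \<Rightarrow> 'h \<Rightarrow> ('k, 'h) dt" where
  "bow H p h \<equiv> dcls H [(p, h)]"

definition dt_component ::
    "('k::field, 'h::ring_1) hopf_data \<Rightarrow> 'h aut_pair \<Rightarrow> ('k, ('k, 'h) dt) module" where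
  "dt_component H = (\<lambda>(\<alpha>, \<beta>).
    (tensor (dual H) (alg H))
      \<lparr>mult := (\<lambda>x y. dcls H
         [(convolution H p (rharp (lharp (\<alpha> h1) q) (finv (antipode H) (\<beta> h3))), h2 * l).
            (p, h) \<leftarrow> x, (q, l) \<leftarrow> y, (h1, h') \<leftarrow> comul H h, (h2, h3) \<leftarrow> comul H h']),
       one := bow H (counit H) 1\<rparr>)"

definition dt_coproduct ::
    "('k::field, 'h::ring_1) hopf_data \<Rightarrow> 'h aut_pair \<Rightarrow> 'h aut_pair \<Rightarrow> ('k, 'h) dt \<Rightarrow>
      (('k, 'h) dt \<times> ('k, 'h) dt) list" where
  "dt_coproduct H = (\<lambda>(\<alpha>, \<beta>) (\<gamma>, \<delta>) x.
     tcls (dt_component H (\<alpha>, \<beta>)) (dt_component H (\<gamma>, \<delta>))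
       [(bow H p2 (\<gamma> h1), bow H p1 (finv \<gamma> (\<beta> (\<gamma> h2)))).
          (p, h) \<leftarrow> x, (p1, p2) \<leftarrow> dual_comul H p, (h1, h2) \<leftarrow> comul H h])"

definition dt_counit :: "('k::field, 'h::ring_1) hopf_data \<Rightarrow> ('k, 'h) dt \<Rightarrow> 'k" where
  "dt_counit H x = (\<Sum>(p, h)\<leftarrow>x. p 1 * counit H h)"

definition dt_crossing ::
    "('k::field, 'h::ring_1) hopf_data \<Rightarrow> 'h aut_pair \<Rightarrow> 'h aut_pair \<Rightarrow> ('k, 'h) dt \<Rightarrow> ('k, 'h) dt"
  where
  "dt_crossing H = (\<lambda>(\<alpha>, \<beta>) (\<gamma>, \<delta>) x.
     dcls H [(p \<circ> \<beta> \<circ> finv \<alpha>, \<alpha> (finv \<gamma> (finv \<beta> (\<gamma> h)))). (p, h) \<leftarrow> x])"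

definition dt_antipode ::
    "('k::field, 'h::ring_1) hopf_data \<Rightarrow> 'h aut_pair \<Rightarrow> ('k, 'h) dt \<Rightarrow> ('k, 'h) dt" where
  "dt_antipode H = (\<lambda>(\<alpha>, \<beta>) x.
     (let D = dt_component H (inv\<^bsub>aut_group H\<^esub> (\<alpha>, \<beta>)) in
      abelian_monoid.sumlist D
        [bow H (counit H) (\<alpha> (\<beta> (antipode H h))) \<otimes>\<^bsub>D\<^esub> bow H (p \<circ> finv (antipode H)) 1. (p, h) \<leftarrow> x]))"

text \<open>The \<open>R\<close>-matrix is computed from a basis \<open>B\<close> of \<open>H\<close> and the dual basis of coordinate
  functionals.\<close>

definition dual_basis :: "('k::field, 'h::ring_1) hopf_data \<Rightarrow> 'h set \<Rightarrow> 'h \<Rightarrow> 'h \<Rightarrow> 'k" where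
  "dual_basis H B e = (\<lambda>h. Modules.module.representation (scl H) B h e)"

definition dt_R ::
    "('k::field, 'h::ring_1) hopf_data \<Rightarrow> 'h set \<Rightarrow> 'h aut_pair \<Rightarrow> 'h aut_pair \<Rightarrow>
      (('k, 'h) dt \<times> ('k, 'h) dt) list" where
  "dt_R H B = (\<lambda>(\<alpha>, \<beta>) (\<gamma>, \<delta>).
     (let D = dt_component H (\<alpha>, \<beta>); E = dt_component H (\<gamma>, \<delta>) in
      finsum (tensor D E)
        (\<lambda>e. tcls D E [(bow H (counit H) (finv \<beta> e), bow H (dual_basis H B e) 1)]) B))"

definition DT ::
    "('k::field, 'h::ring_1) hopf_data \<Rightarrow> 'h set \<Rightarrow> ('h aut_pair, 'k, ('k, 'h) dt) T_coalgebra" where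
  "DT H B =
    \<lparr>component = dt_component H,
     coproduct = dt_coproduct H,
     T_counit = dt_counit H,
     crossing = dt_crossing H,
     T_antipode = dt_antipode H,
     R_matrix = dt_R H B\<rparr>"

end

theory Submission
  imports Defs
begin

text \<open>An object \<open>M\<close> of index \<open>(\<alpha>, \<beta>)\<close> becomes a module over \<open>H\<^sup>* \<bowtie> H(\<alpha>, \<beta>)\<close> by letting \<open>p\<close> act as
  \<open>m \<mapsto> p(m\<^sub>(\<^sub>1\<^sub>)) m\<^sub>(\<^sub>0\<^sub>)\<close>; the compatibility condition is exactly the commutation rule between \<open>H\<^sup>*\<close> and \<open>H\<close>.
  As \<open>H\<close> is finite dimensional, a basis and its dual basis recover the coaction from the action of
  \<open>H\<^sup>*\<close>, so this is a bijection on objects, and it preserves all the structure on the nose. That \<open>YD(H)\<close>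
  is a braided T-category is checked directly, without using finite dimension, and \<open>Rep(DT(H))\<close>
  inherits the axioms along the isomorphism.

  Elements of a vector space are compared by evaluating linear forms, and elements of a tensor
  product by summing bilinear forms over representing lists. Every identity in Sweedler
  notation thereby becomes an equation between finite sums of scalars, in which the order of summation is free.\<close>

section \<open>Linear and bilinear forms on vector spaces\<close>

text \<open>The defining compatibility condition contains \<open>S^{-1}\<close> and a threefold
  coproduct, and tensoring two modules would nest these. It is therefore traded once, in
  \<open>yd_compat_iff\<close>, for \<open>(h_2 m)_0 \<otimes> (h_2 m)_1 \<alpha>(h_1) = h_1 m_0
  \<otimes> \<beta>(h_2) m_1\<close>, which can be applied inside any longer sum;
  \<open>S^{-1}\<close> returns only where the multiplication of DT(H) mentions it. Modules may have
  infinite dimension, so the existence of enough linear forms rests on Zorn's lemma, while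
  expansions in a basis are confined to H and its dual. The other obstacle is strictness. Tensors
  are chosen representatives and operations are normalised off their carriers, so structures that
  agree on all forms are equal as records; this makes an isomorphism possible where one would
  otherwise expect an equivalence. The functor is built from coactions to actions because that
  formula involves no choice of basis; bijectivity is proved afterwards and the inverse is taken
  abstractly, morphisms being the same linear maps on both sides.\<close>

abbreviation vsp :: "('k::field, 'v, 'z) module_scheme \<Rightarrow> bool" where
  "vsp V \<equiv> vectorspace class_ring V"

abbreviation lhom :: "('k::field, 'v, 'z) module_scheme \<Rightarrow> ('k, 'w, 'y) module_scheme \<Rightarrow> ('v \<Rightarrow> 'w) set" where
  "lhom V W \<equiv> LinearCombinations.module_hom class_ring V W"

lemma lhom_iff: "f \<in> lhom V W \<longleftrightarrow>
    (\<forall>x\<in>carrier V. f x \<in> carrier W) \<and>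
    (\<forall>x\<in>carrier V. \<forall>y\<in>carrier V. f (x \<oplus>\<^bsub>V\<^esub> y) = f x \<oplus>\<^bsub>W\<^esub> f y) \<and>
    (\<forall>c. \<forall>x\<in>carrier V. f (c \<odot>\<^bsub>V\<^esub> x) = c \<odot>\<^bsub>W\<^esub> f x)"
  unfolding LinearCombinations.module_hom_def by auto

lemma lhomD:
  assumes "f \<in> lhom V W"
  shows "x \<in> carrier V \<Longrightarrow> f x \<in> carrier W"
    and "x \<in> carrier V \<Longrightarrow> y \<in> carrier V \<Longrightarrow> f (x \<oplus>\<^bsub>V\<^esub> y) = f x \<oplus>\<^bsub>W\<^esub> f y"
    and "x \<in> carrier V \<Longrightarrow> f (c \<odot>\<^bsub>V\<^esub> x) = c \<odot>\<^bsub>W\<^esub> f x"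
  using assms unfolding lhom_iff by auto

text \<open>Only values on the carrier are constrained, so that composites and pointwise expressions
  qualify without being restricted to it.\<close>

definition lform :: "('k::field, 'v, 'z) module_scheme \<Rightarrow> ('v \<Rightarrow> 'k) \<Rightarrow> bool" where
  "lform V f \<longleftrightarrow>
    (\<forall>x\<in>carrier V. \<forall>y\<in>carrier V. f (x \<oplus>\<^bsub>V\<^esub> y) = f x + f y) \<and>
    (\<forall>c. \<forall>x\<in>carrier V. f (c \<odot>\<^bsub>V\<^esub> x) = c * f x)"

definition bform ::
    "('k::field, 'v, 'z) module_scheme \<Rightarrow> ('k, 'w, 'y) module_scheme \<Rightarrow> ('v \<Rightarrow> 'w \<Rightarrow> 'k) \<Rightarrow> bool" where
  "bform V W F \<longleftrightarrow> (\<forall>w\<in>carrier W. lform V (\<lambda>v. F v w)) \<and> (\<forall>v\<in>carrier V. lform W (F v))"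

text \<open>The value of a Sweedler expression. For bilinear \<open>F\<close> it depends only on the
  tensor that the list represents (\<open>tensor_eq_tsum\<close>).\<close>

definition tsum :: "('v \<times> 'w) list \<Rightarrow> ('v \<Rightarrow> 'w \<Rightarrow> 'k::comm_monoid_add) \<Rightarrow> 'k" where
  "tsum t F = (\<Sum>(v, w)\<leftarrow>t. F v w)"

lemma lformD:
  assumes "lform V f"
  shows "x \<in> carrier V \<Longrightarrow> y \<in> carrier V \<Longrightarrow> f (x \<oplus>\<^bsub>V\<^esub> y) = f x + f y"
    and "x \<in> carrier V \<Longrightarrow> f (c \<odot>\<^bsub>V\<^esub> x) = c * f x"
  using assms unfolding lform_def by auto

lemma bformI:
  assumes "\<And>w. w \<in> carrier W \<Longrightarrow> lform V (\<lambda>v. F v w)"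
    and "\<And>v. v \<in> carrier V \<Longrightarrow> lform W (\<lambda>w. F v w)"
  shows "bform V W F"
  using assms unfolding bform_def by auto

lemma bformD:
  assumes "bform V W F"
  shows "w \<in> carrier W \<Longrightarrow> lform V (\<lambda>v. F v w)" and "v \<in> carrier V \<Longrightarrow> lform W (F v)"
  using assms unfolding bform_def by auto

lemma tsum_simps [simp]:
  "tsum [] F = 0"
  "tsum ((v, w) # t) F = F v w + tsum t F"
  "tsum (s @ t) F = tsum s F + tsum t F"
  by (simp_all add: tsum_def)

lemma tsum_map [simp]: "tsum (map (\<lambda>(a, b). (u a b, v a b)) t) F = tsum t (\<lambda>a b. F (u a b) (v a b))"
  by (induction t) auto

lemma tsum_concat [simp]: "tsum (concat (map (\<lambda>(a, b). L a b) t)) F = tsum t (\<lambda>a b. tsum (L a b) F)"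
  by (induction t) auto

text \<open>As a congruence rule it hands the simplifier the fact that the pair occurs in the list,
  from which membership in the carriers is derived.\<close>

lemma tsum_cong [cong]:
  assumes "s = t" and "\<And>a b. (a, b) \<in> set t \<Longrightarrow> F a b = G a b"
  shows "tsum s F = tsum t G"
  unfolding assms(1) using assms(2) by (induction t) auto

lemma tsum_add: "tsum t (\<lambda>a b. F a b + G a b) = tsum t F + tsum t G"
  for F :: "'a \<Rightarrow> 'b \<Rightarrow> 'k::comm_monoid_add"
  by (induction t) (auto simp: algebra_simps)

lemma tsum_mult_left: "tsum t (\<lambda>a b. c * F a b) = c * tsum t F"
  for F :: "'a \<Rightarrow> 'b \<Rightarrow> 'k::semiring_0"
  by (induction t) (auto simp: algebra_simps)

lemma tsum_mult_right: "tsum t (\<lambda>a b. F a b * c) = tsum t F * c"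
  for F :: "'a \<Rightarrow> 'b \<Rightarrow> 'k::semiring_0"
  by (induction t) (auto simp: algebra_simps)

lemma tsum_zero [simp]: "tsum t (\<lambda>a b. 0) = 0"
  by (induction t) auto

lemma tsum_swap: "tsum s (\<lambda>a b. tsum t (F a b)) = tsum t (\<lambda>c d. tsum s (\<lambda>a b. F a b c d))"
  for F :: "'a \<Rightarrow> 'b \<Rightarrow> 'c \<Rightarrow> 'd \<Rightarrow> 'k::comm_monoid_add"
  by (induction s) (auto simp: tsum_add)

lemma tsum_sum: "tsum t (\<lambda>a b. \<Sum>i\<in>I. F i a b) = (\<Sum>i\<in>I. tsum t (F i))"
  for F :: "'i \<Rightarrow> 'a \<Rightarrow> 'b \<Rightarrow> 'k::comm_monoid_add"
  by (induction t) (auto simp: sum.distrib)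

section \<open>Vector space axioms and separation of points by linear forms\<close>

lemma vspI:
  assumes add: "\<And>x y. x \<in> carrier V \<Longrightarrow> y \<in> carrier V \<Longrightarrow> x \<oplus>\<^bsub>V\<^esub> y \<in> carrier V"
    and zero: "\<zero>\<^bsub>V\<^esub> \<in> carrier V"
    and assoc: "\<And>x y z. x \<in> carrier V \<Longrightarrow> y \<in> carrier V \<Longrightarrow> z \<in> carrier V \<Longrightarrow>
      (x \<oplus>\<^bsub>V\<^esub> y) \<oplus>\<^bsub>V\<^esub> z = x \<oplus>\<^bsub>V\<^esub> (y \<oplus>\<^bsub>V\<^esub> z)"
    and comm: "\<And>x y. x \<in> carrier V \<Longrightarrow> y \<in> carrier V \<Longrightarrow> x \<oplus>\<^bsub>V\<^esub> y = y \<oplus>\<^bsub>V\<^esub> x"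
    and l_zero: "\<And>x. x \<in> carrier V \<Longrightarrow> \<zero>\<^bsub>V\<^esub> \<oplus>\<^bsub>V\<^esub> x = x"
    and smult: "\<And>c x. x \<in> carrier V \<Longrightarrow> c \<odot>\<^bsub>V\<^esub> x \<in> carrier V"
    and l_distr: "\<And>c d x. x \<in> carrier V \<Longrightarrow> (c + d) \<odot>\<^bsub>V\<^esub> x = c \<odot>\<^bsub>V\<^esub> x \<oplus>\<^bsub>V\<^esub> d \<odot>\<^bsub>V\<^esub> x"
    and r_distr: "\<And>c x y. x \<in> carrier V \<Longrightarrow> y \<in> carrier V \<Longrightarrow>
      c \<odot>\<^bsub>V\<^esub> (x \<oplus>\<^bsub>V\<^esub> y) = c \<odot>\<^bsub>V\<^esub> x \<oplus>\<^bsub>V\<^esub> c \<odot>\<^bsub>V\<^esub> y"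
    and smult_assoc: "\<And>c d x. x \<in> carrier V \<Longrightarrow> (c * d) \<odot>\<^bsub>V\<^esub> x = c \<odot>\<^bsub>V\<^esub> (d \<odot>\<^bsub>V\<^esub> x)"
    and smult_one: "\<And>x. x \<in> carrier V \<Longrightarrow> 1 \<odot>\<^bsub>V\<^esub> x = x"
    and smult_zero: "\<And>x. x \<in> carrier V \<Longrightarrow> 0 \<odot>\<^bsub>V\<^esub> x = \<zero>\<^bsub>V\<^esub>"
  shows "vsp (V :: ('k::field, 'v, 'z) module_scheme)"
proof -
  \<comment> \<open>Negatives come from scaling by -1; the hypothesis \<open>smult_zero\<close>
    stands in for their existence.\<close>
  have inv: "((- 1) \<odot>\<^bsub>V\<^esub> x) \<oplus>\<^bsub>V\<^esub> x = \<zero>\<^bsub>V\<^esub>" if "x \<in> carrier V" for x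
    using l_distr[OF that, of "-1" 1] smult_one[OF that] smult_zero[OF that] by simp
  have "abelian_group V"
    by (rule abelian_groupI[OF add zero assoc comm l_zero]) (blast intro: inv smult)+
  moreover have "cring (class_ring :: 'k ring)"
    using class_field by (rule fieldE(1))
  ultimately have "Module.module (class_ring :: 'k ring) V"
    unfolding Module.module_def module_axioms_def using assms by auto
  then show ?thesis
    unfolding vectorspace_def using class_field by blast
qed

lemma vspD:
  assumes "vsp (V :: ('k::field, 'v, 'z) module_scheme)"
  shows "x \<in> carrier V \<Longrightarrow> y \<in> carrier V \<Longrightarrow> x \<oplus>\<^bsub>V\<^esub> y \<in> carrier V"
    and "\<zero>\<^bsub>V\<^esub> \<in> carrier V"
    and "x \<in> carrier V \<Longrightarrow> y \<in> carrier V \<Longrightarrow> z \<in> carrier V \<Longrightarrow>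
      (x \<oplus>\<^bsub>V\<^esub> y) \<oplus>\<^bsub>V\<^esub> z = x \<oplus>\<^bsub>V\<^esub> (y \<oplus>\<^bsub>V\<^esub> z)"
    and "x \<in> carrier V \<Longrightarrow> y \<in> carrier V \<Longrightarrow> x \<oplus>\<^bsub>V\<^esub> y = y \<oplus>\<^bsub>V\<^esub> x"
    and "x \<in> carrier V \<Longrightarrow> \<zero>\<^bsub>V\<^esub> \<oplus>\<^bsub>V\<^esub> x = x"
    and "x \<in> carrier V \<Longrightarrow> x \<oplus>\<^bsub>V\<^esub> \<zero>\<^bsub>V\<^esub> = x"
    and "x \<in> carrier V \<Longrightarrow> c \<odot>\<^bsub>V\<^esub> x \<in> carrier V"
    and "x \<in> carrier V \<Longrightarrow> (c + d) \<odot>\<^bsub>V\<^esub> x = c \<odot>\<^bsub>V\<^esub> x \<oplus>\<^bsub>V\<^esub> d \<odot>\<^bsub>V\<^esub> x"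
    and "x \<in> carrier V \<Longrightarrow> y \<in> carrier V \<Longrightarrow>
      c \<odot>\<^bsub>V\<^esub> (x \<oplus>\<^bsub>V\<^esub> y) = c \<odot>\<^bsub>V\<^esub> x \<oplus>\<^bsub>V\<^esub> c \<odot>\<^bsub>V\<^esub> y"
    and "x \<in> carrier V \<Longrightarrow> (c * d) \<odot>\<^bsub>V\<^esub> x = c \<odot>\<^bsub>V\<^esub> (d \<odot>\<^bsub>V\<^esub> x)"
    and "x \<in> carrier V \<Longrightarrow> 1 \<odot>\<^bsub>V\<^esub> x = x"
    and "x \<in> carrier V \<Longrightarrow> 0 \<odot>\<^bsub>V\<^esub> x = \<zero>\<^bsub>V\<^esub>"
    and "x \<in> carrier V \<Longrightarrow> x \<oplus>\<^bsub>V\<^esub> (- 1) \<odot>\<^bsub>V\<^esub> x = \<zero>\<^bsub>V\<^esub>"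
proof -
  interpret vectorspace class_ring V by fact
  show "x \<in> carrier V \<Longrightarrow> y \<in> carrier V \<Longrightarrow> x \<oplus>\<^bsub>V\<^esub> y \<in> carrier V"
    and "\<zero>\<^bsub>V\<^esub> \<in> carrier V"
    and "x \<in> carrier V \<Longrightarrow> y \<in> carrier V \<Longrightarrow> z \<in> carrier V \<Longrightarrow>
      (x \<oplus>\<^bsub>V\<^esub> y) \<oplus>\<^bsub>V\<^esub> z = x \<oplus>\<^bsub>V\<^esub> (y \<oplus>\<^bsub>V\<^esub> z)"
    and "x \<in> carrier V \<Longrightarrow> y \<in> carrier V \<Longrightarrow> x \<oplus>\<^bsub>V\<^esub> y = y \<oplus>\<^bsub>V\<^esub> x"
    and "x \<in> carrier V \<Longrightarrow> \<zero>\<^bsub>V\<^esub> \<oplus>\<^bsub>V\<^esub> x = x"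
    and "x \<in> carrier V \<Longrightarrow> x \<oplus>\<^bsub>V\<^esub> \<zero>\<^bsub>V\<^esub> = x"
    using M.a_comm M.a_assoc by auto
  show "x \<in> carrier V \<Longrightarrow> c \<odot>\<^bsub>V\<^esub> x \<in> carrier V"
    using smult_closed[of c x] by auto
  show *: "x \<in> carrier V \<Longrightarrow> (c + d) \<odot>\<^bsub>V\<^esub> x = c \<odot>\<^bsub>V\<^esub> x \<oplus>\<^bsub>V\<^esub> d \<odot>\<^bsub>V\<^esub> x" for c d
    using smult_l_distr[of c d x] by auto
  show "x \<in> carrier V \<Longrightarrow> y \<in> carrier V \<Longrightarrow>
      c \<odot>\<^bsub>V\<^esub> (x \<oplus>\<^bsub>V\<^esub> y) = c \<odot>\<^bsub>V\<^esub> x \<oplus>\<^bsub>V\<^esub> c \<odot>\<^bsub>V\<^esub> y"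
    using smult_r_distr[of c x y] by auto
  show "x \<in> carrier V \<Longrightarrow> (c * d) \<odot>\<^bsub>V\<^esub> x = c \<odot>\<^bsub>V\<^esub> (d \<odot>\<^bsub>V\<^esub> x)"
    using smult_assoc1[of c d x] by auto
  show 1: "x \<in> carrier V \<Longrightarrow> 1 \<odot>\<^bsub>V\<^esub> x = x"
    using smult_one[of x] by auto
  show 0: "x \<in> carrier V \<Longrightarrow> 0 \<odot>\<^bsub>V\<^esub> x = \<zero>\<^bsub>V\<^esub>"
    using smult_l_null[of x] by auto
  show "x \<in> carrier V \<Longrightarrow> x \<oplus>\<^bsub>V\<^esub> (- 1) \<odot>\<^bsub>V\<^esub> x = \<zero>\<^bsub>V\<^esub>"
    using *[of 1 "-1"] 0 1 by simp
qed

lemma lform_zero: "vsp V \<Longrightarrow> lform V f \<Longrightarrow> f \<zero>\<^bsub>V\<^esub> = 0"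
  by (metis vspD(2) vspD(12) lformD(2) mult_zero_left)

text \<open>Zorn's lemma gives a subspace \<open>U\<close> maximal among those that avoid
  \<open>v\<close>. Maximality makes the line through \<open>v\<close> a complement of
  \<open>U\<close>, and the required form reads off the coefficient of \<open>v\<close>. The
  argument is free of any assumption on the dimension.\<close>

lemma lform_nonzero:
  fixes V :: "('k::field, 'v, 'z) module_scheme"
  assumes V: "vsp V" and v: "v \<in> carrier V" "v \<noteq> \<zero>\<^bsub>V\<^esub>"
  shows "\<exists>f. lform V f \<and> f v \<noteq> 0"
proof -
  note [simp] = vspD(1,2,5-12)[OF V]
  define S where "S = {U. U \<subseteq> carrier V \<and> \<zero>\<^bsub>V\<^esub> \<in> U \<and> (\<forall>x\<in>U. \<forall>y\<in>U. x \<oplus>\<^bsub>V\<^esub> y \<in> U) \<and>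
    (\<forall>c. \<forall>x\<in>U. c \<odot>\<^bsub>V\<^esub> x \<in> U) \<and> v \<notin> U}"
  have "\<exists>M\<in>S. \<forall>X\<in>S. M \<subseteq> X \<longrightarrow> X = M"
  proof (rule subset_Zorn_nonempty)
    have "c \<odot>\<^bsub>V\<^esub> \<zero>\<^bsub>V\<^esub> = \<zero>\<^bsub>V\<^esub>" for c
      using vspD(10)[OF V vspD(2)[OF V], of c 0] by simp
    then have "{\<zero>\<^bsub>V\<^esub>} \<in> S"
      using v unfolding S_def by auto
    then show "S \<noteq> {}" by blast
  next
    fix C assume C: "C \<noteq> {}" "subset.chain S C"
    then have sub: "C \<subseteq> S" and tot: "\<And>X Y. X \<in> C \<Longrightarrow> Y \<in> C \<Longrightarrow> X \<subseteq> Y \<or> Y \<subseteq> X"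
      by (auto simp: subset.chain_def)
    have "x \<oplus>\<^bsub>V\<^esub> y \<in> \<Union> C" if xy: "x \<in> \<Union> C" "y \<in> \<Union> C" for x y
    proof -
      obtain X Y where "X \<in> C" "Y \<in> C" "x \<in> X" "y \<in> Y" using xy by blast
      then obtain Z where "Z \<in> C" "x \<in> Z" "y \<in> Z" using tot by blast
      then show ?thesis using sub unfolding S_def by blast
    qed
    then show "\<Union> C \<in> S"
      using sub C(1) unfolding S_def by blast
  qed
  then obtain U where U: "U \<in> S" and max: "\<And>X. X \<in> S \<Longrightarrow> U \<subseteq> X \<Longrightarrow> X = U" by blast
  have Uc: "x \<in> carrier V" if "x \<in> U" for x using U that unfolding S_def by blast
  have U0: "\<zero>\<^bsub>V\<^esub> \<in> U" and Ua: "\<And>x y. x \<in> U \<Longrightarrow> y \<in> U \<Longrightarrow> x \<oplus>\<^bsub>V\<^esub> y \<in> U"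
    and Us: "\<And>c x. x \<in> U \<Longrightarrow> c \<odot>\<^bsub>V\<^esub> x \<in> U" and Uv: "v \<notin> U"
    using U unfolding S_def by auto
  have swap: "(a \<oplus>\<^bsub>V\<^esub> b) \<oplus>\<^bsub>V\<^esub> (c \<oplus>\<^bsub>V\<^esub> d) = (a \<oplus>\<^bsub>V\<^esub> c) \<oplus>\<^bsub>V\<^esub> (b \<oplus>\<^bsub>V\<^esub> d)"
    if "a \<in> carrier V" "b \<in> carrier V" "c \<in> carrier V" "d \<in> carrier V" for a b c d
  proof -
    have "b \<oplus>\<^bsub>V\<^esub> (c \<oplus>\<^bsub>V\<^esub> d) = c \<oplus>\<^bsub>V\<^esub> (b \<oplus>\<^bsub>V\<^esub> d)"
      using vspD(3)[OF V] vspD(4)[OF V, of b c] that by metis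
    then show ?thesis using that by (simp add: vspD(3)[OF V])
  qed
  have comb: "(a \<oplus>\<^bsub>V\<^esub> c \<odot>\<^bsub>V\<^esub> x) \<oplus>\<^bsub>V\<^esub> (b \<oplus>\<^bsub>V\<^esub> d \<odot>\<^bsub>V\<^esub> x) = (a \<oplus>\<^bsub>V\<^esub> b) \<oplus>\<^bsub>V\<^esub> (c + d) \<odot>\<^bsub>V\<^esub> x"
    if "a \<in> carrier V" "b \<in> carrier V" "x \<in> carrier V" for a b c d x
    using that swap by simp
  have scal: "c \<odot>\<^bsub>V\<^esub> (a \<oplus>\<^bsub>V\<^esub> d \<odot>\<^bsub>V\<^esub> x) = c \<odot>\<^bsub>V\<^esub> a \<oplus>\<^bsub>V\<^esub> (c * d) \<odot>\<^bsub>V\<^esub> x"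
    if "a \<in> carrier V" "x \<in> carrier V" for a c d x
    using that by simp
  \<comment> \<open>If \<open>x\<close> lies outside \<open>U\<close>, then \<open>U\<close>
    enlarged by \<open>x\<close> contains \<open>v\<close> by maximality, and the equation that
    expresses \<open>v\<close> is solved for \<open>x\<close>.\<close>
  have ex: "\<exists>c. \<exists>u\<in>U. x = u \<oplus>\<^bsub>V\<^esub> c \<odot>\<^bsub>V\<^esub> v" if x: "x \<in> carrier V" for x
  proof (cases "x \<in> U")
    case True
    then show ?thesis using v x by (intro exI[of _ 0] bexI[of _ x]) auto
  next
    case False
    define U' where "U' = {u \<oplus>\<^bsub>V\<^esub> c \<odot>\<^bsub>V\<^esub> x |u c. u \<in> U}"
    have "x \<in> U'" using x U0 unfolding U'_def by (auto intro!: exI[of _ "\<zero>\<^bsub>V\<^esub>"] exI[of _ 1])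
    moreover have sub: "U \<subseteq> U'"
    proof
      fix u assume "u \<in> U"
      then have "u = u \<oplus>\<^bsub>V\<^esub> 0 \<odot>\<^bsub>V\<^esub> x" using x Uc by simp
      then show "u \<in> U'" using \<open>u \<in> U\<close> unfolding U'_def by blast
    qed
    ultimately have "U' \<notin> S" using max False by blast
    moreover have "U' \<subseteq> carrier V" using x Uc unfolding U'_def by auto
    moreover have "\<zero>\<^bsub>V\<^esub> \<in> U'" using sub U0 by blast
    moreover have "\<forall>a\<in>U'. \<forall>b\<in>U'. a \<oplus>\<^bsub>V\<^esub> b \<in> U'"
    proof (intro ballI)
      fix a b assume "a \<in> U'" "b \<in> U'"
      then obtain u c u' c' where "a = u \<oplus>\<^bsub>V\<^esub> c \<odot>\<^bsub>V\<^esub> x" "b = u' \<oplus>\<^bsub>V\<^esub> c' \<odot>\<^bsub>V\<^esub> x" "u \<in> U" "u' \<in> U"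
        unfolding U'_def by blast
      then show "a \<oplus>\<^bsub>V\<^esub> b \<in> U'" using comb[of u u' x c c'] Ua Uc x unfolding U'_def by blast
    qed
    moreover have "\<forall>c. \<forall>a\<in>U'. c \<odot>\<^bsub>V\<^esub> a \<in> U'"
    proof (intro ballI allI)
      fix a c assume "a \<in> U'"
      then obtain u d where "a = u \<oplus>\<^bsub>V\<^esub> d \<odot>\<^bsub>V\<^esub> x" "u \<in> U"
        unfolding U'_def by blast
      then show "c \<odot>\<^bsub>V\<^esub> a \<in> U'" using scal[of u x c d] Us Uc x unfolding U'_def by blast
    qed
    ultimately have "v \<in> U'" unfolding S_def by blast
    then obtain u c where u: "u \<in> U" "v = u \<oplus>\<^bsub>V\<^esub> c \<odot>\<^bsub>V\<^esub> x" unfolding U'_def by blast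
    \<comment> \<open>With \<open>c = 0\<close> the vector \<open>v\<close> would lie in
      \<open>U\<close>.\<close>
    have "c \<noteq> 0"
      using u Uv Uc x by (cases "c = 0") auto
    have "(- inverse c) \<odot>\<^bsub>V\<^esub> u \<oplus>\<^bsub>V\<^esub> inverse c \<odot>\<^bsub>V\<^esub> v =
      ((- inverse c) \<odot>\<^bsub>V\<^esub> u \<oplus>\<^bsub>V\<^esub> inverse c \<odot>\<^bsub>V\<^esub> u) \<oplus>\<^bsub>V\<^esub> (inverse c * c) \<odot>\<^bsub>V\<^esub> x"
      unfolding u(2) using scal[OF Uc[OF u(1)] x] vspD(3)[OF V] Uc[OF u(1)] x by simp
    also have "\<dots> = x"
      using vspD(8)[OF V Uc[OF u(1)], of "- inverse c" "inverse c", symmetric] Uc[OF u(1)] x \<open>c \<noteq> 0\<close> by simp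
    finally show ?thesis using Us[OF u(1)] by metis
  qed
  \<comment> \<open>Two different coefficients would put a nonzero multiple of \<open>v\<close>,
    hence \<open>v\<close> itself, into \<open>U\<close>.\<close>
  have uniq: "c = d" if eq: "u \<oplus>\<^bsub>V\<^esub> c \<odot>\<^bsub>V\<^esub> v = u' \<oplus>\<^bsub>V\<^esub> d \<odot>\<^bsub>V\<^esub> v" and u: "u \<in> U" "u' \<in> U" for c d u u'
  proof (rule ccontr)
    assume "c \<noteq> d"
    have "((- 1) \<odot>\<^bsub>V\<^esub> u \<oplus>\<^bsub>V\<^esub> (- d) \<odot>\<^bsub>V\<^esub> v) \<oplus>\<^bsub>V\<^esub> (u \<oplus>\<^bsub>V\<^esub> c \<odot>\<^bsub>V\<^esub> v) = (c - d) \<odot>\<^bsub>V\<^esub> v"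
      using comb[of "(- 1) \<odot>\<^bsub>V\<^esub> u" u v "- d" c] Uc[OF u(1)] v(1) vspD(4)[OF V] vspD(13)[OF V] by simp
    moreover have "((- 1) \<odot>\<^bsub>V\<^esub> u \<oplus>\<^bsub>V\<^esub> (- d) \<odot>\<^bsub>V\<^esub> v) \<oplus>\<^bsub>V\<^esub> (u' \<oplus>\<^bsub>V\<^esub> d \<odot>\<^bsub>V\<^esub> v) = (- 1) \<odot>\<^bsub>V\<^esub> u \<oplus>\<^bsub>V\<^esub> u'"
      using comb[of "(- 1) \<odot>\<^bsub>V\<^esub> u" u' v "- d" d] Uc[OF u(1)] Uc[OF u(2)] v(1) by simp
    ultimately have "(c - d) \<odot>\<^bsub>V\<^esub> v \<in> U" using eq Ua Us u by metis
    then have "inverse (c - d) \<odot>\<^bsub>V\<^esub> ((c - d) \<odot>\<^bsub>V\<^esub> v) \<in> U" using Us by blast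
    moreover have "inverse (c - d) \<odot>\<^bsub>V\<^esub> ((c - d) \<odot>\<^bsub>V\<^esub> v) = v"
      using vspD(10)[OF V v(1), of "inverse (c - d)" "c - d"] \<open>c \<noteq> d\<close> v(1) by simp
    ultimately show False using Uv by simp
  qed
  define f where "f x = (THE c. \<exists>u\<in>U. x = u \<oplus>\<^bsub>V\<^esub> c \<odot>\<^bsub>V\<^esub> v)" for x
  have f: "f (u \<oplus>\<^bsub>V\<^esub> c \<odot>\<^bsub>V\<^esub> v) = c" if "u \<in> U" for u c
    unfolding f_def using that uniq by (intro the_equality) blast+
  have "lform V f"
    unfolding lform_def
  proof (intro conjI ballI allI)
    fix x y assume "x \<in> carrier V" "y \<in> carrier V"
    then obtain u c u' c' where "u \<in> U" "u' \<in> U" "x = u \<oplus>\<^bsub>V\<^esub> c \<odot>\<^bsub>V\<^esub> v" "y = u' \<oplus>\<^bsub>V\<^esub> c' \<odot>\<^bsub>V\<^esub> v"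
      using ex by metis
    then show "f (x \<oplus>\<^bsub>V\<^esub> y) = f x + f y" using comb Uc v f Ua by metis
  next
    fix x c assume "x \<in> carrier V"
    then obtain u d where "u \<in> U" "x = u \<oplus>\<^bsub>V\<^esub> d \<odot>\<^bsub>V\<^esub> v"
      using ex by metis
    then show "f (c \<odot>\<^bsub>V\<^esub> x) = c * f x" using scal Uc v f Us by metis
  qed
  moreover have "f v = 1" using f[OF U0, of 1] v by simp
  ultimately show ?thesis by (intro exI[of _ f]) auto
qed

lemma lform_eqI:
  assumes V: "vsp V" and v: "v \<in> carrier V" "w \<in> carrier V" and eq: "\<And>f. lform V f \<Longrightarrow> f v = f w"
  shows "v = w"
proof -
  let ?d = "v \<oplus>\<^bsub>V\<^esub> (- 1) \<odot>\<^bsub>V\<^esub> w"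
  have "f ?d = 0" if "lform V f" for f
    using eq[OF that] v lformD[OF that] vspD(7)[OF V] by simp
  then have d: "?d = \<zero>\<^bsub>V\<^esub>"
    using lform_nonzero[OF V, of ?d] vspD(1,7)[OF V] v by blast
  have "v = v \<oplus>\<^bsub>V\<^esub> ((- 1) \<odot>\<^bsub>V\<^esub> w \<oplus>\<^bsub>V\<^esub> w)"
    using vspD(4,6,7,13)[OF V] v by metis
  also have "\<dots> = ?d \<oplus>\<^bsub>V\<^esub> w"
    using vspD(3,7)[OF V] v by simp
  also have "\<dots> = w"
    using d vspD(5)[OF V] v by simp
  finally show ?thesis .
qed

section \<open>Tensor products\<close>

lemma tensor_eq_wf:
  assumes "tensor_eq V W xs ys" and "vsp V" and "vsp W"
  shows "set xs \<subseteq> carrier V \<times> carrier W \<and> set ys \<subseteq> carrier V \<times> carrier W"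
  using assms(1)
  by induction (use vspD(1,2,7)[OF assms(2)] vspD(1,2,7)[OF assms(3)] in auto)

text \<open>Every generating relation of the tensor product is an identity satisfied by bilinear
  forms, so the evaluation is invariant along a derivation of \<open>tensor_eq\<close>.\<close>

lemma tensor_eq_tsum:
  assumes F: "bform V W F" and V: "vsp V" and W: "vsp W" and "tensor_eq V W xs ys"
  shows "tsum xs F = tsum ys F"
  using assms(4)
proof induction
  case (zero w)
  then show ?case using lform_zero[OF V bformD(1)[OF F]] by simp
qed (use lformD[OF bformD(1)[OF F]] lformD[OF bformD(2)[OF F]] in \<open>auto simp: algebra_simps\<close>)

text \<open>Equivalent lists are related to the same lists, so \<open>SOME\<close> ranges over the
  same predicate for both.\<close>

lemma tcls_eqI: "tensor_eq V W xs ys \<Longrightarrow> tcls V W xs = tcls V W ys"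
proof -
  assume eq: "tensor_eq V W xs ys"
  have "tensor_eq V W xs zs \<longleftrightarrow> tensor_eq V W ys zs" for zs
    using tensor_eq.trans[OF eq] tensor_eq.trans[OF tensor_eq.sym[OF eq]] by blast
  then show ?thesis unfolding tcls_def by presburger
qed

lemma tcls_rep: "set xs \<subseteq> carrier V \<times> carrier W \<Longrightarrow> tensor_eq V W xs (tcls V W xs)"
  unfolding tcls_def by (rule someI) (rule tensor_eq.refl)

lemma tensor_simps:
  "carrier (tensor V W) = tcls V W ` lists (carrier V \<times> carrier W)"
  "\<zero>\<^bsub>tensor V W\<^esub> = tcls V W []"
  "mult (tensor V W) = undefined" "one (tensor V W) = undefined"
  "x \<oplus>\<^bsub>tensor V W\<^esub> y = (if x \<in> carrier (tensor V W) \<and> y \<in> carrier (tensor V W)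
     then tcls V W (x @ y) else undefined)"
  "c \<odot>\<^bsub>tensor V W\<^esub> x = (if x \<in> carrier (tensor V W)
     then tcls V W [(c \<odot>\<^bsub>V\<^esub> v, w). (v, w) \<leftarrow> x] else undefined)"
  by (simp_all add: tensor_def Let_def)

lemma tcls_in [simp, intro]: "set xs \<subseteq> carrier V \<times> carrier W \<Longrightarrow> tcls V W xs \<in> carrier (tensor V W)"
  by (auto simp: tensor_simps)

text \<open>A chosen representative is equivalent to the list for which it was chosen, so choosing
  again returns it.\<close>

lemma tensor_elemD:
  assumes "vsp V" "vsp W" "t \<in> carrier (tensor V W)"
  shows "set t \<subseteq> carrier V \<times> carrier W" and "tcls V W t = t"
proof -
  obtain xs where xs: "set xs \<subseteq> carrier V \<times> carrier W" "t = tcls V W xs"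
    using assms(3) by (auto simp: tensor_simps)
  then have *: "tensor_eq V W xs t" using tcls_rep by blast
  then show "set t \<subseteq> carrier V \<times> carrier W" using tensor_eq_wf assms by blast
  show "tcls V W t = t" using tcls_eqI[OF *] xs by simp
qed

lemma tensor_add_tcls:
  assumes "vsp V" "vsp W" "set xs \<subseteq> carrier V \<times> carrier W" "set ys \<subseteq> carrier V \<times> carrier W"
  shows "tcls V W xs \<oplus>\<^bsub>tensor V W\<^esub> tcls V W ys = tcls V W (xs @ ys)"
  using assms by (auto simp: tensor_simps(5) intro!: tcls_eqI[OF tensor_eq.sym] tensor_eq.append tcls_rep)

lemma scale_wf: "vsp V \<Longrightarrow> set xs \<subseteq> carrier V \<times> carrier W \<Longrightarrow>
    set (map (\<lambda>(v, w). (c \<odot>\<^bsub>V\<^esub> v, w)) xs) \<subseteq> carrier V \<times> carrier W"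
  using vspD(7) by fastforce

lemma tensor_eq_scale:
  assumes V: "vsp V" and W: "vsp W" and "tensor_eq V W xs ys"
  shows "tensor_eq V W [(c \<odot>\<^bsub>V\<^esub> v, w). (v, w) \<leftarrow> xs] [(c \<odot>\<^bsub>V\<^esub> v, w). (v, w) \<leftarrow> ys]"
  using assms(3)
proof induction
  case (refl xs)
  then show ?case using vspD(7)[OF V] by (intro tensor_eq.refl) auto
next
  case (commute xs ys)
  then show ?case unfolding map_append by (intro tensor_eq.commute scale_wf[OF V])
next
  case (zero w)
  have "c \<odot>\<^bsub>V\<^esub> \<zero>\<^bsub>V\<^esub> = \<zero>\<^bsub>V\<^esub>"
    using vspD(10)[OF V vspD(2)[OF V], of c 0] vspD(12)[OF V vspD(2)[OF V]] by simp
  then show ?case using zero tensor_eq.zero by auto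
next
  case (smult v w d)
  have "c \<odot>\<^bsub>V\<^esub> (d \<odot>\<^bsub>V\<^esub> v) = d \<odot>\<^bsub>V\<^esub> (c \<odot>\<^bsub>V\<^esub> v)"
    using vspD(10)[OF V] smult by (metis mult.commute)
  then show ?case using smult vspD(7)[OF V] by (auto intro!: tensor_eq.smult)
next
  case (sym xs ys)
  then show ?case by (blast intro: tensor_eq.sym)
next
  case (trans xs ys zs)
  then show ?case by (blast intro: tensor_eq.trans)
next
  case (append xs xs' ys ys')
  then show ?case by (auto intro: tensor_eq.append)
next
  case (add_left v v' w)
  then show ?case using vspD(7,9)[OF V] by (auto intro: tensor_eq.add_left)
next
  case (add_right v w w')
  then show ?case using vspD(7,9)[OF V] by (auto intro: tensor_eq.add_right)
qed

lemma tensor_smult_tcls: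
  assumes "vsp V" "vsp W" "set xs \<subseteq> carrier V \<times> carrier W"
  shows "c \<odot>\<^bsub>tensor V W\<^esub> tcls V W xs = tcls V W [(c \<odot>\<^bsub>V\<^esub> v, w). (v, w) \<leftarrow> xs]"
  using assms by (auto simp: tensor_simps(6) intro!: tcls_eqI[OF tensor_eq.sym] tensor_eq_scale tcls_rep)

lemma vsp_tensor [simp, intro]:
  assumes V: "vsp V" and W: "vsp W"
  shows "vsp (tensor V W)"
proof -
  let ?wf = "\<lambda>xs. set xs \<subseteq> carrier V \<times> carrier W"
  note add = tensor_add_tcls[OF assms] and scale = tensor_smult_tcls[OF assms]
  have el: "\<exists>xs. ?wf xs \<and> t = tcls V W xs" if "t \<in> carrier (tensor V W)" for t
    using that by (auto simp: tensor_simps)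
  note cl = scale_wf[OF V, where W = W]
  note [simp] = cl[simplified]
  \<comment> \<open>Scaling by a sum produces the two scaled copies interleaved; they are sorted
    into consecutive blocks, one head at a time.\<close>
  have distr: "tensor_eq V W [((c + d) \<odot>\<^bsub>V\<^esub> v, w). (v, w) \<leftarrow> xs]
    ([(c \<odot>\<^bsub>V\<^esub> v, w). (v, w) \<leftarrow> xs] @ [(d \<odot>\<^bsub>V\<^esub> v, w). (v, w) \<leftarrow> xs])" if "?wf xs" for c d xs
    using that
  proof (induction xs)
    case Nil
    then show ?case by (simp add: tensor_eq.refl)
  next
    case (Cons a xs)
    obtain v w where a: "a = (v, w)" by force
    let ?c = "[(c \<odot>\<^bsub>V\<^esub> v, w). (v, w) \<leftarrow> xs]" and ?d = "[(d \<odot>\<^bsub>V\<^esub> v, w). (v, w) \<leftarrow> xs]"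
    have 1: "tensor_eq V W [((c + d) \<odot>\<^bsub>V\<^esub> v, w)] [(c \<odot>\<^bsub>V\<^esub> v, w), (d \<odot>\<^bsub>V\<^esub> v, w)]"
      using Cons.prems a vspD(8,7)[OF V] by (auto intro: tensor_eq.add_left)
    have 2: "tensor_eq V W ([(d \<odot>\<^bsub>V\<^esub> v, w)] @ ?c) (?c @ [(d \<odot>\<^bsub>V\<^esub> v, w)])"
      using Cons.prems a vspD(7)[OF V] by (intro tensor_eq.commute) auto
    have "tensor_eq V W ([((c + d) \<odot>\<^bsub>V\<^esub> v, w)] @ [((c + d) \<odot>\<^bsub>V\<^esub> v, w). (v, w) \<leftarrow> xs])
      ([(c \<odot>\<^bsub>V\<^esub> v, w), (d \<odot>\<^bsub>V\<^esub> v, w)] @ (?c @ ?d))"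
      using 1 Cons by (intro tensor_eq.append) auto
    moreover have "tensor_eq V W ([(c \<odot>\<^bsub>V\<^esub> v, w)] @ ([(d \<odot>\<^bsub>V\<^esub> v, w)] @ ?c) @ ?d)
       ([(c \<odot>\<^bsub>V\<^esub> v, w)] @ (?c @ [(d \<odot>\<^bsub>V\<^esub> v, w)]) @ ?d)"
      by (rule tensor_eq.append[OF tensor_eq.refl tensor_eq.append[OF 2 tensor_eq.refl]])
        (use Cons.prems a vspD(7)[OF V] cl in auto)
    ultimately show ?case using a by (auto intro: tensor_eq.trans)
  qed
  have null: "tensor_eq V W [(0 \<odot>\<^bsub>V\<^esub> v, w). (v, w) \<leftarrow> xs] []" if "?wf xs" for xs
    using that
  proof (induction xs)
    case Nil
    then show ?case by (simp add: tensor_eq.refl)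
  next
    case (Cons a xs)
    obtain v w where a: "a = (v, w)" by force
    have "tensor_eq V W [(0 \<odot>\<^bsub>V\<^esub> v, w)] []"
      using Cons.prems a vspD(12)[OF V] by (auto intro: tensor_eq.zero)
    from tensor_eq.append[OF this Cons.IH] show ?case using Cons.prems a by auto
  qed
  show ?thesis
  proof (rule vspI)
    fix x y assume "x \<in> carrier (tensor V W)" "y \<in> carrier (tensor V W)"
    then obtain xs ys where xy: "?wf xs" "?wf ys" "x = tcls V W xs" "y = tcls V W ys" using el by metis
    then show "x \<oplus>\<^bsub>tensor V W\<^esub> y \<in> carrier (tensor V W)"
      and "x \<oplus>\<^bsub>tensor V W\<^esub> y = y \<oplus>\<^bsub>tensor V W\<^esub> x"
      and "c \<odot>\<^bsub>tensor V W\<^esub> (x \<oplus>\<^bsub>tensor V W\<^esub> y) = c \<odot>\<^bsub>tensor V W\<^esub> x \<oplus>\<^bsub>tensor V W\<^esub> c \<odot>\<^bsub>tensor V W\<^esub> y" for c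
      using add scale by (auto intro!: tcls_eqI tensor_eq.commute)
  next
    fix x y z assume "x \<in> carrier (tensor V W)" "y \<in> carrier (tensor V W)" "z \<in> carrier (tensor V W)"
    then obtain xs ys zs where "?wf xs" "?wf ys" "?wf zs"
      "x = tcls V W xs" "y = tcls V W ys" "z = tcls V W zs" using el by metis
    then show "x \<oplus>\<^bsub>tensor V W\<^esub> y \<oplus>\<^bsub>tensor V W\<^esub> z = x \<oplus>\<^bsub>tensor V W\<^esub> (y \<oplus>\<^bsub>tensor V W\<^esub> z)"
      using add by simp
  next
    fix x assume "x \<in> carrier (tensor V W)"
    then obtain xs where x: "?wf xs" "x = tcls V W xs" using el by metis
    then show "\<zero>\<^bsub>tensor V W\<^esub> \<oplus>\<^bsub>tensor V W\<^esub> x = x"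
      using add[of "[]" xs] by (simp add: tensor_simps(2))
    show "c \<odot>\<^bsub>tensor V W\<^esub> x \<in> carrier (tensor V W)"
      and "(c + d) \<odot>\<^bsub>tensor V W\<^esub> x = c \<odot>\<^bsub>tensor V W\<^esub> x \<oplus>\<^bsub>tensor V W\<^esub> d \<odot>\<^bsub>tensor V W\<^esub> x"
      and "0 \<odot>\<^bsub>tensor V W\<^esub> x = \<zero>\<^bsub>tensor V W\<^esub>" for c d
      using x add scale distr[of xs] null[of xs] by (auto intro!: tcls_eqI simp: tensor_simps(2))
    have "[((c * d) \<odot>\<^bsub>V\<^esub> v, w). (v, w) \<leftarrow> xs] =
      [(c \<odot>\<^bsub>V\<^esub> v, w). (v, w) \<leftarrow> [(d \<odot>\<^bsub>V\<^esub> v, w). (v, w) \<leftarrow> xs]]" for c d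
      using x(1) vspD(10)[OF V] by auto
    then show "(c * d) \<odot>\<^bsub>tensor V W\<^esub> x = c \<odot>\<^bsub>tensor V W\<^esub> (d \<odot>\<^bsub>tensor V W\<^esub> x)" for c d
      using x(2) scale[OF cl[OF x(1), of d], of c] scale[OF x(1)] by presburger
    have "[(1 \<odot>\<^bsub>V\<^esub> v, w). (v, w) \<leftarrow> xs] = xs"
      using x(1) vspD(11)[OF V] by (intro map_idI) auto
    then show "1 \<odot>\<^bsub>tensor V W\<^esub> x = x"
      using x scale[of xs 1] by simp
  qed (auto simp: tensor_simps(2))
qed

lemma tsum_tcls [simp]:
  assumes "vsp V" "vsp W" "bform V W F" "set xs \<subseteq> carrier V \<times> carrier W"
  shows "tsum (tcls V W xs) F = tsum xs F"
  using tensor_eq_tsum[OF assms(3,1,2) tcls_rep[OF assms(4)]] by simp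

lemma lform_tsum:
  assumes V: "vsp V" and W: "vsp W" and F: "bform V W F"
  shows "lform (tensor V W) (\<lambda>t. tsum t F)"
  unfolding lform_def
proof (intro conjI ballI allI)
  fix s t assume st: "s \<in> carrier (tensor V W)" "t \<in> carrier (tensor V W)"
  note s = tensor_elemD[OF V W st(1)] and t = tensor_elemD[OF V W st(2)]
  show "tsum (s \<oplus>\<^bsub>tensor V W\<^esub> t) F = tsum s F + tsum t F"
    using st s t tsum_tcls[OF V W F, of "s @ t"] by (simp add: tensor_simps(5))
next
  fix c t assume st: "t \<in> carrier (tensor V W)"
  note t = tensor_elemD[OF V W st]
  have "tsum t (\<lambda>v w. F (c \<odot>\<^bsub>V\<^esub> v) w) = tsum t (\<lambda>v w. c * F v w)"
    using t(1) lformD(2)[OF bformD(1)[OF F]] by (intro tsum_cong) auto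
  then show "tsum (c \<odot>\<^bsub>tensor V W\<^esub> t) F = c * tsum t F"
    using st tsum_tcls[OF V W F scale_wf[OF V t(1), of c]]
    by (simp add: tensor_simps(6) tsum_mult_left)
qed

text \<open>Together with \<open>bform_tcls\<close> and \<open>lform_tsum\<close> this is the
  universal property of the tensor product for scalar-valued maps.\<close>

lemma lform_tensor_expand:
  assumes V: "vsp V" and W: "vsp W" and f: "lform (tensor V W) f" and xs: "set xs \<subseteq> carrier V \<times> carrier W"
  shows "f (tcls V W xs) = tsum xs (\<lambda>v w. f (tcls V W [(v, w)]))"
  using xs
proof (induction xs)
  case Nil
  then show ?case using lform_zero[OF vsp_tensor[OF V W] f] by (simp add: tensor_simps(2))
next
  case (Cons a xs)
  then show ?case
    using tensor_add_tcls[OF V W, of "[a]" xs] lformD(1)[OF f, of "tcls V W [a]" "tcls V W xs"]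
    by (cases a) auto
qed

lemma bform_tcls:
  assumes V: "vsp V" and W: "vsp W" and f: "lform (tensor V W) f"
  shows "bform V W (\<lambda>v w. f (tcls V W [(v, w)]))"
proof -
  have "tcls V W [(v \<oplus>\<^bsub>V\<^esub> v', w)] = tcls V W [(v, w)] \<oplus>\<^bsub>tensor V W\<^esub> tcls V W [(v', w)]"
    if "v \<in> carrier V" "v' \<in> carrier V" "w \<in> carrier W" for v v' w
    using that by (simp add: tensor_add_tcls[OF V W] tcls_eqI tensor_eq.add_left)
  moreover have "tcls V W [(v, w \<oplus>\<^bsub>W\<^esub> w')] = tcls V W [(v, w)] \<oplus>\<^bsub>tensor V W\<^esub> tcls V W [(v, w')]"
    if "v \<in> carrier V" "w' \<in> carrier W" "w \<in> carrier W" for v w w'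
    using that by (simp add: tensor_add_tcls[OF V W] tcls_eqI tensor_eq.add_right)
  moreover have "tcls V W [(c \<odot>\<^bsub>V\<^esub> v, w)] = c \<odot>\<^bsub>tensor V W\<^esub> tcls V W [(v, w)]"
    if "v \<in> carrier V" "w \<in> carrier W" for v c w
    using that by (simp add: tensor_smult_tcls[OF V W])
  moreover have "tcls V W [(v, c \<odot>\<^bsub>W\<^esub> w)] = c \<odot>\<^bsub>tensor V W\<^esub> tcls V W [(v, w)]"
    if "v \<in> carrier V" "w \<in> carrier W" for v c w
    using that by (simp add: tensor_smult_tcls[OF V W] tcls_eqI[OF tensor_eq.smult, symmetric])
  ultimately show ?thesis
    unfolding bform_def lform_def using lformD[OF f] by auto
qed

text \<open>Linear forms separate points, and each linear form on the tensor product is the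
  evaluation of a bilinear form on lists.\<close>

lemma tensor_eqI:
  assumes V: "vsp V" and W: "vsp W" and st: "s \<in> carrier (tensor V W)" "t \<in> carrier (tensor V W)"
    and eq: "\<And>F. bform V W F \<Longrightarrow> tsum s F = tsum t F"
  shows "s = t"
proof (rule lform_eqI[OF vsp_tensor[OF V W] st])
  fix f assume f: "lform (tensor V W) f"
  then show "f s = f t"
    using lform_tensor_expand[OF V W f] tensor_elemD[OF V W st(1)] tensor_elemD[OF V W st(2)]
      eq[OF bform_tcls[OF V W f]] by metis
qed

lemma tensor_memD:
  assumes "vsp V" "vsp W" "t \<in> carrier (tensor V W)" "(a, b) \<in> set t"
  shows "a \<in> carrier V" and "b \<in> carrier W"
  using tensor_elemD(1)[OF assms(1-3)] assms(4) by auto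

lemma wf_map:
  assumes "\<And>a b. (a, b) \<in> set t \<Longrightarrow> u a b \<in> A" and "\<And>a b. (a, b) \<in> set t \<Longrightarrow> v a b \<in> B"
  shows "set (map (\<lambda>(a, b). (u a b, v a b)) t) \<subseteq> A \<times> B"
  using assms by auto

lemma wf_concat:
  assumes "\<And>a b. (a, b) \<in> set t \<Longrightarrow> set (L a b) \<subseteq> A"
  shows "set (concat (map (\<lambda>(a, b). L a b) t)) \<subseteq> A"
  using assms by fastforce

lemma wf_single: "a \<in> A \<Longrightarrow> b \<in> B \<Longrightarrow> set [(a, b)] \<subseteq> A \<times> B"
  by auto

text \<open>Each rule matches one layer of a list comprehension, so well-formedness of a Sweedler
  list reduces to its innermost entries.\<close>

lemmas wf_intros = wf_map wf_concat wf_single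

lemma tcls_eq_iff:
  assumes "vsp V" "vsp W" "set xs \<subseteq> carrier V \<times> carrier W" "set ys \<subseteq> carrier V \<times> carrier W"
  shows "tcls V W xs = tcls V W ys \<longleftrightarrow> (\<forall>F. bform V W F \<longrightarrow> tsum xs F = tsum ys F)"
  using tensor_eqI[OF assms(1,2), of "tcls V W xs" "tcls V W ys"] tsum_tcls[OF assms(1,2) _ assms(3)]
    tsum_tcls[OF assms(1,2) _ assms(4)] tcls_in[OF assms(3)] tcls_in[OF assms(4)]
  by metis

lemma tcls_eqI':
  assumes "vsp V" "vsp W" "set xs \<subseteq> carrier V \<times> carrier W" "t \<in> carrier (tensor V W)"
    "\<And>F. bform V W F \<Longrightarrow> tsum t F = tsum xs F"
  shows "t = tcls V W xs"
  by (rule tensor_eqI) (use assms in auto)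

section \<open>Rules for proving linearity\<close>

lemma lhom_id: "(\<lambda>x. x) \<in> lhom V V"
  by (simp add: lhom_iff)

lemma lform_comp:
  assumes "lform V f" "e \<in> lhom X V"
  shows "lform X (\<lambda>x. f (e x))"
  using lformD[OF assms(1)] lhomD[OF assms(2)] by (simp add: lform_def)

lemma lhom_comp:
  assumes "g \<in> lhom V W" "e \<in> lhom X V"
  shows "(\<lambda>x. g (e x)) \<in> lhom X W"
  using lhomD[OF assms(1)] lhomD[OF assms(2)] by (simp add: lhom_iff)

lemma bform_left:
  assumes "bform V W F" "e \<in> lhom X V" "w \<in> carrier W"
  shows "lform X (\<lambda>x. F (e x) w)"
  by (rule lform_comp[OF bformD(1)[OF assms(1,3)] assms(2)])

lemma bform_right:
  assumes "bform V W F" "e \<in> lhom X W" "v \<in> carrier V"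
  shows "lform X (\<lambda>x. F v (e x))"
  by (rule lform_comp[OF bformD(2)[OF assms(1,3)] assms(2)])

lemma lform_cong:
  assumes "lform V g" and "vsp V" and "\<And>x. x \<in> carrier V \<Longrightarrow> f x = g x"
  shows "lform V f"
  using assms(1,3) vspD(1,7)[OF assms(2)] unfolding lform_def by simp

lemma lhom_cong:
  assumes "g \<in> lhom V W" and "vsp V" and "\<And>x. x \<in> carrier V \<Longrightarrow> f x = g x"
  shows "f \<in> lhom V W"
  using assms(1,3) vspD(1,7)[OF assms(2)] unfolding lhom_iff by simp

lemma lform_mult_left: "lform X f \<Longrightarrow> lform X (\<lambda>x. c * f x)"
  by (simp add: lform_def algebra_simps)

lemma lform_mult_right: "lform X f \<Longrightarrow> lform X (\<lambda>x. f x * c)"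
  by (simp add: lform_def algebra_simps)

lemma lform_sum: "(\<And>i. i \<in> I \<Longrightarrow> lform X (f i)) \<Longrightarrow> lform X (\<lambda>x. \<Sum>i\<in>I. f i x)"
  by (simp add: lform_def sum.distrib sum_distrib_left)

lemma lform_tsum_left:
  assumes "e \<in> lhom X (tensor V W)" "vsp V" "vsp W" "bform V W F"
  shows "lform X (\<lambda>x. tsum (e x) F)"
  by (rule lform_comp[OF lform_tsum[OF assms(2-4)] assms(1)])

lemma lform_tsum_body:
  assumes "\<And>a b. (a, b) \<in> set t \<Longrightarrow> lform X (\<lambda>x. F a b x)"
  shows "lform X (\<lambda>x. tsum t (\<lambda>a b. F a b x))"
  using assms
proof (induction t)
  case Nil
  then show ?case by (simp add: lform_def)
next
  case (Cons c t)
  then show ?case by (cases c) (simp add: lform_def algebra_simps)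
qed

text \<open>The target has enough linear forms, so additivity and homogeneity can be tested after
  composing with each of them.\<close>

lemma lhom_lformI:
  assumes X: "vsp X" and W: "vsp W" and c: "\<And>x. x \<in> carrier X \<Longrightarrow> \<phi> x \<in> carrier W"
    and l: "\<And>f. lform W f \<Longrightarrow> lform X (\<lambda>x. f (\<phi> x))"
  shows "\<phi> \<in> lhom X W"
  unfolding lhom_iff
proof (intro conjI ballI allI)
  fix x y assume xy: "x \<in> carrier X" "y \<in> carrier X"
  show "\<phi> x \<in> carrier W" by (rule c) fact
  show "\<phi> (x \<oplus>\<^bsub>X\<^esub> y) = \<phi> x \<oplus>\<^bsub>W\<^esub> \<phi> y"
    by (rule lform_eqI[OF W])
      (use xy c lformD(1)[OF l] vspD(1)[OF X] vspD(1)[OF W] in \<open>auto simp: lformD(1)\<close>)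
next
  fix k x assume x: "x \<in> carrier X"
  show "\<phi> (k \<odot>\<^bsub>X\<^esub> x) = k \<odot>\<^bsub>W\<^esub> \<phi> x"
    by (rule lform_eqI[OF W])
      (use x c lformD(2)[OF l] vspD(7)[OF X] vspD(7)[OF W] in \<open>auto simp: lformD(2)\<close>)
qed

text \<open>When the target is a tensor product, bilinear forms suffice as tests, since every linear
  form on it arises from one.\<close>

lemma lhom_tensorI:
  assumes X: "vsp X" and V: "vsp V" and W: "vsp W"
    and c: "\<And>x. x \<in> carrier X \<Longrightarrow> \<phi> x \<in> carrier (tensor V W)"
    and l: "\<And>F. bform V W F \<Longrightarrow> lform X (\<lambda>x. tsum (\<phi> x) F)"
  shows "\<phi> \<in> lhom X (tensor V W)"
proof (rule lhom_lformI[OF X vsp_tensor[OF V W] c])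
  fix f assume f: "lform (tensor V W) f"
  have "f (\<phi> x) = tsum (\<phi> x) (\<lambda>v w. f (tcls V W [(v, w)]))" if "x \<in> carrier X" for x
    using lform_tensor_expand[OF V W f] tensor_elemD[OF V W c[OF that]] by metis
  then show "lform X (\<lambda>x. f (\<phi> x))"
    by (rule lform_cong[OF l[OF bform_tcls[OF V W f]] X])
qed

text \<open>Meant for nested tensors: a form in three arguments becomes bilinear in the outer entry
  and the inner tensor.\<close>

lemma bform_tensor_right:
  assumes V: "vsp V" and W: "vsp W" and X: "vsp X"
    and "\<And>v w. v \<in> carrier V \<Longrightarrow> w \<in> carrier W \<Longrightarrow> lform X (\<lambda>x. F x v w)"
    and "\<And>x. x \<in> carrier X \<Longrightarrow> bform V W (F x)"
  shows "bform X (tensor V W) (\<lambda>x t. tsum t (F x))"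
proof (rule bformI)
  fix t assume "t \<in> carrier (tensor V W)"
  then show "lform X (\<lambda>x. tsum t (F x))"
    by (intro lform_tsum_body assms(4) tensor_memD[OF V W])
qed (use assms lform_tsum[OF V W] in auto)

lemma tcls_bilinear:
  assumes V: "vsp V" and W: "vsp W"
  shows "w \<in> carrier W \<Longrightarrow> (\<lambda>v. tcls V W [(v, w)]) \<in> lhom V (tensor V W)"
    and "v \<in> carrier V \<Longrightarrow> (\<lambda>w. tcls V W [(v, w)]) \<in> lhom W (tensor V W)"
proof -
  assume w: "w \<in> carrier W"
  show "(\<lambda>v. tcls V W [(v, w)]) \<in> lhom V (tensor V W)"
  proof (rule lhom_tensorI[OF V V W])
    fix F assume F: "bform V W F"
    show "lform V (\<lambda>v. tsum (tcls V W [(v, w)]) F)"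
      by (rule lform_cong[OF bformD(1)[OF F w] V]) (use V W F w in simp)
  qed (use w in auto)
next
  assume v: "v \<in> carrier V"
  show "(\<lambda>w. tcls V W [(v, w)]) \<in> lhom W (tensor V W)"
  proof (rule lhom_tensorI[OF W V W])
    fix F assume F: "bform V W F"
    show "lform W (\<lambda>w. tsum (tcls V W [(v, w)]) F)"
      by (rule lform_cong[OF bformD(2)[OF F v] W]) (use V W F v in simp)
  qed (use v in auto)
qed

lemma lform_sumlist:
  assumes V: "vsp V" and f: "lform V f" and wf: "\<And>a b. (a, b) \<in> set t \<Longrightarrow> e a b \<in> carrier V"
  shows "f (abelian_monoid.sumlist V (map (\<lambda>(a, b). e a b) t)) = tsum t (\<lambda>a b. f (e a b))"
    and "abelian_monoid.sumlist V (map (\<lambda>(a, b). e a b) t) \<in> carrier V"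
proof -
  interpret vectorspace class_ring V by fact
  have *: "f (M.sumlist (map (\<lambda>(a, b). e a b) t)) = tsum t (\<lambda>a b. f (e a b)) \<and>
    M.sumlist (map (\<lambda>(a, b). e a b) t) \<in> carrier V"
    using wf
  proof (induction t)
    case Nil
    then show ?case using lform_zero[OF V f] vspD(2)[OF V] by (simp add: M.sumlist_Nil)
  next
    case (Cons c t)
    then show ?case using lformD(1)[OF f] vspD(1)[OF V] by (cases c) (simp add: M.sumlist_Cons)
  qed
  then show "f (M.sumlist (map (\<lambda>(a, b). e a b) t)) = tsum t (\<lambda>a b. f (e a b))"
    "M.sumlist (map (\<lambda>(a, b). e a b) t) \<in> carrier V" by auto
qed

lemma sumlist_in:
  assumes V: "vsp V" and "set xs \<subseteq> carrier V"
  shows "abelian_monoid.sumlist V xs \<in> carrier V"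
proof -
  interpret vectorspace class_ring V by fact
  show ?thesis using assms(2) by (rule M.sumlist_carrier)
qed

section \<open>Tensor products inside the universe of vector spaces\<close>

lemma is_vspace_vsp [simp, intro]: "is_vspace V \<Longrightarrow> vsp V"
  by (simp add: is_vspace_def)

lemma tensor_space_simps:
  "carrier (tensor_space V W) = Tens ` carrier (tensor V W)"
  "\<zero>\<^bsub>tensor_space V W\<^esub> = Tens \<zero>\<^bsub>tensor V W\<^esub>"
  "mult (tensor_space V W) = undefined" "one (tensor_space V W) = undefined"
  "x \<oplus>\<^bsub>tensor_space V W\<^esub> y = (if x \<in> carrier (tensor_space V W) \<and> y \<in> carrier (tensor_space V W)
     then Tens (summands x \<oplus>\<^bsub>tensor V W\<^esub> summands y) else undefined)"
  "c \<odot>\<^bsub>tensor_space V W\<^esub> x = (if x \<in> carrier (tensor_space V W)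
     then Tens (c \<odot>\<^bsub>tensor V W\<^esub> summands x) else undefined)"
  by (simp_all add: tensor_space_def Let_def)

lemma is_vspace_tensor_space [simp, intro]:
  assumes "is_vspace V" "is_vspace W"
  shows "is_vspace (tensor_space V W)"
proof -
  note T = vspD[OF vsp_tensor[OF is_vspace_vsp is_vspace_vsp, OF assms]]
  have "vsp (tensor_space V W)"
    by (rule vspI) (auto simp: tensor_space_simps T(1-3,5-12) intro: T(4))
  then show ?thesis
    unfolding is_vspace_def by (intro conjI allI impI) (auto simp: tensor_space_simps(3-6))
qed

lemma lhom_Tens: "vsp V \<Longrightarrow> vsp W \<Longrightarrow> Tens \<in> lhom (tensor V W) (tensor_space V W)"
  by (auto simp: lhom_iff tensor_space_simps)

lemma lhom_summands: "vsp V \<Longrightarrow> vsp W \<Longrightarrow> summands \<in> lhom (tensor_space V W) (tensor V W)"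
  using vspD(1,7)[OF vsp_tensor] by (auto simp: lhom_iff tensor_space_simps)

lemma utens_in: "set xs \<subseteq> carrier V \<times> carrier W \<Longrightarrow> utens V W xs \<in> carrier (tensor_space V W)"
  by (simp add: utens_def tensor_space_simps)

lemma utens_pure_in [simp]:
  "v \<in> carrier V \<Longrightarrow> w \<in> carrier W \<Longrightarrow> utens V W [(v, w)] \<in> carrier (tensor_space V W)"
  by (rule utens_in) simp

lemma summands_in [simp]: "x \<in> carrier (tensor_space V W) \<Longrightarrow> summands x \<in> carrier (tensor V W)"
  by (auto simp: tensor_space_simps)

lemma summands_memD:
  assumes "is_vspace V" "is_vspace W" "x \<in> carrier (tensor_space V W)" "(a, b) \<in> set (summands x)"
  shows "a \<in> carrier V" and "b \<in> carrier W"
  using tensor_memD[OF _ _ summands_in[OF assms(3)] assms(4)] assms by auto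

lemma utens_summands:
  assumes "is_vspace V" "is_vspace W" "x \<in> carrier (tensor_space V W)"
  shows "utens V W (summands x) = x"
  using assms tensor_elemD(2)[of V W] by (auto simp: utens_def tensor_space_simps)

lemma tsum_summands_utens [simp]:
  "is_vspace V \<Longrightarrow> is_vspace W \<Longrightarrow> bform V W F \<Longrightarrow> set xs \<subseteq> carrier V \<times> carrier W \<Longrightarrow>
    tsum (summands (utens V W xs)) F = tsum xs F"
  by (simp add: utens_def)

lemma tensor_space_eqI:
  assumes V: "is_vspace V" and W: "is_vspace W"
    and xy: "x \<in> carrier (tensor_space V W)" "y \<in> carrier (tensor_space V W)"
    and eq: "\<And>F. bform V W F \<Longrightarrow> tsum (summands x) F = tsum (summands y) F"
  shows "x = y"
  using tensor_eqI[of V W "summands x" "summands y"] utens_summands[OF V W] assms by (metis is_vspace_vsp summands_in)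

lemma lform_utens:
  assumes V: "is_vspace V" and W: "is_vspace W" and f: "lform (tensor_space V W) f"
    and xs: "set xs \<subseteq> carrier V \<times> carrier W"
  shows "f (utens V W xs) = tsum xs (\<lambda>v w. f (utens V W [(v, w)]))"
  using lform_tensor_expand[OF _ _ lform_comp[OF f lhom_Tens] xs] V W by (simp add: utens_def)

lemma lform_summands:
  assumes V: "is_vspace V" and W: "is_vspace W" and f: "lform (tensor_space V W) f"
    and x: "x \<in> carrier (tensor_space V W)"
  shows "f x = tsum (summands x) (\<lambda>v w. f (utens V W [(v, w)]))"
  using lform_utens[OF V W f, of "summands x"] utens_summands[OF V W x]
    tensor_elemD(1)[of V W "summands x"] V W x by simp

lemma bform_utens:
  assumes V: "is_vspace V" and W: "is_vspace W" and f: "lform (tensor_space V W) f"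
  shows "bform V W (\<lambda>v w. f (utens V W [(v, w)]))"
  using bform_tcls[OF _ _ lform_comp[OF f lhom_Tens]] V W by (simp add: utens_def)

lemma utens_bilinear:
  assumes V: "is_vspace V" and W: "is_vspace W"
  shows "e \<in> lhom X V \<Longrightarrow> w \<in> carrier W \<Longrightarrow> (\<lambda>x. utens V W [(e x, w)]) \<in> lhom X (tensor_space V W)"
    and "e' \<in> lhom X W \<Longrightarrow> v \<in> carrier V \<Longrightarrow> (\<lambda>x. utens V W [(v, e' x)]) \<in> lhom X (tensor_space V W)"
  unfolding utens_def
  using lhom_comp[OF lhom_Tens[of V W] lhom_comp[OF tcls_bilinear(1)[of V W w]], of e X]
    lhom_comp[OF lhom_Tens[of V W] lhom_comp[OF tcls_bilinear(2)[of V W v]], of e' X] V W by auto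

lemma lhom_summandsI:
  "e \<in> lhom X (tensor_space V W) \<Longrightarrow> is_vspace V \<Longrightarrow> is_vspace W \<Longrightarrow>
    (\<lambda>x. summands (e x)) \<in> lhom X (tensor V W)"
  by (rule lhom_comp[OF lhom_summands]) auto

lemma lform_tsum_summands:
  assumes "e \<in> lhom X (tensor_space V W)" "is_vspace V" "is_vspace W" "bform V W F"
  shows "lform X (\<lambda>x. tsum (summands (e x)) F)"
  by (rule lform_tsum_left[OF lhom_summandsI[OF assms(1-3)]]) (use assms in auto)

text \<open>After composition with a form both maps become sums over a representing list, and the
  summands are values on pure tensors.\<close>

lemma lhom_ext2:
  assumes V: "is_vspace V" and W: "is_vspace W" and X: "vsp X"
    and \<phi>: "\<phi> \<in> lhom (tensor_space V W) X" and \<psi>: "\<psi> \<in> lhom (tensor_space V W) X"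
    and eq: "\<And>v w. v \<in> carrier V \<Longrightarrow> w \<in> carrier W \<Longrightarrow> \<phi> (utens V W [(v, w)]) = \<psi> (utens V W [(v, w)])"
    and x: "x \<in> carrier (tensor_space V W)"
  shows "\<phi> x = \<psi> x"
proof (rule lform_eqI[OF X lhomD(1)[OF \<phi> x] lhomD(1)[OF \<psi> x]])
  fix f assume "lform X f"
  then show "f (\<phi> x) = f (\<psi> x)"
    using lform_summands[OF V W lform_comp[OF _ \<phi>] x, of f] lform_summands[OF V W lform_comp[OF _ \<psi>] x, of f]
      summands_memD[OF V W x] eq by (simp cong: tsum_cong)
qed

text \<open>The previous principle is applied to the outer tensor and then, with the last entry
  fixed, to the inner one.\<close>

lemma lhom_ext3:
  assumes U: "is_vspace U" and V: "is_vspace V" and W: "is_vspace W" and X: "vsp X"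
    and \<phi>: "\<phi> \<in> lhom (tensor_space (tensor_space U V) W) X" and \<psi>: "\<psi> \<in> lhom (tensor_space (tensor_space U V) W) X"
    and eq: "\<And>u v w. u \<in> carrier U \<Longrightarrow> v \<in> carrier V \<Longrightarrow> w \<in> carrier W \<Longrightarrow>
      \<phi> (utens (tensor_space U V) W [(utens U V [(u, v)], w)]) = \<psi> (utens (tensor_space U V) W [(utens U V [(u, v)], w)])"
    and x: "x \<in> carrier (tensor_space (tensor_space U V) W)"
  shows "\<phi> x = \<psi> x"
proof (rule lhom_ext2[OF _ W X \<phi> \<psi> _ x])
  fix t w assume t: "t \<in> carrier (tensor_space U V)" and w: "w \<in> carrier W"
  show "\<phi> (utens (tensor_space U V) W [(t, w)]) = \<psi> (utens (tensor_space U V) W [(t, w)])"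
    by (rule lhom_ext2[OF U V X lhom_comp[OF \<phi>] lhom_comp[OF \<psi>] _ t])
      (use U V W w eq in \<open>auto intro!: utens_bilinear lhom_id\<close>)
qed (use U V in auto)

lemma lhom_ext3':
  assumes U: "is_vspace U" and V: "is_vspace V" and W: "is_vspace W" and X: "vsp X"
    and \<phi>: "\<phi> \<in> lhom (tensor_space U (tensor_space V W)) X" and \<psi>: "\<psi> \<in> lhom (tensor_space U (tensor_space V W)) X"
    and eq: "\<And>u v w. u \<in> carrier U \<Longrightarrow> v \<in> carrier V \<Longrightarrow> w \<in> carrier W \<Longrightarrow>
      \<phi> (utens U (tensor_space V W) [(u, utens V W [(v, w)])]) = \<psi> (utens U (tensor_space V W) [(u, utens V W [(v, w)])])"
    and x: "x \<in> carrier (tensor_space U (tensor_space V W))"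
  shows "\<phi> x = \<psi> x"
proof (rule lhom_ext2[OF U _ X \<phi> \<psi> _ x])
  fix t u assume t: "t \<in> carrier (tensor_space V W)" and u: "u \<in> carrier U"
  show "\<phi> (utens U (tensor_space V W) [(u, t)]) = \<psi> (utens U (tensor_space V W) [(u, t)])"
    by (rule lhom_ext2[OF V W X lhom_comp[OF \<phi>] lhom_comp[OF \<psi>] _ t])
      (use U V W u eq in \<open>auto intro!: utens_bilinear lhom_id\<close>)
qed (use V W in auto)

lemma lhom_ext4:
  assumes U: "is_vspace U" and V: "is_vspace V" and W: "is_vspace W" and Z: "is_vspace Z" and X: "vsp X"
    and \<phi>: "\<phi> \<in> lhom (tensor_space (tensor_space (tensor_space U V) W) Z) X"
    and \<psi>: "\<psi> \<in> lhom (tensor_space (tensor_space (tensor_space U V) W) Z) X"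
    and eq: "\<And>u v w z. u \<in> carrier U \<Longrightarrow> v \<in> carrier V \<Longrightarrow> w \<in> carrier W \<Longrightarrow> z \<in> carrier Z \<Longrightarrow>
      \<phi> (utens (tensor_space (tensor_space U V) W) Z [(utens (tensor_space U V) W [(utens U V [(u, v)], w)], z)]) =
      \<psi> (utens (tensor_space (tensor_space U V) W) Z [(utens (tensor_space U V) W [(utens U V [(u, v)], w)], z)])"
    and x: "x \<in> carrier (tensor_space (tensor_space (tensor_space U V) W) Z)"
  shows "\<phi> x = \<psi> x"
proof (rule lhom_ext2[OF _ Z X \<phi> \<psi> _ x])
  fix t z assume t: "t \<in> carrier (tensor_space (tensor_space U V) W)" and z: "z \<in> carrier Z"
  show "\<phi> (utens (tensor_space (tensor_space U V) W) Z [(t, z)]) = \<psi> (utens (tensor_space (tensor_space U V) W) Z [(t, z)])"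
    by (rule lhom_ext3[OF U V W X lhom_comp[OF \<phi>] lhom_comp[OF \<psi>] _ t])
      (use U V W Z z eq in \<open>auto intro!: utens_bilinear lhom_id\<close>)
qed (use U V W in auto)

lemma summands_memD3:
  assumes "is_vspace U" "is_vspace V" "is_vspace W" "x \<in> carrier (tensor_space (tensor_space U V) W)"
    "(t, w) \<in> set (summands x)" "(u, v) \<in> set (summands t)"
  shows "u \<in> carrier U" and "v \<in> carrier V" and "w \<in> carrier W"
  using summands_memD[OF is_vspace_tensor_space[OF assms(1,2)] assms(3-5)]
    summands_memD[OF assms(1,2) _ assms(6)] by auto

lemma summands_memD3':
  assumes "is_vspace U" "is_vspace V" "is_vspace W" "x \<in> carrier (tensor_space U (tensor_space V W))"
    "(u, t) \<in> set (summands x)" "(v, w) \<in> set (summands t)"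
  shows "u \<in> carrier U" and "v \<in> carrier V" and "w \<in> carrier W"
  using summands_memD[OF assms(1) is_vspace_tensor_space[OF assms(2,3)] assms(4,5)]
    summands_memD[OF assms(2,3) _ assms(6)] by auto

text \<open>Every map out of a tensor product below is given on the representing list; it is linear, and
  its value on a pure tensor is read off, as soon as the summands depend bilinearly on the entries.\<close>

definition evaluates ::
    "('k::field, 'a) vspace \<Rightarrow> ('k, 'a) vspace \<Rightarrow> ('k, 'y, 'z) module_scheme \<Rightarrow>
      (('k, 'a) vuniv \<Rightarrow> 'y) \<Rightarrow> (('y \<Rightarrow> 'k) \<Rightarrow> ('k, 'a) vuniv \<Rightarrow> ('k, 'a) vuniv \<Rightarrow> 'k) \<Rightarrow> bool" where
  "evaluates V W Y \<phi> G \<longleftrightarrow> (\<forall>x\<in>carrier (tensor_space V W). \<phi> x \<in> carrier Y) \<and>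
    (\<forall>h. lform Y h \<longrightarrow> bform V W (G h) \<and>
      (\<forall>x\<in>carrier (tensor_space V W). h (\<phi> x) = tsum (summands x) (G h)))"

lemma evaluatesI:
  assumes "\<And>x. x \<in> carrier (tensor_space V W) \<Longrightarrow> \<phi> x \<in> carrier Y"
    and "\<And>h. lform Y h \<Longrightarrow> bform V W (G h)"
    and "\<And>h x. lform Y h \<Longrightarrow> x \<in> carrier (tensor_space V W) \<Longrightarrow> h (\<phi> x) = tsum (summands x) (G h)"
  shows "evaluates V W Y \<phi> G"
  using assms unfolding evaluates_def by blast

lemma evaluatesD:
  assumes "evaluates V W Y \<phi> G"
  shows "x \<in> carrier (tensor_space V W) \<Longrightarrow> \<phi> x \<in> carrier Y"
    and "lform Y h \<Longrightarrow> bform V W (G h)"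
    and "lform Y h \<Longrightarrow> x \<in> carrier (tensor_space V W) \<Longrightarrow> h (\<phi> x) = tsum (summands x) (G h)"
  using assms unfolding evaluates_def by blast+

lemma evaluates_lhom:
  assumes e: "evaluates V W Y \<phi> G" and V: "is_vspace V" and W: "is_vspace W" and Y: "vsp Y"
  shows "\<phi> \<in> lhom (tensor_space V W) Y"
proof (rule lhom_lformI[OF _ Y evaluatesD(1)[OF e]])
  fix h assume h: "lform Y h"
  have "lform (tensor_space V W) (\<lambda>x. tsum (summands x) (G h))"
    by (intro lform_tsum_summands[OF lhom_id] V W evaluatesD(2)[OF e h])
  then show "lform (tensor_space V W) (\<lambda>x. h (\<phi> x))"
    by (rule lform_cong) (use V W evaluatesD(3)[OF e h] in auto)
qed (use V W in auto)

lemma evaluates_pure: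
  assumes e: "evaluates V W Y \<phi> G" and V: "is_vspace V" and W: "is_vspace W" and Y: "vsp Y"
    and v: "v \<in> carrier V" and w: "w \<in> carrier W" and y: "y \<in> carrier Y"
    and eq: "\<And>h. lform Y h \<Longrightarrow> G h v w = h y"
  shows "\<phi> (utens V W [(v, w)]) = y"
proof (rule lform_eqI[OF Y evaluatesD(1)[OF e utens_pure_in[OF v w]] y])
  fix h assume h: "lform Y h"
  show "h (\<phi> (utens V W [(v, w)])) = h y"
    using evaluatesD(3)[OF e h utens_pure_in[OF v w]] evaluatesD(2)[OF e h] V W v w eq[OF h] by simp
qed

section \<open>Tensor products of maps and the associativity constraint\<close>

lemma tensor_map_evaluates:
  assumes V: "is_vspace V" and W: "is_vspace W" and V': "is_vspace V'" and W': "is_vspace W'"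
    and f: "f \<in> lhom V V'" and g: "g \<in> lhom W W'"
  shows "evaluates V W (tensor_space V' W') (tensor_map V W V' W' f g) (\<lambda>h v w. h (utens V' W' [(f v, g w)]))"
proof (rule evaluatesI)
  have wf: "set [(f v, g w). (v, w) \<leftarrow> summands x] \<subseteq> carrier V' \<times> carrier W'"
    if x: "x \<in> carrier (tensor_space V W)" for x
    by (intro wf_intros lhomD(1)[OF f] lhomD(1)[OF g]) (blast intro: summands_memD[OF V W x])+
  then show "x \<in> carrier (tensor_space V W) \<Longrightarrow> tensor_map V W V' W' f g x \<in> carrier (tensor_space V' W')" for x
    by (simp add: tensor_map_def utens_in)
  fix h assume h: "lform (tensor_space V' W') h"
  show "bform V W (\<lambda>v w. h (utens V' W' [(f v, g w)]))"
    by (intro bformI lform_comp[OF h] utens_bilinear[OF V' W'] f g lhomD(1)[OF f] lhomD(1)[OF g])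
  fix x assume x: "x \<in> carrier (tensor_space V W)"
  show "h (tensor_map V W V' W' f g x) = tsum (summands x) (\<lambda>v w. h (utens V' W' [(f v, g w)]))"
    using lform_utens[OF V' W' h wf[OF x]] x by (simp add: tensor_map_def)
qed

lemma tensor_map_lhom:
  assumes "is_vspace V" "is_vspace W" "is_vspace V'" "is_vspace W'" "f \<in> lhom V V'" "g \<in> lhom W W'"
  shows "tensor_map V W V' W' f g \<in> lhom (tensor_space V W) (tensor_space V' W')"
  by (rule evaluates_lhom[OF tensor_map_evaluates[OF assms]]) (use assms in auto)

lemma tensor_map_pure:
  assumes "is_vspace V" "is_vspace W" "is_vspace V'" "is_vspace W'" "f \<in> lhom V V'" "g \<in> lhom W W'"
    and "v \<in> carrier V" "w \<in> carrier W"
  shows "tensor_map V W V' W' f g (utens V W [(v, w)]) = utens V' W' [(f v, g w)]"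
  by (rule evaluates_pure[OF tensor_map_evaluates[OF assms(1-6)]])
    (use assms lhomD(1)[OF assms(5)] lhomD(1)[OF assms(6)] in auto)

lemma assoc_map_evaluates:
  assumes U: "is_vspace U" and V: "is_vspace V" and W: "is_vspace W"
  shows "evaluates (tensor_space U V) W (tensor_space U (tensor_space V W)) (assoc_map U V W)
    (\<lambda>h t w. tsum (summands t) (\<lambda>u v. h (utens U (tensor_space V W) [(u, utens V W [(v, w)])])))"
proof (rule evaluatesI)
  note UV = is_vspace_tensor_space[OF U V] and VW = is_vspace_tensor_space[OF V W]
  have wf: "set [(u, utens V W [(v, w)]). (t, w) \<leftarrow> summands x, (u, v) \<leftarrow> summands t]
    \<subseteq> carrier U \<times> carrier (tensor_space V W)" if x: "x \<in> carrier (tensor_space (tensor_space U V) W)" for x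
    by (intro wf_intros utens_pure_in) (blast intro: summands_memD3[OF U V W x])+
  then show "x \<in> carrier (tensor_space (tensor_space U V) W) \<Longrightarrow>
      assoc_map U V W x \<in> carrier (tensor_space U (tensor_space V W))" for x
    unfolding assoc_map_def by (simp add: utens_in)
  fix h assume h: "lform (tensor_space U (tensor_space V W)) h"
  show "bform (tensor_space U V) W
    (\<lambda>t w. tsum (summands t) (\<lambda>u v. h (utens U (tensor_space V W) [(u, utens V W [(v, w)])])))"
    by (intro bformI lform_tsum_summands[OF lhom_id U V] lform_tsum_body U V lform_comp[OF h] utens_bilinear[OF U VW]
        utens_bilinear[OF V W] lhom_id utens_pure_in) (blast intro: summands_memD[OF U V])+
  fix x assume x: "x \<in> carrier (tensor_space (tensor_space U V) W)"
  show "h (assoc_map U V W x) = tsum (summands x)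
    (\<lambda>t w. tsum (summands t) (\<lambda>u v. h (utens U (tensor_space V W) [(u, utens V W [(v, w)])])))"
    using lform_utens[OF U VW h wf[OF x]] x by (simp add: assoc_map_def)
qed

lemma assoc_map_lhom:
  assumes "is_vspace U" "is_vspace V" "is_vspace W"
  shows "assoc_map U V W \<in> lhom (tensor_space (tensor_space U V) W) (tensor_space U (tensor_space V W))"
  by (rule evaluates_lhom[OF assoc_map_evaluates[OF assms]]) (use assms in auto)

lemma assoc_map_pure:
  assumes "is_vspace U" "is_vspace V" "is_vspace W" "u \<in> carrier U" "v \<in> carrier V" "w \<in> carrier W"
  shows "assoc_map U V W (utens (tensor_space U V) W [(utens U V [(u, v)], w)]) =
    utens U (tensor_space V W) [(u, utens V W [(v, w)])]"
proof (rule evaluates_pure[OF assoc_map_evaluates[OF assms(1-3)]])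
  fix h assume h: "lform (tensor_space U (tensor_space V W)) h"
  have "bform U V (\<lambda>u v. h (utens U (tensor_space V W) [(u, utens V W [(v, w)])]))"
    by (intro bformI lform_comp[OF h] utens_bilinear lhom_id assms is_vspace_tensor_space utens_pure_in)
  then show "tsum (summands (utens U V [(u, v)])) (\<lambda>u v. h (utens U (tensor_space V W) [(u, utens V W [(v, w)])])) =
      h (utens U (tensor_space V W) [(u, utens V W [(v, w)])])"
    using assms by simp
qed (use assms in auto)

text \<open>The hexagon identities contain \<open>inv_arrow\<close> of the associator; an explicit
  formula for the inverse allows them to be checked on pure tensors.\<close>

definition assoc_inv ::
    "('k::field, 'a) vspace \<Rightarrow> ('k, 'a) vspace \<Rightarrow> ('k, 'a) vspace \<Rightarrow> ('k, 'a) vuniv \<Rightarrow> ('k, 'a) vuniv" where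
  "assoc_inv U V W =
    (\<lambda>x\<in>carrier (tensor_space U (tensor_space V W)).
       utens (tensor_space U V) W [(utens U V [(u, v)], w). (u, t) \<leftarrow> summands x, (v, w) \<leftarrow> summands t])"

lemma assoc_inv_evaluates:
  assumes U: "is_vspace U" and V: "is_vspace V" and W: "is_vspace W"
  shows "evaluates U (tensor_space V W) (tensor_space (tensor_space U V) W) (assoc_inv U V W)
    (\<lambda>h u t. tsum (summands t) (\<lambda>v w. h (utens (tensor_space U V) W [(utens U V [(u, v)], w)])))"
proof (rule evaluatesI)
  note UV = is_vspace_tensor_space[OF U V] and VW = is_vspace_tensor_space[OF V W]
  have wf: "set [(utens U V [(u, v)], w). (u, t) \<leftarrow> summands x, (v, w) \<leftarrow> summands t]
    \<subseteq> carrier (tensor_space U V) \<times> carrier W" if x: "x \<in> carrier (tensor_space U (tensor_space V W))" for x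
    by (intro wf_intros utens_pure_in) (blast intro: summands_memD3'[OF U V W x])+
  then show "x \<in> carrier (tensor_space U (tensor_space V W)) \<Longrightarrow>
      assoc_inv U V W x \<in> carrier (tensor_space (tensor_space U V) W)" for x
    unfolding assoc_inv_def by (simp add: utens_in)
  fix h assume h: "lform (tensor_space (tensor_space U V) W) h"
  show "bform U (tensor_space V W)
    (\<lambda>u t. tsum (summands t) (\<lambda>v w. h (utens (tensor_space U V) W [(utens U V [(u, v)], w)])))"
    by (intro bformI lform_tsum_summands[OF lhom_id V W] lform_tsum_body V W lform_comp[OF h] utens_bilinear[OF UV W]
        utens_bilinear[OF U V] lhom_id utens_pure_in) (blast intro: summands_memD[OF V W])+
  fix x assume x: "x \<in> carrier (tensor_space U (tensor_space V W))"
  show "h (assoc_inv U V W x) = tsum (summands x)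
    (\<lambda>u t. tsum (summands t) (\<lambda>v w. h (utens (tensor_space U V) W [(utens U V [(u, v)], w)])))"
    using lform_utens[OF UV W h wf[OF x]] x by (simp add: assoc_inv_def)
qed

lemma assoc_inv_lhom:
  assumes "is_vspace U" "is_vspace V" "is_vspace W"
  shows "assoc_inv U V W \<in> lhom (tensor_space U (tensor_space V W)) (tensor_space (tensor_space U V) W)"
  by (rule evaluates_lhom[OF assoc_inv_evaluates[OF assms]]) (use assms in auto)

lemma assoc_inv_pure:
  assumes "is_vspace U" "is_vspace V" "is_vspace W" "u \<in> carrier U" "v \<in> carrier V" "w \<in> carrier W"
  shows "assoc_inv U V W (utens U (tensor_space V W) [(u, utens V W [(v, w)])]) =
    utens (tensor_space U V) W [(utens U V [(u, v)], w)]"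
proof (rule evaluates_pure[OF assoc_inv_evaluates[OF assms(1-3)]])
  fix h assume h: "lform (tensor_space (tensor_space U V) W) h"
  have "bform V W (\<lambda>v w. h (utens (tensor_space U V) W [(utens U V [(u, v)], w)]))"
    by (intro bformI lform_comp[OF h] utens_bilinear lhom_id assms is_vspace_tensor_space utens_pure_in)
  then show "tsum (summands (utens V W [(v, w)])) (\<lambda>v w. h (utens (tensor_space U V) W [(utens U V [(u, v)], w)])) =
      h (utens (tensor_space U V) W [(utens U V [(u, v)], w)])"
    using assms by simp
qed (use assms in auto)

lemma assoc_inv_assoc_map:
  assumes "is_vspace U" "is_vspace V" "is_vspace W"
  shows "x \<in> carrier (tensor_space (tensor_space U V) W) \<Longrightarrow> assoc_inv U V W (assoc_map U V W x) = x"
    and "y \<in> carrier (tensor_space U (tensor_space V W)) \<Longrightarrow> assoc_map U V W (assoc_inv U V W y) = y"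
proof -
  show "x \<in> carrier (tensor_space (tensor_space U V) W) \<Longrightarrow> assoc_inv U V W (assoc_map U V W x) = x"
    by (rule lhom_ext3[OF assms _ lhom_comp[OF assoc_inv_lhom[OF assms] assoc_map_lhom[OF assms]] lhom_id])
      (use assms in \<open>auto simp: assoc_map_pure assoc_inv_pure\<close>)
  show "y \<in> carrier (tensor_space U (tensor_space V W)) \<Longrightarrow> assoc_map U V W (assoc_inv U V W y) = y"
    by (rule lhom_ext3'[OF assms _ lhom_comp[OF assoc_map_lhom[OF assms] assoc_inv_lhom[OF assms]] lhom_id])
      (use assms in \<open>auto simp: assoc_map_pure assoc_inv_pure\<close>)
qed

section \<open>The unit space and the unit constraints\<close>

lemma unit_space_simps [simp]:
  "carrier unit_space = range Scalar"
  "\<zero>\<^bsub>unit_space\<^esub> = Scalar 0"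
  "Scalar a \<oplus>\<^bsub>unit_space\<^esub> Scalar b = Scalar (a + b)"
  "c \<odot>\<^bsub>unit_space\<^esub> Scalar a = Scalar (c * a)"
  by (simp_all add: unit_space_def Let_def)

lemma is_vspace_unit_space [simp, intro]: "is_vspace (unit_space :: ('k::field, 'a) vspace)"
proof -
  have 1: "vsp (unit_space :: ('k, 'a) vspace)"
    by (rule vspI) (auto simp: algebra_simps)
  have 2: "mult unit_space = undefined" "one unit_space = undefined"
    "\<And>x y. \<not> (x \<in> carrier unit_space \<and> y \<in> carrier unit_space) \<Longrightarrow> x \<oplus>\<^bsub>unit_space\<^esub> y = undefined"
    "\<And>c x. x \<notin> carrier unit_space \<Longrightarrow> c \<odot>\<^bsub>unit_space\<^esub> x = undefined"
    by (auto simp: unit_space_def Let_def)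
  show ?thesis
    unfolding is_vspace_def by (intro conjI allI impI) (rule 1, rule 2, rule 2, erule 2(3), erule 2(4))
qed

lemma lform_the_scalar: "lform unit_space the_scalar"
  by (auto simp: lform_def)

lemma lunit_map_evaluates:
  assumes V: "is_vspace V"
  shows "evaluates unit_space V V (lunit_map V) (\<lambda>h s v. the_scalar s * h v)"
proof (rule evaluatesI)
  have cl: "the_scalar a \<odot>\<^bsub>V\<^esub> b \<in> carrier V" "b \<in> carrier V"
    if "x \<in> carrier (tensor_space unit_space V)" "(a, b) \<in> set (summands x)" for x a b
    using summands_memD(2)[OF _ V that] V by (auto intro!: vspD(7))
  show "x \<in> carrier (tensor_space unit_space V) \<Longrightarrow> lunit_map V x \<in> carrier V"
    for x
    using cl(1) V by (auto simp: lunit_map_def intro!: sumlist_in)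
  fix h assume h: "lform V h"
  show "bform unit_space V (\<lambda>s v. the_scalar s * h v)"
    by (intro bformI lform_mult_right lform_mult_left lform_the_scalar h)
  fix x assume x: "x \<in> carrier (tensor_space unit_space V)"
  show "h (lunit_map V x) = tsum (summands x) (\<lambda>s v. the_scalar s * h v)"
    using lform_sumlist(1)[OF _ h, of "summands x" "\<lambda>s v. the_scalar s \<odot>\<^bsub>V\<^esub> v"] cl[OF x] x V
    by (simp add: lunit_map_def lformD(2)[OF h] cong: tsum_cong)
qed

lemma lunit_map_lhom:
  assumes "is_vspace V"
  shows "lunit_map V \<in> lhom (tensor_space unit_space V) V"
  by (rule evaluates_lhom[OF lunit_map_evaluates[OF assms]]) (use assms in auto)

lemma lunit_map_pure:
  assumes "is_vspace V" "s \<in> carrier unit_space" "v \<in> carrier V"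
  shows "lunit_map V (utens unit_space V [(s, v)]) = the_scalar s \<odot>\<^bsub>V\<^esub> v"
  by (rule evaluates_pure[OF lunit_map_evaluates[OF assms(1)]])
    (use assms in \<open>auto intro: vspD(7) simp: lformD(2)\<close>)

lemma runit_map_evaluates:
  assumes V: "is_vspace V"
  shows "evaluates V unit_space V (runit_map V) (\<lambda>h v s. the_scalar s * h v)"
proof (rule evaluatesI)
  have cl: "the_scalar b \<odot>\<^bsub>V\<^esub> a \<in> carrier V" "a \<in> carrier V"
    if "x \<in> carrier (tensor_space V unit_space)" "(a, b) \<in> set (summands x)" for x a b
    using summands_memD(1)[OF V _ that] V by (auto intro!: vspD(7))
  show "x \<in> carrier (tensor_space V unit_space) \<Longrightarrow> runit_map V x \<in> carrier V"
    for x
    using cl(1) V by (auto simp: runit_map_def intro!: sumlist_in)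
  fix h assume h: "lform V h"
  show "bform V unit_space (\<lambda>v s. the_scalar s * h v)"
    by (intro bformI lform_mult_right lform_mult_left lform_the_scalar h)
  fix x assume x: "x \<in> carrier (tensor_space V unit_space)"
  show "h (runit_map V x) = tsum (summands x) (\<lambda>v s. the_scalar s * h v)"
    using lform_sumlist(1)[OF _ h, of "summands x" "\<lambda>v s. the_scalar s \<odot>\<^bsub>V\<^esub> v"] cl[OF x] x V
    by (simp add: runit_map_def lformD(2)[OF h] cong: tsum_cong)
qed

lemma runit_map_lhom:
  assumes "is_vspace V"
  shows "runit_map V \<in> lhom (tensor_space V unit_space) V"
  by (rule evaluates_lhom[OF runit_map_evaluates[OF assms]]) (use assms in auto)

lemma runit_map_pure:
  assumes "is_vspace V" "s \<in> carrier unit_space" "v \<in> carrier V"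
  shows "runit_map V (utens V unit_space [(v, s)]) = the_scalar s \<odot>\<^bsub>V\<^esub> v"
  by (rule evaluates_pure[OF runit_map_evaluates[OF assms(1)]])
    (use assms in \<open>auto intro: vspD(7) simp: lformD(2)\<close>)

lemma lunit_map_inverse:
  assumes V: "is_vspace V"
  shows "(\<lambda>v. utens unit_space V [(Scalar 1, v)]) \<in> lhom V (tensor_space unit_space V)"
    and "x \<in> carrier (tensor_space unit_space V) \<Longrightarrow> utens unit_space V [(Scalar 1, lunit_map V x)] = x"
    and "v \<in> carrier V \<Longrightarrow> lunit_map V (utens unit_space V [(Scalar 1, v)]) = v"
proof -
  show 1: "(\<lambda>v. utens unit_space V [(Scalar 1, v)]) \<in> lhom V (tensor_space unit_space V)"
    by (intro utens_bilinear V lhom_id) auto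
  show "x \<in> carrier (tensor_space unit_space V) \<Longrightarrow> utens unit_space V [(Scalar 1, lunit_map V x)] = x"
  proof (rule lhom_ext2[OF _ V _ lhom_comp[OF 1 lunit_map_lhom[OF V]] lhom_id])
    fix s v assume s: "s \<in> carrier (unit_space :: ('a, 'b) vspace)" and v: "v \<in> carrier V"
    obtain c where c: "s = Scalar c" using s by auto
    \<comment> \<open>The scalar is moved from the second factor to the first by taking it out of
      the tensor and putting it back, using linearity in each entry.\<close>
    have "utens unit_space V [(Scalar 1, c \<odot>\<^bsub>V\<^esub> v)] = c \<odot>\<^bsub>tensor_space unit_space V\<^esub> utens unit_space V [(Scalar 1, v)]"
      using lhomD(3)[OF 1 v] by simp
    also have "\<dots> = utens unit_space V [(c \<odot>\<^bsub>unit_space\<^esub> Scalar 1, v)]"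
      using lhomD(3)[OF utens_bilinear(1)[OF _ V lhom_id v], of unit_space "Scalar 1" c] by (simp del: unit_space_simps(3,4))
    finally show "utens unit_space V [(Scalar 1, lunit_map V (utens unit_space V [(s, v)]))] = utens unit_space V [(s, v)]"
      using lunit_map_pure[OF V s v] c by simp
  qed (use V in auto)
  show "v \<in> carrier V \<Longrightarrow> lunit_map V (utens unit_space V [(Scalar 1, v)]) = v"
    using lunit_map_pure[OF V] V by (simp add: vspD(11))
qed

lemma runit_map_inverse:
  assumes V: "is_vspace V"
  shows "(\<lambda>v. utens V unit_space [(v, Scalar 1)]) \<in> lhom V (tensor_space V unit_space)"
    and "x \<in> carrier (tensor_space V unit_space) \<Longrightarrow> utens V unit_space [(runit_map V x, Scalar 1)] = x"
    and "v \<in> carrier V \<Longrightarrow> runit_map V (utens V unit_space [(v, Scalar 1)]) = v"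
proof -
  show 1: "(\<lambda>v. utens V unit_space [(v, Scalar 1)]) \<in> lhom V (tensor_space V unit_space)"
    by (intro utens_bilinear V lhom_id) auto
  show "x \<in> carrier (tensor_space V unit_space) \<Longrightarrow> utens V unit_space [(runit_map V x, Scalar 1)] = x"
  proof (rule lhom_ext2[OF V _ _ lhom_comp[OF 1 runit_map_lhom[OF V]] lhom_id])
    fix s v assume s: "s \<in> carrier (unit_space :: ('a, 'b) vspace)" and v: "v \<in> carrier V"
    obtain c where c: "s = Scalar c" using s by auto
    have "utens V unit_space [(c \<odot>\<^bsub>V\<^esub> v, Scalar 1)] = c \<odot>\<^bsub>tensor_space V unit_space\<^esub> utens V unit_space [(v, Scalar 1)]"
      using lhomD(3)[OF 1 v] by simp
    also have "\<dots> = utens V unit_space [(v, c \<odot>\<^bsub>unit_space\<^esub> Scalar 1)]"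
      using lhomD(3)[OF utens_bilinear(2)[OF V _ lhom_id v], of unit_space "Scalar 1" c] by (simp del: unit_space_simps(3,4))
    finally show "utens V unit_space [(runit_map V (utens V unit_space [(v, s)]), Scalar 1)] = utens V unit_space [(v, s)]"
      using runit_map_pure[OF V s v] c by simp
  qed (use V in auto)
  show "v \<in> carrier V \<Longrightarrow> runit_map V (utens V unit_space [(v, Scalar 1)]) = v"
    using runit_map_pure[OF V] V by (simp add: vspD(11))
qed

lemma alg_simps [simp]:
  "carrier (alg H) = UNIV" "mult (alg H) = (*)" "one (alg H) = 1" "zero (alg H) = 0"
  "add (alg H) = (+)" "smult (alg H) = scl H"
  by (simp_all add: alg_def)

lemma tsum_congI: "(\<And>a b. (a, b) \<in> set t \<Longrightarrow> F a b = G a b) \<Longrightarrow> tsum t F = tsum t G"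
  by (rule tsum_cong[OF HOL.refl])

section \<open>Hopf algebras\<close>

text \<open>Trilinear forms take the place of forms on a threefold tensor product, so that
  coassociativity can be used without nested tensors.\<close>

definition tform ::
    "('k::field, 'u, 'z) module_scheme \<Rightarrow> ('k, 'v, 'y) module_scheme \<Rightarrow> ('k, 'w, 'x) module_scheme \<Rightarrow>
      ('u \<Rightarrow> 'v \<Rightarrow> 'w \<Rightarrow> 'k) \<Rightarrow> bool" where
  "tform U V W F \<longleftrightarrow>
    (\<forall>v\<in>carrier V. \<forall>w\<in>carrier W. lform U (\<lambda>u. F u v w)) \<and>
    (\<forall>u\<in>carrier U. \<forall>w\<in>carrier W. lform V (\<lambda>v. F u v w)) \<and>
    (\<forall>u\<in>carrier U. \<forall>v\<in>carrier V. lform W (F u v))"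

lemma tformI:
  assumes "\<And>v w. v \<in> carrier V \<Longrightarrow> w \<in> carrier W \<Longrightarrow> lform U (\<lambda>u. F u v w)"
    and "\<And>u w. u \<in> carrier U \<Longrightarrow> w \<in> carrier W \<Longrightarrow> lform V (\<lambda>v. F u v w)"
    and "\<And>u v. u \<in> carrier U \<Longrightarrow> v \<in> carrier V \<Longrightarrow> lform W (\<lambda>w. F u v w)"
  shows "tform U V W F"
  using assms by (auto simp: tform_def)

lemma tformD:
  assumes "tform U V W F"
  shows "v \<in> carrier V \<Longrightarrow> w \<in> carrier W \<Longrightarrow> lform U (\<lambda>u. F u v w)"
    and "u \<in> carrier U \<Longrightarrow> w \<in> carrier W \<Longrightarrow> lform V (\<lambda>v. F u v w)"
    and "u \<in> carrier U \<Longrightarrow> v \<in> carrier V \<Longrightarrow> lform W (F u v)"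
  using assms by (auto simp: tform_def)

lemma tsum_nested_right:
  assumes U: "vsp U" and V: "vsp V" and W: "vsp W" and F: "tform U V W F" and t: "t \<in> carrier (tensor U (tensor V W))"
    and xs: "set xs \<subseteq> carrier U \<times> carrier (tensor V W)" and eq: "t = tcls U (tensor V W) xs"
  shows "tsum t (\<lambda>u s. tsum s (F u)) = tsum xs (\<lambda>u s. tsum s (F u))"
proof -
  have "bform U (tensor V W) (\<lambda>u s. tsum s (F u))"
    by (rule bform_tensor_right[OF V W U]) (use tformD[OF F] in \<open>auto intro!: bformI\<close>)
  then show ?thesis using U V W xs eq by simp
qed

context hopf_algebra
begin

abbreviation A :: "('k, 'h) module" where "A \<equiv> alg H"

lemma vsp_alg [simp, intro]: "vsp A"
proof -
  interpret vector_space "scl H" by (rule vector_space)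
  show ?thesis by (rule vspI) (auto simp: algebra_simps)
qed

lemma lform_alg_iff: "lform A p \<longleftrightarrow> Vector_Spaces.linear (scl H) (*) p"
proof -
  interpret vector_space "scl H" by (rule vector_space)
  interpret K: vector_space "(*) :: 'k \<Rightarrow> 'k \<Rightarrow> 'k" by unfold_locales (auto simp: algebra_simps)
  show ?thesis
    by (auto simp: lform_def Vector_Spaces.linear_def module_hom_def module_hom_axioms_def
        vector_space_axioms K.vector_space_axioms module_axioms K.module_axioms)
qed

lemma lhom_alg_iff: "f \<in> lhom A A \<longleftrightarrow> Vector_Spaces.linear (scl H) (scl H) f"
proof -
  interpret vector_space "scl H" by (rule vector_space)
  show ?thesis
    by (auto simp: lhom_iff Vector_Spaces.linear_def module_hom_def module_hom_axioms_def
        vector_space_axioms module_axioms)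
qed

lemma lform_counit: "lform A (counit H)"
  using counit_linear lform_alg_iff by blast

lemma lhom_antipode: "antipode H \<in> lhom A A"
  using antipode_linear lhom_alg_iff by blast

lemma comul_in [simp]: "comul H x \<in> carrier (tensor A A)"
  using lhomD(1)[OF comul_linear] by simp

lemma lhom_mult:
  "e \<in> lhom X A \<Longrightarrow> (\<lambda>x. e x * h) \<in> lhom X A"
  "e \<in> lhom X A \<Longrightarrow> (\<lambda>x. h * e x) \<in> lhom X A"
  by (auto simp: lhom_iff algebra_simps scl_mult_left scl_mult_right)

lemma lform_comul: "e \<in> lhom X A \<Longrightarrow> bform A A F \<Longrightarrow> lform X (\<lambda>x. tsum (comul H (e x)) F)"
  by (rule lform_tsum_left[OF lhom_comp[OF comul_linear]]) auto

text \<open>Closure rules: applied with \<open>intro\<close>, they take a Sweedler expression apart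
  along its syntax and thereby prove that it is linear in the chosen variables.\<close>

lemmas lin = lhom_id lhom_mult lform_comul bformI tformI lform_tsum_body lform_mult_left lform_mult_right
  lform_comp[OF lform_counit] lhom_comp[OF lhom_antipode]

lemma alg_eqI: "(\<And>f. lform A f \<Longrightarrow> f x = f y) \<Longrightarrow> x = y"
  by (rule lform_eqI[OF vsp_alg]) auto

lemma lform_sum_alg: "lform A f \<Longrightarrow> f (\<Sum>(a, b)\<leftarrow>t. e a b) = tsum t (\<lambda>a b. f (e a b))"
proof (induction t)
  case Nil
  then show ?case using lform_zero[OF vsp_alg] by simp
next
  case (Cons c t)
  then show ?case using lformD(1)[of A f] by (cases c) simp
qed

text \<open>Both sides of \<open>coassoc\<close> are evaluated at the bilinear form that pairs the
  first entry with the inner tensor; what remains is a regrouping of an iterated sum.\<close>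

lemma comul_coassoc:
  assumes F: "tform A A A F"
  shows "tsum (comul H x) (\<lambda>a b. tsum (comul H a) (\<lambda>a1 a2. F a1 a2 b)) =
    tsum (comul H x) (\<lambda>a b. tsum (comul H b) (F a))"
proof -
  let ?G = "\<lambda>u s. tsum s (F u)"
  let ?l = "[(a1, tcls A A [(a2, b)]). (a, b) \<leftarrow> comul H x, (a1, a2) \<leftarrow> comul H a]"
  let ?r = "[(a, comul H b). (a, b) \<leftarrow> comul H x]"
  have wf: "set ?l \<subseteq> carrier A \<times> carrier (tensor A A)" "set ?r \<subseteq> carrier A \<times> carrier (tensor A A)"
    by (intro wf_intros; simp)+
  note eq = tsum_nested_right[OF vsp_alg vsp_alg vsp_alg F]
  have "tsum ?l ?G = tsum ?r ?G"
    using eq[OF _ wf(1) HOL.refl] eq[OF _ wf(2) HOL.refl] coassoc[of x] wf by simp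
  moreover have "bform A A (F u)" for u
    using tformD[OF F] by (auto intro!: bformI)
  ultimately show ?thesis by simp
qed

lemma counit_left': "lform A f \<Longrightarrow> tsum (comul H x) (\<lambda>a b. counit H a * f b) = f x"
  using arg_cong[OF counit_left[of x], of f] lformD(2)[of A f] by (simp add: lform_sum_alg)

lemma counit_right': "lform A f \<Longrightarrow> tsum (comul H x) (\<lambda>a b. counit H b * f a) = f x"
  using arg_cong[OF counit_right[of x], of f] lformD(2)[of A f] by (simp add: lform_sum_alg)

lemma antipode_left': "lform A f \<Longrightarrow> tsum (comul H x) (\<lambda>a b. f (antipode H a * b)) = counit H x * f 1"
  using arg_cong[OF antipode_left[of x], of f] lformD(2)[of A f] by (simp add: lform_sum_alg)

lemma antipode_right': "lform A f \<Longrightarrow> tsum (comul H x) (\<lambda>a b. f (a * antipode H b)) = counit H x * f 1"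
  using arg_cong[OF antipode_right[of x], of f] lformD(2)[of A f] by (simp add: lform_sum_alg)

lemma comul_mult': "bform A A F \<Longrightarrow>
    tsum (comul H (x * y)) F = tsum (comul H x) (\<lambda>a b. tsum (comul H y) (\<lambda>c d. F (a * c) (b * d)))"
  by (simp add: comul_mult)

lemma comul_one': "bform A A F \<Longrightarrow> tsum (comul H 1) F = F 1 1"
  by (simp add: comul_one)

lemma antipode_one: "antipode H 1 = 1"
proof (rule alg_eqI)
  fix f assume f: "lform A f"
  have "bform A A (\<lambda>a b. f (antipode H a * b))"
    by (intro lin lform_comp[OF f])
  then show "f (antipode H 1) = f 1"
    using antipode_left'[OF f, of 1] by (simp add: comul_one' counit_one)
qed

text \<open>Both sides equal the sum of \<open>f (S (x1 y1) (x2 y2) S (y3) S (x3))\<close>.\<close>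

lemma antipode_mult: "antipode H (x * y) = antipode H y * antipode H x"
proof (rule alg_eqI)
  fix f assume f: "lform A f"
  let ?S = "antipode H" and ?\<Delta> = "comul H" and ?\<epsilon> = "counit H"
  let ?G = "\<lambda>a b c a' b' c'. f (?S (a * a') * (b * b') * (?S c' * ?S c))"
  note L = lin lform_comp[OF f]
  \<comment> \<open>One evaluation of the common expression: first \<open>y_2 S(y_3)\<close>
    collapses, then \<open>x_2 S(x_3)\<close>.\<close>
  have fl: "tsum (?\<Delta> x) (\<lambda>a b. tsum (?\<Delta> b) (\<lambda>b1 b2. tsum (?\<Delta> y) (\<lambda>a' b'. tsum (?\<Delta> b') (\<lambda>b1' b2'.
      ?G a b1 b2 a' b1' b2')))) = f (?S (x * y))"
  proof -
    have 1: "tsum (?\<Delta> b') (\<lambda>b1' b2'. ?G a b1 b2 a' b1' b2') = ?\<epsilon> b' * f (?S (a * a') * b1 * ?S b2)" for a b1 b2 a' b'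
    proof -
      have "lform A (\<lambda>z. f (?S (a * a') * b1 * z * ?S b2))" by (intro L)
      from antipode_right'[OF this, of b'] show ?thesis by (simp add: mult.assoc)
    qed
    have 2: "tsum (?\<Delta> y) (\<lambda>a' b'. ?\<epsilon> b' * f (?S (a * a') * b1 * ?S b2)) = f (?S (a * y) * b1 * ?S b2)" for a b1 b2
      by (rule counit_right') (intro L)
    have 3: "tsum (?\<Delta> b) (\<lambda>b1 b2. f (?S (a * y) * b1 * ?S b2)) = ?\<epsilon> b * f (?S (a * y))" for a b
    proof -
      have "lform A (\<lambda>z. f (?S (a * y) * z))" by (intro L)
      from antipode_right'[OF this, of b] show ?thesis by (simp add: mult.assoc)
    qed
    have 4: "tsum (?\<Delta> x) (\<lambda>a b. ?\<epsilon> b * f (?S (a * y))) = f (?S (x * y))"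
      by (rule counit_right') (intro L)
    show ?thesis by (simp only: 1 2 3 4)
  qed
  \<comment> \<open>For the other evaluation coassociativity, used for \<open>y\<close> and then for
    \<open>x\<close>, regroups the sums so that the first two parts of each element come from one
    coproduct.\<close>
  have "tsum (?\<Delta> x) (\<lambda>a b. tsum (?\<Delta> b) (\<lambda>b1 b2. tsum (?\<Delta> y) (\<lambda>a' b'. tsum (?\<Delta> b') (\<lambda>b1' b2'.
      ?G a b1 b2 a' b1' b2')))) =
    tsum (?\<Delta> x) (\<lambda>a b. tsum (?\<Delta> b) (\<lambda>b1 b2. tsum (?\<Delta> y) (\<lambda>a' b'. tsum (?\<Delta> a') (\<lambda>a1' a2'. ?G a b1 b2 a1' a2' b'))))"
    by (intro tsum_congI comul_coassoc[symmetric] L)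
  also have "\<dots> = tsum (?\<Delta> x) (\<lambda>a b. tsum (?\<Delta> a) (\<lambda>a1 a2. tsum (?\<Delta> y) (\<lambda>a' b'. tsum (?\<Delta> a') (\<lambda>a1' a2'. ?G a1 a2 b a1' a2' b'))))"
    by (intro comul_coassoc[symmetric] L)
  also have "\<dots> = tsum (?\<Delta> x) (\<lambda>a b. tsum (?\<Delta> y) (\<lambda>a' b'. tsum (?\<Delta> a) (\<lambda>a1 a2. tsum (?\<Delta> a') (\<lambda>a1' a2'. ?G a1 a2 b a1' a2' b'))))"
    by (intro tsum_congI tsum_swap)
  \<comment> \<open>The coproduct is multiplicative, so the leading factors have the shape
    \<open>S(z_1) z_2\<close> with \<open>z = a * a'\<close>.\<close>
  also have "\<dots> = tsum (?\<Delta> x) (\<lambda>a b. tsum (?\<Delta> y) (\<lambda>a' b'. ?\<epsilon> (a * a') * f (?S b' * ?S b)))"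
  proof (intro tsum_congI)
    fix a b a' b'
    have "lform A (\<lambda>z. f (z * (?S b' * ?S b)))" by (intro L)
    from antipode_left'[OF this, of "a * a'"]
    have "tsum (?\<Delta> (a * a')) (\<lambda>c d. f (?S c * d * (?S b' * ?S b))) = ?\<epsilon> (a * a') * f (?S b' * ?S b)"
      by simp
    moreover have "bform A A (\<lambda>c d. f (?S c * d * (?S b' * ?S b)))"
      by (intro L)
    ultimately show "tsum (?\<Delta> a) (\<lambda>a1 a2. tsum (?\<Delta> a') (\<lambda>a1' a2'. ?G a1 a2 b a1' a2' b')) = ?\<epsilon> (a * a') * f (?S b' * ?S b)"
      by (simp add: comul_mult')
  qed
  also have "\<dots> = tsum (?\<Delta> x) (\<lambda>a b. ?\<epsilon> a * tsum (?\<Delta> y) (\<lambda>a' b'. ?\<epsilon> a' * f (?S b' * ?S b)))"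
    by (simp add: counit_mult mult.assoc tsum_mult_left)
  also have "\<dots> = f (?S y * ?S x)"
    by (subst counit_left', (intro L)[1], rule counit_left') (intro L)
  finally show "f (?S (x * y)) = f (?S y * ?S x)" using fl by simp
qed

section \<open>Hopf automorphisms and the index group\<close>

lemma aut_iff: "\<alpha> \<in> hopf_aut H \<longleftrightarrow> bij \<alpha> \<and> \<alpha> \<in> lhom A A \<and> (\<forall>x y. \<alpha> (x * y) = \<alpha> x * \<alpha> y) \<and> \<alpha> 1 = 1 \<and>
    (\<forall>x F. bform A A F \<longrightarrow> tsum (comul H (\<alpha> x)) F = tsum (comul H x) (\<lambda>a b. F (\<alpha> a) (\<alpha> b))) \<and>
    (\<forall>x. counit H (\<alpha> x) = counit H x) \<and> (\<forall>x. antipode H (\<alpha> x) = \<alpha> (antipode H x))"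
proof -
  have "comul H (\<alpha> x) = tcls A A [(\<alpha> a, \<alpha> b). (a, b) \<leftarrow> comul H x] \<longleftrightarrow>
    (\<forall>F. bform A A F \<longrightarrow> tsum (comul H (\<alpha> x)) F = tsum (comul H x) (\<lambda>a b. F (\<alpha> a) (\<alpha> b)))" for x
    using tcls_eqI'[OF vsp_alg vsp_alg, of "[(\<alpha> a, \<alpha> b). (a, b) \<leftarrow> comul H x]" "comul H (\<alpha> x)"] by auto
  then show ?thesis unfolding hopf_aut_def lhom_alg_iff by auto
qed

lemma autD:
  assumes "\<alpha> \<in> hopf_aut H"
  shows "bij \<alpha>" and "\<alpha> \<in> lhom A A" and "\<alpha> (x * y) = \<alpha> x * \<alpha> y" and "\<alpha> 1 = 1"
    and "bform A A F \<Longrightarrow> tsum (comul H (\<alpha> x)) F = tsum (comul H x) (\<lambda>a b. F (\<alpha> a) (\<alpha> b))"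
    and "counit H (\<alpha> x) = counit H x" and "antipode H (\<alpha> x) = \<alpha> (antipode H x)"
    and "finv \<alpha> (\<alpha> x) = x" and "\<alpha> (finv \<alpha> x) = x"
  using assms unfolding aut_iff by (auto simp: bij_def surj_f_inv_f)

lemma aut_id: "id \<in> hopf_aut H"
  by (auto simp: aut_iff lhom_iff)

lemma aut_comp:
  assumes a: "\<alpha> \<in> hopf_aut H" and b: "\<beta> \<in> hopf_aut H"
  shows "\<alpha> \<circ> \<beta> \<in> hopf_aut H"
proof -
  have "bform A A (\<lambda>a b. F (\<alpha> a) (\<alpha> b))" if "bform A A F" for F
    by (intro bformI bform_left[OF that] bform_right[OF that] autD(2)[OF a] UNIV_I alg_simps(1)[THEN equalityD2, THEN subsetD])
  then show ?thesis
    unfolding aut_iff using autD[OF a] autD[OF b] lhom_comp[OF autD(2)[OF a] autD(2)[OF b]]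
      bij_comp[OF autD(1)[OF b] autD(1)[OF a]]
    by (auto simp: comp_def)
qed

lemma aut_finv:
  assumes a: "\<alpha> \<in> hopf_aut H"
  shows "finv \<alpha> \<in> hopf_aut H"
proof -
  note [simp] = autD(8,9)[OF a]
  have eqI: "finv \<alpha> x = y" if "x = \<alpha> y" for x y using that by simp
  have 1: "bij (finv \<alpha>)" using autD(1)[OF a] by (rule bij_imp_bij_inv)
  have 2: "finv \<alpha> \<in> lhom A A"
    using lhomD(2,3)[OF autD(2)[OF a]] by (auto simp: lhom_iff intro!: eqI)
  have 3: "finv \<alpha> (x * y) = finv \<alpha> x * finv \<alpha> y" for x y
    by (auto intro!: eqI simp: autD(3)[OF a])
  have 4: "finv \<alpha> 1 = 1" by (auto intro!: eqI simp: autD(4)[OF a])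
  have 5: "tsum (comul H (finv \<alpha> x)) F = tsum (comul H x) (\<lambda>a b. F (finv \<alpha> a) (finv \<alpha> b))" if F: "bform A A F" for x F
  proof -
    have "bform A A (\<lambda>a b. F (finv \<alpha> a) (finv \<alpha> b))"
      by (intro bformI bform_left[OF F] bform_right[OF F] 2) auto
    from autD(5)[OF a this, of "finv \<alpha> x"] show ?thesis by simp
  qed
  show ?thesis unfolding aut_iff
    using 1 2 3 4 5 autD(6,7)[OF a, of "finv \<alpha> _", symmetric] by (auto intro!: eqI[symmetric] simp: autD(7)[OF a])
qed

lemma carrier_aut_group [simp]: "carrier (aut_group H) = hopf_aut H \<times> hopf_aut H"
  by (simp add: aut_group_def)

lemma aut_group_simps [simp]:
  "(\<alpha>, \<beta>) \<otimes>\<^bsub>aut_group H\<^esub> (\<gamma>, \<delta>) = (\<alpha> \<circ> \<gamma>, \<delta> \<circ> finv \<gamma> \<circ> \<beta> \<circ> \<gamma>)"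
  "\<one>\<^bsub>aut_group H\<^esub> = (id, id)"
  by (simp_all add: aut_group_def)

lemma finv_comp:
  assumes "\<alpha> \<in> hopf_aut H" "\<beta> \<in> hopf_aut H"
  shows "finv (\<alpha> \<circ> \<beta>) = finv \<beta> \<circ> finv \<alpha>"
  using autD(1)[OF assms(1)] autD(1)[OF assms(2)] by (rule o_inv_distrib)

lemma finv_finv: "\<alpha> \<in> hopf_aut H \<Longrightarrow> finv (finv \<alpha>) = \<alpha>"
  using autD(1) inv_inv_eq by blast

lemma aut_group_inverse:
  assumes a: "\<alpha> \<in> hopf_aut H" and b: "\<beta> \<in> hopf_aut H"
  shows "(finv \<alpha>, \<alpha> \<circ> finv \<beta> \<circ> finv \<alpha>) \<otimes>\<^bsub>aut_group H\<^esub> (\<alpha>, \<beta>) = \<one>\<^bsub>aut_group H\<^esub>"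
    and "(finv \<alpha>, \<alpha> \<circ> finv \<beta> \<circ> finv \<alpha>) \<in> carrier (aut_group H)"
  using autD(8,9)[OF a] autD(8,9)[OF b] a b by (auto simp: fun_eq_iff intro!: aut_comp aut_finv)

lemma group_aut_group: "group (aut_group H)"
proof (rule groupI)
  fix x y z
  assume "x \<in> carrier (aut_group H)" "y \<in> carrier (aut_group H)" "z \<in> carrier (aut_group H)"
  then obtain \<alpha> \<beta> \<gamma> \<delta> \<epsilon> \<zeta> where xyz: "x = (\<alpha>, \<beta>)" "y = (\<gamma>, \<delta>)" "z = (\<epsilon>, \<zeta>)"
    and a: "\<alpha> \<in> hopf_aut H" "\<beta> \<in> hopf_aut H" "\<gamma> \<in> hopf_aut H" "\<delta> \<in> hopf_aut H" "\<epsilon> \<in> hopf_aut H" "\<zeta> \<in> hopf_aut H"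
    by auto
  show "x \<otimes>\<^bsub>aut_group H\<^esub> y \<in> carrier (aut_group H)"
    unfolding xyz using a by (auto intro!: aut_comp aut_finv)
  show "x \<otimes>\<^bsub>aut_group H\<^esub> y \<otimes>\<^bsub>aut_group H\<^esub> z = x \<otimes>\<^bsub>aut_group H\<^esub> (y \<otimes>\<^bsub>aut_group H\<^esub> z)"
    unfolding xyz using a autD(9)[OF a(5)] by (simp add: finv_comp fun_eq_iff)
  show "\<one>\<^bsub>aut_group H\<^esub> \<otimes>\<^bsub>aut_group H\<^esub> x = x"
    unfolding xyz using autD(8)[OF a(1)] by (simp add: fun_eq_iff)
  show "\<exists>y\<in>carrier (aut_group H). y \<otimes>\<^bsub>aut_group H\<^esub> x = \<one>\<^bsub>aut_group H\<^esub>"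
    using aut_group_inverse[OF a(1,2)] unfolding xyz by blast
qed (auto simp: aut_id)

lemma aut_group_inv:
  assumes "\<alpha> \<in> hopf_aut H" "\<beta> \<in> hopf_aut H"
  shows "inv\<^bsub>aut_group H\<^esub> (\<alpha>, \<beta>) = (finv \<alpha>, \<alpha> \<circ> finv \<beta> \<circ> finv \<alpha>)"
  using group.inv_equality[OF group_aut_group aut_group_inverse(1)[OF assms]] aut_group_inverse(2)[OF assms] assms by simp

end

section \<open>Identities for the inverse of the antipode\<close>

locale hopf_algebra_bij = hopf_algebra H for H :: "('k::field, 'h::ring_1) hopf_data" +
  assumes bij_antipode: "bij (antipode H)"
begin

abbreviation Sinv :: "'h \<Rightarrow> 'h" where "Sinv \<equiv> finv (antipode H)"

lemma Sinv_simps [simp]: "Sinv (antipode H x) = x" "antipode H (Sinv x) = x"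
  using bij_antipode by (auto simp: bij_def surj_f_inv_f)

lemma Sinv_eqI: "x = antipode H y \<Longrightarrow> Sinv x = y"
  by simp

lemma lhom_Sinv: "Sinv \<in> lhom A A"
  using lhomD(2,3)[OF lhom_antipode] by (auto simp: lhom_iff intro!: Sinv_eqI)

lemma Sinv_aut: "\<alpha> \<in> hopf_aut H \<Longrightarrow> Sinv (\<alpha> x) = \<alpha> (Sinv x)"
  by (rule Sinv_eqI) (simp add: autD(7))

lemmas lin' = lin lhom_comp[OF lhom_Sinv]

text \<open>\<open>S\<close> reverses products, so
  \<open>S^{-1}(h_2) h_1 = S^{-1}(S(h_1) h_2)\<close>, and the ordinary antipode law applies under
  \<open>S^{-1}\<close>.\<close>

lemma Sinv_left: "lform A f \<Longrightarrow> tsum (comul H x) (\<lambda>a b. f (Sinv b * a)) = counit H x * f 1"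
proof -
  assume f: "lform A f"
  have "f (Sinv b * a) = f (Sinv (antipode H a * b))" for a b
    by (rule arg_cong[of _ _ f], rule Sinv_eqI[symmetric]) (simp add: antipode_mult)
  then show ?thesis
    using antipode_left'[OF lform_comp[OF f lhom_Sinv], of x] Sinv_eqI[of 1 1] antipode_one by simp
qed

lemma Sinv_right: "lform A f \<Longrightarrow> tsum (comul H x) (\<lambda>a b. f (b * Sinv a)) = counit H x * f 1"
proof -
  assume f: "lform A f"
  have "f (b * Sinv a) = f (Sinv (a * antipode H b))" for a b
    by (rule arg_cong[of _ _ f], rule Sinv_eqI[symmetric]) (simp add: antipode_mult)
  then show ?thesis
    using antipode_right'[OF lform_comp[OF f lhom_Sinv], of x] Sinv_eqI[of 1 1] antipode_one by simp
qed

end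

section \<open>Yetter-Drinfeld modules\<close>

lemma tform_nested:
  assumes U: "vsp U" and V: "vsp V" and W: "vsp W" and G: "bform U (tensor V W) G"
  shows "tform U V W (\<lambda>u v w. G u (tcls V W [(v, w)]))"
    and "u \<in> carrier U \<Longrightarrow> s \<in> carrier (tensor V W) \<Longrightarrow> tsum s (\<lambda>v w. G u (tcls V W [(v, w)])) = G u s"
proof -
  show "tform U V W (\<lambda>u v w. G u (tcls V W [(v, w)]))"
    by (intro tformI bform_left[OF G lhom_id] bform_right[OF G] tcls_bilinear[OF V W]) auto
  assume u: "u \<in> carrier U" and s: "s \<in> carrier (tensor V W)"
  show "tsum s (\<lambda>v w. G u (tcls V W [(v, w)])) = G u s"
    using lform_tensor_expand[OF V W bformD(2)[OF G u], of s] tensor_elemD[OF V W s] by simp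
qed

text \<open>A bilinear form whose second argument is a tensor is determined by its values on pure
  tensors, and these depend trilinearly on the entries (\<open>tform_nested\<close>).\<close>

lemma tcls_nested_eq_iff:
  assumes U: "vsp U" and V: "vsp V" and W: "vsp W"
    and xs: "set xs \<subseteq> carrier U \<times> carrier (tensor V W)" and ys: "set ys \<subseteq> carrier U \<times> carrier (tensor V W)"
  shows "tcls U (tensor V W) xs = tcls U (tensor V W) ys \<longleftrightarrow>
    (\<forall>F. tform U V W F \<longrightarrow> tsum xs (\<lambda>u s. tsum s (F u)) = tsum ys (\<lambda>u s. tsum s (F u)))" (is "?l = ?r")
proof
  assume ?l
  then show ?r
    using tsum_nested_right[OF U V W _ tcls_in[OF xs] xs HOL.refl] tsum_nested_right[OF U V W _ tcls_in[OF ys] ys HOL.refl]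
    by metis
next
  assume r: ?r
  have "tsum xs G = tsum ys G" if G: "bform U (tensor V W) G" for G
  proof -
    have "tsum zs G = tsum zs (\<lambda>u s. tsum s (\<lambda>v w. G u (tcls V W [(v, w)])))"
      if "set zs \<subseteq> carrier U \<times> carrier (tensor V W)" for zs
      by (intro tsum_congI tform_nested(2)[OF U V W G, symmetric]) (use that in auto)
    then show ?thesis using r tform_nested(1)[OF U V W G] xs ys by simp
  qed
  then show ?l using tcls_eq_iff[OF U vsp_tensor[OF V W] xs ys] by blast
qed

context hopf_algebra_bij
begin

lemma right_comodule_iff:
  "right_comodule H V \<rho> \<longleftrightarrow> is_vspace V \<and> \<rho> \<in> extensional (carrier V) \<and> \<rho> \<in> lhom V (tensor V A) \<and>
    (\<forall>m\<in>carrier V. \<forall>F. tform V A A F \<longrightarrow>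
      tsum (\<rho> m) (\<lambda>m0 m1. tsum (\<rho> m0) (\<lambda>m00 m01. F m00 m01 m1)) = tsum (\<rho> m) (\<lambda>m0 m1. tsum (comul H m1) (F m0))) \<and>
    (\<forall>m\<in>carrier V. \<forall>f. lform V f \<longrightarrow> tsum (\<rho> m) (\<lambda>m0 m1. counit H m1 * f m0) = f m)"
proof (cases "is_vspace V \<and> \<rho> \<in> lhom V (tensor V A)")
  case True
  then have V: "is_vspace V" and \<rho>: "\<rho> \<in> lhom V (tensor V A)" by auto
  have mem: "a \<in> carrier V" if "m \<in> carrier V" "(a, b) \<in> set (\<rho> m)" for m a b
    using tensor_memD(1)[OF _ _ lhomD(1)[OF \<rho> that(1)] that(2)] V by auto
  have 1: "tcls V (tensor A A) [(m00, tcls A A [(m01, m1)]). (m0, m1) \<leftarrow> \<rho> m, (m00, m01) \<leftarrow> \<rho> m0] =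
        tcls V (tensor A A) [(m0, comul H m1). (m0, m1) \<leftarrow> \<rho> m] \<longleftrightarrow>
      (\<forall>F. tform V A A F \<longrightarrow>
      tsum (\<rho> m) (\<lambda>m0 m1. tsum (\<rho> m0) (\<lambda>m00 m01. F m00 m01 m1)) = tsum (\<rho> m) (\<lambda>m0 m1. tsum (comul H m1) (F m0)))"
    if m: "m \<in> carrier V" for m
  proof -
    have wf: "set [(m00, tcls A A [(m01, m1)]). (m0, m1) \<leftarrow> \<rho> m, (m00, m01) \<leftarrow> \<rho> m0] \<subseteq> carrier V \<times> carrier (tensor A A)"
      "set [(m0, comul H m1). (m0, m1) \<leftarrow> \<rho> m] \<subseteq> carrier V \<times> carrier (tensor A A)"
      by (intro wf_intros; (blast intro: mem m | simp))+
    have "bform A A (F u)" if "tform V A A F" "u \<in> carrier V" for F u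
      using tformD[OF that(1)] that(2) by (auto intro!: bformI)
    then have "tsum [(m00, tcls A A [(m01, m1)]). (m0, m1) \<leftarrow> \<rho> m, (m00, m01) \<leftarrow> \<rho> m0] (\<lambda>u s. tsum s (F u)) =
      tsum (\<rho> m) (\<lambda>m0 m1. tsum (\<rho> m0) (\<lambda>m00 m01. F m00 m01 m1))" if "tform V A A F" for F
      using that by (auto intro!: tsum_congI tsum_tcls[THEN HOL.trans] dest: mem[OF m] mem)
    then show ?thesis
      unfolding tcls_nested_eq_iff[OF is_vspace_vsp[OF V] vsp_alg vsp_alg wf] by simp
  qed
  have 2: "abelian_monoid.sumlist V [counit H m1 \<odot>\<^bsub>V\<^esub> m0. (m0, m1) \<leftarrow> \<rho> m] = m \<longleftrightarrow>
    (\<forall>f. lform V f \<longrightarrow> tsum (\<rho> m) (\<lambda>m0 m1. counit H m1 * f m0) = f m)" (is "?s = m \<longleftrightarrow> ?r")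
    if m: "m \<in> carrier V" for m
  proof -
    have cl: "counit H b \<odot>\<^bsub>V\<^esub> a \<in> carrier V" if "(a, b) \<in> set (\<rho> m)" for a b
      using mem[OF m that] V by (auto intro: vspD(7))
    have "f ?s = tsum (\<rho> m) (\<lambda>m0 m1. counit H m1 * f m0)" if f: "lform V f" for f
      using lform_sumlist(1)[OF is_vspace_vsp[OF V] f, of "\<rho> m" "\<lambda>m0 m1. counit H m1 \<odot>\<^bsub>V\<^esub> m0"] cl
        lformD(2)[OF f mem[OF m]] by (simp cong: tsum_cong)
    moreover have "?s \<in> carrier V" using V cl by (auto intro!: sumlist_in)
    ultimately show ?thesis using lform_eqI[OF is_vspace_vsp[OF V], of ?s m] m by metis
  qed
  show ?thesis unfolding right_comodule_def using 1 2 by auto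
next
  case False
  then show ?thesis unfolding right_comodule_def by blast
qed

text \<open>From left to right, a further part of \<open>h\<close> is multiplied on through \<alpha>
  and \<open>S^{-1}(k_1)\<close> cancels against it by \<open>Sinv_left\<close>. From right to left,
  multiplication by \<open>\<alpha>(S^{-1}(h_1))\<close> undoes this by \<open>Sinv_right\<close>.
  In the new form no antipode and no threefold coproduct occurs, so it can be applied inside a
  longer sum.\<close>

lemma yd_compat_iff:
  assumes V: "is_vspace V" and \<rho>: "\<rho> \<in> lhom V (tensor V A)"
    and act: "\<And>h. act h \<in> lhom V V" "\<And>m. m \<in> carrier V \<Longrightarrow> (\<lambda>h. act h m) \<in> lhom A V"
    and \<alpha>: "\<alpha> \<in> hopf_aut H" and \<beta>: "\<beta> \<in> hopf_aut H" and m: "m \<in> carrier V"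
  shows "(\<forall>h. \<rho> (act h m) = tcls V A [(act h2 m0, \<beta> h3 * m1 * \<alpha> (Sinv h1)).
             (h1, h') \<leftarrow> comul H h, (h2, h3) \<leftarrow> comul H h', (m0, m1) \<leftarrow> \<rho> m]) \<longleftrightarrow>
    (\<forall>h F. bform V A F \<longrightarrow> tsum (comul H h) (\<lambda>h1 h2. tsum (\<rho> (act h2 m)) (\<lambda>m0 m1. F m0 (m1 * \<alpha> h1))) =
      tsum (comul H h) (\<lambda>h1 h2. tsum (\<rho> m) (\<lambda>m0 m1. F (act h1 m0) (\<beta> h2 * m1))))" (is "?l \<longleftrightarrow> ?r")
proof -
  have mem: "a \<in> carrier V" if "m \<in> carrier V" "(a, b) \<in> set (\<rho> m)" for m a b
    using tensor_memD(1)[OF _ _ lhomD(1)[OF \<rho> that(1)] that(2)] V by auto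
  note L = lin' lhom_comp[OF autD(2)[OF \<alpha>]] lhom_comp[OF autD(2)[OF \<beta>]] lhom_comp[OF act(1)] lhom_comp[OF act(2)]
    lform_tsum_left[OF lhom_comp[OF \<rho>] is_vspace_vsp[OF V] vsp_alg]
  note mems = m lhomD(1)[OF act(1)]
  have wf: "set [(act h2 m0, \<beta> h3 * m1 * \<alpha> (Sinv h1)).
             (h1, h') \<leftarrow> comul H h, (h2, h3) \<leftarrow> comul H h', (m0, m1) \<leftarrow> \<rho> m] \<subseteq> carrier V \<times> carrier A" for h
    by (intro wf_intros) (auto intro: lhomD(1)[OF act(1)] mem[OF m])
  have l: "?l \<longleftrightarrow> (\<forall>h F. bform V A F \<longrightarrow> tsum (\<rho> (act h m)) F =
      tsum (comul H h) (\<lambda>h1 h'. tsum (comul H h') (\<lambda>h2 h3. tsum (\<rho> m) (\<lambda>m0 m1. F (act h2 m0) (\<beta> h3 * m1 * \<alpha> (Sinv h1))))))"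
    (is "_ \<longleftrightarrow> ?l'")
  proof -
    have "\<rho> (act h m) \<in> carrier (tensor V A)" for h by (intro lhomD(1)[OF \<rho>] mems)
    note * = tcls_eqI'[OF is_vspace_vsp[OF V] vsp_alg wf this]
    have eq: "tsum (tcls V A [(act h2 m0, \<beta> h3 * m1 * \<alpha> (Sinv h1)).
             (h1, h') \<leftarrow> comul H h, (h2, h3) \<leftarrow> comul H h', (m0, m1) \<leftarrow> \<rho> m]) F =
      tsum (comul H h) (\<lambda>h1 h'. tsum (comul H h') (\<lambda>h2 h3. tsum (\<rho> m) (\<lambda>m0 m1. F (act h2 m0) (\<beta> h3 * m1 * \<alpha> (Sinv h1)))))"
      if "bform V A F" for h F
      using tsum_tcls[OF is_vspace_vsp[OF V] vsp_alg that wf] by simp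
    show ?thesis
    proof (intro iffI allI impI)
      fix h F assume ?l "bform V A F"
      then show "tsum (\<rho> (act h m)) F = tsum (comul H h) (\<lambda>h1 h'. tsum (comul H h') (\<lambda>h2 h3.
          tsum (\<rho> m) (\<lambda>m0 m1. F (act h2 m0) (\<beta> h3 * m1 * \<alpha> (Sinv h1)))))"
        using eq by metis
    next
      fix h assume l': ?l'
      show "\<rho> (act h m) = tcls V A [(act h2 m0, \<beta> h3 * m1 * \<alpha> (Sinv h1)).
             (h1, h') \<leftarrow> comul H h, (h2, h3) \<leftarrow> comul H h', (m0, m1) \<leftarrow> \<rho> m]"
        by (rule *) (simp add: l')
    qed
  qed
  show ?thesis unfolding l
  proof (intro iffI allI impI)
    fix h F assume l': ?l' and F: "bform V A F"
    note L' = L bform_left[OF F] bform_right[OF F]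
    let ?G = "\<lambda>h1 k1 k'. tsum (comul H k') (\<lambda>k2 k3. tsum (\<rho> m) (\<lambda>m0 m1. F (act k2 m0) (\<beta> k3 * m1 * \<alpha> (Sinv k1) * \<alpha> h1)))"
    have "tsum (comul H h) (\<lambda>h1 h2. tsum (\<rho> (act h2 m)) (\<lambda>m0 m1. F m0 (m1 * \<alpha> h1))) =
      tsum (comul H h) (\<lambda>h1 h2. tsum (comul H h2) (\<lambda>k1 k'. ?G h1 k1 k'))"
    proof (intro tsum_congI)
      fix h1 h2
      have "bform V A (\<lambda>m0 m1. F m0 (m1 * \<alpha> h1))" by (intro L'; simp)
      then show "tsum (\<rho> (act h2 m)) (\<lambda>m0 m1. F m0 (m1 * \<alpha> h1)) = tsum (comul H h2) (\<lambda>k1 k'. ?G h1 k1 k')"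
        using l' by simp
    qed
    \<comment> \<open>Regrouping makes \<open>h1\<close> and \<open>k1\<close> the two parts of one
      element \<open>x\<close>, so that \<open>S^{-1}(x_2) x_1\<close> appears.\<close>
    also have "\<dots> = tsum (comul H h) (\<lambda>x k'. tsum (comul H x) (\<lambda>h1 k1. ?G h1 k1 k'))"
      by (intro comul_coassoc[symmetric] L'; (blast intro: mems mem | simp))
    also have "\<dots> = tsum (comul H h) (\<lambda>x k'. counit H x * tsum (comul H k') (\<lambda>k2 k3. tsum (\<rho> m) (\<lambda>m0 m1. F (act k2 m0) (\<beta> k3 * m1))))"
    proof (intro tsum_congI)
      fix x k'
      have "lform A (\<lambda>z. tsum (comul H k') (\<lambda>k2 k3. tsum (\<rho> m) (\<lambda>m0 m1. F (act k2 m0) (\<beta> k3 * m1 * \<alpha> z))))"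
        by (intro L'; (blast intro: mems mem | simp))
      from Sinv_left[OF this, of x]
      show "tsum (comul H x) (\<lambda>h1 k1. ?G h1 k1 k') = counit H x * tsum (comul H k') (\<lambda>k2 k3. tsum (\<rho> m) (\<lambda>m0 m1. F (act k2 m0) (\<beta> k3 * m1)))"
        by (simp add: autD(3,4)[OF \<alpha>] mult.assoc)
    qed
    also have "\<dots> = tsum (comul H h) (\<lambda>h1 h2. tsum (\<rho> m) (\<lambda>m0 m1. F (act h1 m0) (\<beta> h2 * m1)))"
      by (intro counit_left' L'; (blast intro: mems mem | simp))
    finally show "tsum (comul H h) (\<lambda>h1 h2. tsum (\<rho> (act h2 m)) (\<lambda>m0 m1. F m0 (m1 * \<alpha> h1))) = \<dots>" .
  next
    fix h F assume r: ?r and F: "bform V A F"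
    note L' = L bform_left[OF F] bform_right[OF F]
    have "tsum (comul H h) (\<lambda>h1 h'. tsum (comul H h') (\<lambda>h2 h3. tsum (\<rho> m) (\<lambda>m0 m1. F (act h2 m0) (\<beta> h3 * m1 * \<alpha> (Sinv h1))))) =
      tsum (comul H h) (\<lambda>h1 h'. tsum (comul H h') (\<lambda>h2 h3. tsum (\<rho> (act h3 m)) (\<lambda>m0 m1. F m0 (m1 * \<alpha> h2 * \<alpha> (Sinv h1)))))"
    proof (rule tsum_congI)
      fix h1 h'
      have F': "bform V A (\<lambda>m0 m1. F m0 (m1 * \<alpha> (Sinv h1)))" by (intro L'; simp)
      show "tsum (comul H h') (\<lambda>h2 h3. tsum (\<rho> m) (\<lambda>m0 m1. F (act h2 m0) (\<beta> h3 * m1 * \<alpha> (Sinv h1)))) =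
        tsum (comul H h') (\<lambda>h2 h3. tsum (\<rho> (act h3 m)) (\<lambda>m0 m1. F m0 (m1 * \<alpha> h2 * \<alpha> (Sinv h1))))"
        using r[rule_format, OF F', of h'] by (simp add: mult.assoc)
    qed
    also have "\<dots> = tsum (comul H h) (\<lambda>x h3. tsum (comul H x) (\<lambda>h1 h2. tsum (\<rho> (act h3 m)) (\<lambda>m0 m1. F m0 (m1 * \<alpha> h2 * \<alpha> (Sinv h1)))))"
      by (intro comul_coassoc[symmetric] L'; (blast intro: mems mem | simp))
    also have "\<dots> = tsum (comul H h) (\<lambda>x h3. counit H x * tsum (\<rho> (act h3 m)) F)"
    proof (intro tsum_congI)
      fix x h3
      have "lform A (\<lambda>z. tsum (\<rho> (act h3 m)) (\<lambda>m0 m1. F m0 (m1 * \<alpha> z)))"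
        by (intro L'; (blast intro: mems mem | simp))
      from Sinv_right[OF this, of x]
      show "tsum (comul H x) (\<lambda>h1 h2. tsum (\<rho> (act h3 m)) (\<lambda>m0 m1. F m0 (m1 * \<alpha> h2 * \<alpha> (Sinv h1)))) =
        counit H x * tsum (\<rho> (act h3 m)) F"
        by (simp add: autD(3,4)[OF \<alpha>] mult.assoc)
    qed
    also have "\<dots> = tsum (\<rho> (act h m)) F"
      by (intro counit_left' L' F; (blast intro: mems mem | simp))
    finally show "tsum (\<rho> (act h m)) F = tsum (comul H h) (\<lambda>h1 h'. tsum (comul H h') (\<lambda>h2 h3.
        tsum (\<rho> m) (\<lambda>m0 m1. F (act h2 m0) (\<beta> h3 * m1 * \<alpha> (Sinv h1)))))" by simp
  qed
qed

section \<open>Objects and their structure maps described by forms\<close>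

lemma left_module_alg_iff:
  "left_module A V act \<longleftrightarrow> is_vspace V \<and> (\<forall>h. act h \<in> extensional (carrier V) \<and> act h \<in> lhom V V) \<and>
    (\<forall>m\<in>carrier V. (\<lambda>h. act h m) \<in> lhom A V) \<and> (\<forall>h k. \<forall>m\<in>carrier V. act (h * k) m = act h (act k m)) \<and>
    (\<forall>m\<in>carrier V. act 1 m = m)"
  by (auto simp: left_module_def lhom_iff extensional_def)

text \<open>Equalities between chosen representatives are replaced by equations between sums of
  scalars, and the compatibility condition by its antipode-free form; \<open>yd_objectsD\<close> is
  the converse.\<close>

lemma yd_objectsI:
  assumes "yd_index M = (\<alpha>, \<beta>)" "\<alpha> \<in> hopf_aut H" "\<beta> \<in> hopf_aut H" and V: "is_vspace (yd_space M)"
    and "\<And>h. yd_act M h \<in> extensional (carrier (yd_space M))"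
    and act: "\<And>h. yd_act M h \<in> lhom (yd_space M) (yd_space M)"
      "\<And>m. m \<in> carrier (yd_space M) \<Longrightarrow> (\<lambda>h. yd_act M h m) \<in> lhom A (yd_space M)"
    and "\<And>h k m. m \<in> carrier (yd_space M) \<Longrightarrow> yd_act M (h * k) m = yd_act M h (yd_act M k m)"
    and "\<And>m. m \<in> carrier (yd_space M) \<Longrightarrow> yd_act M 1 m = m"
    and "yd_coact M \<in> extensional (carrier (yd_space M))"
    and \<rho>: "yd_coact M \<in> lhom (yd_space M) (tensor (yd_space M) A)"
    and "\<And>m F. m \<in> carrier (yd_space M) \<Longrightarrow> tform (yd_space M) A A F \<Longrightarrow>
      tsum (yd_coact M m) (\<lambda>m0 m1. tsum (yd_coact M m0) (\<lambda>m00 m01. F m00 m01 m1)) =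
      tsum (yd_coact M m) (\<lambda>m0 m1. tsum (comul H m1) (F m0))"
    and "\<And>m f. m \<in> carrier (yd_space M) \<Longrightarrow> lform (yd_space M) f \<Longrightarrow>
      tsum (yd_coact M m) (\<lambda>m0 m1. counit H m1 * f m0) = f m"
    and "\<And>m h F. m \<in> carrier (yd_space M) \<Longrightarrow> bform (yd_space M) A F \<Longrightarrow>
      tsum (comul H h) (\<lambda>h1 h2. tsum (yd_coact M (yd_act M h2 m)) (\<lambda>m0 m1. F m0 (m1 * \<alpha> h1))) =
      tsum (comul H h) (\<lambda>h1 h2. tsum (yd_coact M m) (\<lambda>m0 m1. F (yd_act M h1 m0) (\<beta> h2 * m1)))"
  shows "M \<in> yd_objects H"
  using assms yd_compat_iff[OF V \<rho> act assms(2,3)]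
  unfolding yd_objects_def yd_module_def left_module_alg_iff right_comodule_iff by auto

lemma yd_objectsD:
  assumes "M \<in> yd_objects H"
  shows "fst (yd_index M) \<in> hopf_aut H" "snd (yd_index M) \<in> hopf_aut H" and "is_vspace (yd_space M)"
    and "yd_act M h \<in> extensional (carrier (yd_space M))"
    and "yd_act M h \<in> lhom (yd_space M) (yd_space M)"
    and "m \<in> carrier (yd_space M) \<Longrightarrow> (\<lambda>h. yd_act M h m) \<in> lhom A (yd_space M)"
    and "m \<in> carrier (yd_space M) \<Longrightarrow> yd_act M (h * k) m = yd_act M h (yd_act M k m)"
    and "m \<in> carrier (yd_space M) \<Longrightarrow> yd_act M 1 m = m"
    and "yd_coact M \<in> extensional (carrier (yd_space M))"
    and "yd_coact M \<in> lhom (yd_space M) (tensor (yd_space M) A)"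
    and "m \<in> carrier (yd_space M) \<Longrightarrow> tform (yd_space M) A A F \<Longrightarrow>
      tsum (yd_coact M m) (\<lambda>m0 m1. tsum (yd_coact M m0) (\<lambda>m00 m01. F m00 m01 m1)) =
      tsum (yd_coact M m) (\<lambda>m0 m1. tsum (comul H m1) (F m0))"
    and "m \<in> carrier (yd_space M) \<Longrightarrow> lform (yd_space M) f \<Longrightarrow>
      tsum (yd_coact M m) (\<lambda>m0 m1. counit H m1 * f m0) = f m"
    and "m \<in> carrier (yd_space M) \<Longrightarrow> bform (yd_space M) A G \<Longrightarrow>
      tsum (comul H h) (\<lambda>h1 h2. tsum (yd_coact M (yd_act M h2 m)) (\<lambda>m0 m1. G m0 (m1 * fst (yd_index M) h1))) =
      tsum (comul H h) (\<lambda>h1 h2. tsum (yd_coact M m) (\<lambda>m0 m1. G (yd_act M h1 m0) (snd (yd_index M) h2 * m1)))"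
proof -
  obtain \<alpha> \<beta> where i: "yd_index M = (\<alpha>, \<beta>)" by force
  have *: "\<alpha> \<in> hopf_aut H" "\<beta> \<in> hopf_aut H" "left_module A (yd_space M) (yd_act M)"
    "right_comodule H (yd_space M) (yd_coact M)"
    using assms i unfolding yd_objects_def yd_module_def by auto
  note l = *(3)[unfolded left_module_alg_iff] and r = *(4)[unfolded right_comodule_iff]
  show "fst (yd_index M) \<in> hopf_aut H" "snd (yd_index M) \<in> hopf_aut H" "is_vspace (yd_space M)"
    "yd_act M h \<in> extensional (carrier (yd_space M))" "yd_act M h \<in> lhom (yd_space M) (yd_space M)"
    "yd_coact M \<in> extensional (carrier (yd_space M))" "yd_coact M \<in> lhom (yd_space M) (tensor (yd_space M) A)"
    using i * l r by auto
  show "m \<in> carrier (yd_space M) \<Longrightarrow> (\<lambda>h. yd_act M h m) \<in> lhom A (yd_space M)"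
    "m \<in> carrier (yd_space M) \<Longrightarrow> yd_act M (h * k) m = yd_act M h (yd_act M k m)"
    "m \<in> carrier (yd_space M) \<Longrightarrow> yd_act M 1 m = m"
    using l by blast+
  show "m \<in> carrier (yd_space M) \<Longrightarrow> tform (yd_space M) A A F \<Longrightarrow>
      tsum (yd_coact M m) (\<lambda>m0 m1. tsum (yd_coact M m0) (\<lambda>m00 m01. F m00 m01 m1)) =
      tsum (yd_coact M m) (\<lambda>m0 m1. tsum (comul H m1) (F m0))"
    "m \<in> carrier (yd_space M) \<Longrightarrow> lform (yd_space M) f \<Longrightarrow>
      tsum (yd_coact M m) (\<lambda>m0 m1. counit H m1 * f m0) = f m"
    using r by blast+
  show "m \<in> carrier (yd_space M) \<Longrightarrow> bform (yd_space M) A G \<Longrightarrow>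
      tsum (comul H h) (\<lambda>h1 h2. tsum (yd_coact M (yd_act M h2 m)) (\<lambda>m0 m1. G m0 (m1 * fst (yd_index M) h1))) =
      tsum (comul H h) (\<lambda>h1 h2. tsum (yd_coact M m) (\<lambda>m0 m1. G (yd_act M h1 m0) (snd (yd_index M) h2 * m1)))"
    using yd_compat_iff[of "yd_space M" "yd_coact M" "yd_act M" \<alpha> \<beta> m] l r * i assms
    unfolding yd_objects_def yd_module_def by auto
qed

lemma yd_lin:
  assumes M: "M \<in> yd_objects H"
  shows "e \<in> lhom X (yd_space M) \<Longrightarrow> (\<lambda>x. yd_act M h (e x)) \<in> lhom X (yd_space M)"
    and "e' \<in> lhom X A \<Longrightarrow> m \<in> carrier (yd_space M) \<Longrightarrow> (\<lambda>x. yd_act M (e' x) m) \<in> lhom X (yd_space M)"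
    and "e \<in> lhom X (yd_space M) \<Longrightarrow> bform (yd_space M) A F \<Longrightarrow> lform X (\<lambda>x. tsum (yd_coact M (e x)) F)"
  using lhom_comp[OF yd_objectsD(5)[OF M]] lhom_comp[OF yd_objectsD(6)[OF M]]
    lform_tsum_left[OF lhom_comp[OF yd_objectsD(10)[OF M]] is_vspace_vsp[OF yd_objectsD(3)[OF M]] vsp_alg]
  by auto

lemma yd_mem:
  assumes M: "M \<in> yd_objects H" and m: "m \<in> carrier (yd_space M)"
  shows "yd_act M h m \<in> carrier (yd_space M)"
    and "yd_coact M m \<in> carrier (tensor (yd_space M) A)"
    and "(a, b) \<in> set (yd_coact M m) \<Longrightarrow> a \<in> carrier (yd_space M)"
  using lhomD(1)[OF yd_objectsD(5)[OF M] m] lhomD(1)[OF yd_objectsD(10)[OF M] m]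
    tensor_memD(1)[of "yd_space M" A] yd_objectsD(3)[OF M] m by auto

text \<open>In tensor products, conjugates and braidings the elements of H act through an
  automorphism. A coalgebra automorphism can be pulled through the coproduct, so the condition
  survives the substitution.\<close>

lemma yd_compat_aut:
  assumes M: "M \<in> yd_objects H" and i: "yd_index M = (\<alpha>, \<beta>)" and \<gamma>: "\<gamma> \<in> hopf_aut H"
    and m: "m \<in> carrier (yd_space M)" and F: "bform (yd_space M) A F"
  shows "tsum (comul H h) (\<lambda>h1 h2. tsum (yd_coact M (yd_act M (\<gamma> h2) m)) (\<lambda>m0 m1. F m0 (m1 * \<alpha> (\<gamma> h1)))) =
      tsum (comul H h) (\<lambda>h1 h2. tsum (yd_coact M m) (\<lambda>m0 m1. F (yd_act M (\<gamma> h1) m0) (\<beta> (\<gamma> h2) * m1)))"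
proof -
  have \<alpha>: "\<alpha> \<in> hopf_aut H" and \<beta>: "\<beta> \<in> hopf_aut H" using yd_objectsD(1,2)[OF M] i by auto
  note L = lin' lhom_comp[OF autD(2)[OF \<alpha>]] lhom_comp[OF autD(2)[OF \<beta>]] yd_lin[OF M] bform_left[OF F] bform_right[OF F]
  have "bform A A (\<lambda>h1 h2. tsum (yd_coact M (yd_act M h2 m)) (\<lambda>m0 m1. F m0 (m1 * \<alpha> h1)))"
    "bform A A (\<lambda>h1 h2. tsum (yd_coact M m) (\<lambda>m0 m1. F (yd_act M h1 m0) (\<beta> h2 * m1)))"
    by (intro L; (blast intro: m yd_mem[OF M] | simp))+
  then show ?thesis
    using yd_objectsD(13)[OF M m F, of "\<gamma> h"] i by (simp add: autD(5)[OF \<gamma>])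
qed

text \<open>The structure maps are extensional and tensors are chosen representatives, so agreement
  on the carrier, tested by forms, is equality of records.\<close>

lemma yd_obj_eqI:
  assumes M: "M \<in> yd_objects H" and N: "N \<in> yd_objects H" and "yd_index M = yd_index N"
    and s: "yd_space M = yd_space N"
    and a: "\<And>h m. m \<in> carrier (yd_space M) \<Longrightarrow> yd_act M h m = yd_act N h m"
    and c: "\<And>m F. m \<in> carrier (yd_space M) \<Longrightarrow> bform (yd_space M) A F \<Longrightarrow> tsum (yd_coact M m) F = tsum (yd_coact N m) F"
  shows "M = N"
proof -
  have "yd_act M = yd_act N"
    using extensionalityI[OF yd_objectsD(4)[OF M], of "yd_act N _"] yd_objectsD(4)[OF N] s a by (intro ext) metis
  moreover have "yd_coact M m = yd_coact N m" if m: "m \<in> carrier (yd_space M)" for m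
    by (rule tensor_eqI[of "yd_space M" A])
      (use m s c[OF m] yd_mem(2)[OF M] yd_mem(2)[OF N] yd_objectsD(3)[OF M] in auto)
  then have "yd_coact M = yd_coact N"
    using extensionalityI[OF yd_objectsD(9)[OF M]] yd_objectsD(9)[OF N] s by metis
  ultimately show ?thesis using assms(3,4) by (simp add: yd_obj.equality)
qed

end

section \<open>Tensor products of Yetter-Drinfeld modules\<close>

locale yd_pair = hopf_algebra_bij H for H :: "('k::field, 'h::ring_1) hopf_data" +
  fixes M N :: "('k, 'h, 'a) yd_obj" and \<alpha> \<beta> \<gamma> \<delta> :: "'h \<Rightarrow> 'h"
  assumes M: "M \<in> yd_objects H" and N: "N \<in> yd_objects H"
    and iM: "yd_index M = (\<alpha>, \<beta>)" and iN: "yd_index N = (\<gamma>, \<delta>)"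
begin

abbreviation "V \<equiv> yd_space M"
abbreviation "W \<equiv> yd_space N"
abbreviation "T \<equiv> tensor_space V W"
abbreviation "MN \<equiv> yd_tensor H M N"

text \<open>The automorphism through which H acts on the second factor. The tensor product has index
  \<open>(\<alpha>\<gamma>, \<delta>\<sigma>)\<close>.\<close>

definition \<sigma> :: "'h \<Rightarrow> 'h" where "\<sigma> = finv \<gamma> \<circ> \<beta> \<circ> \<gamma>"

lemma auts: "\<alpha> \<in> hopf_aut H" "\<beta> \<in> hopf_aut H" "\<gamma> \<in> hopf_aut H" "\<delta> \<in> hopf_aut H" "\<sigma> \<in> hopf_aut H"
proof -
  show "\<alpha> \<in> hopf_aut H" "\<beta> \<in> hopf_aut H" "\<gamma> \<in> hopf_aut H" "\<delta> \<in> hopf_aut H"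
    using yd_objectsD(1,2)[OF M] yd_objectsD(1,2)[OF N] iM iN by auto
  then show "\<sigma> \<in> hopf_aut H" unfolding \<sigma>_def by (intro aut_comp aut_finv)
qed

lemma \<gamma>\<sigma>: "\<beta> (\<gamma> x) = \<gamma> (\<sigma> x)"
  using autD(9)[OF auts(3)] by (simp add: \<sigma>_def)

lemma V [simp]: "is_vspace V" and W [simp]: "is_vspace W" and T [simp]: "is_vspace T"
  using yd_objectsD(3)[OF M] yd_objectsD(3)[OF N] by auto

lemma MN_simps:
  "yd_index MN = (\<alpha> \<circ> \<gamma>, \<delta> \<circ> \<sigma>)"
  "yd_space MN = T"
  "yd_act MN h = (\<lambda>x\<in>carrier T. utens V W [(yd_act M (\<gamma> h1) m, yd_act N (\<sigma> h2) n).
                     (m, n) \<leftarrow> summands x, (h1, h2) \<leftarrow> comul H h])"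
  "yd_coact MN = (\<lambda>x\<in>carrier T. tcls T A [(utens V W [(m0, n0)], n1 * m1).
                          (m, n) \<leftarrow> summands x, (m0, m1) \<leftarrow> yd_coact M m, (n0, n1) \<leftarrow> yd_coact N n])"
  by (simp_all add: yd_tensor_def Let_def iM iN \<sigma>_def comp_assoc)

lemmas L = lin' lhom_comp[OF autD(2)[OF auts(1)]] lhom_comp[OF autD(2)[OF auts(2)]]
  lhom_comp[OF autD(2)[OF auts(3)]] lhom_comp[OF autD(2)[OF auts(4)]] lhom_comp[OF autD(2)[OF auts(5)]]
  yd_lin[OF M] yd_lin[OF N] utens_bilinear[OF V W] lform_tsum_summands[OF _ V W]

lemmas mem = yd_mem[OF M] yd_mem[OF N] utens_pure_in summands_memD[OF V W]

lemma act_wf: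
  assumes "x \<in> carrier T"
  shows "set [(yd_act M (\<gamma> h1) m, yd_act N (\<sigma> h2) n). (m, n) \<leftarrow> summands x, (h1, h2) \<leftarrow> comul H h]
    \<subseteq> carrier V \<times> carrier W"
  by (intro wf_intros; blast intro: mem assms)

lemma coact_wf:
  assumes "x \<in> carrier T"
  shows "set [(utens V W [(m0, n0)], n1 * m1).
      (m, n) \<leftarrow> summands x, (m0, m1) \<leftarrow> yd_coact M m, (n0, n1) \<leftarrow> yd_coact N n] \<subseteq> carrier T \<times> carrier A"
  by (intro wf_intros; (blast intro: mem assms | simp))

lemma act_in: "x \<in> carrier T \<Longrightarrow> yd_act MN h x \<in> carrier T"
  using utens_in[OF act_wf] by (simp add: MN_simps)

lemma coact_in: "x \<in> carrier T \<Longrightarrow> yd_coact MN x \<in> carrier (tensor T A)"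
  using tcls_in[OF coact_wf] by (simp add: MN_simps)

lemma act_tsum:
  assumes F: "bform V W F" and x: "x \<in> carrier T"
  shows "tsum (summands (yd_act MN h x)) F =
    tsum (summands x) (\<lambda>m n. tsum (comul H h) (\<lambda>h1 h2. F (yd_act M (\<gamma> h1) m) (yd_act N (\<sigma> h2) n)))"
  using tsum_summands_utens[OF V W F act_wf[OF x]] x by (simp add: MN_simps)

lemma coact_tsum:
  assumes F: "bform T A F" and x: "x \<in> carrier T"
  shows "tsum (yd_coact MN x) F = tsum (summands x) (\<lambda>m n. tsum (yd_coact M m) (\<lambda>m0 m1.
    tsum (yd_coact N n) (\<lambda>n0 n1. F (utens V W [(m0, n0)]) (n1 * m1))))"
  using tsum_tcls[OF is_vspace_vsp[OF T] vsp_alg F coact_wf[OF x]] x by (simp add: MN_simps)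

lemma act_lform:
  assumes f: "lform T f" and x: "x \<in> carrier T"
  shows "f (yd_act MN h x) = tsum (summands x) (\<lambda>m n. tsum (comul H h) (\<lambda>h1 h2.
    f (utens V W [(yd_act M (\<gamma> h1) m, yd_act N (\<sigma> h2) n)])))"
  using lform_summands[OF V W f act_in[OF x]] act_tsum[OF bform_utens[OF V W f] x] by simp

lemma coact_bform:
  assumes F: "bform T A F"
  shows "bform V W (\<lambda>m n. tsum (yd_coact M m) (\<lambda>m0 m1. tsum (yd_coact N n) (\<lambda>n0 n1. F (utens V W [(m0, n0)]) (n1 * m1))))"
  by (intro L bform_left[OF F] bform_right[OF F]; (blast intro: mem | simp))

lemma coact_tsum_pure:
  assumes F: "bform T A F" and "m \<in> carrier V" "n \<in> carrier W"
  shows "tsum (yd_coact MN (utens V W [(m, n)])) F =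
    tsum (yd_coact M m) (\<lambda>m0 m1. tsum (yd_coact N n) (\<lambda>n0 n1. F (utens V W [(m0, n0)]) (n1 * m1)))"
  using assms coact_tsum[OF F utens_pure_in] coact_bform[OF F] by simp

lemma act_lform_pure:
  assumes f: "lform T f" and "m \<in> carrier V" "n \<in> carrier W"
  shows "f (yd_act MN h (utens V W [(m, n)])) =
    tsum (comul H h) (\<lambda>h1 h2. f (utens V W [(yd_act M (\<gamma> h1) m, yd_act N (\<sigma> h2) n)]))"
proof -
  have "bform V W (\<lambda>m n. tsum (comul H h) (\<lambda>h1 h2. f (utens V W [(yd_act M (\<gamma> h1) m, yd_act N (\<sigma> h2) n)])))"
    by (intro L lform_comp[OF f]; (blast intro: mem | simp))
  then show ?thesis using assms act_lform[OF f utens_pure_in] by simp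
qed

lemma act_lhom: "yd_act MN h \<in> lhom T T" "x \<in> carrier T \<Longrightarrow> (\<lambda>h. yd_act MN h x) \<in> lhom A T"
proof -
  have "lform T (\<lambda>x. f (yd_act MN h x))" if f: "lform T f" for f
    by (rule lform_cong[OF _ is_vspace_vsp[OF T] act_lform[OF f]]) (intro L lform_comp[OF f]; (blast intro: mem | simp))
  then show "yd_act MN h \<in> lhom T T"
    by (intro lhom_lformI act_in) auto
  assume x: "x \<in> carrier T"
  have "lform A (\<lambda>h. f (yd_act MN h x))" if f: "lform T f" for f
    by (rule lform_cong[OF _ vsp_alg act_lform[OF f x]]) (intro L lform_comp[OF f]; (blast intro: mem x | simp))
  then show "(\<lambda>h. yd_act MN h x) \<in> lhom A T"
    by (intro lhom_lformI act_in x) auto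
qed

lemma coact_lhom: "yd_coact MN \<in> lhom T (tensor T A)"
proof (rule lhom_tensorI)
  fix F assume F: "bform T A F"
  show "lform T (\<lambda>x. tsum (yd_coact MN x) F)"
    by (rule lform_cong[OF _ is_vspace_vsp[OF T] coact_tsum[OF F]]) (intro L coact_bform[OF F])
qed (auto intro: coact_in)

lemma act_mult:
  assumes x: "x \<in> carrier T"
  shows "yd_act MN (h * k) x = yd_act MN h (yd_act MN k x)"
proof (rule tensor_space_eqI[OF V W act_in[OF x] act_in[OF act_in[OF x]]])
  fix F assume F: "bform V W F"
  note LF = L bform_left[OF F] bform_right[OF F]
  have "tsum (summands (yd_act MN h (yd_act MN k x))) F =
    tsum (summands x) (\<lambda>m n. tsum (comul H k) (\<lambda>k1 k2. tsum (comul H h) (\<lambda>h1 h2.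
      F (yd_act M (\<gamma> h1) (yd_act M (\<gamma> k1) m)) (yd_act N (\<sigma> h2) (yd_act N (\<sigma> k2) n)))))"
    unfolding act_tsum[OF F act_in[OF x]]
    by (rule act_tsum[OF _ x]) (intro LF; (blast intro: mem | simp))
  also have "\<dots> = tsum (summands x) (\<lambda>m n. tsum (comul H (h * k)) (\<lambda>h1 h2. F (yd_act M (\<gamma> h1) m) (yd_act N (\<sigma> h2) n)))"
  proof (rule tsum_congI)
    fix m n assume "(m, n) \<in> set (summands x)"
    then have mn: "m \<in> carrier V" "n \<in> carrier W" by (blast intro: mem x)+
    have "bform A A (\<lambda>h1 h2. F (yd_act M (\<gamma> h1) m) (yd_act N (\<sigma> h2) n))"
      by (intro LF; (blast intro: mem mn | simp))
    then show "tsum (comul H k) (\<lambda>k1 k2. tsum (comul H h) (\<lambda>h1 h2.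
        F (yd_act M (\<gamma> h1) (yd_act M (\<gamma> k1) m)) (yd_act N (\<sigma> h2) (yd_act N (\<sigma> k2) n)))) =
      tsum (comul H (h * k)) (\<lambda>h1 h2. F (yd_act M (\<gamma> h1) m) (yd_act N (\<sigma> h2) n))"
      by (subst tsum_swap) (simp add: comul_mult' autD(3)[OF auts(3)] autD(3)[OF auts(5)]
          yd_objectsD(7)[OF M mn(1)] yd_objectsD(7)[OF N mn(2)])
  qed
  also have "\<dots> = tsum (summands (yd_act MN (h * k) x)) F"
    by (rule act_tsum[OF F x, symmetric])
  finally show "tsum (summands (yd_act MN (h * k) x)) F = tsum (summands (yd_act MN h (yd_act MN k x))) F" ..
qed

lemma act_one:
  assumes x: "x \<in> carrier T"
  shows "yd_act MN 1 x = x"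
proof (rule tensor_space_eqI[OF V W act_in[OF x] x])
  fix F assume F: "bform V W F"
  note LF = L bform_left[OF F] bform_right[OF F]
  have "tsum (comul H 1) (\<lambda>h1 h2. F (yd_act M (\<gamma> h1) m) (yd_act N (\<sigma> h2) n)) = F m n"
    if "(m, n) \<in> set (summands x)" for m n
  proof -
    have mn: "m \<in> carrier V" "n \<in> carrier W" using that by (blast intro: mem x)+
    have "bform A A (\<lambda>h1 h2. F (yd_act M (\<gamma> h1) m) (yd_act N (\<sigma> h2) n))"
      by (intro LF; (blast intro: mem mn | simp))
    then show ?thesis
      by (simp add: comul_one' autD(4)[OF auts(3)] autD(4)[OF auts(5)] yd_objectsD(8)[OF M mn(1)] yd_objectsD(8)[OF N mn(2)])
  qed
  then show "tsum (summands (yd_act MN 1 x)) F = tsum (summands x) F"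
    unfolding act_tsum[OF F x] by (rule tsum_congI)
qed

text \<open>The two factors are recoassociated one at a time; the coproducts of \<open>n1\<close>
  and \<open>m1\<close> are then merged into that of \<open>n1 * m1\<close> by
  multiplicativity.\<close>

lemma coact_coassoc:
  assumes x: "x \<in> carrier T" and F: "tform T A A F"
  shows "tsum (yd_coact MN x) (\<lambda>x0 x1. tsum (yd_coact MN x0) (\<lambda>x00 x01. F x00 x01 x1)) =
    tsum (yd_coact MN x) (\<lambda>x0 x1. tsum (comul H x1) (F x0))"
proof -
  note LF = L lform_comp[OF tformD(1)[OF F]] lform_comp[OF tformD(2)[OF F]] lform_comp[OF tformD(3)[OF F]]
  let ?G = "\<lambda>m00 m01 m1 n00 n01 n1. F (utens V W [(m00, n00)]) (n01 * m01) (n1 * m1)"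
  have b1: "bform T A (\<lambda>x0 x1. tsum (yd_coact MN x0) (\<lambda>x00 x01. F x00 x01 x1))"
    by (intro LF lform_tsum_left[OF lhom_comp[OF coact_lhom]]; (blast intro: mem tensor_memD[OF is_vspace_vsp[OF T] vsp_alg coact_in] | simp))
  have b2: "bform T A (\<lambda>x0 x1. tsum (comul H x1) (F x0))"
    by (intro LF; (blast intro: mem | simp))
  have b3: "bform T A (\<lambda>x00 x01. F x00 x01 k)" for k
    by (intro LF; (blast intro: mem | simp))
  have b4: "bform A A (\<lambda>a b. F t a b)" if "t \<in> carrier T" for t
    by (intro LF; (blast intro: mem that | simp))
  show ?thesis
    unfolding coact_tsum[OF b1 x] coact_tsum[OF b2 x]
  proof (rule tsum_congI)
    fix m n assume "(m, n) \<in> set (summands x)"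
    then have mn: "m \<in> carrier V" "n \<in> carrier W" by (blast intro: mem x)+
    have "tsum (yd_coact M m) (\<lambda>m0 m1. tsum (yd_coact N n) (\<lambda>n0 n1.
        tsum (yd_coact MN (utens V W [(m0, n0)])) (\<lambda>x00 x01. F x00 x01 (n1 * m1)))) =
      tsum (yd_coact M m) (\<lambda>m0 m1. tsum (yd_coact N n) (\<lambda>n0 n1.
        tsum (yd_coact M m0) (\<lambda>m00 m01. tsum (yd_coact N n0) (\<lambda>n00 n01. ?G m00 m01 m1 n00 n01 n1))))"
      by (intro tsum_congI coact_tsum_pure b3; blast intro: mem mn)
    also have "\<dots> = tsum (yd_coact M m) (\<lambda>m0 m1. tsum (yd_coact M m0) (\<lambda>m00 m01.
        tsum (yd_coact N n) (\<lambda>n0 n1. tsum (yd_coact N n0) (\<lambda>n00 n01. ?G m00 m01 m1 n00 n01 n1))))"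
      by (rule tsum_congI, rule tsum_swap)
    also have "\<dots> = tsum (yd_coact M m) (\<lambda>m0 m1. tsum (yd_coact M m0) (\<lambda>m00 m01.
        tsum (yd_coact N n) (\<lambda>n0 n1. tsum (comul H n1) (\<lambda>a b. ?G m00 m01 m1 n0 a b))))"
    proof (rule tsum_congI, rule tsum_congI)
      fix m0 m1 m00 m01 assume "(m0, m1) \<in> set (yd_coact M m)" "(m00, m01) \<in> set (yd_coact M m0)"
      then have mm: "m00 \<in> carrier V" by (blast intro: mem mn)
      show "tsum (yd_coact N n) (\<lambda>n0 n1. tsum (yd_coact N n0) (\<lambda>n00 n01. ?G m00 m01 m1 n00 n01 n1)) =
        tsum (yd_coact N n) (\<lambda>n0 n1. tsum (comul H n1) (\<lambda>a b. ?G m00 m01 m1 n0 a b))"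
        by (rule yd_objectsD(11)[OF N mn(2)]) (intro LF; (blast intro: mem mm | simp))
    qed
    also have "\<dots> = tsum (yd_coact M m) (\<lambda>m0 m1. tsum (comul H m1) (\<lambda>c d.
        tsum (yd_coact N n) (\<lambda>n0 n1. tsum (comul H n1) (\<lambda>a b. ?G m0 c d n0 a b))))"
      by (rule yd_objectsD(11)[OF M mn(1)]) (intro LF; (blast intro: mem mn | simp))
    also have "\<dots> = tsum (yd_coact M m) (\<lambda>m0 m1. tsum (yd_coact N n) (\<lambda>n0 n1.
        tsum (comul H n1) (\<lambda>a b. tsum (comul H m1) (\<lambda>c d. ?G m0 c d n0 a b))))"
      by (rule tsum_congI, subst tsum_swap, rule tsum_congI, rule tsum_swap)
    also have "\<dots> = tsum (yd_coact M m) (\<lambda>m0 m1. tsum (yd_coact N n) (\<lambda>n0 n1. tsum (comul H (n1 * m1)) (F (utens V W [(m0, n0)]))))"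
      by (rule tsum_congI, rule tsum_congI, rule comul_mult'[symmetric], rule b4) (blast intro: mem mn)
    finally show "tsum (yd_coact M m) (\<lambda>m0 m1. tsum (yd_coact N n) (\<lambda>n0 n1.
        tsum (yd_coact MN (utens V W [(m0, n0)])) (\<lambda>x00 x01. F x00 x01 (n1 * m1)))) = \<dots>" .
  qed
qed

lemma coact_counit:
  assumes x: "x \<in> carrier T" and f: "lform T f"
  shows "tsum (yd_coact MN x) (\<lambda>x0 x1. counit H x1 * f x0) = f x"
proof -
  note LF = L lform_comp[OF f]
  have b: "bform T A (\<lambda>x0 x1. counit H x1 * f x0)" by (intro LF)
  have "tsum (yd_coact M m) (\<lambda>m0 m1. tsum (yd_coact N n) (\<lambda>n0 n1. counit H (n1 * m1) * f (utens V W [(m0, n0)]))) =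
    f (utens V W [(m, n)])" if "(m, n) \<in> set (summands x)" for m n
  proof -
    have mn: "m \<in> carrier V" "n \<in> carrier W" using that by (blast intro: mem x)+
    have "tsum (yd_coact N n) (\<lambda>n0 n1. counit H n1 * f (utens V W [(m0, n0)])) = f (utens V W [(m0, n)])"
      if "m0 \<in> carrier V" for m0
      by (rule yd_objectsD(12)[OF N mn(2)]) (intro LF that)
    then have "tsum (yd_coact M m) (\<lambda>m0 m1. tsum (yd_coact N n) (\<lambda>n0 n1. counit H (n1 * m1) * f (utens V W [(m0, n0)]))) =
       tsum (yd_coact M m) (\<lambda>m0 m1. counit H m1 * f (utens V W [(m0, n)]))"
      using yd_mem(3)[OF M mn(1)]
      by (intro tsum_congI) (simp add: counit_mult mult.commute[of "counit H _" "counit H _"] mult.assoc tsum_mult_left)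
    also have "\<dots> = f (utens V W [(m, n)])"
      by (rule yd_objectsD(12)[OF M mn(1)]) (intro LF mn)
    finally show ?thesis .
  qed
  then show ?thesis
    unfolding coact_tsum[OF b x] lform_summands[OF V W f x] by (rule tsum_congI)
qed

text \<open>The rewritten compatibility condition is applied to the two factors in turn; no antipode occurs.\<close>

lemma compat:
  assumes x: "x \<in> carrier T" and F: "bform T A F"
  shows "tsum (comul H h) (\<lambda>h1 h2. tsum (yd_coact MN (yd_act MN h2 x)) (\<lambda>x0 x1. F x0 (x1 * (\<alpha> \<circ> \<gamma>) h1))) =
    tsum (comul H h) (\<lambda>h1 h2. tsum (yd_coact MN x) (\<lambda>x0 x1. F (yd_act MN h1 x0) ((\<delta> \<circ> \<sigma>) h2 * x1)))"
proof -
  note LF = L bform_left[OF F] bform_right[OF F]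
  let ?t = "\<lambda>m n. utens V W [(m, n)]"
  have b1: "bform T A (\<lambda>x0 x1. F x0 (x1 * k))" for k by (intro LF; simp)
  have b2: "bform T A (\<lambda>x0 x1. F (yd_act MN h x0) (k * x1))" for h k
    by (intro LF lhom_comp[OF act_lhom(1)] act_in; simp)
  have l: "tsum (yd_coact MN (yd_act MN h2 x)) (\<lambda>x0 x1. F x0 (x1 * \<alpha> (\<gamma> h1))) =
    tsum (summands x) (\<lambda>m n. tsum (comul H h2) (\<lambda>a b. tsum (yd_coact M (yd_act M (\<gamma> a) m)) (\<lambda>m0 m1.
      tsum (yd_coact N (yd_act N (\<sigma> b) n)) (\<lambda>n0 n1. F (?t m0 n0) (n1 * m1 * \<alpha> (\<gamma> h1))))))" for h1 h2
    unfolding coact_tsum[OF b1 act_in[OF x]] by (rule act_tsum[OF _ x]) (rule coact_bform[OF b1])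
  have r: "tsum (yd_coact MN x) (\<lambda>x0 x1. F (yd_act MN h1 x0) (\<delta> (\<sigma> h2) * x1)) =
    tsum (summands x) (\<lambda>m n. tsum (yd_coact M m) (\<lambda>m0 m1. tsum (yd_coact N n) (\<lambda>n0 n1.
      tsum (comul H h1) (\<lambda>a b. F (?t (yd_act M (\<gamma> a) m0) (yd_act N (\<sigma> b) n0)) (\<delta> (\<sigma> h2) * (n1 * m1))))))" for h1 h2
    unfolding coact_tsum[OF b2 x]
  proof (intro tsum_congI)
    fix m n m0 m1 n0 n1
    assume "(m, n) \<in> set (summands x)" "(m0, m1) \<in> set (yd_coact M m)" "(n0, n1) \<in> set (yd_coact N n)"
    then have "m0 \<in> carrier V" "n0 \<in> carrier W" by (blast intro: mem x)+
    then show "F (yd_act MN h1 (?t m0 n0)) (\<delta> (\<sigma> h2) * (n1 * m1)) =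
      tsum (comul H h1) (\<lambda>a b. F (?t (yd_act M (\<gamma> a) m0) (yd_act N (\<sigma> b) n0)) (\<delta> (\<sigma> h2) * (n1 * m1)))"
      by (intro act_lform_pure LF) simp
  qed
  have "tsum (comul H h) (\<lambda>h1 h2. tsum (yd_coact MN (yd_act MN h2 x)) (\<lambda>x0 x1. F x0 (x1 * \<alpha> (\<gamma> h1)))) =
    tsum (summands x) (\<lambda>m n. tsum (comul H h) (\<lambda>h1 h2. tsum (comul H h2) (\<lambda>a b. tsum (yd_coact M (yd_act M (\<gamma> a) m)) (\<lambda>m0 m1.
      tsum (yd_coact N (yd_act N (\<sigma> b) n)) (\<lambda>n0 n1. F (?t m0 n0) (n1 * m1 * \<alpha> (\<gamma> h1)))))))"
    unfolding l by (rule tsum_swap)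
  also have "\<dots> = tsum (summands x) (\<lambda>m n. tsum (comul H h) (\<lambda>h1 h2. tsum (yd_coact M m) (\<lambda>m0 m1. tsum (yd_coact N n) (\<lambda>n0 n1.
      tsum (comul H h1) (\<lambda>a b. F (?t (yd_act M (\<gamma> a) m0) (yd_act N (\<sigma> b) n0)) (\<delta> (\<sigma> h2) * (n1 * m1)))))))"
  proof (rule tsum_congI)
    fix m n assume "(m, n) \<in> set (summands x)"
    then have mn: "m \<in> carrier V" "n \<in> carrier W" by (blast intro: mem x)+
    let ?K = "\<lambda>a b c. tsum (yd_coact M m) (\<lambda>m0 m1. tsum (yd_coact N n) (\<lambda>n0 n1.
        F (?t (yd_act M (\<gamma> a) m0) (yd_act N (\<sigma> b) n0)) (\<delta> (\<sigma> c) * n1 * m1)))"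
    have "tsum (comul H h) (\<lambda>h1 h2. tsum (comul H h2) (\<lambda>a b. tsum (yd_coact M (yd_act M (\<gamma> a) m)) (\<lambda>m0 m1.
        tsum (yd_coact N (yd_act N (\<sigma> b) n)) (\<lambda>n0 n1. F (?t m0 n0) (n1 * m1 * \<alpha> (\<gamma> h1)))))) =
      tsum (comul H h) (\<lambda>y b. tsum (comul H y) (\<lambda>h1 a. tsum (yd_coact M (yd_act M (\<gamma> a) m)) (\<lambda>m0 m1.
        tsum (yd_coact N (yd_act N (\<sigma> b) n)) (\<lambda>n0 n1. F (?t m0 n0) (n1 * (m1 * \<alpha> (\<gamma> h1)))))))"
      unfolding mult.assoc by (intro comul_coassoc[symmetric] LF; (blast intro: mem mn | simp))
    also have "\<dots> = tsum (comul H h) (\<lambda>y b. tsum (comul H y) (\<lambda>h1 a. tsum (yd_coact M m) (\<lambda>m0 m1.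
        tsum (yd_coact N (yd_act N (\<sigma> b) n)) (\<lambda>n0 n1. F (?t (yd_act M (\<gamma> h1) m0) n0) (n1 * (\<beta> (\<gamma> a) * m1))))))"
      by (rule tsum_congI, rule yd_compat_aut[OF M iM auts(3) mn(1)]) (intro LF; (blast intro: mem mn | simp))
    also have "\<dots> = tsum (comul H h) (\<lambda>y b. tsum (comul H b) (\<lambda>a c. tsum (yd_coact M m) (\<lambda>m0 m1.
        tsum (yd_coact N (yd_act N (\<sigma> c) n)) (\<lambda>n0 n1. F (?t (yd_act M (\<gamma> y) m0) n0) (n1 * (\<beta> (\<gamma> a) * m1))))))"
      by (intro comul_coassoc LF; (blast intro: mem mn | simp))
    \<comment> \<open>The condition for \<open>M\<close> leaves \<open>\<beta>(\<gamma>(a))\<close>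
      behind. By \<open>\<beta>\<gamma> = \<gamma>\<sigma>\<close> this is
      \<open>\<gamma>(\<sigma>(a))\<close>, which is what the condition for \<open>N\<close>, of
      index \<open>(\<gamma>, \<delta>)\<close>, consumes along \<open>\<sigma>\<close>.\<close>
    also have "\<dots> = tsum (comul H h) (\<lambda>y b. tsum (yd_coact M m) (\<lambda>m0 m1. tsum (comul H b) (\<lambda>a c.
        tsum (yd_coact N (yd_act N (\<sigma> c) n)) (\<lambda>n0 n1. F (?t (yd_act M (\<gamma> y) m0) n0) (n1 * \<gamma> (\<sigma> a) * m1)))))"
      unfolding \<gamma>\<sigma> mult.assoc by (rule tsum_congI, rule tsum_swap)
    also have "\<dots> = tsum (comul H h) (\<lambda>y b. tsum (yd_coact M m) (\<lambda>m0 m1. tsum (comul H b) (\<lambda>a c.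
        tsum (yd_coact N n) (\<lambda>n0 n1. F (?t (yd_act M (\<gamma> y) m0) (yd_act N (\<sigma> a) n0)) (\<delta> (\<sigma> c) * n1 * m1)))))"
    proof (rule tsum_congI, rule tsum_congI)
      fix y b m0 m1 assume "(m0, m1) \<in> set (yd_coact M m)"
      then have m0: "m0 \<in> carrier V" by (blast intro: mem mn)
      have "bform W A (\<lambda>n0 k. F (?t (yd_act M (\<gamma> y) m0) n0) (k * m1))"
        by (intro LF; (blast intro: mem m0 | simp))
      from yd_compat_aut[OF N iN auts(5) mn(2) this, of b]
      show "tsum (comul H b) (\<lambda>a c. tsum (yd_coact N (yd_act N (\<sigma> c) n)) (\<lambda>n0 n1. F (?t (yd_act M (\<gamma> y) m0) n0) (n1 * \<gamma> (\<sigma> a) * m1))) =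
        tsum (comul H b) (\<lambda>a c. tsum (yd_coact N n) (\<lambda>n0 n1. F (?t (yd_act M (\<gamma> y) m0) (yd_act N (\<sigma> a) n0)) (\<delta> (\<sigma> c) * n1 * m1)))" .
    qed
    also have "\<dots> = tsum (comul H h) (\<lambda>y b. tsum (comul H b) (\<lambda>a c. ?K y a c))"
      by (rule tsum_congI, rule tsum_swap)
    also have "\<dots> = tsum (comul H h) (\<lambda>y b. tsum (comul H y) (\<lambda>a c. ?K a c b))"
      by (intro comul_coassoc[symmetric] LF; (blast intro: mem mn | simp))
    also have "\<dots> = tsum (comul H h) (\<lambda>h1 h2. tsum (yd_coact M m) (\<lambda>m0 m1. tsum (yd_coact N n) (\<lambda>n0 n1.
        tsum (comul H h1) (\<lambda>a b. F (?t (yd_act M (\<gamma> a) m0) (yd_act N (\<sigma> b) n0)) (\<delta> (\<sigma> h2) * (n1 * m1))))))"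
      unfolding mult.assoc by (rule tsum_congI, subst tsum_swap, rule tsum_congI, rule tsum_swap)
    finally show "tsum (comul H h) (\<lambda>h1 h2. tsum (comul H h2) (\<lambda>a b. tsum (yd_coact M (yd_act M (\<gamma> a) m)) (\<lambda>m0 m1.
        tsum (yd_coact N (yd_act N (\<sigma> b) n)) (\<lambda>n0 n1. F (?t m0 n0) (n1 * m1 * \<alpha> (\<gamma> h1)))))) = \<dots>" .
  qed
  also have "\<dots> = tsum (comul H h) (\<lambda>h1 h2. tsum (yd_coact MN x) (\<lambda>x0 x1. F (yd_act MN h1 x0) (\<delta> (\<sigma> h2) * x1)))"
    unfolding r by (rule tsum_swap)
  finally show ?thesis by simp
qed

lemma MN_in: "MN \<in> yd_objects H"
proof (rule yd_objectsI[OF MN_simps(1)])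
  show "yd_act MN h \<in> extensional (carrier (yd_space MN))" "yd_coact MN \<in> extensional (carrier (yd_space MN))" for h
    by (simp_all add: MN_simps)
  show "\<alpha> \<circ> \<gamma> \<in> hopf_aut H" "\<delta> \<circ> \<sigma> \<in> hopf_aut H" using auts by (auto intro: aut_comp)
qed (simp_all only: MN_simps(2) T act_lhom act_mult act_one coact_lhom coact_coassoc coact_counit compat)

end

section \<open>Unit object and conjugation\<close>

lemma lform_ext2:
  assumes V: "is_vspace V" and W: "is_vspace W"
    and f: "lform (tensor_space V W) f" and g: "lform (tensor_space V W) g"
    and eq: "\<And>v w. v \<in> carrier V \<Longrightarrow> w \<in> carrier W \<Longrightarrow> f (utens V W [(v, w)]) = g (utens V W [(v, w)])"
    and x: "x \<in> carrier (tensor_space V W)"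
  shows "f x = g x"
  unfolding lform_summands[OF V W f x] lform_summands[OF V W g x]
  by (intro tsum_congI eq) (blast intro: summands_memD[OF V W x])+

lemma lform_ext3:
  assumes U: "is_vspace U" and V: "is_vspace V" and W: "is_vspace W"
    and f: "lform (tensor_space (tensor_space U V) W) f" and g: "lform (tensor_space (tensor_space U V) W) g"
    and eq: "\<And>u v w. u \<in> carrier U \<Longrightarrow> v \<in> carrier V \<Longrightarrow> w \<in> carrier W \<Longrightarrow>
      f (utens (tensor_space U V) W [(utens U V [(u, v)], w)]) = g (utens (tensor_space U V) W [(utens U V [(u, v)], w)])"
    and x: "x \<in> carrier (tensor_space (tensor_space U V) W)"
  shows "f x = g x"
proof (rule lform_ext2[OF _ W f g _ x])
  fix t w assume t: "t \<in> carrier (tensor_space U V)" and w: "w \<in> carrier W"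
  show "f (utens (tensor_space U V) W [(t, w)]) = g (utens (tensor_space U V) W [(t, w)])"
    by (rule lform_ext2[OF U V lform_comp[OF f] lform_comp[OF g] _ t])
      (use U V W w eq in \<open>auto intro!: utens_bilinear lhom_id\<close>)
qed (use U V in auto)

context hopf_algebra_bij
begin

lemma yd_unit_simps:
  "yd_index (yd_unit H) = (id, id)" "yd_space (yd_unit H) = unit_space"
  "yd_act (yd_unit H) h = (\<lambda>s\<in>carrier unit_space. counit H h \<odot>\<^bsub>unit_space\<^esub> s)"
  "yd_coact (yd_unit H) = (\<lambda>s\<in>carrier unit_space. tcls unit_space A [(s, 1)])"
  by (simp_all add: yd_unit_def)

lemma yd_unit_coact_tsum:
  "bform unit_space A F \<Longrightarrow> s \<in> carrier unit_space \<Longrightarrow> tsum (yd_coact (yd_unit H) s) F = F s 1"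
  by (simp add: yd_unit_simps)

lemma yd_unit_act_lform:
  "lform unit_space f \<Longrightarrow> s \<in> carrier unit_space \<Longrightarrow> f (yd_act (yd_unit H) h s) = counit H h * f s"
  using lformD(2)[of unit_space f s "counit H h"] by (simp add: yd_unit_simps del: unit_space_simps)

lemma yd_unit_in: "yd_unit H \<in> yd_objects H"
proof (rule yd_objectsI)
  let ?U = "yd_unit H"
  note S = yd_unit_simps
  show "yd_index ?U = (id, id)" "id \<in> hopf_aut H" "is_vspace (yd_space ?U)"
    by (simp_all add: S aut_id)
  show "yd_act ?U h \<in> extensional (carrier (yd_space ?U))" "yd_coact ?U \<in> extensional (carrier (yd_space ?U))" for h
    unfolding S by (rule restrict_extensional)+
  show "yd_act ?U h \<in> lhom (yd_space ?U) (yd_space ?U)" for h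
    by (auto simp: S lhom_iff algebra_simps)
  show "(\<lambda>h. yd_act ?U h m) \<in> lhom A (yd_space ?U)" if "m \<in> carrier (yd_space ?U)" for m
    using that lformD[OF lform_counit] by (auto simp: S lhom_iff algebra_simps)
  show "yd_act ?U (h * k) m = yd_act ?U h (yd_act ?U k m)" "yd_act ?U 1 m = m" if "m \<in> carrier (yd_space ?U)" for h k m
    using that by (auto simp: S counit_mult counit_one)
  show "yd_coact ?U \<in> lhom (yd_space ?U) (tensor (yd_space ?U) A)"
    unfolding S by (rule lhom_cong[OF tcls_bilinear(1)]) (auto simp del: unit_space_simps(1))
  fix m assume m: "m \<in> carrier (yd_space ?U)"
  then have m': "m \<in> carrier unit_space" by (simp add: S)
  show "tsum (yd_coact ?U m) (\<lambda>m0 m1. tsum (yd_coact ?U m0) (\<lambda>m00 m01. F m00 m01 m1)) =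
      tsum (yd_coact ?U m) (\<lambda>m0 m1. tsum (comul H m1) (F m0))" if F: "tform (yd_space ?U) A A F" for F
  proof -
    note F' = F[unfolded S]
    note LF = lin lform_comp[OF tformD(1)[OF F']] lform_comp[OF tformD(2)[OF F']] lform_comp[OF tformD(3)[OF F']]
    have 1: "tsum (yd_coact ?U s) (\<lambda>m00 m01. F m00 m01 k) = F s 1 k" if "s \<in> carrier unit_space" for s k
      by (rule yd_unit_coact_tsum[OF _ that]) (intro LF; simp)
    have "tsum (yd_coact ?U m) (\<lambda>m0 m1. tsum (yd_coact ?U m0) (\<lambda>m00 m01. F m00 m01 m1)) = tsum (yd_coact ?U m) (\<lambda>m0 m1. F m0 1 m1)"
      by (rule tsum_congI, rule 1)
        (use m' tensor_memD(1)[OF is_vspace_vsp[OF is_vspace_unit_space] vsp_alg tcls_in] in \<open>force simp: S\<close>)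
    also have "\<dots> = F m 1 1"
      by (rule yd_unit_coact_tsum[OF _ m']) (intro LF; simp)
    also have "\<dots> = tsum (yd_coact ?U m) (\<lambda>m0 m1. tsum (comul H m1) (F m0))"
      by (subst yd_unit_coact_tsum[OF _ m'], (intro LF; simp)[1], rule comul_one'[symmetric]) (intro LF; use m' in simp)
    finally show ?thesis .
  qed
  show "tsum (yd_coact ?U m) (\<lambda>m0 m1. counit H m1 * f m0) = f m" if f: "lform (yd_space ?U) f" for f
    by (subst yd_unit_coact_tsum[OF _ m']) (intro lin lform_comp[OF f[unfolded S]], simp add: counit_one)
  show "tsum (comul H h) (\<lambda>h1 h2. tsum (yd_coact ?U (yd_act ?U h2 m)) (\<lambda>m0 m1. F m0 (m1 * id h1))) =
      tsum (comul H h) (\<lambda>h1 h2. tsum (yd_coact ?U m) (\<lambda>m0 m1. F (yd_act ?U h1 m0) (id h2 * m1)))"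
    if F: "bform (yd_space ?U) A F" for h F
  proof -
    note F' = F[unfolded S]
    note LF = lin bform_left[OF F'] bform_right[OF F']
    have c: "yd_act ?U h m \<in> carrier unit_space" for h
      using m' by (auto simp: S)
    have lh: "yd_act ?U h \<in> lhom unit_space unit_space" for h
      by (auto simp: S lhom_iff algebra_simps)
    have act: "F (yd_act ?U h m) k = counit H h * F m k" for h k
      by (rule yd_unit_act_lform[OF bformD(1)[OF F'] m']) simp
    \<comment> \<open>Both sides equal \<open>F m h\<close>: the action through the counit removes
      one part of \<open>h\<close> on either side.\<close>
    have "tsum (comul H h) (\<lambda>h1 h2. tsum (yd_coact ?U (yd_act ?U h2 m)) (\<lambda>m0 m1. F m0 (m1 * id h1))) =
      tsum (comul H h) (\<lambda>h1 h2. F (yd_act ?U h2 m) (1 * id h1))"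
      by (rule tsum_congI, rule yd_unit_coact_tsum[OF _ c]) (intro LF; simp)
    also have "\<dots> = F m h"
      using counit_right'[OF bformD(2)[OF F' m'], of h] by (simp add: act)
    also have "\<dots> = tsum (comul H h) (\<lambda>h1 h2. F (yd_act ?U h1 m) (id h2 * 1))"
      using counit_left'[OF bformD(2)[OF F' m'], of h] by (simp add: act)
    also have "\<dots> = tsum (comul H h) (\<lambda>h1 h2. tsum (yd_coact ?U m) (\<lambda>m0 m1. F (yd_act ?U h1 m0) (id h2 * m1)))"
      by (rule tsum_congI, rule yd_unit_coact_tsum[OF _ m', symmetric])
        (intro LF lhom_comp[OF lh]; (blast intro: lhomD(1)[OF lh] | simp))
    finally show ?thesis .
  qed
qed (rule aut_id)

end

section \<open>Conjugation of a module by a pair of automorphisms\<close>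

locale yd_twist = hopf_algebra_bij H for H :: "('k::field, 'h::ring_1) hopf_data" +
  fixes N :: "('k, 'h, 'a) yd_obj" and \<alpha> \<beta> \<gamma> \<delta> :: "'h \<Rightarrow> 'h"
  assumes N: "N \<in> yd_objects H" and iN: "yd_index N = (\<gamma>, \<delta>)"
    and \<alpha>: "\<alpha> \<in> hopf_aut H" and \<beta>: "\<beta> \<in> hopf_aut H"
begin

abbreviation "W \<equiv> yd_space N"
abbreviation "PN \<equiv> yd_phi H (\<alpha>, \<beta>) N"

text \<open>The conjugate is \<open>N\<close> with its action precomposed with \<open>\<tau>\<close>
  and its coaction postcomposed with \<open>\<kappa>\<close>; its index becomes
  \<open>(\<alpha>\<gamma>\<alpha>^{-1}, \<kappa>\<delta>\<tau>)\<close>.\<close>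

definition \<tau> :: "'h \<Rightarrow> 'h" where "\<tau> = finv \<gamma> \<circ> \<beta> \<circ> \<gamma> \<circ> finv \<alpha>"
definition \<kappa> :: "'h \<Rightarrow> 'h" where "\<kappa> = \<alpha> \<circ> finv \<beta>"

lemma auts: "\<gamma> \<in> hopf_aut H" "\<delta> \<in> hopf_aut H" "\<tau> \<in> hopf_aut H" "\<kappa> \<in> hopf_aut H"
proof -
  show "\<gamma> \<in> hopf_aut H" "\<delta> \<in> hopf_aut H"
    using yd_objectsD(1,2)[OF N] iN by auto
  then show "\<tau> \<in> hopf_aut H" "\<kappa> \<in> hopf_aut H"
    unfolding \<tau>_def \<kappa>_def using \<alpha> \<beta> by (intro aut_comp aut_finv; simp)+
qed

lemma W [simp]: "is_vspace W"
  using yd_objectsD(3)[OF N] by auto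

lemma PN_simps:
  "yd_index PN = (\<alpha> \<circ> \<gamma> \<circ> finv \<alpha>, \<kappa> \<circ> \<delta> \<circ> \<tau>)"
  "yd_space PN = W"
  "yd_act PN h = (\<lambda>n\<in>carrier W. yd_act N (\<tau> h) n)"
  "yd_coact PN = (\<lambda>n\<in>carrier W. tcls W A [(n0, \<kappa> n1). (n0, n1) \<leftarrow> yd_coact N n])"
proof -
  have "(\<alpha>, \<beta>) \<otimes>\<^bsub>aut_group H\<^esub> (\<gamma>, \<delta>) \<otimes>\<^bsub>aut_group H\<^esub> inv\<^bsub>aut_group H\<^esub> (\<alpha>, \<beta>) = (\<alpha> \<circ> \<gamma> \<circ> finv \<alpha>, \<kappa> \<circ> \<delta> \<circ> \<tau>)"
    using autD(8)[OF \<alpha>] by (simp add: aut_group_inv[OF \<alpha> \<beta>] finv_finv[OF \<alpha>] \<kappa>_def \<tau>_def fun_eq_iff)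
  then show "yd_index PN = (\<alpha> \<circ> \<gamma> \<circ> finv \<alpha>, \<kappa> \<circ> \<delta> \<circ> \<tau>)"
    by (simp add: yd_phi_def Let_def iN)
qed (simp_all add: yd_phi_def Let_def iN \<tau>_def \<kappa>_def)

lemmas L = lin' lhom_comp[OF autD(2)[OF \<alpha>]] lhom_comp[OF autD(2)[OF \<beta>]]
  lhom_comp[OF autD(2)[OF auts(1)]] lhom_comp[OF autD(2)[OF auts(2)]]
  lhom_comp[OF autD(2)[OF auts(3)]] lhom_comp[OF autD(2)[OF auts(4)]] yd_lin[OF N]

lemmas mem = yd_mem[OF N]

lemma coact_wf:
  "n \<in> carrier W \<Longrightarrow> set [(n0, \<kappa> n1). (n0, n1) \<leftarrow> yd_coact N n] \<subseteq> carrier W \<times> carrier A"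
  by (intro wf_intros; (blast intro: mem | simp))

lemma coact_in: "n \<in> carrier W \<Longrightarrow> yd_coact PN n \<in> carrier (tensor W A)"
  using tcls_in[OF coact_wf] by (simp add: PN_simps)

lemma coact_tsum:
  assumes F: "bform W A F" and n: "n \<in> carrier W"
  shows "tsum (yd_coact PN n) F = tsum (yd_coact N n) (\<lambda>n0 n1. F n0 (\<kappa> n1))"
  using tsum_tcls[OF is_vspace_vsp[OF W] vsp_alg F coact_wf[OF n]] n by (simp add: PN_simps)

lemma act_eq: "n \<in> carrier W \<Longrightarrow> yd_act PN h n = yd_act N (\<tau> h) n"
  by (simp add: PN_simps)

lemma PN_in: "PN \<in> yd_objects H"
proof (rule yd_objectsI[OF PN_simps(1)])
  note S = PN_simps
  note ab [simp] = autD(8,9)[OF \<alpha>] autD(8,9)[OF \<beta>] autD(8,9)[OF auts(1)]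
  show "\<alpha> \<circ> \<gamma> \<circ> finv \<alpha> \<in> hopf_aut H" "\<kappa> \<circ> \<delta> \<circ> \<tau> \<in> hopf_aut H"
    using \<alpha> auts by (intro aut_comp aut_finv; simp)+
  show "is_vspace (yd_space PN)" by (simp add: S)
  show "yd_act PN h \<in> extensional (carrier (yd_space PN))" "yd_coact PN \<in> extensional (carrier (yd_space PN))" for h
    unfolding S by (rule restrict_extensional)+
  show "yd_act PN h \<in> lhom (yd_space PN) (yd_space PN)" for h
    unfolding S(2) by (rule lhom_cong[OF yd_objectsD(5)[OF N] _ act_eq]) auto
  show "yd_coact PN \<in> lhom (yd_space PN) (tensor (yd_space PN) A)"
    unfolding S(2)
  proof (rule lhom_tensorI)
    fix F assume F: "bform W A F"
    show "lform W (\<lambda>x. tsum (yd_coact PN x) F)"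
      by (rule lform_cong[OF _ is_vspace_vsp[OF W] coact_tsum[OF F]])
        (intro L bform_left[OF F] bform_right[OF F]; simp)
  qed (auto intro: coact_in)
  fix n assume "n \<in> carrier (yd_space PN)"
  then have n: "n \<in> carrier W" by (simp add: S)
  show "(\<lambda>h. yd_act PN h n) \<in> lhom A (yd_space PN)"
    unfolding S(2) act_eq[OF n] by (intro L n)
  show "yd_act PN (h * k) n = yd_act PN h (yd_act PN k n)" "yd_act PN 1 n = n" for h k
    using n yd_mem(1)[OF N n] yd_objectsD(7,8)[OF N n] by (simp_all add: act_eq autD(3,4)[OF auts(3)])
  show "tsum (yd_coact PN n) (\<lambda>m0 m1. tsum (yd_coact PN m0) (\<lambda>m00 m01. F m00 m01 m1)) =
      tsum (yd_coact PN n) (\<lambda>m0 m1. tsum (comul H m1) (F m0))" if F: "tform (yd_space PN) A A F" for F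
  proof -
    note F' = F[unfolded S]
    note LF = L lform_comp[OF tformD(1)[OF F']] lform_comp[OF tformD(2)[OF F']] lform_comp[OF tformD(3)[OF F']]
    have b1: "bform W A (\<lambda>m00 m01. F m00 m01 k)" for k by (intro LF; simp)
    have "tsum (yd_coact PN n) (\<lambda>m0 m1. tsum (yd_coact PN m0) (\<lambda>m00 m01. F m00 m01 m1)) =
      tsum (yd_coact PN n) (\<lambda>m0 m1. tsum (yd_coact N m0) (\<lambda>m00 m01. F m00 (\<kappa> m01) m1))"
      by (intro tsum_congI coact_tsum b1) (blast intro: tensor_memD(1)[OF is_vspace_vsp[OF W] vsp_alg coact_in[OF n]])
    also have "\<dots> = tsum (yd_coact N n) (\<lambda>m0 m1. tsum (yd_coact N m0) (\<lambda>m00 m01. F m00 (\<kappa> m01) (\<kappa> m1)))"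
      by (rule coact_tsum[OF _ n]) (intro LF; (blast intro: mem | simp))
    also have "\<dots> = tsum (yd_coact N n) (\<lambda>m0 m1. tsum (comul H m1) (\<lambda>a b. F m0 (\<kappa> a) (\<kappa> b)))"
      by (rule yd_objectsD(11)[OF N n]) (intro LF; (blast intro: mem | simp))
    also have "\<dots> = tsum (yd_coact N n) (\<lambda>m0 m1. tsum (comul H (\<kappa> m1)) (F m0))"
      by (intro tsum_congI autD(5)[OF auts(4), symmetric] LF; (blast intro: mem n | simp))
    also have "\<dots> = tsum (yd_coact PN n) (\<lambda>m0 m1. tsum (comul H m1) (F m0))"
      by (rule coact_tsum[OF _ n, symmetric]) (intro LF; (blast intro: mem | simp))
    finally show ?thesis .
  qed
  show "tsum (yd_coact PN n) (\<lambda>m0 m1. counit H m1 * f m0) = f n" if f: "lform (yd_space PN) f" for f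
  proof -
    note f' = f[unfolded S]
    have "tsum (yd_coact PN n) (\<lambda>m0 m1. counit H m1 * f m0) = tsum (yd_coact N n) (\<lambda>m0 m1. counit H (\<kappa> m1) * f m0)"
      by (rule coact_tsum[OF _ n]) (intro L lform_comp[OF f'])
    then show ?thesis using yd_objectsD(12)[OF N n f'] by (simp add: autD(6)[OF auts(4)])
  qed
  show "tsum (comul H h) (\<lambda>h1 h2. tsum (yd_coact PN (yd_act PN h2 n)) (\<lambda>m0 m1. F m0 (m1 * (\<alpha> \<circ> \<gamma> \<circ> finv \<alpha>) h1))) =
      tsum (comul H h) (\<lambda>h1 h2. tsum (yd_coact PN n) (\<lambda>m0 m1. F (yd_act PN h1 m0) ((\<kappa> \<circ> \<delta> \<circ> \<tau>) h2 * m1)))"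
    if F: "bform (yd_space PN) A F" for h F
  proof -
    note F' = F[unfolded S]
    note LF = L bform_left[OF F'] bform_right[OF F']
    \<comment> \<open>With \<open>\<alpha>\<gamma>\<alpha>^{-1} = \<kappa>\<gamma>\<tau>\<close>,
      the condition required of the conjugate is the condition for \<open>N\<close> along
      \<open>\<tau>\<close>, pushed through the algebra map \<open>\<kappa>\<close>.\<close>
    have \<kappa>: "(\<alpha> \<circ> \<gamma> \<circ> finv \<alpha>) x = \<kappa> (\<gamma> (\<tau> x))" for x by (simp add: \<kappa>_def \<tau>_def)
    have "tsum (comul H h) (\<lambda>h1 h2. tsum (yd_coact PN (yd_act PN h2 n)) (\<lambda>m0 m1. F m0 (m1 * (\<alpha> \<circ> \<gamma> \<circ> finv \<alpha>) h1))) =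
      tsum (comul H h) (\<lambda>h1 h2. tsum (yd_coact N (yd_act N (\<tau> h2) n)) (\<lambda>m0 m1. F m0 (\<kappa> (m1 * \<gamma> (\<tau> h1)))))"
    proof (rule tsum_congI)
      fix h1 h2
      have "bform W A (\<lambda>m0 m1. F m0 (m1 * \<kappa> (\<gamma> (\<tau> h1))))" by (intro LF; simp)
      from coact_tsum[OF this yd_mem(1)[OF N n]]
      show "tsum (yd_coact PN (yd_act PN h2 n)) (\<lambda>m0 m1. F m0 (m1 * (\<alpha> \<circ> \<gamma> \<circ> finv \<alpha>) h1)) =
        tsum (yd_coact N (yd_act N (\<tau> h2) n)) (\<lambda>m0 m1. F m0 (\<kappa> (m1 * \<gamma> (\<tau> h1))))"
        unfolding \<kappa> act_eq[OF n] autD(3)[OF auts(4)] .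
    qed
    also have "\<dots> = tsum (comul H h) (\<lambda>h1 h2. tsum (yd_coact N n) (\<lambda>m0 m1. F (yd_act N (\<tau> h1) m0) (\<kappa> (\<delta> (\<tau> h2) * m1))))"
      by (rule yd_compat_aut[OF N iN auts(3) n]) (intro LF; simp)
    also have "\<dots> = tsum (comul H h) (\<lambda>h1 h2. tsum (yd_coact N n) (\<lambda>m0 m1. F (yd_act PN h1 m0) ((\<kappa> \<circ> \<delta> \<circ> \<tau>) h2 * \<kappa> m1)))"
      by (intro tsum_congI) (simp add: act_eq yd_mem(3)[OF N n] autD(3)[OF auts(4)])
    also have "\<dots> = tsum (comul H h) (\<lambda>h1 h2. tsum (yd_coact PN n) (\<lambda>m0 m1. F (yd_act PN h1 m0) ((\<kappa> \<circ> \<delta> \<circ> \<tau>) h2 * m1)))"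
    proof (rule tsum_congI, rule coact_tsum[OF _ n, symmetric])
      fix h1 h2
      have act: "yd_act PN h1 \<in> lhom W W" by (rule lhom_cong[OF yd_objectsD(5)[OF N] _ act_eq]) auto
      show "bform W A (\<lambda>m0 m1. F (yd_act PN h1 m0) ((\<kappa> \<circ> \<delta> \<circ> \<tau>) h2 * m1))"
        by (intro LF lhom_comp[OF act]; (blast intro: lhomD(1)[OF act] | simp))
    qed
    finally show ?thesis .
  qed
qed

end

section \<open>Morphisms, and the constraints as morphisms\<close>

context hopf_algebra_bij
begin

lemma yd_homs_iff:
  assumes M: "M \<in> yd_objects H" and N: "N \<in> yd_objects H"
  shows "f \<in> yd_homs H M N \<longleftrightarrow> yd_index M = yd_index N \<and> f \<in> extensional (carrier (yd_space M)) \<and>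
    f \<in> lhom (yd_space M) (yd_space N) \<and>
    (\<forall>h. \<forall>m\<in>carrier (yd_space M). f (yd_act M h m) = yd_act N h (f m)) \<and>
    (\<forall>m\<in>carrier (yd_space M). \<forall>F. bform (yd_space N) A F \<longrightarrow>
      tsum (yd_coact N (f m)) F = tsum (yd_coact M m) (\<lambda>m0 m1. F (f m0) m1))"
proof (cases "f \<in> lhom (yd_space M) (yd_space N)")
  case True
  have "yd_coact N (f m) = tcls (yd_space N) A [(f m0, m1). (m0, m1) \<leftarrow> yd_coact M m] \<longleftrightarrow>
      (\<forall>F. bform (yd_space N) A F \<longrightarrow> tsum (yd_coact N (f m)) F = tsum (yd_coact M m) (\<lambda>m0 m1. F (f m0) m1))"
    if m: "m \<in> carrier (yd_space M)" for m
  proof -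
    have wf: "set [(f m0, m1). (m0, m1) \<leftarrow> yd_coact M m] \<subseteq> carrier (yd_space N) \<times> carrier A"
      by (intro wf_intros lhomD(1)[OF True] yd_mem(3)[OF M m]) auto
    show ?thesis
      using tcls_eqI'[OF is_vspace_vsp[OF yd_objectsD(3)[OF N]] vsp_alg wf yd_mem(2)[OF N lhomD(1)[OF True m]]]
        tsum_tcls[OF is_vspace_vsp[OF yd_objectsD(3)[OF N]] vsp_alg _ wf] by auto
  qed
  then show ?thesis unfolding yd_homs_def by auto
next
  case False
  then show ?thesis unfolding yd_homs_def by blast
qed

lemma yd_homsD:
  assumes "f \<in> yd_homs H M N" and M: "M \<in> yd_objects H" and N: "N \<in> yd_objects H"
  shows "yd_index M = yd_index N" and "f \<in> extensional (carrier (yd_space M))"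
    and "f \<in> lhom (yd_space M) (yd_space N)"
    and "m \<in> carrier (yd_space M) \<Longrightarrow> f (yd_act M h m) = yd_act N h (f m)"
    and "m \<in> carrier (yd_space M) \<Longrightarrow> bform (yd_space N) A F \<Longrightarrow>
      tsum (yd_coact N (f m)) F = tsum (yd_coact M m) (\<lambda>m0 m1. F (f m0) m1)"
  using assms(1) unfolding yd_homs_iff[OF M N] by blast+

lemma yd_homsI:
  assumes "M \<in> yd_objects H" "N \<in> yd_objects H" "yd_index M = yd_index N"
    and "f \<in> extensional (carrier (yd_space M))" "f \<in> lhom (yd_space M) (yd_space N)"
    and "\<And>h m. m \<in> carrier (yd_space M) \<Longrightarrow> f (yd_act M h m) = yd_act N h (f m)"
    and "\<And>m F. m \<in> carrier (yd_space M) \<Longrightarrow> bform (yd_space N) A F \<Longrightarrow>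
      tsum (yd_coact N (f m)) F = tsum (yd_coact M m) (\<lambda>m0 m1. F (f m0) m1)"
  shows "f \<in> yd_homs H M N"
  using assms by (simp add: yd_homs_iff)

lemma yd_hom_id: "M \<in> yd_objects H \<Longrightarrow> (\<lambda>x\<in>carrier (yd_space M). x) \<in> yd_homs H M M"
proof (rule yd_homsI)
  assume M: "M \<in> yd_objects H"
  show "(\<lambda>x\<in>carrier (yd_space M). x) \<in> lhom (yd_space M) (yd_space M)"
    by (rule lhom_cong[OF lhom_id]) (use yd_objectsD(3)[OF M] in auto)
  fix m F assume "m \<in> carrier (yd_space M)"
  then show "tsum (yd_coact M ((\<lambda>x\<in>carrier (yd_space M). x) m)) F =
    tsum (yd_coact M m) (\<lambda>m0 m1. F ((\<lambda>x\<in>carrier (yd_space M). x) m0) m1)"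
    using yd_mem(3)[OF M] by (auto intro!: tsum_congI)
qed (auto intro: yd_mem)

lemma yd_hom_compose:
  assumes f: "f \<in> yd_homs H L M" and g: "g \<in> yd_homs H M N"
    and L: "L \<in> yd_objects H" and M: "M \<in> yd_objects H" and N: "N \<in> yd_objects H"
  shows "compose (carrier (yd_space L)) g f \<in> yd_homs H L N"
proof (rule yd_homsI[OF L N])
  note f' = yd_homsD[OF f L M] and g' = yd_homsD[OF g M N]
  show "compose (carrier (yd_space L)) g f \<in> lhom (yd_space L) (yd_space N)"
    by (rule lhom_cong[OF lhom_comp[OF g'(3) f'(3)]]) (use yd_objectsD(3)[OF L] in \<open>auto simp: compose_eq\<close>)
  fix m assume m: "m \<in> carrier (yd_space L)"
  show "compose (carrier (yd_space L)) g f (yd_act L h m) = yd_act N h (compose (carrier (yd_space L)) g f m)" for h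
    using m f'(4) g'(4) lhomD(1)[OF f'(3)] yd_mem(1)[OF L m] by (simp add: compose_eq)
  fix F assume F: "bform (yd_space N) A F"
  have "tsum (yd_coact N (g (f m))) F = tsum (yd_coact L m) (\<lambda>m0 m1. F (g (f m0)) m1)"
    using f'(5)[OF m, of "\<lambda>a b. F (g a) b"] g'(5)[OF lhomD(1)[OF f'(3) m] F]
    by (simp add: bformI bform_left[OF F g'(3)] bform_right[OF F lhom_id] lhomD(1)[OF g'(3)])
  then show "tsum (yd_coact N (compose (carrier (yd_space L)) g f m)) F =
     tsum (yd_coact L m) (\<lambda>m0 m1. F (compose (carrier (yd_space L)) g f m0) m1)"
    using m yd_mem(3)[OF L m] by (simp add: compose_eq cong: tsum_cong)
qed (use yd_homsD(1)[OF f L M] yd_homsD(1)[OF g M N] in auto)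

text \<open>The laws for \<open>f\<close> are used at \<open>g n\<close>; applying \<open>g\<close>,
  or testing with a form composed with \<open>g\<close>, turns them into the laws for
  \<open>g\<close>.\<close>

lemma yd_hom_inverse:
  assumes f: "f \<in> yd_homs H M N" and M: "M \<in> yd_objects H" and N: "N \<in> yd_objects H"
    and g: "g \<in> lhom (yd_space N) (yd_space M)" "g \<in> extensional (carrier (yd_space N))"
    and gf: "\<And>m. m \<in> carrier (yd_space M) \<Longrightarrow> g (f m) = m" and fg: "\<And>n. n \<in> carrier (yd_space N) \<Longrightarrow> f (g n) = n"
  shows "g \<in> yd_homs H N M"
proof (rule yd_homsI[OF N M _ g(2,1)])
  note f' = yd_homsD[OF f M N]
  show "yd_index N = yd_index M" using f'(1) by simp
  fix n assume n: "n \<in> carrier (yd_space N)"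
  note gn = lhomD(1)[OF g(1) n]
  show "g (yd_act N h n) = yd_act M h (g n)" for h
    using f'(4)[OF gn, of h] fg[OF n] gf[OF yd_mem(1)[OF M gn]] by metis
  fix F assume F: "bform (yd_space M) A F"
  have "tsum (yd_coact N (f (g n))) (\<lambda>a b. F (g a) b) = tsum (yd_coact M (g n)) (\<lambda>a b. F (g (f a)) b)"
    by (rule f'(5)[OF gn]) (intro bformI bform_left[OF F g(1)] bform_right[OF F lhom_id] lhomD(1)[OF g(1)])
  also have "\<dots> = tsum (yd_coact M (g n)) F"
    by (intro tsum_congI) (simp add: gf yd_mem(3)[OF M gn])
  finally show "tsum (yd_coact M (g n)) F = tsum (yd_coact N n) (\<lambda>m0 m1. F (g m0) m1)"
    by (simp add: fg[OF n])
qed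

lemma yd_pairI: "M \<in> yd_objects H \<Longrightarrow> N \<in> yd_objects H \<Longrightarrow>
    yd_pair H M N (fst (yd_index M)) (snd (yd_index M)) (fst (yd_index N)) (snd (yd_index N))"
  by unfold_locales simp_all

lemma yd_twistI: "N \<in> yd_objects H \<Longrightarrow> b \<in> carrier (aut_group H) \<Longrightarrow>
    yd_twist H N (fst b) (snd b) (fst (yd_index N)) (snd (yd_index N))"
  by unfold_locales auto

lemma yd_tensor_in: "M \<in> yd_objects H \<Longrightarrow> N \<in> yd_objects H \<Longrightarrow> yd_tensor H M N \<in> yd_objects H"
  by (rule yd_pair.MN_in[OF yd_pairI])

lemma yd_phi_in: "N \<in> yd_objects H \<Longrightarrow> b \<in> carrier (aut_group H) \<Longrightarrow> yd_phi H b N \<in> yd_objects H"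
  using yd_twist.PN_in[OF yd_twistI, of N b] by simp

lemma yd_tensor_space: "yd_space (yd_tensor H M N) = tensor_space (yd_space M) (yd_space N)"
  and yd_tensor_index: "yd_index (yd_tensor H M N) = yd_index M \<otimes>\<^bsub>aut_group H\<^esub> yd_index N"
  by (simp_all add: yd_tensor_def Let_def split: prod.splits)

lemma yd_phi_space: "yd_space (yd_phi H b N) = yd_space N"
  and yd_phi_index: "yd_index (yd_phi H b N) = b \<otimes>\<^bsub>aut_group H\<^esub> yd_index N \<otimes>\<^bsub>aut_group H\<^esub> inv\<^bsub>aut_group H\<^esub> b"
  by (simp_all add: yd_phi_def Let_def split: prod.splits)

lemma yd_index_in: "M \<in> yd_objects H \<Longrightarrow> yd_index M \<in> carrier (aut_group H)"
  by (simp add: yd_objects_def)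

text \<open>Both laws are linear in the tensor, so they need only be verified on pure tensors, where
  they split into the laws for \<open>f\<close> and for \<open>g\<close>.\<close>

lemma yd_tensor_map_hom:
  assumes M: "M \<in> yd_objects H" and N: "N \<in> yd_objects H" and M': "M' \<in> yd_objects H" and N': "N' \<in> yd_objects H"
    and f: "f \<in> yd_homs H M M'" and g: "g \<in> yd_homs H N N'"
  shows "tensor_map (yd_space M) (yd_space N) (yd_space M') (yd_space N') f g \<in> yd_homs H (yd_tensor H M N) (yd_tensor H M' N')"
    (is "?t \<in> _")
proof -
  obtain \<alpha> \<beta> \<gamma> \<delta> where i: "yd_index M = (\<alpha>, \<beta>)" "yd_index N = (\<gamma>, \<delta>)" by (meson surj_pair)
  note f' = yd_homsD[OF f M M'] and g' = yd_homsD[OF g N N']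
  have i': "yd_index M' = (\<alpha>, \<beta>)" "yd_index N' = (\<gamma>, \<delta>)" using i f'(1) g'(1) by auto
  interpret P: yd_pair H M N \<alpha> \<beta> \<gamma> \<delta> using M N i by unfold_locales
  interpret P': yd_pair H M' N' \<alpha> \<beta> \<gamma> \<delta> using M' N' i' by unfold_locales
  note pure = tensor_map_pure[OF P.V P.W P'.V P'.W f'(3) g'(3)]
  note th = tensor_map_lhom[OF P.V P.W P'.V P'.W f'(3) g'(3)]
  note fm = lhomD(1)[OF f'(3)] and gm = lhomD(1)[OF g'(3)]
  show ?thesis
  proof (rule yd_homsI[OF P.MN_in P'.MN_in], unfold P.MN_simps(2) P'.MN_simps(2))
    show "yd_index (yd_tensor H M N) = yd_index (yd_tensor H M' N')"
      by (simp add: P.MN_simps(1) P'.MN_simps(1))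
    show "?t \<in> extensional (carrier P.T)" by (simp add: tensor_map_def)
    show "?t \<in> lhom P.T P'.T" by (rule th)
    fix x assume x: "x \<in> carrier P.T"
    show "?t (yd_act P.MN h x) = yd_act P'.MN h (?t x)" for h
    proof (rule lhom_ext2[OF P.V P.W is_vspace_vsp[OF P'.T] lhom_comp[OF th P.act_lhom(1)] lhom_comp[OF P'.act_lhom(1) th] _ x])
      fix m n assume mn: "m \<in> carrier P.V" "n \<in> carrier P.W"
      show "?t (yd_act P.MN h (utens P.V P.W [(m, n)])) = yd_act P'.MN h (?t (utens P.V P.W [(m, n)]))"
        unfolding pure[OF mn]
      proof (rule lform_eqI[OF is_vspace_vsp[OF P'.T]])
        fix k assume k: "lform P'.T k"
        show "k (?t (yd_act P.MN h (utens P.V P.W [(m, n)]))) = k (yd_act P'.MN h (utens P'.V P'.W [(f m, g n)]))"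
          unfolding P.act_lform_pure[OF lform_comp[OF k th] mn] P'.act_lform_pure[OF k fm[OF mn(1)] gm[OF mn(2)]]
          using mn by (simp add: pure P.mem f'(4) g'(4))
      qed (intro lhomD(1)[OF th] P.act_in P'.act_in utens_pure_in mn fm gm)+
    qed
    fix F assume F: "bform P'.T A F"
    have Ft: "bform P.T A (\<lambda>a b. F (?t a) b)"
      by (intro bformI bform_left[OF F th] bform_right[OF F lhom_id] lhomD(1)[OF th])
    show "tsum (yd_coact P'.MN (?t x)) F = tsum (yd_coact P.MN x) (\<lambda>m0 m1. F (?t m0) m1)"
    proof (rule lform_ext2[OF P.V P.W _ _ _ x])
      show "lform P.T (\<lambda>x. tsum (yd_coact P'.MN (?t x)) F)" "lform P.T (\<lambda>x. tsum (yd_coact P.MN x) (\<lambda>m0 m1. F (?t m0) m1))"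
        by (intro lform_tsum_left[OF lhom_comp[OF P'.coact_lhom th]] F P'.T is_vspace_vsp vsp_alg)
          (intro lform_tsum_left[OF P.coact_lhom] Ft P.T is_vspace_vsp vsp_alg)
      fix m n assume mn: "m \<in> carrier P.V" "n \<in> carrier P.W"
      note LF = P'.L bform_left[OF F] bform_right[OF F]
      have "tsum (yd_coact P'.MN (?t (utens P.V P.W [(m, n)]))) F =
        tsum (yd_coact M' (f m)) (\<lambda>m0 m1. tsum (yd_coact N' (g n)) (\<lambda>n0 n1. F (utens P'.V P'.W [(m0, n0)]) (n1 * m1)))"
        unfolding pure[OF mn] by (rule P'.coact_tsum_pure[OF F fm[OF mn(1)] gm[OF mn(2)]])
      also have "\<dots> = tsum (yd_coact M m) (\<lambda>m0 m1. tsum (yd_coact N' (g n)) (\<lambda>n0 n1. F (utens P'.V P'.W [(f m0, n0)]) (n1 * m1)))"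
        by (rule f'(5)[OF mn(1)]) (intro LF; (blast intro: P'.mem mn gm | simp))
      also have "\<dots> = tsum (yd_coact M m) (\<lambda>m0 m1. tsum (yd_coact N n) (\<lambda>n0 n1. F (utens P'.V P'.W [(f m0, g n0)]) (n1 * m1)))"
        by (intro tsum_congI g'(5)[OF mn(2)]) (intro LF; (blast intro: P'.mem P.mem mn fm | simp))
      also have "\<dots> = tsum (yd_coact P.MN (utens P.V P.W [(m, n)])) (\<lambda>m0 m1. F (?t m0) m1)"
        unfolding P.coact_tsum_pure[OF Ft mn] by (intro tsum_congI) (simp add: pure yd_mem(3)[OF M mn(1)] yd_mem(3)[OF N mn(2)])
      finally show "tsum (yd_coact P'.MN (?t (utens P.V P.W [(m, n)]))) F = \<dots>" .
    qed
  qed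
qed


text \<open>Between the two bracketings the actions differ by coassociativity of H and the coactions
  by associativity of its product.\<close>

lemma yd_assoc_hom:
  assumes L: "L \<in> yd_objects H" and M: "M \<in> yd_objects H" and N: "N \<in> yd_objects H"
  shows "assoc_map (yd_space L) (yd_space M) (yd_space N) \<in>
    yd_homs H (yd_tensor H (yd_tensor H L M) N) (yd_tensor H L (yd_tensor H M N))" (is "?a \<in> _")
proof -
  obtain \<alpha> \<beta> \<gamma> \<delta> \<epsilon> \<zeta> where i: "yd_index L = (\<alpha>, \<beta>)" "yd_index M = (\<gamma>, \<delta>)" "yd_index N = (\<epsilon>, \<zeta>)" by (meson surj_pair)
  interpret LM: yd_pair H L M \<alpha> \<beta> \<gamma> \<delta> using L M i by unfold_locales
  interpret MN: yd_pair H M N \<gamma> \<delta> \<epsilon> \<zeta> using M N i by unfold_locales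
  interpret P: yd_pair H "yd_tensor H L M" N "\<alpha> \<circ> \<gamma>" "\<delta> \<circ> LM.\<sigma>" \<epsilon> \<zeta>
    using LM.MN_in N i LM.MN_simps(1) by unfold_locales
  interpret Q: yd_pair H L "yd_tensor H M N" \<alpha> \<beta> "\<gamma> \<circ> \<epsilon>" "\<zeta> \<circ> MN.\<sigma>"
    using MN.MN_in L i MN.MN_simps(1) by unfold_locales
  let ?U = "yd_space L" and ?V = "yd_space M" and ?W = "yd_space N"
  note inv = autD(8,9)[OF MN.auts(3)] autD(8,9)[OF MN.auts(1)]
  \<comment> \<open>With either bracketing H acts on the three factors through the same
    automorphisms \<open>\<gamma>\<epsilon>\<close>, \<open>\<epsilon> Q.\<sigma>\<close> and
    \<open>MN.\<sigma> Q.\<sigma>\<close>.\<close>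
  have s1: "LM.\<sigma> (\<epsilon> x) = \<epsilon> (Q.\<sigma> x)" for x
    by (simp add: LM.\<sigma>_def Q.\<sigma>_def finv_comp[OF MN.auts(1,3)] inv)
  have s2: "P.\<sigma> x = MN.\<sigma> (Q.\<sigma> x)" for x
    unfolding P.\<sigma>_def by (simp add: LM.\<sigma>_def MN.\<sigma>_def Q.\<sigma>_def finv_comp[OF MN.auts(1,3)] inv)
  note S = LM.MN_simps(2) MN.MN_simps(2)
  note VS = LM.V LM.W MN.W
  note th = assoc_map_lhom[OF VS] and pure = assoc_map_pure[OF VS]
  note PT = P.T[unfolded S] and QT = Q.T[unfolded S]
  have PL: "yd_act P.MN h \<in> lhom (tensor_space LM.T ?W) (tensor_space LM.T ?W)" for h
    using P.act_lhom(1) unfolding S .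
  have QL: "yd_act Q.MN h \<in> lhom (tensor_space ?U MN.T) (tensor_space ?U MN.T)" for h
    using Q.act_lhom(1) unfolding S .
  show ?thesis
  proof (rule yd_homsI[OF P.MN_in Q.MN_in], unfold P.MN_simps(2) Q.MN_simps(2) S)
    show "yd_index P.MN = yd_index Q.MN"
      by (simp add: P.MN_simps(1) Q.MN_simps(1) fun_eq_iff s2)
    show "?a \<in> extensional (carrier (tensor_space LM.T ?W))" by (simp add: assoc_map_def)
    show "?a \<in> lhom (tensor_space LM.T ?W) (tensor_space ?U MN.T)" by (rule th)
    fix x assume x: "x \<in> carrier (tensor_space LM.T ?W)"
    show "?a (yd_act P.MN h x) = yd_act Q.MN h (?a x)" for h
    proof (rule lhom_ext3[OF VS is_vspace_vsp[OF QT] lhom_comp[OF th PL] lhom_comp[OF QL th] _ x])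
      fix l m n assume l: "l \<in> carrier ?U" and m: "m \<in> carrier ?V" and n: "n \<in> carrier ?W"
      have lm: "utens ?U ?V [(l, m)] \<in> carrier LM.T" and mn: "utens ?V ?W [(m, n)] \<in> carrier MN.T" using l m n by simp_all
      show "?a (yd_act P.MN h (utens LM.T ?W [(utens ?U ?V [(l, m)], n)])) =
        yd_act Q.MN h (?a (utens LM.T ?W [(utens ?U ?V [(l, m)], n)]))"
        unfolding pure[OF l m n]
      proof (rule lform_eqI[OF is_vspace_vsp[OF QT]])
        show "?a (yd_act P.MN h (utens LM.T ?W [(utens ?U ?V [(l, m)], n)])) \<in> carrier (tensor_space ?U MN.T)"
          by (intro lhomD(1)[OF th] lhomD(1)[OF PL] utens_pure_in lm n)
        show "yd_act Q.MN h (utens ?U MN.T [(l, utens ?V ?W [(m, n)])]) \<in> carrier (tensor_space ?U MN.T)"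
          by (intro lhomD(1)[OF QL] utens_pure_in mn l)
        fix k assume k: "lform (tensor_space ?U MN.T) k"
        let ?\<Phi> = "\<lambda>x y z. k (utens ?U MN.T [(yd_act L (\<gamma> (\<epsilon> x)) l, utens ?V ?W [(yd_act M (\<epsilon> (Q.\<sigma> y)) m, yd_act N (P.\<sigma> z) n)])])"
        note LF = LM.L MN.L lhom_comp[OF autD(2)[OF Q.auts(5)]] lhom_comp[OF autD(2)[OF P.auts(5)]] lform_comp[OF k]
          utens_bilinear[OF LM.V MN.T] utens_bilinear[OF LM.T MN.W]
        have "k (?a (yd_act P.MN h (utens LM.T ?W [(utens ?U ?V [(l, m)], n)]))) =
          tsum (comul H h) (\<lambda>h1 h2. k (?a (utens LM.T ?W [(yd_act LM.MN (\<epsilon> h1) (utens ?U ?V [(l, m)]), yd_act N (P.\<sigma> h2) n)])))"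
          using P.act_lform_pure[OF lform_comp[OF k[folded S] th[folded S]] lm[folded S] n, of h] unfolding S .
        also have "\<dots> = tsum (comul H h) (\<lambda>h1 h2. tsum (comul H h1) (\<lambda>a b. ?\<Phi> a b h2))"
        proof (rule tsum_congI)
          fix h1 h2
          have n': "yd_act N (P.\<sigma> h2) n \<in> carrier ?W" by (rule yd_mem(1)[OF N n])
          have "lform LM.T (\<lambda>t. k (?a (utens LM.T ?W [(t, yd_act N (P.\<sigma> h2) n)])))"
            by (intro LF lform_comp[OF lform_comp[OF k th]] n')
          from LM.act_lform_pure[OF this l m, of "\<epsilon> h1"]
          have "k (?a (utens LM.T ?W [(yd_act LM.MN (\<epsilon> h1) (utens ?U ?V [(l, m)]), yd_act N (P.\<sigma> h2) n)])) =
            tsum (comul H (\<epsilon> h1)) (\<lambda>a b. k (utens ?U MN.T [(yd_act L (\<gamma> a) l, utens ?V ?W [(yd_act M (LM.\<sigma> b) m, yd_act N (P.\<sigma> h2) n)])]))"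
            by (simp add: pure yd_mem(1)[OF L l] yd_mem(1)[OF M m] n')
          also have "\<dots> = tsum (comul H h1) (\<lambda>a b. k (utens ?U MN.T [(yd_act L (\<gamma> (\<epsilon> a)) l, utens ?V ?W [(yd_act M (LM.\<sigma> (\<epsilon> b)) m, yd_act N (P.\<sigma> h2) n)])]))"
            by (rule autD(5)[OF MN.auts(3)]) (intro LF; (blast intro: LM.mem MN.mem l m n | simp))
          finally show "k (?a (utens LM.T ?W [(yd_act LM.MN (\<epsilon> h1) (utens ?U ?V [(l, m)]), yd_act N (P.\<sigma> h2) n)])) =
            tsum (comul H h1) (\<lambda>a b. ?\<Phi> a b h2)" unfolding s1 .
        qed
        also have "\<dots> = tsum (comul H h) (\<lambda>h1 h2. tsum (comul H h2) (?\<Phi> h1))"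
          by (intro comul_coassoc LF; (blast intro: LM.mem MN.mem l m n | simp))
        also have "\<dots> = tsum (comul H h) (\<lambda>h1 h2. k (utens ?U MN.T [(yd_act L ((\<gamma> \<circ> \<epsilon>) h1) l, yd_act MN.MN (Q.\<sigma> h2) (utens ?V ?W [(m, n)]))]))"
        proof (rule tsum_congI)
          fix h1 h2
          have l': "yd_act L (\<gamma> (\<epsilon> h1)) l \<in> carrier ?U" by (rule yd_mem(1)[OF L l])
          have "lform MN.T (\<lambda>t. k (utens ?U MN.T [(yd_act L (\<gamma> (\<epsilon> h1)) l, t)]))"
            by (intro LF l')
          from MN.act_lform_pure[OF this m n, of "Q.\<sigma> h2"]
          have "k (utens ?U MN.T [(yd_act L (\<gamma> (\<epsilon> h1)) l, yd_act MN.MN (Q.\<sigma> h2) (utens ?V ?W [(m, n)]))]) =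
            tsum (comul H (Q.\<sigma> h2)) (\<lambda>a b. k (utens ?U MN.T [(yd_act L (\<gamma> (\<epsilon> h1)) l, utens ?V ?W [(yd_act M (\<epsilon> a) m, yd_act N (MN.\<sigma> b) n)])]))" .
          also have "\<dots> = tsum (comul H h2) (\<lambda>a b. k (utens ?U MN.T [(yd_act L (\<gamma> (\<epsilon> h1)) l, utens ?V ?W [(yd_act M (\<epsilon> (Q.\<sigma> a)) m, yd_act N (MN.\<sigma> (Q.\<sigma> b)) n)])]))"
            by (rule autD(5)[OF Q.auts(5)]) (intro LF; (blast intro: LM.mem MN.mem l m n | simp))
          finally show "tsum (comul H h2) (?\<Phi> h1) = k (utens ?U MN.T [(yd_act L ((\<gamma> \<circ> \<epsilon>) h1) l, yd_act MN.MN (Q.\<sigma> h2) (utens ?V ?W [(m, n)]))])"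
            unfolding s2 by simp
        qed
        also have "\<dots> = k (yd_act Q.MN h (utens ?U MN.T [(l, utens ?V ?W [(m, n)])]))"
          using Q.act_lform_pure[OF k[folded S] l mn[folded S], of h] unfolding S by simp
        finally show "k (?a (yd_act P.MN h (utens LM.T ?W [(utens ?U ?V [(l, m)], n)]))) =
          k (yd_act Q.MN h (utens ?U MN.T [(l, utens ?V ?W [(m, n)])]))" .
      qed
    qed
    fix F assume F: "bform (tensor_space ?U MN.T) A F"
    have Fa: "bform (tensor_space LM.T ?W) A (\<lambda>a b. F (?a a) b)"
      by (intro bformI bform_left[OF F th] bform_right[OF F lhom_id] lhomD(1)[OF th])
    note PC = P.coact_lhom[unfolded S] and QC = Q.coact_lhom[unfolded S]
    show "tsum (yd_coact Q.MN (?a x)) F = tsum (yd_coact P.MN x) (\<lambda>m0 m1. F (?a m0) m1)"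
    proof (rule lform_ext3[OF VS _ _ _ x])
      show "lform (tensor_space LM.T ?W) (\<lambda>x. tsum (yd_coact Q.MN (?a x)) F)"
        by (intro lform_tsum_left[OF lhom_comp[OF QC th]] F QT is_vspace_vsp vsp_alg)
      show "lform (tensor_space LM.T ?W) (\<lambda>x. tsum (yd_coact P.MN x) (\<lambda>m0 m1. F (?a m0) m1))"
        by (intro lform_tsum_left[OF PC] Fa PT is_vspace_vsp vsp_alg)
      fix l m n assume l: "l \<in> carrier ?U" and m: "m \<in> carrier ?V" and n: "n \<in> carrier ?W"
      have lm: "utens ?U ?V [(l, m)] \<in> carrier LM.T" and mn: "utens ?V ?W [(m, n)] \<in> carrier MN.T" using l m n by simp_all
      note LF = LM.L MN.L bform_left[OF F] bform_right[OF F] bform_left[OF Fa] bform_right[OF Fa]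
          utens_bilinear[OF LM.V MN.T] utens_bilinear[OF LM.T MN.W]
      let ?R = "tsum (yd_coact L l) (\<lambda>l0 l1. tsum (yd_coact M m) (\<lambda>m0 m1. tsum (yd_coact N n) (\<lambda>n0 n1.
        F (utens ?U MN.T [(l0, utens ?V ?W [(m0, n0)])]) (n1 * m1 * l1))))"
      have "tsum (yd_coact Q.MN (?a (utens LM.T ?W [(utens ?U ?V [(l, m)], n)]))) F =
        tsum (yd_coact L l) (\<lambda>l0 l1. tsum (yd_coact MN.MN (utens ?V ?W [(m, n)])) (\<lambda>t0 t1. F (utens ?U MN.T [(l0, t0)]) (t1 * l1)))"
        unfolding pure[OF l m n] using Q.coact_tsum_pure[OF F[folded S] l mn[folded S]] unfolding S .
      also have "\<dots> = ?R"
        by (rule tsum_congI, rule MN.coact_tsum_pure[OF _ m n]) (intro LF; (blast intro: LM.mem l | simp))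
      finally have 1: "tsum (yd_coact Q.MN (?a (utens LM.T ?W [(utens ?U ?V [(l, m)], n)]))) F = ?R" .
      have "tsum (yd_coact P.MN (utens LM.T ?W [(utens ?U ?V [(l, m)], n)])) (\<lambda>m0 m1. F (?a m0) m1) =
        tsum (yd_coact LM.MN (utens ?U ?V [(l, m)])) (\<lambda>t0 t1. tsum (yd_coact N n) (\<lambda>n0 n1. F (?a (utens LM.T ?W [(t0, n0)])) (n1 * t1)))"
        using P.coact_tsum_pure[OF Fa[folded S] lm[folded S] n] unfolding S .
      also have "\<dots> = tsum (yd_coact L l) (\<lambda>l0 l1. tsum (yd_coact M m) (\<lambda>m0 m1. tsum (yd_coact N n) (\<lambda>n0 n1.
          F (?a (utens LM.T ?W [(utens ?U ?V [(l0, m0)], n0)])) (n1 * (m1 * l1)))))"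
        by (rule LM.coact_tsum_pure[OF _ l m]) (intro LF; (blast intro: MN.mem n | simp))
      also have "\<dots> = ?R"
        by (intro tsum_congI) (simp add: pure yd_mem(3)[OF L l] yd_mem(3)[OF M m] yd_mem(3)[OF N n] mult.assoc)
      finally show "tsum (yd_coact Q.MN (?a (utens LM.T ?W [(utens ?U ?V [(l, m)], n)]))) F =
        tsum (yd_coact P.MN (utens LM.T ?W [(utens ?U ?V [(l, m)], n)])) (\<lambda>m0 m1. F (?a m0) m1)"
        using 1 by simp
    qed
  qed
qed

lemma yd_lunit_hom:
  fixes N :: "('k, 'h, 'a) yd_obj"
  assumes N: "N \<in> yd_objects H"
  shows "lunit_map (yd_space N) \<in> yd_homs H (yd_tensor H (yd_unit H) N) N"
proof -
  obtain \<gamma> \<delta> where i: "yd_index N = (\<gamma>, \<delta>)" by (meson surj_pair)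
  interpret P: yd_pair H "yd_unit H" N id id \<gamma> \<delta>
    using N i yd_unit_in yd_unit_simps(1) by unfold_locales
  note S = yd_unit_simps(2)
  let ?W = "yd_space N"
  have \<sigma>: "P.\<sigma> = id" using autD(8)[OF P.auts(3)] by (simp add: P.\<sigma>_def fun_eq_iff)
  note th = lunit_map_lhom[OF P.W] and pure = lunit_map_pure[OF P.W]
  have PL: "yd_act P.MN h \<in> lhom (tensor_space unit_space ?W) (tensor_space unit_space ?W)" for h
    using P.act_lhom(1) unfolding S .
  have purel: "f (lunit_map ?W (utens unit_space ?W [(s, n)])) = the_scalar s * f n"
    if "lform ?W f" "s \<in> carrier unit_space" "n \<in> carrier ?W" for f s n
    using that by (simp add: pure lformD(2)[OF that(1)] del: unit_space_simps)
  note ts = lform_comp[OF lform_the_scalar]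
  have u: "yd_act (yd_unit H) h s \<in> carrier unit_space" "the_scalar (yd_act (yd_unit H) h s) = counit H h * the_scalar s"
    if "s \<in> carrier unit_space" for h s
    using that by (auto simp: yd_unit_simps)
  show ?thesis
  proof (rule yd_homsI[OF P.MN_in N], unfold P.MN_simps(2) S)
    show "yd_index P.MN = yd_index N" by (simp add: P.MN_simps(1) i \<sigma>)
    show "lunit_map ?W \<in> extensional (carrier (tensor_space unit_space ?W))" by (simp add: lunit_map_def)
    show "lunit_map ?W \<in> lhom (tensor_space unit_space ?W) ?W" by (rule th)
    fix x assume x: "x \<in> carrier (tensor_space unit_space ?W)"
    show "lunit_map ?W (yd_act P.MN h x) = yd_act N h (lunit_map ?W x)" for h
    proof (rule lhom_ext2[OF is_vspace_unit_space P.W is_vspace_vsp[OF P.W] lhom_comp[OF th PL] lhom_comp[OF yd_objectsD(5)[OF N] th] _ x])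
      fix s :: "('k, 'a) vuniv" and n assume s: "s \<in> carrier unit_space" and n: "n \<in> carrier ?W"
      let ?x = "utens unit_space ?W [(s, n)]"
      have xin: "?x \<in> carrier (tensor_space unit_space ?W)" using s n by (rule utens_pure_in)
      show "lunit_map ?W (yd_act P.MN h ?x) = yd_act N h (lunit_map ?W ?x)"
      proof (rule lform_eqI[OF is_vspace_vsp[OF P.W]])
        fix f assume f: "lform ?W f"
        have "f (lunit_map ?W (yd_act P.MN h ?x)) =
          tsum (comul H h) (\<lambda>h1 h2. f (lunit_map ?W (utens unit_space ?W [(yd_act (yd_unit H) (\<gamma> h1) s, yd_act N h2 n)])))"
          using P.act_lform_pure[OF lform_comp[OF f th[folded S]] s[folded S] n, of h] unfolding S \<sigma> by simp
        also have "\<dots> = tsum (comul H h) (\<lambda>h1 h2. counit H h1 * (the_scalar s * f (yd_act N h2 n)))"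
          by (intro tsum_congI) (simp add: purel[OF f u(1)[OF s] yd_mem(1)[OF N n]] u(2)[OF s] autD(6)[OF P.auts(3)])
        also have "\<dots> = the_scalar s * f (yd_act N h n)"
          by (intro counit_left' P.L lform_comp[OF f] n)
        also have "\<dots> = f (yd_act N h (lunit_map ?W ?x))"
          by (rule purel[OF lform_comp[OF f yd_objectsD(5)[OF N]] s n, symmetric])
        finally show "f (lunit_map ?W (yd_act P.MN h ?x)) = f (yd_act N h (lunit_map ?W ?x))" .
      qed (intro lhomD(1)[OF th] lhomD(1)[OF PL] yd_mem(1)[OF N] xin)+
    qed
    fix F assume F: "bform ?W A F"
    have Fa: "bform (tensor_space unit_space ?W) A (\<lambda>a b. F (lunit_map ?W a) b)"
      by (intro bformI bform_left[OF F th] bform_right[OF F lhom_id] lhomD(1)[OF th])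
    show "tsum (yd_coact N (lunit_map ?W x)) F = tsum (yd_coact P.MN x) (\<lambda>m0 m1. F (lunit_map ?W m0) m1)"
    proof (rule lform_ext2[OF is_vspace_unit_space P.W _ _ _ x])
      show "lform (tensor_space unit_space ?W) (\<lambda>x. tsum (yd_coact N (lunit_map ?W x)) F)"
        by (intro yd_lin(3)[OF N] th F)
      show "lform (tensor_space unit_space ?W) (\<lambda>x. tsum (yd_coact P.MN x) (\<lambda>m0 m1. F (lunit_map ?W m0) m1))"
        by (intro lform_tsum_left[OF P.coact_lhom[unfolded S]] Fa is_vspace_vsp vsp_alg is_vspace_tensor_space is_vspace_unit_space P.W)
      fix s :: "('k, 'a) vuniv" and n assume s: "s \<in> carrier unit_space" and n: "n \<in> carrier ?W"
      let ?x = "utens unit_space ?W [(s, n)]"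
      have "tsum (yd_coact P.MN ?x) (\<lambda>m0 m1. F (lunit_map ?W m0) m1) =
        tsum (yd_coact (yd_unit H) s) (\<lambda>s0 s1. tsum (yd_coact N n) (\<lambda>n0 n1. F (lunit_map ?W (utens unit_space ?W [(s0, n0)])) (n1 * s1)))"
        using P.coact_tsum_pure[OF Fa[folded S] s[folded S] n] unfolding S .
      also have "\<dots> = tsum (yd_coact N n) (\<lambda>n0 n1. F (lunit_map ?W (utens unit_space ?W [(s, n0)])) (n1 * 1))"
        by (rule yd_unit_coact_tsum[OF _ s])
          (intro P.L bform_left[OF Fa] bform_right[OF Fa] utens_bilinear[OF is_vspace_unit_space P.W] utens_pure_in; (blast intro: P.mem n | simp))
      also have "\<dots> = tsum (yd_coact N n) (\<lambda>n0 n1. the_scalar s * F n0 n1)"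
        by (intro tsum_congI) (simp add: purel[OF bformD(1)[OF F] s] yd_mem(3)[OF N n])
      also have "\<dots> = tsum (yd_coact N (lunit_map ?W ?x)) F"
        unfolding tsum_mult_left by (rule purel[OF yd_lin(3)[OF N lhom_id F] s n, symmetric])
      finally show "tsum (yd_coact N (lunit_map ?W ?x)) F = tsum (yd_coact P.MN ?x) (\<lambda>m0 m1. F (lunit_map ?W m0) m1)" ..
    qed
  qed
qed

lemma yd_runit_hom:
  fixes M :: "('k, 'h, 'a) yd_obj"
  assumes M: "M \<in> yd_objects H"
  shows "runit_map (yd_space M) \<in> yd_homs H (yd_tensor H M (yd_unit H)) M"
proof -
  obtain \<alpha> \<beta> where i: "yd_index M = (\<alpha>, \<beta>)" by (meson surj_pair)
  interpret P: yd_pair H M "yd_unit H" \<alpha> \<beta> id id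
    using M i yd_unit_in yd_unit_simps(1) by unfold_locales
  note S = yd_unit_simps(2)
  let ?V = "yd_space M"
  \<comment> \<open>On this side H acts on the unit through \<beta>, which has no effect because
    automorphisms preserve the counit.\<close>
  have \<sigma>: "P.\<sigma> = \<beta>" by (simp add: P.\<sigma>_def fun_eq_iff)
  note th = runit_map_lhom[OF P.V] and pure = runit_map_pure[OF P.V]
  have PL: "yd_act P.MN h \<in> lhom (tensor_space ?V unit_space) (tensor_space ?V unit_space)" for h
    using P.act_lhom(1) unfolding S .
  have purel: "f (runit_map ?V (utens ?V unit_space [(n, s)])) = the_scalar s * f n"
    if "lform ?V f" "s \<in> carrier unit_space" "n \<in> carrier ?V" for f s n
    using that by (simp add: pure lformD(2)[OF that(1)] del: unit_space_simps)
  have u: "yd_act (yd_unit H) h s \<in> carrier unit_space" "the_scalar (yd_act (yd_unit H) h s) = counit H h * the_scalar s"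
    if "s \<in> carrier unit_space" for h s
    using that by (auto simp: yd_unit_simps)
  show ?thesis
  proof (rule yd_homsI[OF P.MN_in M], unfold P.MN_simps(2) S)
    show "yd_index P.MN = yd_index M" by (simp add: P.MN_simps(1) i \<sigma>)
    show "runit_map ?V \<in> extensional (carrier (tensor_space ?V unit_space))" by (simp add: runit_map_def)
    show "runit_map ?V \<in> lhom (tensor_space ?V unit_space) ?V" by (rule th)
    fix x assume x: "x \<in> carrier (tensor_space ?V unit_space)"
    show "runit_map ?V (yd_act P.MN h x) = yd_act M h (runit_map ?V x)" for h
    proof (rule lhom_ext2[OF P.V is_vspace_unit_space is_vspace_vsp[OF P.V] lhom_comp[OF th PL] lhom_comp[OF yd_objectsD(5)[OF M] th] _ x])
      fix n and s :: "('k, 'a) vuniv" assume s: "s \<in> carrier unit_space" and n: "n \<in> carrier ?V"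
      let ?x = "utens ?V unit_space [(n, s)]"
      have xin: "?x \<in> carrier (tensor_space ?V unit_space)" using n s by (rule utens_pure_in)
      show "runit_map ?V (yd_act P.MN h ?x) = yd_act M h (runit_map ?V ?x)"
      proof (rule lform_eqI[OF is_vspace_vsp[OF P.V]])
        fix f assume f: "lform ?V f"
        have "f (runit_map ?V (yd_act P.MN h ?x)) =
          tsum (comul H h) (\<lambda>h1 h2. f (runit_map ?V (utens ?V unit_space [(yd_act M h1 n, yd_act (yd_unit H) (\<beta> h2) s)])))"
          using P.act_lform_pure[OF lform_comp[OF f th[folded S]] n s[folded S], of h] unfolding S \<sigma> by simp
        also have "\<dots> = tsum (comul H h) (\<lambda>h1 h2. counit H h2 * (the_scalar s * f (yd_act M h1 n)))"
          by (intro tsum_congI) (simp add: purel[OF f u(1)[OF s] yd_mem(1)[OF M n]] u(2)[OF s] autD(6)[OF P.auts(2)])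
        also have "\<dots> = the_scalar s * f (yd_act M h n)"
          by (intro counit_right' P.L lform_comp[OF f] n)
        also have "\<dots> = f (yd_act M h (runit_map ?V ?x))"
          by (rule purel[OF lform_comp[OF f yd_objectsD(5)[OF M]] s n, symmetric])
        finally show "f (runit_map ?V (yd_act P.MN h ?x)) = f (yd_act M h (runit_map ?V ?x))" .
      qed (intro lhomD(1)[OF th] lhomD(1)[OF PL] yd_mem(1)[OF M] xin)+
    qed
    fix F assume F: "bform ?V A F"
    have Fa: "bform (tensor_space ?V unit_space) A (\<lambda>a b. F (runit_map ?V a) b)"
      by (intro bformI bform_left[OF F th] bform_right[OF F lhom_id] lhomD(1)[OF th])
    show "tsum (yd_coact M (runit_map ?V x)) F = tsum (yd_coact P.MN x) (\<lambda>m0 m1. F (runit_map ?V m0) m1)"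
    proof (rule lform_ext2[OF P.V is_vspace_unit_space _ _ _ x])
      show "lform (tensor_space ?V unit_space) (\<lambda>x. tsum (yd_coact M (runit_map ?V x)) F)"
        by (intro yd_lin(3)[OF M] th F)
      show "lform (tensor_space ?V unit_space) (\<lambda>x. tsum (yd_coact P.MN x) (\<lambda>m0 m1. F (runit_map ?V m0) m1))"
        by (intro lform_tsum_left[OF P.coact_lhom[unfolded S]] Fa is_vspace_vsp vsp_alg is_vspace_tensor_space is_vspace_unit_space P.V)
      fix n and s :: "('k, 'a) vuniv" assume s: "s \<in> carrier unit_space" and n: "n \<in> carrier ?V"
      let ?x = "utens ?V unit_space [(n, s)]"
      have "tsum (yd_coact P.MN ?x) (\<lambda>m0 m1. F (runit_map ?V m0) m1) =
        tsum (yd_coact M n) (\<lambda>n0 n1. tsum (yd_coact (yd_unit H) s) (\<lambda>s0 s1. F (runit_map ?V (utens ?V unit_space [(n0, s0)])) (s1 * n1)))"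
        using P.coact_tsum_pure[OF Fa[folded S] n s[folded S]] unfolding S .
      also have "\<dots> = tsum (yd_coact M n) (\<lambda>n0 n1. F (runit_map ?V (utens ?V unit_space [(n0, s)])) (1 * n1))"
        by (intro tsum_congI yd_unit_coact_tsum[OF _ s])
          (intro P.L bform_left[OF Fa] bform_right[OF Fa] utens_bilinear[OF P.V is_vspace_unit_space] utens_pure_in; (blast intro: P.mem n | simp))
      also have "\<dots> = tsum (yd_coact M n) (\<lambda>n0 n1. the_scalar s * F n0 n1)"
        by (intro tsum_congI) (simp add: purel[OF bformD(1)[OF F] s] yd_mem(3)[OF M n])
      also have "\<dots> = tsum (yd_coact M (runit_map ?V ?x)) F"
        unfolding tsum_mult_left by (rule purel[OF yd_lin(3)[OF M lhom_id F] s n, symmetric])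
      finally show "tsum (yd_coact M (runit_map ?V ?x)) F = tsum (yd_coact P.MN ?x) (\<lambda>m0 m1. F (runit_map ?V m0) m1)" ..
    qed
  qed
qed


section \<open>Conjugation as an action of the group by strict monoidal functors\<close>

lemma yd_phi_comp:
  assumes N: "N \<in> yd_objects H" and a: "a \<in> carrier (aut_group H)" and b: "b \<in> carrier (aut_group H)"
  shows "yd_phi H (a \<otimes>\<^bsub>aut_group H\<^esub> b) N = yd_phi H a (yd_phi H b N)"
proof -
  interpret G: group "aut_group H" by (rule group_aut_group)
  obtain \<alpha> \<beta> \<alpha>' \<beta>' \<gamma> \<delta> where i: "a = (\<alpha>, \<beta>)" "b = (\<alpha>', \<beta>')" "yd_index N = (\<gamma>, \<delta>)" by (meson surj_pair)
  have auts: "\<alpha> \<in> hopf_aut H" "\<beta> \<in> hopf_aut H" "\<alpha>' \<in> hopf_aut H" "\<beta>' \<in> hopf_aut H" using a b i by auto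
  interpret B: yd_twist H N \<alpha>' \<beta>' \<gamma> \<delta> using N i auts by unfold_locales
  note ab = auts B.auts
  interpret A: yd_twist H "yd_phi H b N" \<alpha> \<beta> "\<alpha>' \<circ> \<gamma> \<circ> finv \<alpha>'" "B.\<kappa> \<circ> \<delta> \<circ> B.\<tau>"
    using B.PN_in B.PN_simps(1) i auts by unfold_locales auto
  interpret C: yd_twist H N "\<alpha> \<circ> \<alpha>'" "\<beta>' \<circ> finv \<alpha>' \<circ> \<beta> \<circ> \<alpha>'" \<gamma> \<delta>
    using N i auts by unfold_locales (auto intro: aut_comp aut_finv)
  note inv = autD(8,9)[OF auts(1)] autD(8,9)[OF auts(2)] autD(8,9)[OF auts(3)] autD(8,9)[OF auts(4)] autD(8,9)[OF B.auts(1)]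
  \<comment> \<open>The outer twist is formed with the already conjugated index
    \<open>\<alpha>'\<gamma>\<alpha>'^{-1}\<close>; this is what makes the twists compose. Those of
    the action and those of the coaction compose in opposite orders.\<close>
  have \<tau>: "C.\<tau> x = B.\<tau> (A.\<tau> x)" and \<kappa>: "C.\<kappa> x = A.\<kappa> (B.\<kappa> x)" for x
    unfolding A.\<tau>_def C.\<tau>_def B.\<tau>_def A.\<kappa>_def B.\<kappa>_def C.\<kappa>_def
    by (simp_all add: finv_comp finv_finv ab aut_comp aut_finv inv)
  note S = B.PN_simps(2)[folded i]
  show ?thesis
  proof (rule yd_obj_eqI)
    show "yd_phi H (a \<otimes>\<^bsub>aut_group H\<^esub> b) N \<in> yd_objects H" "yd_phi H a (yd_phi H b N) \<in> yd_objects H"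
      using N a b by (auto intro!: yd_phi_in simp del: aut_group_simps carrier_aut_group)
    show "yd_index (yd_phi H (a \<otimes>\<^bsub>aut_group H\<^esub> b) N) = yd_index (yd_phi H a (yd_phi H b N))"
      unfolding yd_phi_index using a b yd_index_in[OF N]
      by (simp add: G.m_assoc G.inv_mult_group del: aut_group_simps carrier_aut_group)
    show "yd_space (yd_phi H (a \<otimes>\<^bsub>aut_group H\<^esub> b) N) = yd_space (yd_phi H a (yd_phi H b N))"
      by (simp add: yd_phi_space)
    fix m assume "m \<in> carrier (yd_space (yd_phi H (a \<otimes>\<^bsub>aut_group H\<^esub> b) N))"
    then have m: "m \<in> carrier B.W" by (simp add: yd_phi_space)
    then have m': "m \<in> carrier A.W" by (simp add: yd_phi_space)
    show "yd_act (yd_phi H (a \<otimes>\<^bsub>aut_group H\<^esub> b) N) h m = yd_act (yd_phi H a (yd_phi H b N)) h m" for h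
      using C.act_eq[OF m] A.act_eq[OF m'] B.act_eq[OF m] by (simp add: i \<tau>)
    fix F assume "bform (yd_space (yd_phi H (a \<otimes>\<^bsub>aut_group H\<^esub> b) N)) A F"
    then have F: "bform B.W A F" by (simp add: yd_phi_space)
    then have F': "bform A.W A F" by (simp add: yd_phi_space)
    have F2: "bform B.W A (\<lambda>x y. F x (A.\<kappa> y))"
      by (intro A.L B.L bform_left[OF F] bform_right[OF F]; simp)
    show "tsum (yd_coact (yd_phi H (a \<otimes>\<^bsub>aut_group H\<^esub> b) N) m) F = tsum (yd_coact (yd_phi H a (yd_phi H b N)) m) F"
      using C.coact_tsum[OF F m] A.coact_tsum[OF F' m'] B.coact_tsum[OF F2 m] by (simp add: i \<kappa>)
  qed
qed

lemma yd_phi_one: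
  assumes N: "N \<in> yd_objects H"
  shows "yd_phi H \<one>\<^bsub>aut_group H\<^esub> N = N"
proof -
  interpret G: group "aut_group H" by (rule group_aut_group)
  obtain \<gamma> \<delta> where i: "yd_index N = (\<gamma>, \<delta>)" by (meson surj_pair)
  interpret P: yd_twist H N id id \<gamma> \<delta> using N i aut_id by unfold_locales
  have \<tau>: "P.\<tau> = id" and \<kappa>: "P.\<kappa> = id"
    using autD(8)[OF P.auts(1)] by (simp_all add: P.\<tau>_def P.\<kappa>_def fun_eq_iff)
  have e: "yd_phi H \<one>\<^bsub>aut_group H\<^esub> N = P.PN" by simp
  show ?thesis unfolding e
  proof (rule yd_obj_eqI[OF P.PN_in N])
    show "yd_index P.PN = yd_index N" by (simp add: P.PN_simps(1) i \<tau> \<kappa>)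
    fix m assume "m \<in> carrier (yd_space P.PN)"
    then have m: "m \<in> carrier P.W" by (simp add: yd_phi_space)
    show "yd_act P.PN h m = yd_act N h m" for h using P.act_eq[OF m] by (simp add: \<tau>)
    show "tsum (yd_coact P.PN m) F = tsum (yd_coact N m) F" if "bform (yd_space P.PN) A F" for F
      using P.coact_tsum[OF that[unfolded yd_phi_space] m] by (simp add: \<kappa>)
  qed (simp add: yd_phi_space)
qed

lemma yd_phi_unit:
  assumes b: "b \<in> carrier (aut_group H)"
  shows "yd_phi H b (yd_unit H) = (yd_unit H :: ('k, 'h, 'a) yd_obj)"
proof -
  interpret G: group "aut_group H" by (rule group_aut_group)
  obtain \<alpha> \<beta> where i: "b = (\<alpha>, \<beta>)" by (meson surj_pair)
  have ab: "\<alpha> \<in> hopf_aut H" "\<beta> \<in> hopf_aut H" using b i by auto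
  interpret P: yd_twist H "yd_unit H :: ('k, 'h, 'a) yd_obj" \<alpha> \<beta> id id
    using ab yd_unit_in yd_unit_simps(1) by unfold_locales
  note S = yd_unit_simps(2)
  show ?thesis unfolding i
  proof (rule yd_obj_eqI[OF P.PN_in yd_unit_in])
    show "yd_index P.PN = yd_index (yd_unit H :: ('k, 'h, 'a) yd_obj)"
      using b G.r_inv[of b] G.r_one[of b] unfolding yd_phi_index yd_unit_simps(1) i aut_group_simps(2)[symmetric]
      by metis
    fix m assume m: "m \<in> carrier (yd_space P.PN)"
    then have m: "m \<in> carrier P.W" and m': "m \<in> carrier unit_space" by (simp_all only: yd_phi_space S)
    show "yd_act P.PN h m = yd_act (yd_unit H) h m" for h
      using P.act_eq[OF m] m' by (simp add: yd_unit_simps autD(6)[OF P.auts(3)])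
    fix F assume "bform (yd_space P.PN) A F"
    then have F: "bform P.W A F" and F': "bform unit_space A F" by (simp_all only: yd_phi_space S)
    have "bform unit_space A (\<lambda>x y. F x (P.\<kappa> y))"
      by (intro P.L bform_left[OF F'] bform_right[OF F']; simp)
    from yd_unit_coact_tsum[OF F' m'] yd_unit_coact_tsum[OF this m']
    show "tsum (yd_coact P.PN m) F = tsum (yd_coact (yd_unit H) m) F"
      using P.coact_tsum[OF F m] by (simp add: autD(4)[OF P.auts(4)])
  qed (simp add: yd_phi_space)
qed

lemma yd_phi_tensor:
  assumes M: "M \<in> yd_objects H" and N: "N \<in> yd_objects H" and b: "b \<in> carrier (aut_group H)"
  shows "yd_phi H b (yd_tensor H M N) = yd_tensor H (yd_phi H b M) (yd_phi H b N)"
proof -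
  interpret G: group "aut_group H" by (rule group_aut_group)
  obtain \<alpha> \<beta> \<gamma> \<delta> \<epsilon> \<zeta> where i: "b = (\<alpha>, \<beta>)" "yd_index M = (\<gamma>, \<delta>)" "yd_index N = (\<epsilon>, \<zeta>)" by (meson surj_pair)
  have auts: "\<alpha> \<in> hopf_aut H" "\<beta> \<in> hopf_aut H" using b i by auto
  interpret MN: yd_pair H M N \<gamma> \<delta> \<epsilon> \<zeta> using M N i by unfold_locales
  interpret P: yd_twist H "yd_tensor H M N" \<alpha> \<beta> "\<gamma> \<circ> \<epsilon>" "\<zeta> \<circ> MN.\<sigma>"
    using MN.MN_in MN.MN_simps(1) auts by unfold_locales
  interpret PM: yd_twist H M \<alpha> \<beta> \<gamma> \<delta> using M i auts by unfold_locales
  interpret PN: yd_twist H N \<alpha> \<beta> \<epsilon> \<zeta> using N i auts by unfold_locales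
  interpret Q: yd_pair H PM.PN PN.PN "\<alpha> \<circ> \<gamma> \<circ> finv \<alpha>" "PM.\<kappa> \<circ> \<delta> \<circ> PM.\<tau>" "\<alpha> \<circ> \<epsilon> \<circ> finv \<alpha>" "PN.\<kappa> \<circ> \<zeta> \<circ> PN.\<tau>"
    using PM.PN_in PN.PN_in PM.PN_simps(1) PN.PN_simps(1) by unfold_locales
  note ab = auts MN.auts
  note inv = autD(8,9)[OF auts(1)] autD(8,9)[OF auts(2)] autD(8,9)[OF MN.auts(1)] autD(8,9)[OF MN.auts(2)] autD(8,9)[OF MN.auts(3)]
  \<comment> \<open>Twisting the action on the tensor product and then splitting it, or splitting
    first and twisting on each factor, sends the two parts of \<open>h\<close> through the same
    automorphisms.\<close>
  have a1: "\<epsilon> (P.\<tau> x) = PM.\<tau> ((\<alpha> \<circ> \<epsilon> \<circ> finv \<alpha>) x)" for x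
    unfolding P.\<tau>_def PM.\<tau>_def by (simp add: finv_comp ab aut_comp aut_finv inv)
  have a2: "MN.\<sigma> (P.\<tau> x) = PN.\<tau> (Q.\<sigma> x)" for x
    unfolding MN.\<sigma>_def P.\<tau>_def PN.\<tau>_def Q.\<sigma>_def unfolding PM.\<tau>_def PM.\<kappa>_def
    by (simp add: finv_comp finv_finv ab aut_comp aut_finv inv)
  have T: "Q.T = MN.T" by (simp add: yd_phi_space)
  show ?thesis unfolding i(1)
  proof (rule yd_obj_eqI[OF P.PN_in Q.MN_in])
    show "yd_index P.PN = yd_index Q.MN"
    proof -
      have conj: "c \<otimes>\<^bsub>aut_group H\<^esub> (x \<otimes>\<^bsub>aut_group H\<^esub> y) \<otimes>\<^bsub>aut_group H\<^esub> inv\<^bsub>aut_group H\<^esub> c =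
        (c \<otimes>\<^bsub>aut_group H\<^esub> x \<otimes>\<^bsub>aut_group H\<^esub> inv\<^bsub>aut_group H\<^esub> c) \<otimes>\<^bsub>aut_group H\<^esub> (c \<otimes>\<^bsub>aut_group H\<^esub> y \<otimes>\<^bsub>aut_group H\<^esub> inv\<^bsub>aut_group H\<^esub> c)"
        if "c \<in> carrier (aut_group H)" "x \<in> carrier (aut_group H)" "y \<in> carrier (aut_group H)" for c x y
      proof -
        have "inv\<^bsub>aut_group H\<^esub> c \<otimes>\<^bsub>aut_group H\<^esub> (c \<otimes>\<^bsub>aut_group H\<^esub> (y \<otimes>\<^bsub>aut_group H\<^esub> inv\<^bsub>aut_group H\<^esub> c)) = y \<otimes>\<^bsub>aut_group H\<^esub> inv\<^bsub>aut_group H\<^esub> c"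
          using that by (simp add: G.m_assoc[symmetric] del: aut_group_simps carrier_aut_group)
        then show ?thesis using that by (simp add: G.m_assoc del: aut_group_simps carrier_aut_group)
      qed
      show ?thesis
        unfolding yd_phi_index yd_tensor_index by (rule conj) (use b i(1) yd_index_in[OF M] yd_index_in[OF N] in simp_all)
    qed
    fix x assume "x \<in> carrier (yd_space P.PN)"
    then have x: "x \<in> carrier MN.T" and x1: "x \<in> carrier P.W" and x2: "x \<in> carrier Q.T"
      by (simp_all add: yd_phi_space yd_tensor_space)
    show "yd_act P.PN h x = yd_act Q.MN h x" for h
      unfolding P.act_eq[OF x1]
    proof (rule tensor_space_eqI[OF MN.V MN.W MN.act_in[OF x] Q.act_in[OF x2, unfolded T]])
      fix F assume F: "bform MN.V MN.W F"
      then have F': "bform Q.V Q.W F" by (simp add: yd_phi_space)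
      have "tsum (summands (yd_act MN.MN (P.\<tau> h) x)) F =
        tsum (summands x) (\<lambda>m n. tsum (comul H (P.\<tau> h)) (\<lambda>h1 h2. F (yd_act M (\<epsilon> h1) m) (yd_act N (MN.\<sigma> h2) n)))"
        by (rule MN.act_tsum[OF F x])
      also have "\<dots> = tsum (summands x) (\<lambda>m n. tsum (comul H h) (\<lambda>h1 h2. F (yd_act M (\<epsilon> (P.\<tau> h1)) m) (yd_act N (MN.\<sigma> (P.\<tau> h2)) n)))"
        by (rule tsum_congI, rule autD(5)[OF P.auts(3)])
          (intro MN.L bform_left[OF F] bform_right[OF F]; (blast intro: MN.mem x | simp))
      also have "\<dots> = tsum (summands x) (\<lambda>m n. tsum (comul H h) (\<lambda>h1 h2. F (yd_act PM.PN ((\<alpha> \<circ> \<epsilon> \<circ> finv \<alpha>) h1) m) (yd_act PN.PN (Q.\<sigma> h2) n)))"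
        unfolding a1 a2 by (intro tsum_congI) (simp only: PM.act_eq[OF summands_memD(1)[OF MN.V MN.W x]] PN.act_eq[OF summands_memD(2)[OF MN.V MN.W x]])
      also have "\<dots> = tsum (summands (yd_act Q.MN h x)) F"
        by (rule Q.act_tsum[OF F' x2, symmetric])
      finally show "tsum (summands (yd_act MN.MN (P.\<tau> h) x)) F = tsum (summands (yd_act Q.MN h x)) F" .
    qed
    fix F assume "bform (yd_space P.PN) A F"
    then have F: "bform MN.T A F" and F1: "bform P.W A F" and F2: "bform Q.T A F"
      by (simp_all add: yd_phi_space yd_tensor_space)
    \<comment> \<open>The twist of the coaction depends on the conjugating pair alone and not on the
      object, so a single algebra map is applied to the product of \<open>n1\<close> and
      \<open>m1\<close>.\<close>
    have \<kappa>: "P.\<kappa> = PM.\<kappa>" "PN.\<kappa> = PM.\<kappa>" by (simp_all only: P.\<kappa>_def PM.\<kappa>_def PN.\<kappa>_def)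
    note LF = MN.L PM.L bform_left[OF F] bform_right[OF F]
    have F\<kappa>: "bform MN.T A (\<lambda>x y. F x (PM.\<kappa> y))" by (intro LF; simp)
    have "tsum (yd_coact P.PN x) F = tsum (yd_coact MN.MN x) (\<lambda>x y. F x (PM.\<kappa> y))"
      using P.coact_tsum[OF F1 x1] unfolding P.\<kappa>_def PM.\<kappa>_def .
    also have "\<dots> = tsum (summands x) (\<lambda>m n. tsum (yd_coact M m) (\<lambda>m0 m1. tsum (yd_coact N n) (\<lambda>n0 n1.
        F (utens MN.V MN.W [(m0, n0)]) (PM.\<kappa> n1 * PM.\<kappa> m1))))"
      using MN.coact_tsum[OF F\<kappa> x] unfolding autD(3)[OF PM.auts(4)] .
    also have "\<dots> = tsum (summands x) (\<lambda>m n. tsum (yd_coact M m) (\<lambda>m0 m1. tsum (yd_coact PN.PN n) (\<lambda>n0 n1.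
        F (utens MN.V MN.W [(m0, n0)]) (n1 * PM.\<kappa> m1))))"
    proof (intro tsum_congI)
      fix m n m0 m1 assume mn: "(m, n) \<in> set (summands x)" "(m0, m1) \<in> set (yd_coact M m)"
      have n: "n \<in> carrier MN.W" and m0: "m0 \<in> carrier MN.V" using mn by (blast intro: MN.mem x)+
      have "bform MN.W A (\<lambda>n0 n1. F (utens MN.V MN.W [(m0, n0)]) (n1 * PM.\<kappa> m1))"
        by (intro LF; (blast intro: m0 MN.mem | simp))
      from PN.coact_tsum[OF this n]
      show "tsum (yd_coact N n) (\<lambda>n0 n1. F (utens MN.V MN.W [(m0, n0)]) (PM.\<kappa> n1 * PM.\<kappa> m1)) =
        tsum (yd_coact PN.PN n) (\<lambda>n0 n1. F (utens MN.V MN.W [(m0, n0)]) (n1 * PM.\<kappa> m1))"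
        unfolding PN.\<kappa>_def PM.\<kappa>_def by (rule HOL.sym)
    qed
    also have "\<dots> = tsum (summands x) (\<lambda>m n. tsum (yd_coact PM.PN m) (\<lambda>m0 m1. tsum (yd_coact PN.PN n) (\<lambda>n0 n1.
        F (utens MN.V MN.W [(m0, n0)]) (n1 * m1))))"
    proof (rule tsum_congI, rule PM.coact_tsum[symmetric])
      fix m n assume mn: "(m, n) \<in> set (summands x)"
      show "m \<in> carrier PM.W" using mn by (blast intro: MN.mem x)
      have n: "n \<in> carrier MN.W" using mn by (blast intro: MN.mem x)
      have "n0 \<in> carrier MN.W" if "(n0, n1) \<in> set (yd_coact PN.PN n)" for n0 n1
        using yd_mem(3)[OF PN.PN_in _ that] n by (simp add: yd_phi_space)
      then show "bform PM.W A (\<lambda>m0 m1. tsum (yd_coact PN.PN n) (\<lambda>n0 n1. F (utens MN.V MN.W [(m0, n0)]) (n1 * m1)))"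
        by (intro LF; (blast intro: MN.mem | simp))
    qed
    also have "\<dots> = tsum (yd_coact Q.MN x) F"
      using Q.coact_tsum[OF F2 x2, symmetric] by (simp only: yd_phi_space)
    finally show "tsum (yd_coact P.PN x) F = tsum (yd_coact Q.MN x) F" .
  qed (simp add: yd_phi_space yd_tensor_space)
qed

lemma yd_phi_hom:
  assumes f: "f \<in> yd_homs H M N" and M: "M \<in> yd_objects H" and N: "N \<in> yd_objects H" and b: "b \<in> carrier (aut_group H)"
  shows "f \<in> yd_homs H (yd_phi H b M) (yd_phi H b N)"
proof -
  note f' = yd_homsD[OF f M N]
  obtain \<alpha> \<beta> \<gamma> \<delta> where i: "b = (\<alpha>, \<beta>)" "yd_index M = (\<gamma>, \<delta>)" by (meson surj_pair)
  then have i': "yd_index N = (\<gamma>, \<delta>)" using f'(1) by simp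
  have auts: "\<alpha> \<in> hopf_aut H" "\<beta> \<in> hopf_aut H" using b i by auto
  interpret PM: yd_twist H M \<alpha> \<beta> \<gamma> \<delta> using M i auts by unfold_locales
  interpret PN: yd_twist H N \<alpha> \<beta> \<gamma> \<delta> using N i' auts by unfold_locales
  show ?thesis unfolding i(1)
  proof (rule yd_homsI[OF PM.PN_in PN.PN_in], unfold PM.PN_simps(2) PN.PN_simps(2))
    show "yd_index PM.PN = yd_index PN.PN" by (simp add: yd_phi_index f'(1))
    fix m assume m: "m \<in> carrier PM.W"
    note fm = lhomD(1)[OF f'(3) m]
    show "f (yd_act PM.PN h m) = yd_act PN.PN h (f m)" for h
      using f'(4)[OF m] by (simp add: PM.act_eq[OF m] PN.act_eq[OF fm])
    fix F assume F: "bform PN.W A F"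
    note LF = PN.L bform_left[OF F] bform_right[OF F] bform_left[OF F f'(3)]
    have F1: "bform PN.W A (\<lambda>x y. F x (PN.\<kappa> y))" by (intro LF; simp)
    have F2: "bform PM.W A (\<lambda>x y. F (f x) y)" by (intro LF lhomD(1)[OF f'(3)]; simp)
    show "tsum (yd_coact PN.PN (f m)) F = tsum (yd_coact PM.PN m) (\<lambda>m0 m1. F (f m0) m1)"
      unfolding PN.coact_tsum[OF F fm] PM.coact_tsum[OF F2 m] f'(5)[OF m F1] ..
  qed (use f' in auto)
qed

end

section \<open>The braiding and its inverse\<close>

context yd_pair
begin

abbreviation "PN \<equiv> yd_phi H (\<alpha>, \<beta>) N"
abbreviation "T' \<equiv> tensor_space W V"
abbreviation "c \<equiv> yd_braid H M N"

lemma \<beta>': "finv \<beta> \<in> hopf_aut H"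
  by (rule aut_finv[OF auts(2)])

lemmas LB = L lhom_comp[OF autD(2)[OF \<beta>']] utens_bilinear[OF W V]

lemma braid_eq: "c = (\<lambda>x\<in>carrier T. utens W V [(n0, yd_act M (finv \<beta> n1) m). (m, n) \<leftarrow> summands x, (n0, n1) \<leftarrow> yd_coact N n])"
  by (simp add: yd_braid_def iM)

lemma braid_evaluates: "evaluates V W T' c (\<lambda>f m n. tsum (yd_coact N n) (\<lambda>n0 n1. f (utens W V [(n0, yd_act M (finv \<beta> n1) m)])))"
proof (rule evaluatesI)
  have wf: "set [(n0, yd_act M (finv \<beta> n1) m). (m, n) \<leftarrow> summands x, (n0, n1) \<leftarrow> yd_coact N n] \<subseteq> carrier W \<times> carrier V"
    if "x \<in> carrier T" for x
    by (intro wf_intros; blast intro: mem that)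
  then show "c x \<in> carrier T'" if "x \<in> carrier T" for x
    using that by (simp add: braid_eq utens_in)
  fix f assume f: "lform T' f"
  show "bform V W (\<lambda>m n. tsum (yd_coact N n) (\<lambda>n0 n1. f (utens W V [(n0, yd_act M (finv \<beta> n1) m)])))"
    by (intro LB lform_comp[OF f]; (blast intro: mem | simp))
  fix x assume x: "x \<in> carrier T"
  show "f (c x) = tsum (summands x) (\<lambda>m n. tsum (yd_coact N n) (\<lambda>n0 n1. f (utens W V [(n0, yd_act M (finv \<beta> n1) m)])))"
    using lform_utens[OF W V f wf[OF x]] x by (simp add: braid_eq)
qed

lemma T' [simp]: "is_vspace T'" by (rule is_vspace_tensor_space[OF W V])

lemma braid_lhom: "c \<in> lhom T T'"
  by (rule evaluates_lhom[OF braid_evaluates V W is_vspace_vsp[OF T']])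

lemma braid_pure:
  assumes "lform T' f" "m \<in> carrier V" "n \<in> carrier W"
  shows "f (c (utens V W [(m, n)])) = tsum (yd_coact N n) (\<lambda>n0 n1. f (utens W V [(n0, yd_act M (finv \<beta> n1) m)]))"
  using evaluatesD(3)[OF braid_evaluates assms(1) utens_pure_in[OF assms(2,3)]]
    evaluatesD(2)[OF braid_evaluates assms(1)] assms(2,3) by simp

lemma braid_hom: "c \<in> yd_homs H MN (yd_tensor H PN M)"
proof -
  interpret P: yd_twist H N \<alpha> \<beta> \<gamma> \<delta> using N iN auts by unfold_locales
  interpret Q: yd_pair H PN M "\<alpha> \<circ> \<gamma> \<circ> finv \<alpha>" "P.\<kappa> \<circ> \<delta> \<circ> P.\<tau>" \<alpha> \<beta>
    using P.PN_in P.PN_simps(1) M iM by unfold_locales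
  note inv = autD(8,9)[OF auts(1)] autD(8,9)[OF auts(2)] autD(8,9)[OF auts(3)]
  have QT: "Q.T = T'" by (simp only: yd_phi_space)
  \<comment> \<open>In the target, H acts on \<open>N\<close> through \<open>\<tau>\<alpha>\<close>,
    which equals \<open>\<sigma>\<close> as in the source, while it acts on \<open>M\<close> through
    \<open>\<beta>^{-1}\<delta>\<sigma>\<close>.\<close>
  have \<sigma>1: "P.\<tau> (\<alpha> x) = \<sigma> x" for x by (simp add: P.\<tau>_def \<sigma>_def inv)
  have \<sigma>2: "Q.\<sigma> x = finv \<beta> (\<delta> (\<sigma> x))" for x
    unfolding Q.\<sigma>_def by (simp add: P.\<tau>_def P.\<kappa>_def \<sigma>_def inv)
  have QL: "yd_act Q.MN h \<in> lhom T' T'" for h using Q.act_lhom(1) unfolding QT .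
  have QC: "yd_coact Q.MN \<in> lhom T' (tensor T' A)" using Q.coact_lhom unfolding QT .
  show ?thesis
  proof (rule yd_homsI[OF MN_in Q.MN_in], unfold Q.MN_simps(2) MN_simps(2) QT)
    show "yd_index MN = yd_index Q.MN"
      by (simp add: MN_simps(1) Q.MN_simps(1) fun_eq_iff inv \<sigma>2)
    show "c \<in> extensional (carrier T)" by (simp add: braid_eq)
    show "c \<in> lhom T T'" by (rule braid_lhom)
    fix x assume x: "x \<in> carrier T"
    show "c (yd_act MN h x) = yd_act Q.MN h (c x)" for h
    proof (rule lhom_ext2[OF V W is_vspace_vsp[OF T'] lhom_comp[OF braid_lhom act_lhom(1)] lhom_comp[OF QL braid_lhom] _ x])
      fix m n assume m: "m \<in> carrier V" and n: "n \<in> carrier W"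
      show "c (yd_act MN h (utens V W [(m, n)])) = yd_act Q.MN h (c (utens V W [(m, n)]))"
      proof (rule lform_eqI[OF is_vspace_vsp[OF T']])
        fix f assume f: "lform T' f"
        note LF = LB lform_comp[OF f]
        have "f (c (yd_act MN h (utens V W [(m, n)]))) =
          tsum (comul H h) (\<lambda>h1 h2. f (c (utens V W [(yd_act M (\<gamma> h1) m, yd_act N (\<sigma> h2) n)])))"
          by (rule act_lform_pure[OF lform_comp[OF f braid_lhom] m n])
        \<comment> \<open>Writing \<open>\<gamma>(h_1)\<close> as
          \<open>\<beta>^{-1}(\<gamma>(\<sigma>(h_1)))\<close> collects both actions on
          \<open>m\<close> into one argument of \<open>\<beta>^{-1}\<close>, of the shape to which
          the condition for \<open>N\<close> applies.\<close>
        also have "\<dots> = tsum (comul H h) (\<lambda>h1 h2. tsum (yd_coact N (yd_act N (\<sigma> h2) n)) (\<lambda>n0 n1.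
            f (utens W V [(n0, yd_act M (finv \<beta> (n1 * \<gamma> (\<sigma> h1))) m)])))"
          by (intro tsum_congI)
            (simp add: braid_pure[OF f yd_mem(1)[OF M m] yd_mem(1)[OF N n]] yd_objectsD(7)[OF M m, symmetric]
              autD(3)[OF \<beta>'] \<gamma>\<sigma>[symmetric] inv)
        also have "\<dots> = tsum (comul H h) (\<lambda>h1 h2. tsum (yd_coact N n) (\<lambda>n0 n1.
            f (utens W V [(yd_act N (\<sigma> h1) n0, yd_act M (finv \<beta> (\<delta> (\<sigma> h2) * n1)) m)])))"
          by (rule yd_compat_aut[OF N iN auts(5) n]) (intro LF; (blast intro: mem m | simp))
        also have "\<dots> = tsum (yd_coact N n) (\<lambda>n0 n1. tsum (comul H h) (\<lambda>h1 h2.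
            f (utens W V [(yd_act N (\<sigma> h1) n0, yd_act M (finv \<beta> (\<delta> (\<sigma> h2) * n1)) m)])))"
          by (rule tsum_swap)
        also have "\<dots> = tsum (yd_coact N n) (\<lambda>n0 n1. f (yd_act Q.MN h (utens W V [(n0, yd_act M (finv \<beta> n1) m)])))"
        proof (rule tsum_congI)
          fix n0 n1 assume "(n0, n1) \<in> set (yd_coact N n)"
          then have n0: "n0 \<in> carrier W" and m1: "yd_act M (finv \<beta> n1) m \<in> carrier V" by (blast intro: mem m n)+
          have "f (yd_act Q.MN h (utens W V [(n0, yd_act M (finv \<beta> n1) m)])) = tsum (comul H h) (\<lambda>h1 h2.
            f (utens W V [(yd_act PN (\<alpha> h1) n0, yd_act M (Q.\<sigma> h2) (yd_act M (finv \<beta> n1) m))]))"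
            using Q.act_lform_pure[of f n0 "yd_act M (finv \<beta> n1) m" h] f n0 m1 unfolding yd_phi_space by blast
          then show "tsum (comul H h) (\<lambda>h1 h2. f (utens W V [(yd_act N (\<sigma> h1) n0, yd_act M (finv \<beta> (\<delta> (\<sigma> h2) * n1)) m)])) =
            f (yd_act Q.MN h (utens W V [(n0, yd_act M (finv \<beta> n1) m)]))"
            by (simp add: P.act_eq[OF n0] \<sigma>1 \<sigma>2 yd_objectsD(7)[OF M m, symmetric] autD(3)[OF \<beta>'])
        qed
        also have "\<dots> = f (yd_act Q.MN h (c (utens V W [(m, n)])))"
          by (rule braid_pure[OF lform_comp[OF f QL] m n, symmetric])
        finally show "f (c (yd_act MN h (utens V W [(m, n)]))) = f (yd_act Q.MN h (c (utens V W [(m, n)])))" .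
      qed (intro lhomD(1)[OF braid_lhom] lhomD(1)[OF QL] act_in utens_pure_in m n)+
    qed
    fix F assume F: "bform T' A F"
    have Fc: "bform T A (\<lambda>a b. F (c a) b)"
      by (intro bformI bform_left[OF F braid_lhom] bform_right[OF F lhom_id] lhomD(1)[OF braid_lhom])
    show "tsum (yd_coact Q.MN (c x)) F = tsum (yd_coact MN x) (\<lambda>m0 m1. F (c m0) m1)"
    proof (rule lform_ext2[OF V W _ _ _ x])
      show 1: "lform T (\<lambda>x. tsum (yd_coact Q.MN (c x)) F)"
        by (intro lform_tsum_left[OF lhom_comp[OF QC braid_lhom]] F is_vspace_vsp T' vsp_alg)
      show "lform T (\<lambda>x. tsum (yd_coact MN x) (\<lambda>m0 m1. F (c m0) m1))"
        by (intro lform_tsum_left[OF coact_lhom] Fc is_vspace_vsp T vsp_alg)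
      fix m n assume m: "m \<in> carrier V" and n: "n \<in> carrier W"
      note LF = LB bform_left[OF F] bform_right[OF F]
      let ?t = "\<lambda>a b. utens W V [(a, b)]"
      have "tsum (yd_coact Q.MN (c (utens V W [(m, n)]))) F =
        tsum (yd_coact N n) (\<lambda>n0 n1. tsum (yd_coact Q.MN (?t n0 (yd_act M (finv \<beta> n1) m))) F)"
        by (rule braid_pure[OF lform_tsum_left[OF QC is_vspace_vsp[OF T'] vsp_alg F] m n])
      also have "\<dots> = tsum (yd_coact N n) (\<lambda>n0 n1. tsum (yd_coact N n0) (\<lambda>n00 n01.
          tsum (yd_coact M (yd_act M (finv \<beta> n1) m)) (\<lambda>m0 m1. F (?t n00 m0) (m1 * \<alpha> (finv \<beta> n01)))))"
      proof (rule tsum_congI)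
        fix n0 n1 assume "(n0, n1) \<in> set (yd_coact N n)"
        then have n0: "n0 \<in> carrier W" and m1: "yd_act M (finv \<beta> n1) m \<in> carrier V" by (blast intro: mem m n)+
        have b: "bform W A (\<lambda>n00 n01. tsum (yd_coact M (yd_act M (finv \<beta> n1) m)) (\<lambda>m0 m1. F (?t n00 m0) (m1 * n01)))"
          by (intro LF; (blast intro: mem m1 | simp))
        have "tsum (yd_coact Q.MN (?t n0 (yd_act M (finv \<beta> n1) m))) F = tsum (yd_coact PN n0) (\<lambda>n00 n01.
          tsum (yd_coact M (yd_act M (finv \<beta> n1) m)) (\<lambda>m0 m1. F (?t n00 m0) (m1 * n01)))"
          using Q.coact_tsum_pure[of F n0 "yd_act M (finv \<beta> n1) m"] F n0 m1 unfolding yd_phi_space by blast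
        then show "tsum (yd_coact Q.MN (?t n0 (yd_act M (finv \<beta> n1) m))) F = tsum (yd_coact N n0) (\<lambda>n00 n01.
          tsum (yd_coact M (yd_act M (finv \<beta> n1) m)) (\<lambda>m0 m1. F (?t n00 m0) (m1 * \<alpha> (finv \<beta> n01))))"
          unfolding P.coact_tsum[OF b n0] by (simp add: P.\<kappa>_def)
      qed
      also have "\<dots> = tsum (yd_coact N n) (\<lambda>n0 n1. tsum (comul H n1) (\<lambda>a b.
          tsum (yd_coact M (yd_act M (finv \<beta> b) m)) (\<lambda>m0 m1. F (?t n0 m0) (m1 * \<alpha> (finv \<beta> a)))))"
        by (rule yd_objectsD(11)[OF N n]) (intro LF; (blast intro: mem m | simp))
      \<comment> \<open>The conjugated coaction of \<open>N\<close> has contributed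
        \<open>\<alpha>\<beta>^{-1}\<close>, exactly the right-hand factor that the condition for
        \<open>M\<close> along \<open>\<beta>^{-1}\<close> absorbs.\<close>
      also have "\<dots> = tsum (yd_coact N n) (\<lambda>n0 n1. tsum (comul H n1) (\<lambda>a b.
          tsum (yd_coact M m) (\<lambda>m0 m1. F (?t n0 (yd_act M (finv \<beta> a) m0)) (\<beta> (finv \<beta> b) * m1))))"
        by (rule tsum_congI, rule yd_compat_aut[OF M iM \<beta>' m]) (intro LF; (blast intro: mem n | simp))
      also have "\<dots> = tsum (yd_coact N n) (\<lambda>n0 n1. tsum (yd_coact M m) (\<lambda>m0 m1. tsum (comul H n1) (\<lambda>a b.
          F (?t n0 (yd_act M (finv \<beta> a) m0)) (b * m1))))"
        unfolding inv by (rule tsum_congI, rule tsum_swap)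
      also have "\<dots> = tsum (yd_coact M m) (\<lambda>m0 m1. tsum (yd_coact N n) (\<lambda>n0 n1. tsum (comul H n1) (\<lambda>a b.
          F (?t n0 (yd_act M (finv \<beta> a) m0)) (b * m1))))"
        by (rule tsum_swap)
      also have "\<dots> = tsum (yd_coact M m) (\<lambda>m0 m1. tsum (yd_coact N n) (\<lambda>n0 n1. tsum (yd_coact N n0) (\<lambda>n00 n01.
          F (?t n00 (yd_act M (finv \<beta> n01) m0)) (n1 * m1))))"
        by (rule tsum_congI, rule yd_objectsD(11)[OF N n, symmetric]) (intro LF; (blast intro: mem m | simp))
      also have "\<dots> = tsum (yd_coact M m) (\<lambda>m0 m1. tsum (yd_coact N n) (\<lambda>n0 n1. F (c (utens V W [(m0, n0)])) (n1 * m1)))"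
        by (rule tsum_congI, rule tsum_congI, rule braid_pure[symmetric])
          ((intro LF; simp), (blast intro: mem m n)+)
      also have "\<dots> = tsum (yd_coact MN (utens V W [(m, n)])) (\<lambda>m0 m1. F (c m0) m1)"
        by (rule coact_tsum_pure[OF Fc m n, symmetric])
      finally show "tsum (yd_coact Q.MN (c (utens V W [(m, n)]))) F = tsum (yd_coact MN (utens V W [(m, n)])) (\<lambda>m0 m1. F (c m0) m1)" .
    qed
  qed
qed

text \<open>Undoes the braiding by acting with \<open>S(n_1)\<close>: in the two composites
  coassociativity produces \<open>S(n_1) n_2\<close> and \<open>n_1 S(n_2)\<close>. The coaction is
  that of \<open>N\<close> itself, not of its conjugate.\<close>

definition braid_inv :: "('k, 'a) vuniv \<Rightarrow> ('k, 'a) vuniv" where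
  "braid_inv = (\<lambda>x\<in>carrier T'. utens V W [(yd_act M (finv \<beta> (antipode H n1)) m, n0). (n, m) \<leftarrow> summands x, (n0, n1) \<leftarrow> yd_coact N n])"

lemma braid_inv_evaluates: "evaluates W V T braid_inv (\<lambda>f n m. tsum (yd_coact N n) (\<lambda>n0 n1. f (utens V W [(yd_act M (finv \<beta> (antipode H n1)) m, n0)])))"
proof (rule evaluatesI)
  have wf: "set [(yd_act M (finv \<beta> (antipode H n1)) m, n0). (n, m) \<leftarrow> summands x, (n0, n1) \<leftarrow> yd_coact N n] \<subseteq> carrier V \<times> carrier W"
    if "x \<in> carrier T'" for x
    by (intro wf_intros; blast intro: mem summands_memD[OF W V that])
  then show "braid_inv x \<in> carrier T" if "x \<in> carrier T'" for x
    using that by (simp add: braid_inv_def utens_in)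
  fix f assume f: "lform T f"
  show "bform W V (\<lambda>n m. tsum (yd_coact N n) (\<lambda>n0 n1. f (utens V W [(yd_act M (finv \<beta> (antipode H n1)) m, n0)])))"
    by (intro LB lform_comp[OF f]; (blast intro: mem | simp))
  fix x assume x: "x \<in> carrier T'"
  show "f (braid_inv x) = tsum (summands x) (\<lambda>n m. tsum (yd_coact N n) (\<lambda>n0 n1. f (utens V W [(yd_act M (finv \<beta> (antipode H n1)) m, n0)])))"
    using lform_utens[OF V W f wf[OF x]] x by (simp add: braid_inv_def)
qed

lemma braid_inv_lhom: "braid_inv \<in> lhom T' T"
  by (rule evaluates_lhom[OF braid_inv_evaluates W V is_vspace_vsp[OF T]])

lemma braid_inv_pure:
  assumes "lform T f" "m \<in> carrier V" "n \<in> carrier W"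
  shows "f (braid_inv (utens W V [(n, m)])) = tsum (yd_coact N n) (\<lambda>n0 n1. f (utens V W [(yd_act M (finv \<beta> (antipode H n1)) m, n0)]))"
  using evaluatesD(3)[OF braid_inv_evaluates assms(1) utens_pure_in[OF assms(3,2)]]
    evaluatesD(2)[OF braid_inv_evaluates assms(1)] assms(2,3) by simp

lemma braid_inv_braid:
  assumes x: "x \<in> carrier T"
  shows "braid_inv (c x) = x"
proof (rule lhom_ext2[OF V W is_vspace_vsp[OF T] lhom_comp[OF braid_inv_lhom braid_lhom] lhom_id _ x])
  fix m n assume m: "m \<in> carrier V" and n: "n \<in> carrier W"
  show "braid_inv (c (utens V W [(m, n)])) = utens V W [(m, n)]"
  proof (rule lform_eqI[OF is_vspace_vsp[OF T]])
    fix f assume f: "lform T f"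
    note LF = LB lform_comp[OF f]
    have "f (braid_inv (c (utens V W [(m, n)]))) = tsum (yd_coact N n) (\<lambda>n0 n1. tsum (yd_coact N n0) (\<lambda>n00 n01.
        f (utens V W [(yd_act M (finv \<beta> (antipode H n01 * n1)) m, n00)])))"
      unfolding braid_pure[OF lform_comp[OF f braid_inv_lhom] m n]
      by (intro tsum_congI) (simp add: braid_inv_pure[OF f yd_mem(1)[OF M m] yd_mem(3)[OF N n]]
          yd_objectsD(7)[OF M m, symmetric] autD(3)[OF \<beta>'])
    also have "\<dots> = tsum (yd_coact N n) (\<lambda>n0 n1. tsum (comul H n1) (\<lambda>a b. f (utens V W [(yd_act M (finv \<beta> (antipode H a * b)) m, n0)])))"
      by (rule yd_objectsD(11)[OF N n]) (intro LF; (blast intro: mem m | simp))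
    also have "\<dots> = tsum (yd_coact N n) (\<lambda>n0 n1. counit H n1 * f (utens V W [(m, n0)]))"
    proof (rule tsum_congI)
      fix n0 n1 assume "(n0, n1) \<in> set (yd_coact N n)"
      then have n0: "n0 \<in> carrier W" by (blast intro: mem n)
      have "lform A (\<lambda>z. f (utens V W [(yd_act M (finv \<beta> z) m, n0)]))"
        by (intro LF m n0)
      from antipode_left'[OF this, of n1]
      show "tsum (comul H n1) (\<lambda>a b. f (utens V W [(yd_act M (finv \<beta> (antipode H a * b)) m, n0)])) = counit H n1 * f (utens V W [(m, n0)])"
        by (simp add: autD(4)[OF \<beta>'] yd_objectsD(8)[OF M m])
    qed
    also have "\<dots> = f (utens V W [(m, n)])"
      by (rule yd_objectsD(12)[OF N n]) (intro LF m)
    finally show "f (braid_inv (c (utens V W [(m, n)]))) = f (utens V W [(m, n)])" .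
  qed (intro lhomD(1)[OF braid_lhom] lhomD(1)[OF braid_inv_lhom] utens_pure_in m n)+
qed

lemma braid_braid_inv:
  assumes x: "x \<in> carrier T'"
  shows "c (braid_inv x) = x"
proof (rule lhom_ext2[OF W V is_vspace_vsp[OF T'] lhom_comp[OF braid_lhom braid_inv_lhom] lhom_id _ x])
  fix n m assume m: "m \<in> carrier V" and n: "n \<in> carrier W"
  show "c (braid_inv (utens W V [(n, m)])) = utens W V [(n, m)]"
  proof (rule lform_eqI[OF is_vspace_vsp[OF T']])
    fix f assume f: "lform T' f"
    note LF = LB lform_comp[OF f]
    have "f (c (braid_inv (utens W V [(n, m)]))) = tsum (yd_coact N n) (\<lambda>n0 n1. tsum (yd_coact N n0) (\<lambda>n00 n01.
        f (utens W V [(n00, yd_act M (finv \<beta> (n01 * antipode H n1)) m)])))"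
      unfolding braid_inv_pure[OF lform_comp[OF f braid_lhom] m n]
      by (intro tsum_congI) (simp add: braid_pure[OF f yd_mem(1)[OF M m] yd_mem(3)[OF N n]]
          yd_objectsD(7)[OF M m, symmetric] autD(3)[OF \<beta>'])
    also have "\<dots> = tsum (yd_coact N n) (\<lambda>n0 n1. tsum (comul H n1) (\<lambda>a b. f (utens W V [(n0, yd_act M (finv \<beta> (a * antipode H b)) m)])))"
      by (rule yd_objectsD(11)[OF N n]) (intro LF; (blast intro: mem m | simp))
    also have "\<dots> = tsum (yd_coact N n) (\<lambda>n0 n1. counit H n1 * f (utens W V [(n0, m)]))"
    proof (rule tsum_congI)
      fix n0 n1 assume "(n0, n1) \<in> set (yd_coact N n)"
      then have n0: "n0 \<in> carrier W" by (blast intro: mem n)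
      have "lform A (\<lambda>z. f (utens W V [(n0, yd_act M (finv \<beta> z) m)]))"
        by (intro LF m n0)
      from antipode_right'[OF this, of n1]
      show "tsum (comul H n1) (\<lambda>a b. f (utens W V [(n0, yd_act M (finv \<beta> (a * antipode H b)) m)])) = counit H n1 * f (utens W V [(n0, m)])"
        by (simp add: autD(4)[OF \<beta>'] yd_objectsD(8)[OF M m])
    qed
    also have "\<dots> = f (utens W V [(n, m)])"
      by (rule yd_objectsD(12)[OF N n]) (intro LF m)
    finally show "f (c (braid_inv (utens W V [(n, m)]))) = f (utens W V [(n, m)])" .
  qed (intro lhomD(1)[OF braid_lhom] lhomD(1)[OF braid_inv_lhom] utens_pure_in m n)+
qed

end

section \<open>Naturality, invariance under conjugation, and the hexagons\<close>

context hopf_algebra_bij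
begin

lemma yd_braid_hom:
  assumes M: "M \<in> yd_objects H" and N: "N \<in> yd_objects H"
  shows "yd_braid H M N \<in> yd_homs H (yd_tensor H M N) (yd_tensor H (yd_phi H (yd_index M) N) M)"
  using yd_pair.braid_hom[OF yd_pairI[OF M N]] by simp

lemma yd_braid_inverse:
  assumes M: "M \<in> yd_objects H" and N: "N \<in> yd_objects H"
  shows "\<exists>g \<in> yd_homs H (yd_tensor H (yd_phi H (yd_index M) N) M) (yd_tensor H M N).
    (\<forall>x\<in>carrier (tensor_space (yd_space M) (yd_space N)). g (yd_braid H M N x) = x) \<and>
    (\<forall>x\<in>carrier (tensor_space (yd_space N) (yd_space M)). yd_braid H M N (g x) = x)"
proof -
  interpret P: yd_pair H M N "fst (yd_index M)" "snd (yd_index M)" "fst (yd_index N)" "snd (yd_index N)"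
    by (rule yd_pairI[OF M N])
  have "P.braid_inv \<in> yd_homs H (yd_tensor H (yd_phi H (yd_index M) N) M) (yd_tensor H M N)"
    by (rule yd_hom_inverse[OF yd_braid_hom[OF M N]])
      (use P.braid_inv_lhom P.braid_inv_braid P.braid_braid_inv M N yd_index_in[OF M] in
        \<open>auto simp: yd_tensor_space yd_phi_space P.braid_inv_def intro!: yd_tensor_in yd_phi_in\<close>)
  then show ?thesis using P.braid_inv_braid P.braid_braid_inv by blast
qed

text \<open>The first entry of the braiding asks for colinearity of \<open>g\<close>, the second for
  H-linearity of \<open>f\<close>.\<close>

lemma yd_braid_natural:
  assumes M: "M \<in> yd_objects H" and M': "M' \<in> yd_objects H" and N: "N \<in> yd_objects H" and N': "N' \<in> yd_objects H"
    and f: "f \<in> yd_homs H M M'" and g: "g \<in> yd_homs H N N'"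
    and x: "x \<in> carrier (tensor_space (yd_space M) (yd_space N))"
  shows "yd_braid H M' N' (tensor_map (yd_space M) (yd_space N) (yd_space M') (yd_space N') f g x) =
    tensor_map (yd_space N) (yd_space M) (yd_space N') (yd_space M') g f (yd_braid H M N x)"
proof -
  note f' = yd_homsD[OF f M M'] and g' = yd_homsD[OF g N N']
  obtain \<alpha> \<beta> \<gamma> \<delta> where i: "yd_index M = (\<alpha>, \<beta>)" "yd_index N = (\<gamma>, \<delta>)" by (meson surj_pair)
  then have i': "yd_index M' = (\<alpha>, \<beta>)" "yd_index N' = (\<gamma>, \<delta>)" using f'(1) g'(1) by auto
  interpret P: yd_pair H M N \<alpha> \<beta> \<gamma> \<delta> using M N i by unfold_locales
  interpret P': yd_pair H M' N' \<alpha> \<beta> \<gamma> \<delta> using M' N' i' by unfold_locales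
  let ?t = "tensor_map P.V P.W P'.V P'.W f g" and ?t' = "tensor_map P.W P.V P'.W P'.V g f"
  note th = tensor_map_lhom[OF P.V P.W P'.V P'.W f'(3) g'(3)] and th' = tensor_map_lhom[OF P.W P.V P'.W P'.V g'(3) f'(3)]
  note pure = tensor_map_pure[OF P.V P.W P'.V P'.W f'(3) g'(3)] and pure' = tensor_map_pure[OF P.W P.V P'.W P'.V g'(3) f'(3)]
  show ?thesis
  proof (rule lhom_ext2[OF P.V P.W is_vspace_vsp[OF P'.T'] lhom_comp[OF P'.braid_lhom th] lhom_comp[OF th' P.braid_lhom] _ x])
    fix m n assume m: "m \<in> carrier P.V" and n: "n \<in> carrier P.W"
    note fm = lhomD(1)[OF f'(3) m] and gn = lhomD(1)[OF g'(3) n]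
    show "P'.c (?t (utens P.V P.W [(m, n)])) = ?t' (P.c (utens P.V P.W [(m, n)]))"
    proof (rule lform_eqI[OF is_vspace_vsp[OF P'.T']])
      fix k assume k: "lform P'.T' k"
      have "k (P'.c (?t (utens P.V P.W [(m, n)]))) = tsum (yd_coact N' (g n)) (\<lambda>n0 n1. k (utens P'.W P'.V [(n0, yd_act M' (finv \<beta> n1) (f m))]))"
        unfolding pure[OF m n] by (rule P'.braid_pure[OF k fm gn])
      also have "\<dots> = tsum (yd_coact N n) (\<lambda>n0 n1. k (utens P'.W P'.V [(g n0, yd_act M' (finv \<beta> n1) (f m))]))"
        by (rule g'(5)[OF n]) (intro P'.LB lform_comp[OF k]; (blast intro: P'.mem fm | simp))
      also have "\<dots> = tsum (yd_coact N n) (\<lambda>n0 n1. k (?t' (utens P.W P.V [(n0, yd_act M (finv \<beta> n1) m)])))"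
        by (intro tsum_congI) (simp add: pure' f'(4)[OF m] yd_mem(1)[OF M m] yd_mem(3)[OF N n])
      also have "\<dots> = k (?t' (P.c (utens P.V P.W [(m, n)])))"
        by (rule P.braid_pure[OF lform_comp[OF k th'] m n, symmetric])
      finally show "k (P'.c (?t (utens P.V P.W [(m, n)]))) = k (?t' (P.c (utens P.V P.W [(m, n)])))" .
    qed (intro lhomD(1)[OF P'.braid_lhom] lhomD(1)[OF th'] lhomD(1)[OF th] lhomD(1)[OF P.braid_lhom] utens_pure_in m n)+
  qed
qed

text \<open>Conjugation inserts \<open>\<kappa>\<close> into the coaction of \<open>N\<close> and
  \<open>\<tau>\<close> into the action of \<open>M\<close>, and changes the second index of
  \<open>M\<close> to \<open>\<kappa>\<delta>\<tau>\<close>. These cancel, since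
  \<open>\<tau>(\<kappa>\<delta>\<tau>)^{-1}\<kappa> = \<delta>^{-1}\<close>.\<close>

lemma yd_braid_phi:
  assumes M: "M \<in> yd_objects H" and N: "N \<in> yd_objects H" and b: "b \<in> carrier (aut_group H)"
  shows "yd_braid H (yd_phi H b M) (yd_phi H b N) = yd_braid H M N"
proof -
  obtain \<alpha> \<beta> \<gamma> \<delta> \<epsilon> \<zeta> where i: "b = (\<alpha>, \<beta>)" "yd_index M = (\<gamma>, \<delta>)" "yd_index N = (\<epsilon>, \<zeta>)" by (meson surj_pair)
  have auts: "\<alpha> \<in> hopf_aut H" "\<beta> \<in> hopf_aut H" using b i by auto
  interpret P: yd_pair H M N \<gamma> \<delta> \<epsilon> \<zeta> using M N i by unfold_locales
  interpret PM: yd_twist H M \<alpha> \<beta> \<gamma> \<delta> using M i auts by unfold_locales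
  interpret PN: yd_twist H N \<alpha> \<beta> \<epsilon> \<zeta> using N i auts by unfold_locales
  interpret Q: yd_pair H PM.PN PN.PN "\<alpha> \<circ> \<gamma> \<circ> finv \<alpha>" "PM.\<kappa> \<circ> \<delta> \<circ> PM.\<tau>" "\<alpha> \<circ> \<epsilon> \<circ> finv \<alpha>" "PN.\<kappa> \<circ> \<zeta> \<circ> PN.\<tau>"
    using PM.PN_in PN.PN_in PM.PN_simps(1) PN.PN_simps(1) by unfold_locales
  note inv = autD(8,9)[OF auts(1)] autD(8,9)[OF auts(2)] autD(8,9)[OF PM.auts(1)] autD(8,9)[OF PM.auts(2)]
    autD(8,9)[OF PM.auts(3)] autD(8,9)[OF PM.auts(4)]
  have \<kappa>: "PM.\<tau> (finv (PM.\<kappa> \<circ> \<delta> \<circ> PM.\<tau>) (PM.\<kappa> x)) = finv \<delta> x" for x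
    by (simp add: finv_comp PM.auts aut_comp inv)
  have S: "Q.T = P.T" "Q.T' = P.T'" by (simp_all only: yd_phi_space)
  show ?thesis unfolding i(1)
  proof (rule extensionalityI[of _ "carrier P.T"])
    show "Q.c \<in> extensional (carrier P.T)" "P.c \<in> extensional (carrier P.T)"
      unfolding Q.braid_eq P.braid_eq S by simp_all
    fix x assume x: "x \<in> carrier P.T"
    show "Q.c x = P.c x"
    proof (rule lhom_ext2[OF P.V P.W is_vspace_vsp[OF P.T'] Q.braid_lhom[unfolded S] P.braid_lhom _ x])
      fix m n assume m: "m \<in> carrier P.V" and n: "n \<in> carrier P.W"
      show "Q.c (utens P.V P.W [(m, n)]) = P.c (utens P.V P.W [(m, n)])"
      proof (rule lform_eqI[OF is_vspace_vsp[OF P.T']])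
        fix k assume k: "lform P.T' k"
        have "k (Q.c (utens P.V P.W [(m, n)])) = tsum (yd_coact PN.PN n) (\<lambda>n0 n1.
          k (utens P.W P.V [(n0, yd_act PM.PN (finv (PM.\<kappa> \<circ> \<delta> \<circ> PM.\<tau>) n1) m)]))"
          using Q.braid_pure[of k m n] k m n unfolding yd_phi_space by blast
        also have "\<dots> = tsum (yd_coact N n) (\<lambda>n0 n1. k (utens P.W P.V [(n0, yd_act PM.PN (finv (PM.\<kappa> \<circ> \<delta> \<circ> PM.\<tau>) (PN.\<kappa> n1)) m)]))"
          by (rule PN.coact_tsum[OF _ n])
            (intro P.LB lform_comp[OF k] yd_lin(2)[OF PM.PN_in, unfolded yd_phi_space] lhom_comp[OF autD(2)[OF aut_finv[OF Q.auts(2)]]];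
             (blast intro: yd_mem(1)[OF PM.PN_in, unfolded yd_phi_space] m | simp))
        also have "\<dots> = tsum (yd_coact N n) (\<lambda>n0 n1. k (utens P.W P.V [(n0, yd_act M (finv \<delta> n1) m)]))"
          unfolding PM.act_eq[OF m] \<kappa> ..
        also have "\<dots> = k (P.c (utens P.V P.W [(m, n)]))"
          by (rule P.braid_pure[OF k m n, symmetric])
        finally show "k (Q.c (utens P.V P.W [(m, n)])) = k (P.c (utens P.V P.W [(m, n)]))" .
      qed (intro lhomD(1)[OF Q.braid_lhom[unfolded S]] lhomD(1)[OF P.braid_lhom] utens_pure_in m n)+
    qed
  qed
qed

text \<open>Two successive braidings use the coaction of \<open>N\<close> twice, a single one splits
  \<open>n_1\<close> by the coproduct in the action on \<open>L \<otimes> M\<close>; the two agree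
  by coassociativity of the coaction.\<close>

lemma yd_braid_tensor_left:
  assumes L: "L \<in> yd_objects H" and M: "M \<in> yd_objects H" and N: "N \<in> yd_objects H"
    and x: "x \<in> carrier (tensor_space (tensor_space (yd_space L) (yd_space M)) (yd_space N))"
  defines "U \<equiv> yd_space L" and "V \<equiv> yd_space M" and "W \<equiv> yd_space N"
  shows "yd_braid H (yd_tensor H L M) N x = assoc_map W U V
    (tensor_map (tensor_space U W) V (tensor_space W U) V (yd_braid H L (yd_phi H (yd_index M) N)) (\<lambda>x\<in>carrier V. x)
    (assoc_inv U W V (tensor_map U (tensor_space V W) U (tensor_space W V) (\<lambda>x\<in>carrier U. x) (yd_braid H M N)
    (assoc_map U V W x))))"
proof -
  obtain \<alpha> \<beta> \<gamma> \<delta> \<epsilon> \<zeta> where i: "yd_index L = (\<alpha>, \<beta>)" "yd_index M = (\<gamma>, \<delta>)" "yd_index N = (\<epsilon>, \<zeta>)" by (meson surj_pair)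
  interpret LM: yd_pair H L M \<alpha> \<beta> \<gamma> \<delta> using L M i by unfold_locales
  interpret MN: yd_pair H M N \<gamma> \<delta> \<epsilon> \<zeta> using M N i by unfold_locales
  interpret PN: yd_twist H N \<gamma> \<delta> \<epsilon> \<zeta> using N i MN.auts by unfold_locales
  interpret P: yd_pair H "yd_tensor H L M" N "\<alpha> \<circ> \<gamma>" "\<delta> \<circ> LM.\<sigma>" \<epsilon> \<zeta>
    using LM.MN_in N i LM.MN_simps(1) by unfold_locales
  interpret Q: yd_pair H L PN.PN \<alpha> \<beta> "\<gamma> \<circ> \<epsilon> \<circ> finv \<gamma>" "PN.\<kappa> \<circ> \<zeta> \<circ> PN.\<tau>"
    using PN.PN_in PN.PN_simps(1) L i by unfold_locales
  note inv = autD(8,9)[OF LM.auts(2)] autD(8,9)[OF LM.auts(3)] autD(8,9)[OF LM.auts(4)] autD(8,9)[OF LM.auts(5)]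
  \<comment> \<open>Acting on \<open>L \<otimes> M\<close> along
    \<open>(\<delta>\<sigma>)^{-1}\<close> means acting on \<open>L\<close> through
    \<open>\<beta>^{-1}\<kappa>\<close> and on \<open>M\<close> through
    \<open>\<delta>^{-1}\<close>. The first is the map used by the braiding of \<open>L\<close> with
    the conjugate of \<open>N\<close>, the second the one used by the braiding of \<open>M\<close>
    with \<open>N\<close>.\<close>
  have \<kappa>1: "\<gamma> (finv (\<delta> \<circ> LM.\<sigma>) x) = finv \<beta> (PN.\<kappa> x)" and \<kappa>2: "LM.\<sigma> (finv (\<delta> \<circ> LM.\<sigma>) x) = finv \<delta> x" for x
  proof -
    have "\<beta> (\<gamma> (finv (\<delta> \<circ> LM.\<sigma>) x)) = PN.\<kappa> x"
      unfolding LM.\<gamma>\<sigma> by (simp add: finv_comp LM.auts inv PN.\<kappa>_def)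
    then show "\<gamma> (finv (\<delta> \<circ> LM.\<sigma>) x) = finv \<beta> (PN.\<kappa> x)" by (metis inv(1))
    show "LM.\<sigma> (finv (\<delta> \<circ> LM.\<sigma>) x) = finv \<delta> x" by (simp add: finv_comp LM.auts inv)
  qed
  have UVW: "is_vspace U" "is_vspace V" "is_vspace W" unfolding U_def V_def W_def by simp_all
  note T = is_vspace_tensor_space[OF UVW(1,2)] is_vspace_tensor_space[OF UVW(2,3)] is_vspace_tensor_space[OF UVW(1,3)]
    is_vspace_tensor_space[OF UVW(3,1)] is_vspace_tensor_space[OF UVW(3,2)]
  have id: "(\<lambda>x\<in>carrier U. x) \<in> lhom U U" "(\<lambda>x\<in>carrier V. x) \<in> lhom V V"
    by (rule lhom_cong[OF lhom_id]; use UVW in simp)+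
  have S: "yd_space (yd_tensor H L M) = tensor_space U V" "yd_space PN.PN = W" "yd_space L = U" "yd_space M = V" "yd_space N = W"
    by (simp_all add: yd_tensor_space yd_phi_space U_def V_def W_def)
  note Pl = P.braid_lhom[unfolded S] and Ql = Q.braid_lhom[unfolded S] and MNl = MN.braid_lhom[unfolded S]
  let ?q = "tensor_map (tensor_space U W) V (tensor_space W U) V Q.c (\<lambda>x\<in>carrier V. x)"
  let ?r = "tensor_map U (tensor_space V W) U (tensor_space W V) (\<lambda>x\<in>carrier U. x) MN.c"
  note q = tensor_map_lhom[OF T(3) UVW(2) T(4) UVW(2) Ql id(2)] and qp = tensor_map_pure[OF T(3) UVW(2) T(4) UVW(2) Ql id(2)]
  note r = tensor_map_lhom[OF UVW(1) T(2) UVW(1) T(5) id(1) MNl] and rp = tensor_map_pure[OF UVW(1) T(2) UVW(1) T(5) id(1) MNl]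
  note a1 = assoc_map_lhom[OF UVW] and a2 = assoc_inv_lhom[OF UVW(1,3,2)] and a3 = assoc_map_lhom[OF UVW(3,1,2)]
  note ap1 = assoc_map_pure[OF UVW] and ap2 = assoc_inv_pure[OF UVW(1,3,2)] and ap3 = assoc_map_pure[OF UVW(3,1,2)]
  note T3 = is_vspace_tensor_space[OF UVW(3) T(1)]
  have "P.c x = assoc_map W U V (?q (assoc_inv U W V (?r (assoc_map U V W x))))"
  proof (rule lhom_ext3[OF UVW is_vspace_vsp[OF T3] Pl
        lhom_comp[OF a3 lhom_comp[OF q lhom_comp[OF a2 lhom_comp[OF r a1]]]] _ x[folded U_def V_def W_def]])
    fix l m n assume l: "l \<in> carrier U" and m: "m \<in> carrier V" and n: "n \<in> carrier W"
    let ?x = "utens (tensor_space U V) W [(utens U V [(l, m)], n)]"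
    have lm: "utens U V [(l, m)] \<in> carrier (tensor_space U V)" and mn: "utens V W [(m, n)] \<in> carrier (tensor_space V W)" using l m n by simp_all
    have xin: "?x \<in> carrier (tensor_space (tensor_space U V) W)" using lm n by simp
    show "P.c ?x = assoc_map W U V (?q (assoc_inv U W V (?r (assoc_map U V W ?x))))"
    proof (rule lform_eqI[OF is_vspace_vsp[OF T3]])
      show "P.c ?x \<in> carrier (tensor_space W (tensor_space U V))" by (rule lhomD(1)[OF Pl xin])
      show "assoc_map W U V (?q (assoc_inv U W V (?r (assoc_map U V W ?x)))) \<in> carrier (tensor_space W (tensor_space U V))"
        by (intro lhomD(1)[OF a3] lhomD(1)[OF q] lhomD(1)[OF a2] lhomD(1)[OF r] lhomD(1)[OF a1] xin)
      fix f assume f: "lform (tensor_space W (tensor_space U V)) f"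
      note LF = LM.LB[unfolded S] MN.LB[unfolded S] lform_comp[OF f] utens_bilinear[OF UVW(3) T(1)]
      note ms = LM.mem[unfolded S] MN.mem[unfolded S]
      let ?\<Phi> = "\<lambda>n0 a b. f (utens W (tensor_space U V) [(n0, utens U V [(yd_act L a l, yd_act M b m)])])"
      let ?D = "finv (\<delta> \<circ> LM.\<sigma>)"
      have "f (P.c ?x) = tsum (yd_coact N n) (\<lambda>n0 n1. f (utens W (tensor_space U V) [(n0, yd_act LM.MN (?D n1) (utens U V [(l, m)]))]))"
        using P.braid_pure[unfolded S, OF f lm n] .
      also have "\<dots> = tsum (yd_coact N n) (\<lambda>n0 n1. tsum (comul H (?D n1)) (\<lambda>a b. ?\<Phi> n0 (\<gamma> a) (LM.\<sigma> b)))"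
      proof (rule tsum_congI)
        fix n0 n1 assume "(n0, n1) \<in> set (yd_coact N n)"
        then have n0: "n0 \<in> carrier W" by (blast intro: ms n)
        have "lform (tensor_space U V) (\<lambda>t. f (utens W (tensor_space U V) [(n0, t)]))" by (intro LF n0)
        from LM.act_lform_pure[unfolded S, OF this l m]
        show "f (utens W (tensor_space U V) [(n0, yd_act LM.MN (?D n1) (utens U V [(l, m)]))]) =
          tsum (comul H (?D n1)) (\<lambda>a b. ?\<Phi> n0 (\<gamma> a) (LM.\<sigma> b))" .
      qed
      also have "\<dots> = tsum (yd_coact N n) (\<lambda>n0 n1. tsum (comul H n1) (\<lambda>a b. ?\<Phi> n0 (\<gamma> (?D a)) (LM.\<sigma> (?D b))))"
        by (intro tsum_congI autD(5)[OF aut_finv[OF P.auts(2)]]) (intro LF; (blast intro: ms l m n | simp))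
      also have "\<dots> = tsum (yd_coact N n) (\<lambda>n0 n1. tsum (yd_coact N n0) (\<lambda>n00 n01. ?\<Phi> n00 (finv \<beta> (PN.\<kappa> n01)) (finv \<delta> n1)))"
        unfolding \<kappa>1 \<kappa>2
        by (rule yd_objectsD(11)[OF N, unfolded S, OF n, symmetric])
          (intro LF lhom_comp[OF autD(2)[OF PN.auts(4)]]; (blast intro: ms l m n | simp))
      also have "\<dots> = tsum (yd_coact N n) (\<lambda>n0 n1. tsum (yd_coact PN.PN n0) (\<lambda>n00 n01. ?\<Phi> n00 (finv \<beta> n01) (finv \<delta> n1)))"
        by (rule tsum_congI, rule PN.coact_tsum[unfolded S, symmetric])
          ((intro LF; (blast intro: ms l m n | simp)), blast intro: ms n)
      also have "\<dots> = tsum (yd_coact N n) (\<lambda>n0 n1. f (assoc_map W U V (?q (utens (tensor_space U W) V [(utens U W [(l, n0)], yd_act M (finv \<delta> n1) m)]))))"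
      proof (rule tsum_congI)
        fix n0 n1 assume "(n0, n1) \<in> set (yd_coact N n)"
        then have n0: "n0 \<in> carrier W" and m1: "yd_act M (finv \<delta> n1) m \<in> carrier V" by (blast intro: ms n m)+
        have ln: "utens U W [(l, n0)] \<in> carrier (tensor_space U W)" using l n0 by simp
        have g: "lform (tensor_space W U) (\<lambda>t. f (assoc_map W U V (utens (tensor_space W U) V [(t, yd_act M (finv \<delta> n1) m)])))"
          by (intro lform_comp[OF lform_comp[OF f a3]] utens_bilinear[OF T(4) UVW(2)] lhom_id m1)
        have "f (assoc_map W U V (?q (utens (tensor_space U W) V [(utens U W [(l, n0)], yd_act M (finv \<delta> n1) m)]))) =
          f (assoc_map W U V (utens (tensor_space W U) V [(Q.c (utens U W [(l, n0)]), yd_act M (finv \<delta> n1) m)]))"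
          using m1 by (simp add: qp[OF ln m1])
        also have "\<dots> = tsum (yd_coact PN.PN n0) (\<lambda>n00 n01. f (assoc_map W U V (utens (tensor_space W U) V [(utens W U [(n00, yd_act L (finv \<beta> n01) l)], yd_act M (finv \<delta> n1) m)])))"
          by (rule Q.braid_pure[unfolded S, OF g l n0])
        also have "\<dots> = tsum (yd_coact PN.PN n0) (\<lambda>n00 n01. ?\<Phi> n00 (finv \<beta> n01) (finv \<delta> n1))"
        proof (rule tsum_congI)
          fix n00 n01 assume "(n00, n01) \<in> set (yd_coact PN.PN n0)"
          then have "n00 \<in> carrier W" using yd_mem(3)[OF PN.PN_in, unfolded S, OF n0] by blast
          then show "f (assoc_map W U V (utens (tensor_space W U) V [(utens W U [(n00, yd_act L (finv \<beta> n01) l)], yd_act M (finv \<delta> n1) m)])) =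
            ?\<Phi> n00 (finv \<beta> n01) (finv \<delta> n1)"
            using yd_mem(1)[OF L, unfolded S, OF l] m1 by (simp add: ap3)
        qed
        finally show "tsum (yd_coact PN.PN n0) (\<lambda>n00 n01. ?\<Phi> n00 (finv \<beta> n01) (finv \<delta> n1)) =
          f (assoc_map W U V (?q (utens (tensor_space U W) V [(utens U W [(l, n0)], yd_act M (finv \<delta> n1) m)])))" by simp
      qed
      also have "\<dots> = tsum (yd_coact N n) (\<lambda>n0 n1. f (assoc_map W U V (?q (assoc_inv U W V (utens U (tensor_space W V) [(l, utens W V [(n0, yd_act M (finv \<delta> n1) m)])])))))"
        by (rule tsum_congI) (simp add: ap2 l yd_mem(1)[OF M, unfolded S, OF m] yd_mem(3)[OF N, unfolded S, OF n])
      also have "\<dots> = f (assoc_map W U V (?q (assoc_inv U W V (utens U (tensor_space W V) [(l, MN.c (utens V W [(m, n)]))]))))"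
        by (rule MN.braid_pure[unfolded S, symmetric, OF _ m n])
          (intro lform_comp[OF lform_comp[OF lform_comp[OF lform_comp[OF f a3] q] a2]] utens_bilinear[OF UVW(1) T(5)] lhom_id l)
      also have "\<dots> = f (assoc_map W U V (?q (assoc_inv U W V (?r (assoc_map U V W ?x)))))"
        using l m n by (simp add: ap1 rp[OF l mn])
      finally show "f (P.c ?x) = f (assoc_map W U V (?q (assoc_inv U W V (?r (assoc_map U V W ?x)))))" .
    qed
  qed
  then show ?thesis by (simp add: i)
qed

text \<open>The coaction of \<open>M \<otimes> N\<close> carries \<open>n_1 m_1\<close>, and acting
  by this product on \<open>L\<close> is acting by \<open>m_1\<close> and then by
  \<open>n_1\<close>. This hexagon is associativity of the action of \<open>L\<close>.\<close>

lemma yd_braid_tensor_right: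
  assumes L: "L \<in> yd_objects H" and M: "M \<in> yd_objects H" and N: "N \<in> yd_objects H"
    and x: "x \<in> carrier (tensor_space (yd_space L) (tensor_space (yd_space M) (yd_space N)))"
  defines "U \<equiv> yd_space L" and "V \<equiv> yd_space M" and "W \<equiv> yd_space N"
  shows "yd_braid H L (yd_tensor H M N) x = assoc_inv V W U
    (tensor_map V (tensor_space U W) V (tensor_space W U) (\<lambda>x\<in>carrier V. x) (yd_braid H L N)
    (assoc_map V U W (tensor_map (tensor_space U V) W (tensor_space V U) W (yd_braid H L M) (\<lambda>x\<in>carrier W. x)
    (assoc_inv U V W x))))"
proof -
  obtain \<alpha> \<beta> \<gamma> \<delta> \<epsilon> \<zeta> where i: "yd_index L = (\<alpha>, \<beta>)" "yd_index M = (\<gamma>, \<delta>)" "yd_index N = (\<epsilon>, \<zeta>)" by (meson surj_pair)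
  interpret LM: yd_pair H L M \<alpha> \<beta> \<gamma> \<delta> using L M i by unfold_locales
  interpret LN: yd_pair H L N \<alpha> \<beta> \<epsilon> \<zeta> using L N i by unfold_locales
  interpret MN: yd_pair H M N \<gamma> \<delta> \<epsilon> \<zeta> using M N i by unfold_locales
  interpret P: yd_pair H L "yd_tensor H M N" \<alpha> \<beta> "\<gamma> \<circ> \<epsilon>" "\<zeta> \<circ> MN.\<sigma>"
    using MN.MN_in L i MN.MN_simps(1) by unfold_locales
  have UVW: "is_vspace U" "is_vspace V" "is_vspace W" unfolding U_def V_def W_def by simp_all
  note T = is_vspace_tensor_space[OF UVW(1,2)] is_vspace_tensor_space[OF UVW(2,3)] is_vspace_tensor_space[OF UVW(1,3)]
    is_vspace_tensor_space[OF UVW(3,1)] is_vspace_tensor_space[OF UVW(2,1)]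
  have id: "(\<lambda>x\<in>carrier W. x) \<in> lhom W W" "(\<lambda>x\<in>carrier V. x) \<in> lhom V V"
    by (rule lhom_cong[OF lhom_id]; use UVW in simp)+
  have S: "yd_space (yd_tensor H M N) = tensor_space V W" "yd_space L = U" "yd_space M = V" "yd_space N = W"
    by (simp_all add: yd_tensor_space U_def V_def W_def)
  note Pl = P.braid_lhom[unfolded S] and LMl = LM.braid_lhom[unfolded S] and LNl = LN.braid_lhom[unfolded S]
  let ?q = "tensor_map V (tensor_space U W) V (tensor_space W U) (\<lambda>x\<in>carrier V. x) LN.c"
  let ?r = "tensor_map (tensor_space U V) W (tensor_space V U) W LM.c (\<lambda>x\<in>carrier W. x)"
  note q = tensor_map_lhom[OF UVW(2) T(3) UVW(2) T(4) id(2) LNl] and qp = tensor_map_pure[OF UVW(2) T(3) UVW(2) T(4) id(2) LNl]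
  note r = tensor_map_lhom[OF T(1) UVW(3) T(5) UVW(3) LMl id(1)] and rp = tensor_map_pure[OF T(1) UVW(3) T(5) UVW(3) LMl id(1)]
  note a1 = assoc_inv_lhom[OF UVW] and a2 = assoc_map_lhom[OF UVW(2,1,3)] and a3 = assoc_inv_lhom[OF UVW(2,3,1)]
  note ap1 = assoc_inv_pure[OF UVW] and ap2 = assoc_map_pure[OF UVW(2,1,3)] and ap3 = assoc_inv_pure[OF UVW(2,3,1)]
  note T3 = is_vspace_tensor_space[OF T(2) UVW(1)]
  have "P.c x = assoc_inv V W U (?q (assoc_map V U W (?r (assoc_inv U V W x))))"
  proof (rule lhom_ext3'[OF UVW is_vspace_vsp[OF T3] Pl
        lhom_comp[OF a3 lhom_comp[OF q lhom_comp[OF a2 lhom_comp[OF r a1]]]] _ x[folded U_def V_def W_def]])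
    fix l m n assume l: "l \<in> carrier U" and m: "m \<in> carrier V" and n: "n \<in> carrier W"
    let ?x = "utens U (tensor_space V W) [(l, utens V W [(m, n)])]"
    have lm: "utens U V [(l, m)] \<in> carrier (tensor_space U V)" and mn: "utens V W [(m, n)] \<in> carrier (tensor_space V W)" using l m n by simp_all
    have xin: "?x \<in> carrier (tensor_space U (tensor_space V W))" using l mn by simp
    show "P.c ?x = assoc_inv V W U (?q (assoc_map V U W (?r (assoc_inv U V W ?x))))"
    proof (rule lform_eqI[OF is_vspace_vsp[OF T3]])
      show "P.c ?x \<in> carrier (tensor_space (tensor_space V W) U)" by (rule lhomD(1)[OF Pl xin])
      show "assoc_inv V W U (?q (assoc_map V U W (?r (assoc_inv U V W ?x)))) \<in> carrier (tensor_space (tensor_space V W) U)"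
        by (intro lhomD(1)[OF a3] lhomD(1)[OF q] lhomD(1)[OF a2] lhomD(1)[OF r] lhomD(1)[OF a1] xin)
      fix f assume f: "lform (tensor_space (tensor_space V W) U) f"
      note LF = LM.LB[unfolded S] MN.LB[unfolded S] lform_comp[OF f] utens_bilinear[OF T(2) UVW(1)]
      note ms = LM.mem[unfolded S] MN.mem[unfolded S]
      let ?\<Phi> = "\<lambda>m0 n0 k. f (utens (tensor_space V W) U [(utens V W [(m0, n0)], yd_act L (finv \<beta> k) l)])"
      have b: "bform (tensor_space V W) A (\<lambda>t k. f (utens (tensor_space V W) U [(t, yd_act L (finv \<beta> k) l)]))"
        by (intro LF; (blast intro: ms l | simp))
      have "f (P.c ?x) = tsum (yd_coact MN.MN (utens V W [(m, n)])) (\<lambda>t k. f (utens (tensor_space V W) U [(t, yd_act L (finv \<beta> k) l)]))"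
        using P.braid_pure[unfolded S, OF f l mn] .
      also have "\<dots> = tsum (yd_coact M m) (\<lambda>m0 m1. tsum (yd_coact N n) (\<lambda>n0 n1. ?\<Phi> m0 n0 (n1 * m1)))"
        by (rule MN.coact_tsum_pure[unfolded S, OF b m n])
      also have "\<dots> = tsum (yd_coact M m) (\<lambda>m0 m1. f (assoc_inv V W U (?q (assoc_map V U W
          (utens (tensor_space V U) W [(utens V U [(m0, yd_act L (finv \<beta> m1) l)], n)])))))"
      proof (rule tsum_congI)
        fix m0 m1 assume "(m0, m1) \<in> set (yd_coact M m)"
        then have m0: "m0 \<in> carrier V" and l1: "yd_act L (finv \<beta> m1) l \<in> carrier U" by (blast intro: ms l m)+
        have ln: "utens U W [(yd_act L (finv \<beta> m1) l, n)] \<in> carrier (tensor_space U W)" using l1 n by simp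
        have g: "lform (tensor_space W U) (\<lambda>t. f (assoc_inv V W U (utens V (tensor_space W U) [(m0, t)])))"
          by (intro lform_comp[OF lform_comp[OF f a3]] utens_bilinear[OF UVW(2) T(4)] lhom_id m0)
        have "f (assoc_inv V W U (?q (assoc_map V U W (utens (tensor_space V U) W [(utens V U [(m0, yd_act L (finv \<beta> m1) l)], n)])))) =
          f (assoc_inv V W U (utens V (tensor_space W U) [(m0, LN.c (utens U W [(yd_act L (finv \<beta> m1) l, n)]))]))"
          using m0 by (simp add: ap2[OF m0 l1 n] qp[OF m0 ln])
        also have "\<dots> = tsum (yd_coact N n) (\<lambda>n0 n1. f (assoc_inv V W U (utens V (tensor_space W U)
            [(m0, utens W U [(n0, yd_act L (finv \<beta> n1) (yd_act L (finv \<beta> m1) l))])])))"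
          by (rule LN.braid_pure[unfolded S, OF g l1 n])
        also have "\<dots> = tsum (yd_coact N n) (\<lambda>n0 n1. ?\<Phi> m0 n0 (n1 * m1))"
          by (intro tsum_congI) (simp add: ap3 m0 yd_mem(3)[OF N, unfolded S, OF n] yd_mem(1)[OF L, unfolded S, OF l1]
              autD(3)[OF LM.\<beta>'] yd_objectsD(7)[OF L, unfolded S, OF l])
        finally show "tsum (yd_coact N n) (\<lambda>n0 n1. ?\<Phi> m0 n0 (n1 * m1)) = f (assoc_inv V W U (?q (assoc_map V U W
          (utens (tensor_space V U) W [(utens V U [(m0, yd_act L (finv \<beta> m1) l)], n)]))))" by simp
      qed
      also have "\<dots> = f (assoc_inv V W U (?q (assoc_map V U W (utens (tensor_space V U) W [(LM.c (utens U V [(l, m)]), n)]))))"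
        by (rule LM.braid_pure[unfolded S, symmetric, OF _ l m])
          (intro lform_comp[OF lform_comp[OF lform_comp[OF f a3] q]] lhom_comp[OF a2] utens_bilinear[OF T(5) UVW(3)] lhom_id n)
      also have "\<dots> = f (assoc_inv V W U (?q (assoc_map V U W (?r (assoc_inv U V W ?x)))))"
        using l m n by (simp add: ap1 rp[OF lm n])
      finally show "f (P.c ?x) = f (assoc_inv V W U (?q (assoc_map V U W (?r (assoc_inv U V W ?x)))))" .
    qed
  qed
  then show ?thesis .
qed

end

section \<open>The braided T-category of Yetter-Drinfeld modules\<close>

lemma inverse_arrows_unique:
  assumes C: "category C" and g: "inverse_arrows C f g" and g': "inverse_arrows C f g'"
  shows "g = g'"
proof -
  interpret category C by fact
  let ?a = "Dom C f" and ?b = "Cod C f"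
  have ar: "arrow C ?a ?b f" "arrow C ?b ?a g" "arrow C ?b ?a g'"
    using g g' by (auto simp: inverse_arrows_def arrow_def)
  have "g = Cmp C (Cmp C g' f) g"
    using g' ide_cmp[OF ar(2)] by (simp add: inverse_arrows_def)
  also have "\<dots> = Cmp C g' (Cmp C f g)"
    using cmp_assoc[OF ar(2,1,3)] by simp
  also have "\<dots> = g'"
    using g cmp_ide[OF ar(3)] by (simp add: inverse_arrows_def)
  finally show ?thesis .
qed

lemma inv_arrow_eq: "category C \<Longrightarrow> inverse_arrows C f g \<Longrightarrow> inv_arrow C f = g"
  unfolding inv_arrow_def by (blast intro: inverse_arrows_unique)

lemma lhom_restrict_id: "is_vspace V \<Longrightarrow> (\<lambda>x\<in>carrier V. x) \<in> lhom V V"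
  by (rule lhom_cong[OF lhom_id]) auto

context hopf_algebra_bij
begin

lemma YD_simps:
  "Obj (YD H) = yd_objects H"
  "Arr (YD H) = {(M, f, N). M \<in> yd_objects H \<and> N \<in> yd_objects H \<and> f \<in> yd_homs H M N}"
  "Dom (YD H) (M, f, N) = M" "Cod (YD H) (M, f, N) = N"
  "Ide (YD H) M = (M, \<lambda>x\<in>carrier (yd_space M). x, M)"
  "Cmp (YD H) (M', g, N') (M, f, N) = (M, compose (carrier (yd_space M)) g f, N')"
  "TenO (YD H) = yd_tensor H"
  "TenA (YD H) (M, f, N) (M', f', N') = (yd_tensor H M M',
     tensor_map (yd_space M) (yd_space M') (yd_space N) (yd_space N') f f', yd_tensor H N N')"
  "UnitO (YD H) = yd_unit H"
  "Assoc (YD H) L M N = (yd_tensor H (yd_tensor H L M) N, assoc_map (yd_space L) (yd_space M) (yd_space N),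
     yd_tensor H L (yd_tensor H M N))"
  "LUnit (YD H) M = (yd_tensor H (yd_unit H) M, lunit_map (yd_space M), M)"
  "RUnit (YD H) M = (yd_tensor H M (yd_unit H), runit_map (yd_space M), M)"
  "Part (YD H) a = {M \<in> yd_objects H. yd_index M = a}"
  "PhiO (YD H) = yd_phi H"
  "PhiA (YD H) b (M, f, N) = (yd_phi H b M, f, yd_phi H b N)"
  "Braid (YD H) M N = (yd_tensor H M N, yd_braid H M N, yd_tensor H (yd_phi H (yd_index M) N) M)"
  by (simp_all add: YD_def T_cat_over_vspaces_def)

lemma arrow_YD: "arrow (YD H) M N F \<longleftrightarrow>
    M \<in> yd_objects H \<and> N \<in> yd_objects H \<and> (\<exists>f\<in>yd_homs H M N. F = (M, f, N))"
  by (auto simp: arrow_def YD_simps)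

lemma category_YD: "category (YD H)"
proof
  fix F assume "F \<in> Arr (YD H)"
  then show "Dom (YD H) F \<in> Obj (YD H) \<and> Cod (YD H) F \<in> Obj (YD H)" by (auto simp: YD_simps)
next
  fix M assume "M \<in> Obj (YD H)"
  then show "arrow (YD H) M M (Ide (YD H) M)" by (auto simp: YD_simps arrow_YD intro: yd_hom_id)
next
  fix L M N F G assume "arrow (YD H) L M F" "arrow (YD H) M N G"
  then show "arrow (YD H) L N (Cmp (YD H) G F)"
    by (auto simp: YD_simps arrow_YD intro: yd_hom_compose)
next
  fix M N F assume "arrow (YD H) M N F"
  then obtain f where M: "M \<in> yd_objects H" and N: "N \<in> yd_objects H" and f: "f \<in> yd_homs H M N" "F = (M, f, N)"
    by (auto simp: arrow_YD)
  note f' = yd_homsD[OF f(1) M N]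
  show "Cmp (YD H) F (Ide (YD H) M) = F" "Cmp (YD H) (Ide (YD H) N) F = F"
    using f' by (auto simp: YD_simps f(2) compose_def intro!: extensionalityI[OF _ f'(2)] dest: lhomD(1))
next
  fix K L M N F G E assume "arrow (YD H) K L F" "arrow (YD H) L M G" "arrow (YD H) M N E"
  then obtain f g e where K: "K \<in> yd_objects H" and L: "L \<in> yd_objects H"
    and f: "f \<in> yd_homs H K L" "F = (K, f, L)" "G = (L, g, M)" "E = (M, e, N)"
    by (auto simp: arrow_YD)
  then show "Cmp (YD H) E (Cmp (YD H) G F) = Cmp (YD H) (Cmp (YD H) E G) F"
    using lhomD(1)[OF yd_homsD(3)[OF f(1) K L]] by (auto simp: YD_simps compose_def fun_eq_iff)
qed

lemma inverse_arrows_YD: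
  assumes f: "f \<in> yd_homs H M N" and g: "g \<in> yd_homs H N M" and M: "M \<in> yd_objects H" and N: "N \<in> yd_objects H"
    and "\<And>x. x \<in> carrier (yd_space M) \<Longrightarrow> g (f x) = x" "\<And>y. y \<in> carrier (yd_space N) \<Longrightarrow> f (g y) = y"
  shows "inverse_arrows (YD H) (M, f, N) (N, g, M)"
  using assms by (auto simp: inverse_arrows_def YD_simps compose_def fun_eq_iff)

text \<open>Any linear two-sided inverse suffices, because \<open>yd_hom_inverse\<close> supplies
  the compatibility with the structure maps. It is restricted to the carrier since morphisms are
  extensional functions.\<close>

lemma iso_arrow_YD:
  assumes f: "f \<in> yd_homs H M N" and M: "M \<in> yd_objects H" and N: "N \<in> yd_objects H"
    and g: "g \<in> lhom (yd_space N) (yd_space M)"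
    and gf: "\<And>x. x \<in> carrier (yd_space M) \<Longrightarrow> g (f x) = x" and fg: "\<And>y. y \<in> carrier (yd_space N) \<Longrightarrow> f (g y) = y"
  shows "iso_arrow (YD H) M N (M, f, N)"
    and "inverse_arrows (YD H) (M, f, N) (N, restrict g (carrier (yd_space N)), M)"
proof -
  let ?g = "restrict g (carrier (yd_space N))"
  have c: "f x \<in> carrier (yd_space N)" if "x \<in> carrier (yd_space M)" for x
    using lhomD(1)[OF yd_homsD(3)[OF f M N] that] .
  have "?g \<in> lhom (yd_space N) (yd_space M)"
    by (rule lhom_cong[OF g]) (use yd_objectsD(3)[OF N] in auto)
  then have g': "?g \<in> yd_homs H N M"
    by (rule yd_hom_inverse[OF f M N]) (use gf fg c in auto)
  show "inverse_arrows (YD H) (M, f, N) (N, ?g, M)"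
    by (rule inverse_arrows_YD[OF f g' M N]) (use gf fg c in auto)
  then show "iso_arrow (YD H) M N (M, f, N)"
    using f M N by (auto simp: iso_arrow_def arrow_YD)
qed

lemma yd_assoc_inverse:
  assumes L: "L \<in> yd_objects H" and M: "M \<in> yd_objects H" and N: "N \<in> yd_objects H"
  shows "iso_arrow (YD H) (yd_tensor H (yd_tensor H L M) N) (yd_tensor H L (yd_tensor H M N)) (Assoc (YD H) L M N)"
    and "inv_arrow (YD H) (Assoc (YD H) L M N) = (yd_tensor H L (yd_tensor H M N),
      assoc_inv (yd_space L) (yd_space M) (yd_space N), yd_tensor H (yd_tensor H L M) N)"
proof -
  let ?U = "yd_space L" and ?V = "yd_space M" and ?W = "yd_space N"
  note VS = yd_objectsD(3)[OF L] yd_objectsD(3)[OF M] yd_objectsD(3)[OF N]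
  note i = iso_arrow_YD[OF yd_assoc_hom[OF L M N], of "assoc_inv ?U ?V ?W", unfolded yd_tensor_space,
      OF _ _ assoc_inv_lhom[OF VS] assoc_inv_assoc_map[OF VS]]
  have "restrict (assoc_inv ?U ?V ?W) (carrier (tensor_space ?U (tensor_space ?V ?W))) = assoc_inv ?U ?V ?W"
    by (simp add: assoc_inv_def)
  with i show "iso_arrow (YD H) (yd_tensor H (yd_tensor H L M) N) (yd_tensor H L (yd_tensor H M N)) (Assoc (YD H) L M N)"
    and "inv_arrow (YD H) (Assoc (YD H) L M N) = (yd_tensor H L (yd_tensor H M N),
      assoc_inv ?U ?V ?W, yd_tensor H (yd_tensor H L M) N)"
    using L M N yd_tensor_in by (auto simp: YD_simps intro!: inv_arrow_eq category_YD)
qed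

lemma tensor_map_ext: "tensor_map V W V' W' f g \<in> extensional (carrier (tensor_space V W))"
  by (simp add: tensor_map_def)

text \<open>The equations among constraints concern the underlying linear maps only and are checked
  on pure tensors; extensionality then turns agreement on the carrier into equality of
  arrows.\<close>

lemma monoidal_category_YD: "monoidal_category (YD H :: (_, ('k, 'h, 'a) yd_obj, _) T_cat)"
proof -
  interpret category "YD H :: (_, ('k, 'h, 'a) yd_obj, _) T_cat" by (rule category_YD)
  note vs = yd_objectsD(3)
  show ?thesis
  proof
    show "UnitO (YD H) \<in> Obj (YD H)" by (simp add: YD_simps yd_unit_in)
  next
    fix M N :: "('k, 'h, 'a) yd_obj" assume "M \<in> Obj (YD H)" "N \<in> Obj (YD H)"
    then have M: "M \<in> yd_objects H" and N: "N \<in> yd_objects H" by (simp_all add: YD_simps)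
    show "TenO (YD H) M N \<in> Obj (YD H)"
      using M N by (simp add: YD_simps yd_tensor_in)
    note idM = lhom_restrict_id[OF vs[OF M]] and idN = lhom_restrict_id[OF vs[OF N]]
    note vMN = is_vspace_tensor_space[OF vs[OF M] vs[OF N]]
    have "tensor_map (yd_space M) (yd_space N) (yd_space M) (yd_space N) (\<lambda>x\<in>carrier (yd_space M). x) (\<lambda>x\<in>carrier (yd_space N). x) =
      (\<lambda>x\<in>carrier (tensor_space (yd_space M) (yd_space N)). x)"
    proof (rule extensionalityI[OF tensor_map_ext restrict_extensional])
      fix x assume x: "x \<in> carrier (tensor_space (yd_space M) (yd_space N))"
      show "tensor_map (yd_space M) (yd_space N) (yd_space M) (yd_space N) (\<lambda>x\<in>carrier (yd_space M). x) (\<lambda>x\<in>carrier (yd_space N). x) x =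
        (\<lambda>x\<in>carrier (tensor_space (yd_space M) (yd_space N)). x) x"
        by (rule lhom_ext2[OF vs[OF M] vs[OF N] is_vspace_vsp[OF vMN] tensor_map_lhom[OF vs[OF M] vs[OF N] vs[OF M] vs[OF N] idM idN]
              lhom_restrict_id[OF vMN] _ x])
          (simp add: tensor_map_pure[OF vs[OF M] vs[OF N] vs[OF M] vs[OF N] idM idN])
    qed
    then show "TenA (YD H) (Ide (YD H) M) (Ide (YD H) N) = Ide (YD H) (TenO (YD H) M N)"
      by (simp add: YD_simps yd_tensor_space)
    let ?U = "UnitO (YD H)"
    have "tensor_map (yd_space M) (tensor_space unit_space (yd_space N)) (yd_space M) (yd_space N)
        (\<lambda>x\<in>carrier (yd_space M). x) (lunit_map (yd_space N)) (assoc_map (yd_space M) unit_space (yd_space N) x) =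
      tensor_map (tensor_space (yd_space M) unit_space) (yd_space N) (yd_space M) (yd_space N)
        (runit_map (yd_space M)) (\<lambda>x\<in>carrier (yd_space N). x) x"
      if x: "x \<in> carrier (tensor_space (tensor_space (yd_space M) unit_space) (yd_space N))" for x
    proof -
      note UN = is_vspace_tensor_space[OF is_vspace_unit_space vs[OF N]] and MU = is_vspace_tensor_space[OF vs[OF M] is_vspace_unit_space]
      note l = tensor_map_lhom[OF vs[OF M] UN vs[OF M] vs[OF N] idM lunit_map_lhom[OF vs[OF N]]]
      note r = tensor_map_lhom[OF MU vs[OF N] vs[OF M] vs[OF N] runit_map_lhom[OF vs[OF M]] idN]
      note lp = tensor_map_pure[OF vs[OF M] UN vs[OF M] vs[OF N] idM lunit_map_lhom[OF vs[OF N]]]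
      note rp = tensor_map_pure[OF MU vs[OF N] vs[OF M] vs[OF N] runit_map_lhom[OF vs[OF M]] idN]
      show ?thesis
      proof (rule lhom_ext3[OF vs[OF M] is_vspace_unit_space vs[OF N] is_vspace_vsp[OF is_vspace_tensor_space[OF vs[OF M] vs[OF N]]]
            lhom_comp[OF l assoc_map_lhom[OF vs[OF M] is_vspace_unit_space vs[OF N]]] r _ x])
        fix m and s :: "('k, 'a) vuniv" and n assume m: "m \<in> carrier (yd_space M)" and s: "s \<in> carrier unit_space" and n: "n \<in> carrier (yd_space N)"
        \<comment> \<open>The triangle axiom is the relation that moves a scalar across the tensor
          sign.\<close>
        have "utens (yd_space M) (yd_space N) [(m, the_scalar s \<odot>\<^bsub>yd_space N\<^esub> n)] = utens (yd_space M) (yd_space N) [(the_scalar s \<odot>\<^bsub>yd_space M\<^esub> m, n)]"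
          unfolding utens_def by (simp add: tcls_eqI[OF tensor_eq.smult[OF m n]])
        then show "tensor_map (yd_space M) (tensor_space unit_space (yd_space N)) (yd_space M) (yd_space N)
            (\<lambda>x\<in>carrier (yd_space M). x) (lunit_map (yd_space N)) (assoc_map (yd_space M) unit_space (yd_space N)
            (utens (tensor_space (yd_space M) unit_space) (yd_space N) [(utens (yd_space M) unit_space [(m, s)], n)])) =
          tensor_map (tensor_space (yd_space M) unit_space) (yd_space N) (yd_space M) (yd_space N)
            (runit_map (yd_space M)) (\<lambda>x\<in>carrier (yd_space N). x)
            (utens (tensor_space (yd_space M) unit_space) (yd_space N) [(utens (yd_space M) unit_space [(m, s)], n)])"
          unfolding assoc_map_pure[OF vs[OF M] is_vspace_unit_space vs[OF N] m s n]
            lp[OF m utens_pure_in[OF s n]] rp[OF utens_pure_in[OF m s] n] lunit_map_pure[OF vs[OF N] s n] runit_map_pure[OF vs[OF M] s m]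
          using m n by simp
      qed
    qed
    then show "Cmp (YD H) (TenA (YD H) (Ide (YD H) M) (LUnit (YD H) N)) (Assoc (YD H) M ?U N) =
      TenA (YD H) (RUnit (YD H) M) (Ide (YD H) N)"
      by (auto simp: YD_simps yd_tensor_space yd_unit_simps(2) compose_eq intro!: extensionalityI[OF compose_extensional tensor_map_ext])
  next
    fix M N M' N' :: "('k, 'h, 'a) yd_obj" and F F' assume "arrow (YD H) M N F" "arrow (YD H) M' N' F'"
    then show "arrow (YD H) (TenO (YD H) M M') (TenO (YD H) N N') (TenA (YD H) F F')"
      by (auto simp: arrow_YD YD_simps intro: yd_tensor_in yd_tensor_map_hom)
  next
    fix L M N L' M' N' :: "('k, 'h, 'a) yd_obj" and F G F' G'
    assume "arrow (YD H) L M F" "arrow (YD H) M N G" "arrow (YD H) L' M' F'" "arrow (YD H) M' N' G'"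
    then obtain f g f' g' where ob: "L \<in> yd_objects H" "M \<in> yd_objects H" "N \<in> yd_objects H"
      "L' \<in> yd_objects H" "M' \<in> yd_objects H" "N' \<in> yd_objects H"
      and h: "f \<in> yd_homs H L M" "g \<in> yd_homs H M N" "f' \<in> yd_homs H L' M'" "g' \<in> yd_homs H M' N'"
      and F: "F = (L, f, M)" "G = (M, g, N)" "F' = (L', f', M')" "G' = (M', g', N')"
      by (auto simp: arrow_YD)
    note v = ob[THEN vs]
    note lf = yd_homsD(3)[OF h(1) ob(1,2)] and lg = yd_homsD(3)[OF h(2) ob(2,3)]
      and lf' = yd_homsD(3)[OF h(3) ob(4,5)] and lg' = yd_homsD(3)[OF h(4) ob(5,6)]
    note c = yd_homsD(3)[OF yd_hom_compose[OF h(1,2) ob(1-3)] ob(1,3)] and c' = yd_homsD(3)[OF yd_hom_compose[OF h(3,4) ob(4-6)] ob(4,6)]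
    have "tensor_map (yd_space L) (yd_space L') (yd_space N) (yd_space N') (compose (carrier (yd_space L)) g f) (compose (carrier (yd_space L')) g' f') x =
      tensor_map (yd_space M) (yd_space M') (yd_space N) (yd_space N') g g' (tensor_map (yd_space L) (yd_space L') (yd_space M) (yd_space M') f f' x)"
      if x: "x \<in> carrier (tensor_space (yd_space L) (yd_space L'))" for x
    proof (rule lhom_ext2[OF v(1,4) is_vspace_vsp[OF is_vspace_tensor_space[OF v(3,6)]] tensor_map_lhom[OF v(1,4,3,6) c c']
          lhom_comp[OF tensor_map_lhom[OF v(2,5,3,6) lg lg'] tensor_map_lhom[OF v(1,4,2,5) lf lf']] _ x])
      fix m n assume mn: "m \<in> carrier (yd_space L)" "n \<in> carrier (yd_space L')"
      show "tensor_map (yd_space L) (yd_space L') (yd_space N) (yd_space N') (compose (carrier (yd_space L)) g f) (compose (carrier (yd_space L')) g' f') (utens (yd_space L) (yd_space L') [(m, n)]) =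
        tensor_map (yd_space M) (yd_space M') (yd_space N) (yd_space N') g g' (tensor_map (yd_space L) (yd_space L') (yd_space M) (yd_space M') f f' (utens (yd_space L) (yd_space L') [(m, n)]))"
        unfolding tensor_map_pure[OF v(1,4,3,6) c c' mn] tensor_map_pure[OF v(1,4,2,5) lf lf' mn]
          tensor_map_pure[OF v(2,5,3,6) lg lg' lhomD(1)[OF lf mn(1)] lhomD(1)[OF lf' mn(2)]]
        using mn by (simp add: compose_eq)
    qed
    then show "TenA (YD H) (Cmp (YD H) G F) (Cmp (YD H) G' F') = Cmp (YD H) (TenA (YD H) G G') (TenA (YD H) F F')"
      unfolding F by (auto simp: YD_simps yd_tensor_space compose_eq intro!: extensionalityI[OF tensor_map_ext compose_extensional])
  next
    fix L M N :: "('k, 'h, 'a) yd_obj" assume "L \<in> Obj (YD H)" "M \<in> Obj (YD H)" "N \<in> Obj (YD H)"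
    then show "iso_arrow (YD H) (TenO (YD H) (TenO (YD H) L M) N) (TenO (YD H) L (TenO (YD H) M N)) (Assoc (YD H) L M N)"
      using yd_assoc_inverse(1) by (simp add: YD_simps)
  next
    fix L L' M M' N N' :: "('k, 'h, 'a) yd_obj" and F G E
    assume "arrow (YD H) L L' F" "arrow (YD H) M M' G" "arrow (YD H) N N' E"
    then obtain f g e where ob: "L \<in> yd_objects H" "M \<in> yd_objects H" "N \<in> yd_objects H"
      "L' \<in> yd_objects H" "M' \<in> yd_objects H" "N' \<in> yd_objects H"
      and h: "f \<in> yd_homs H L L'" "g \<in> yd_homs H M M'" "e \<in> yd_homs H N N'"
      and F: "F = (L, f, L')" "G = (M, g, M')" "E = (N, e, N')"
      by (auto simp: arrow_YD)
    note v = ob[THEN vs]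
    note lf = yd_homsD(3)[OF h(1) ob(1,4)] and lg = yd_homsD(3)[OF h(2) ob(2,5)] and le = yd_homsD(3)[OF h(3) ob(3,6)]
    let ?U = "yd_space L" and ?V = "yd_space M" and ?W = "yd_space N" and ?U' = "yd_space L'" and ?V' = "yd_space M'" and ?W' = "yd_space N'"
    note t = is_vspace_tensor_space[OF v(1,2)] is_vspace_tensor_space[OF v(4,5)] is_vspace_tensor_space[OF v(2,3)] is_vspace_tensor_space[OF v(5,6)]
    note fg = tensor_map_lhom[OF v(1,2,4,5) lf lg] and ge = tensor_map_lhom[OF v(2,3,5,6) lg le]
    have "assoc_map ?U' ?V' ?W' (tensor_map (tensor_space ?U ?V) ?W (tensor_space ?U' ?V') ?W' (tensor_map ?U ?V ?U' ?V' f g) e x) =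
      tensor_map ?U (tensor_space ?V ?W) ?U' (tensor_space ?V' ?W') f (tensor_map ?V ?W ?V' ?W' g e) (assoc_map ?U ?V ?W x)"
      if x: "x \<in> carrier (tensor_space (tensor_space ?U ?V) ?W)" for x
    proof (rule lhom_ext3[OF v(1-3) is_vspace_vsp[OF is_vspace_tensor_space[OF v(4) t(4)]]
          lhom_comp[OF assoc_map_lhom[OF v(4-6)] tensor_map_lhom[OF t(1) v(3) t(2) v(6) fg le]]
          lhom_comp[OF tensor_map_lhom[OF v(1) t(3) v(4) t(4) lf ge] assoc_map_lhom[OF v(1-3)]] _ x])
      fix l m n assume l: "l \<in> carrier ?U" and m: "m \<in> carrier ?V" and n: "n \<in> carrier ?W"
      note l' = lhomD(1)[OF lf l] and m' = lhomD(1)[OF lg m] and n' = lhomD(1)[OF le n]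
      show "assoc_map ?U' ?V' ?W' (tensor_map (tensor_space ?U ?V) ?W (tensor_space ?U' ?V') ?W' (tensor_map ?U ?V ?U' ?V' f g) e
          (utens (tensor_space ?U ?V) ?W [(utens ?U ?V [(l, m)], n)])) =
        tensor_map ?U (tensor_space ?V ?W) ?U' (tensor_space ?V' ?W') f (tensor_map ?V ?W ?V' ?W' g e) (assoc_map ?U ?V ?W
          (utens (tensor_space ?U ?V) ?W [(utens ?U ?V [(l, m)], n)]))"
        unfolding assoc_map_pure[OF v(1-3) l m n] tensor_map_pure[OF t(1) v(3) t(2) v(6) fg le utens_pure_in[OF l m] n]
          tensor_map_pure[OF v(1,2,4,5) lf lg l m] assoc_map_pure[OF v(4-6) l' m' n']
          tensor_map_pure[OF v(1) t(3) v(4) t(4) lf ge l utens_pure_in[OF m n]] tensor_map_pure[OF v(2,3,5,6) lg le m n] ..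
    qed
    then show "Cmp (YD H) (Assoc (YD H) L' M' N') (TenA (YD H) (TenA (YD H) F G) E) =
      Cmp (YD H) (TenA (YD H) F (TenA (YD H) G E)) (Assoc (YD H) L M N)"
      unfolding F by (auto simp: YD_simps yd_tensor_space compose_eq intro!: extensionalityI[OF compose_extensional compose_extensional])
  next
    fix M :: "('k, 'h, 'a) yd_obj" assume "M \<in> Obj (YD H)"
    then have M: "M \<in> yd_objects H" by (simp add: YD_simps)
    show "iso_arrow (YD H) (TenO (YD H) (UnitO (YD H)) M) M (LUnit (YD H) M)"
      using iso_arrow_YD(1)[OF yd_lunit_hom[OF M] yd_tensor_in[OF yd_unit_in M] M, unfolded yd_tensor_space yd_unit_simps(2), OF lunit_map_inverse[OF vs[OF M]]]
      by (simp add: YD_simps)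
    show "iso_arrow (YD H) (TenO (YD H) M (UnitO (YD H))) M (RUnit (YD H) M)"
      using iso_arrow_YD(1)[OF yd_runit_hom[OF M] yd_tensor_in[OF M yd_unit_in] M, unfolded yd_tensor_space yd_unit_simps(2), OF runit_map_inverse[OF vs[OF M]]]
      by (simp add: YD_simps)
  next
    fix M N :: "('k, 'h, 'a) yd_obj" and F assume "arrow (YD H) M N F"
    then obtain f where M: "M \<in> yd_objects H" and N: "N \<in> yd_objects H" and f: "f \<in> yd_homs H M N" and F: "F = (M, f, N)"
      by (auto simp: arrow_YD)
    let ?V = "yd_space M" and ?W = "yd_space N"
    note lf = yd_homsD(3)[OF f M N] and v = vs[OF M] vs[OF N] and u = is_vspace_unit_space
    have id: "(\<lambda>x\<in>carrier unit_space. x) \<in> lhom unit_space unit_space"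
      by (rule lhom_cong[OF lhom_id]) auto
    have "lunit_map ?W (tensor_map unit_space ?V unit_space ?W (\<lambda>x\<in>carrier unit_space. x) f x) = f (lunit_map ?V x)"
      if x: "x \<in> carrier (tensor_space unit_space ?V)" for x
    proof (rule lhom_ext2[OF u v(1) is_vspace_vsp[OF v(2)] lhom_comp[OF lunit_map_lhom[OF v(2)] tensor_map_lhom[OF u v(1) u v(2) id lf]]
          lhom_comp[OF lf lunit_map_lhom[OF v(1)]] _ x])
      fix s m assume s: "s \<in> carrier (unit_space :: ('k, 'a) vspace)" and m: "m \<in> carrier ?V"
      show "lunit_map ?W (tensor_map unit_space ?V unit_space ?W (\<lambda>x\<in>carrier unit_space. x) f (utens unit_space ?V [(s, m)])) =
        f (lunit_map ?V (utens unit_space ?V [(s, m)]))"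
        unfolding tensor_map_pure[OF u v(1) u v(2) id lf s m] lunit_map_pure[OF v(1) s m] restrict_apply'[OF s]
          lunit_map_pure[OF v(2) s lhomD(1)[OF lf m]] lhomD(3)[OF lf m] ..
    qed
    then show "Cmp (YD H) (LUnit (YD H) N) (TenA (YD H) (Ide (YD H) (UnitO (YD H))) F) = Cmp (YD H) F (LUnit (YD H) M)"
      unfolding F by (auto simp: YD_simps yd_tensor_space yd_unit_simps(2) compose_eq intro!: extensionalityI[OF compose_extensional compose_extensional])
    have "runit_map ?W (tensor_map ?V unit_space ?W unit_space f (\<lambda>x\<in>carrier unit_space. x) x) = f (runit_map ?V x)"
      if x: "x \<in> carrier (tensor_space ?V unit_space)" for x
    proof (rule lhom_ext2[OF v(1) u is_vspace_vsp[OF v(2)] lhom_comp[OF runit_map_lhom[OF v(2)] tensor_map_lhom[OF v(1) u v(2) u lf id]]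
          lhom_comp[OF lf runit_map_lhom[OF v(1)]] _ x])
      fix m s assume s: "s \<in> carrier (unit_space :: ('k, 'a) vspace)" and m: "m \<in> carrier ?V"
      show "runit_map ?W (tensor_map ?V unit_space ?W unit_space f (\<lambda>x\<in>carrier unit_space. x) (utens ?V unit_space [(m, s)])) =
        f (runit_map ?V (utens ?V unit_space [(m, s)]))"
        unfolding tensor_map_pure[OF v(1) u v(2) u lf id m s] runit_map_pure[OF v(1) s m] restrict_apply'[OF s]
          runit_map_pure[OF v(2) s lhomD(1)[OF lf m]] lhomD(3)[OF lf m] ..
    qed
    then show "Cmp (YD H) (RUnit (YD H) N) (TenA (YD H) F (Ide (YD H) (UnitO (YD H)))) = Cmp (YD H) F (RUnit (YD H) M)"
      unfolding F by (auto simp: YD_simps yd_tensor_space yd_unit_simps(2) compose_eq intro!: extensionalityI[OF compose_extensional compose_extensional])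
  next
    fix K L M N :: "('k, 'h, 'a) yd_obj" assume "K \<in> Obj (YD H)" "L \<in> Obj (YD H)" "M \<in> Obj (YD H)" "N \<in> Obj (YD H)"
    then have v: "is_vspace (yd_space K)" "is_vspace (yd_space L)" "is_vspace (yd_space M)" "is_vspace (yd_space N)"
      by (simp_all add: YD_simps vs)
    let ?U = "yd_space K" and ?V = "yd_space L" and ?W = "yd_space M" and ?X = "yd_space N"
    note ten = is_vspace_tensor_space
    have id: "(\<lambda>x\<in>carrier ?U. x) \<in> lhom ?U ?U" "(\<lambda>x\<in>carrier ?X. x) \<in> lhom ?X ?X"
      by (rule lhom_cong[OF lhom_id]; use v in auto)+
    note a1 = assoc_map_lhom[OF v(1-3)] and a2 = assoc_map_lhom[OF v(1) ten[OF v(2,3)] v(4)] and a3 = assoc_map_lhom[OF v(2-4)]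
      and a4 = assoc_map_lhom[OF ten[OF v(1,2)] v(3,4)] and a5 = assoc_map_lhom[OF v(1,2) ten[OF v(3,4)]]
    note b1 = tensor_map_lhom[OF ten[OF ten[OF v(1,2)] v(3)] v(4) ten[OF v(1) ten[OF v(2,3)]] v(4) a1 id(2)]
      and b2 = tensor_map_lhom[OF v(1) ten[OF ten[OF v(2,3)] v(4)] v(1) ten[OF v(2) ten[OF v(3,4)]] id(1) a3]
    note p1 = tensor_map_pure[OF ten[OF ten[OF v(1,2)] v(3)] v(4) ten[OF v(1) ten[OF v(2,3)]] v(4) a1 id(2)]
      and p2 = tensor_map_pure[OF v(1) ten[OF ten[OF v(2,3)] v(4)] v(1) ten[OF v(2) ten[OF v(3,4)]] id(1) a3]
    let ?A = "assoc_map ?U ?V (tensor_space ?W ?X)" and ?B = "assoc_map (tensor_space ?U ?V) ?W ?X"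
    let ?C = "tensor_map ?U (tensor_space (tensor_space ?V ?W) ?X) ?U (tensor_space ?V (tensor_space ?W ?X)) (\<lambda>x\<in>carrier ?U. x) (assoc_map ?V ?W ?X)"
    let ?D = "assoc_map ?U (tensor_space ?V ?W) ?X"
    let ?E = "tensor_map (tensor_space (tensor_space ?U ?V) ?W) ?X (tensor_space ?U (tensor_space ?V ?W)) ?X (assoc_map ?U ?V ?W) (\<lambda>x\<in>carrier ?X. x)"
    have "?A (?B x) = ?C (?D (?E x))"
      if x: "x \<in> carrier (tensor_space (tensor_space (tensor_space ?U ?V) ?W) ?X)" for x
    proof (rule lhom_ext4[OF v is_vspace_vsp lhom_comp[OF a5 a4] lhom_comp[OF b2 lhom_comp[OF a2 b1]] _ x])
      fix k l m n assume k: "k \<in> carrier ?U" and l: "l \<in> carrier ?V" and m: "m \<in> carrier ?W" and n: "n \<in> carrier ?X"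
      note q = utens_pure_in
      let ?x = "utens (tensor_space (tensor_space ?U ?V) ?W) ?X [(utens (tensor_space ?U ?V) ?W [(utens ?U ?V [(k, l)], m)], n)]"
      show "?A (?B ?x) = ?C (?D (?E ?x))"
        unfolding p1[OF q[OF q[OF k l] m] n] restrict_apply'[OF n] assoc_map_pure[OF v(1-3) k l m]
          assoc_map_pure[OF v(1) ten[OF v(2,3)] v(4) k q[OF l m] n] p2[OF k q[OF q[OF l m] n]] restrict_apply'[OF k]
          assoc_map_pure[OF v(2-4) l m n] assoc_map_pure[OF ten[OF v(1,2)] v(3,4) q[OF k l] m n]
          assoc_map_pure[OF v(1,2) ten[OF v(3,4)] k l q[OF m n]] ..
    qed (intro ten v)
    then show "Cmp (YD H) (Assoc (YD H) K L (TenO (YD H) M N)) (Assoc (YD H) (TenO (YD H) K L) M N) =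
      Cmp (YD H) (TenA (YD H) (Ide (YD H) K) (Assoc (YD H) L M N))
        (Cmp (YD H) (Assoc (YD H) K (TenO (YD H) L M) N) (TenA (YD H) (Assoc (YD H) K L M) (Ide (YD H) N)))"
      by (auto simp: YD_simps yd_tensor_space compose_eq intro!: extensionalityI[OF compose_extensional compose_extensional])
  qed
qed

lemma braided_T_category_YD: "braided_T_category (aut_group H) (YD H :: (_, ('k, 'h, 'a) yd_obj, _) T_cat)"
proof -
  interpret G: group "aut_group H" by (rule group_aut_group)
  interpret C: monoidal_category "YD H :: (_, ('k, 'h, 'a) yd_obj, _) T_cat" by (rule monoidal_category_YD)
  note [simp del] = aut_group_simps carrier_aut_group
  note ix = yd_index_in
  have fun_ok: "strict_monoidal_functor (YD H) (YD H) (PhiO (YD H) b) (PhiA (YD H) b)" if b: "b \<in> carrier (aut_group H)" for b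
    unfolding strict_monoidal_functor_def is_functor_def
    using b by (auto simp: YD_simps arrow_YD yd_phi_in yd_phi_hom yd_phi_space yd_phi_tensor yd_phi_unit yd_tensor_in yd_unit_in)
  \<comment> \<open>The composition and unit laws make conjugation a group action, so the inverse
    group element provides the inverse functor.\<close>
  have phi_inv: "yd_phi H (inv\<^bsub>aut_group H\<^esub> b) (yd_phi H b M) = M" "yd_phi H b (yd_phi H (inv\<^bsub>aut_group H\<^esub> b) M) = M"
    if "b \<in> carrier (aut_group H)" "M \<in> yd_objects H" for b M
    using that by (simp_all add: yd_phi_comp[symmetric] yd_phi_one)
  have bijO: "bij_betw (yd_phi H b) (yd_objects H) (yd_objects H)" if b: "b \<in> carrier (aut_group H)" for b
    by (rule bij_betw_byWitness[where f' = "yd_phi H (inv\<^bsub>aut_group H\<^esub> b)"]) (use b in \<open>auto simp: phi_inv yd_phi_in\<close>)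
  have bijA: "bij_betw (PhiA (YD H) b) (Arr (YD H)) (Arr (YD H))" if b: "b \<in> carrier (aut_group H)" for b
    by (rule bij_betw_byWitness[where f' = "PhiA (YD H) (inv\<^bsub>aut_group H\<^esub> b)"])
      (use b in \<open>auto simp: phi_inv yd_phi_in YD_simps yd_phi_hom\<close>)
  have partO: "yd_phi H b ` {M \<in> yd_objects H. yd_index M = a} =
      {M \<in> yd_objects H. yd_index M = b \<otimes>\<^bsub>aut_group H\<^esub> a \<otimes>\<^bsub>aut_group H\<^esub> inv\<^bsub>aut_group H\<^esub> b}"
    if a: "a \<in> carrier (aut_group H)" and b: "b \<in> carrier (aut_group H)" for a b
  proof (intro subset_antisym subsetI)
    fix N assume "N \<in> {M \<in> yd_objects H. yd_index M = b \<otimes>\<^bsub>aut_group H\<^esub> a \<otimes>\<^bsub>aut_group H\<^esub> inv\<^bsub>aut_group H\<^esub> b}"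
    then have N: "N \<in> yd_objects H" "yd_index N = b \<otimes>\<^bsub>aut_group H\<^esub> a \<otimes>\<^bsub>aut_group H\<^esub> inv\<^bsub>aut_group H\<^esub> b" by auto
    have "inv\<^bsub>aut_group H\<^esub> b \<otimes>\<^bsub>aut_group H\<^esub> (b \<otimes>\<^bsub>aut_group H\<^esub> a \<otimes>\<^bsub>aut_group H\<^esub> inv\<^bsub>aut_group H\<^esub> b) \<otimes>\<^bsub>aut_group H\<^esub> inv\<^bsub>aut_group H\<^esub> (inv\<^bsub>aut_group H\<^esub> b) = a"
    proof -
      have "inv\<^bsub>aut_group H\<^esub> b \<otimes>\<^bsub>aut_group H\<^esub> (b \<otimes>\<^bsub>aut_group H\<^esub> a) = a"
        using a b by (simp add: G.m_assoc[symmetric])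
      then show ?thesis using a b by (simp add: G.m_assoc)
    qed
    then have "yd_phi H (inv\<^bsub>aut_group H\<^esub> b) N \<in> {M \<in> yd_objects H. yd_index M = a}"
      using N b by (simp add: yd_phi_in yd_phi_index)
    moreover have "N = yd_phi H b (yd_phi H (inv\<^bsub>aut_group H\<^esub> b) N)"
      using phi_inv(2)[OF b N(1)] by simp
    ultimately show "N \<in> yd_phi H b ` {M \<in> yd_objects H. yd_index M = a}" by blast
  qed (use a b in \<open>auto simp: yd_phi_in yd_phi_index\<close>)
  show ?thesis
  proof
    show "Obj (YD H) = (\<Union>a\<in>carrier (aut_group H). Part (YD H) a)"
      by (auto simp: YD_simps ix)
    show "Part (YD H) a \<inter> Part (YD H) b = {}" if "a \<noteq> b" for a b
      using that by (auto simp: YD_simps)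
    show "Arr (YD H) = (\<Union>a\<in>carrier (aut_group H). part_arrows (YD H) a)"
      by (auto simp: YD_simps part_arrows_def ix yd_homsD(1))
    show "TenO (YD H) U V \<in> Part (YD H) (a \<otimes>\<^bsub>aut_group H\<^esub> b)" if "U \<in> Part (YD H) a" "V \<in> Part (YD H) b" for a b U V
      using that by (auto simp: YD_simps yd_tensor_in yd_tensor_index)
    show "UnitO (YD H) \<in> Part (YD H) \<one>\<^bsub>aut_group H\<^esub>"
      by (simp add: YD_simps yd_unit_in yd_unit_simps(1) aut_group_simps)
    show "invertible_strict_monoidal_functor (YD H) (YD H) (PhiO (YD H) a) (PhiA (YD H) a)" if "a \<in> carrier (aut_group H)" for a
      unfolding invertible_strict_monoidal_functor_def
      using fun_ok[OF that] bijO[OF that] bijA[OF that] by (simp add: YD_simps(1,14))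
    show "PhiO (YD H) (a \<otimes>\<^bsub>aut_group H\<^esub> b) U = PhiO (YD H) a (PhiO (YD H) b U)"
      if "a \<in> carrier (aut_group H)" "b \<in> carrier (aut_group H)" "U \<in> Obj (YD H)" for a b U
      using that by (simp add: YD_simps yd_phi_comp)
    show "PhiA (YD H) (a \<otimes>\<^bsub>aut_group H\<^esub> b) f = PhiA (YD H) a (PhiA (YD H) b f)"
      if "a \<in> carrier (aut_group H)" "b \<in> carrier (aut_group H)" "f \<in> Arr (YD H)" for a b f
      using that by (auto simp: YD_simps yd_phi_comp)
    fix a b assume a: "a \<in> carrier (aut_group H)" and b: "b \<in> carrier (aut_group H)"
    let ?c = "b \<otimes>\<^bsub>aut_group H\<^esub> a \<otimes>\<^bsub>aut_group H\<^esub> inv\<^bsub>aut_group H\<^esub> b"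
    show pO: "PhiO (YD H) b ` Part (YD H) a = Part (YD H) ?c"
      using partO[OF a b] by (simp add: YD_simps)
    show "PhiA (YD H) b ` part_arrows (YD H) a = part_arrows (YD H) ?c"
    proof (intro subset_antisym subsetI)
      fix E assume "E \<in> part_arrows (YD H) ?c"
      then obtain M f N where E: "E = (M, f, N)" "f \<in> yd_homs H M N" and M: "M \<in> Part (YD H) ?c" and N: "N \<in> Part (YD H) ?c"
        by (auto simp: part_arrows_def YD_simps)
      obtain M' N' where M': "M' \<in> Part (YD H) a" "M = yd_phi H b M'" and N': "N' \<in> Part (YD H) a" "N = yd_phi H b N'"
        using M N unfolding pO[unfolded YD_simps(14), symmetric] by blast
      \<comment> \<open>Conjugation does not change the underlying map, so conjugating with the
        inverse of \<open>b\<close> shows that the same \<open>f\<close> is a morphism between the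
        preimages.\<close>
      have "f \<in> yd_homs H M' N'"
        using yd_phi_hom[OF E(2), of "inv\<^bsub>aut_group H\<^esub> b"] M N M' N' b by (simp add: YD_simps phi_inv)
      then have "(M', f, N') \<in> part_arrows (YD H) a" "E = PhiA (YD H) b (M', f, N')"
        using M' N' E by (auto simp: part_arrows_def YD_simps)
      then show "E \<in> PhiA (YD H) b ` part_arrows (YD H) a" by blast
    qed (use a b in \<open>auto simp: part_arrows_def YD_simps yd_phi_in yd_phi_index yd_phi_hom\<close>)
  next
    fix a and M N :: "('k, 'h, 'a) yd_obj" assume a: "a \<in> carrier (aut_group H)" and "M \<in> Part (YD H) a" "N \<in> Obj (YD H)"
    then have M: "M \<in> yd_objects H" "yd_index M = a" and N: "N \<in> yd_objects H" by (auto simp: YD_simps)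
    obtain g where g: "g \<in> yd_homs H (yd_tensor H (yd_phi H (yd_index M) N) M) (yd_tensor H M N)"
      "\<forall>x\<in>carrier (tensor_space (yd_space M) (yd_space N)). g (yd_braid H M N x) = x"
      "\<forall>x\<in>carrier (tensor_space (yd_space N) (yd_space M)). yd_braid H M N (g x) = x"
      using yd_braid_inverse[OF M(1) N] by blast
    note ob = yd_tensor_in[OF M(1) N] yd_tensor_in[OF yd_phi_in[OF N ix[OF M(1)]] M(1)]
    show "iso_arrow (YD H) (TenO (YD H) M N) (TenO (YD H) (PhiO (YD H) a N) M) (Braid (YD H) M N)"
      using iso_arrow_YD(1)[OF yd_braid_hom[OF M(1) N] ob yd_homsD(3)[OF g(1) ob(2,1)]] g(2,3) M(2)
      by (simp add: YD_simps yd_tensor_space yd_phi_space)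
  next
    fix a F E and M M' N N' :: "('k, 'h, 'a) yd_obj" assume a: "a \<in> carrier (aut_group H)" and "M \<in> Part (YD H) a" "arrow (YD H) M M' F" "arrow (YD H) N N' E"
    then obtain f g where ob: "M \<in> yd_objects H" "M' \<in> yd_objects H" "N \<in> yd_objects H" "N' \<in> yd_objects H"
      and f: "f \<in> yd_homs H M M'" "g \<in> yd_homs H N N'" and F: "F = (M, f, M')" "E = (N, g, N')" and i: "yd_index M = a"
      by (auto simp: arrow_YD YD_simps)
    have i': "yd_index M' = a" using yd_homsD(1)[OF f(1) ob(1,2)] i by simp
    show "Cmp (YD H) (Braid (YD H) M' N') (TenA (YD H) F E) = Cmp (YD H) (TenA (YD H) (PhiA (YD H) a E) F) (Braid (YD H) M N)"
      using yd_braid_natural[OF ob f] unfolding F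
      by (auto simp: YD_simps i i' yd_tensor_space yd_phi_space compose_eq intro!: extensionalityI[OF compose_extensional compose_extensional])
  next
    fix a b and L M N :: "('k, 'h, 'a) yd_obj" assume a: "a \<in> carrier (aut_group H)" and b: "b \<in> carrier (aut_group H)"
      and "L \<in> Part (YD H) a" "M \<in> Part (YD H) b" "N \<in> Obj (YD H)"
    then have ob: "L \<in> yd_objects H" "M \<in> yd_objects H" "N \<in> yd_objects H" and i: "yd_index L = a" "yd_index M = b"
      by (auto simp: YD_simps)
    note bN = yd_phi_in[OF ob(3) b]
    have ext: "yd_braid H P Q \<in> extensional (carrier (tensor_space (yd_space P) (yd_space Q)))" for P Q
      by (simp add: yd_braid_def split: prod.split)
    show "Braid (YD H) (TenO (YD H) L M) N =
        Cmp (YD H) (Assoc (YD H) (PhiO (YD H) a (PhiO (YD H) b N)) L M)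
        (Cmp (YD H) (TenA (YD H) (Braid (YD H) L (PhiO (YD H) b N)) (Ide (YD H) M))
        (Cmp (YD H) (inv_arrow (YD H) (Assoc (YD H) L (PhiO (YD H) b N) M))
        (Cmp (YD H) (TenA (YD H) (Ide (YD H) L) (Braid (YD H) M N))
          (Assoc (YD H) L M N))))"
      unfolding YD_simps(7,14) yd_assoc_inverse(2)[OF ob(1) bN ob(2)]
      using yd_braid_tensor_left[OF ob]
      by (auto simp: YD_simps i yd_tensor_space yd_phi_space yd_tensor_index yd_phi_comp[OF ob(3) a b] compose_eq
          intro!: extensionalityI[OF ext[of "yd_tensor H L M" N, unfolded yd_tensor_space] compose_extensional])
  next
    fix a and L M N :: "('k, 'h, 'a) yd_obj" assume a: "a \<in> carrier (aut_group H)"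
      and "L \<in> Part (YD H) a" "M \<in> Obj (YD H)" "N \<in> Obj (YD H)"
    then have ob: "L \<in> yd_objects H" "M \<in> yd_objects H" "N \<in> yd_objects H" and i: "yd_index L = a"
      by (auto simp: YD_simps)
    note aM = yd_phi_in[OF ob(2) a] and aN = yd_phi_in[OF ob(3) a]
    have ext: "yd_braid H P Q \<in> extensional (carrier (tensor_space (yd_space P) (yd_space Q)))" for P Q
      by (simp add: yd_braid_def split: prod.split)
    show "Braid (YD H) L (TenO (YD H) M N) =
        Cmp (YD H) (inv_arrow (YD H) (Assoc (YD H) (PhiO (YD H) a M) (PhiO (YD H) a N) L))
        (Cmp (YD H) (TenA (YD H) (Ide (YD H) (PhiO (YD H) a M)) (Braid (YD H) L N))
        (Cmp (YD H) (Assoc (YD H) (PhiO (YD H) a M) L N)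
        (Cmp (YD H) (TenA (YD H) (Braid (YD H) L M) (Ide (YD H) N))
          (inv_arrow (YD H) (Assoc (YD H) L M N)))))"
      unfolding YD_simps(7,14) yd_assoc_inverse(2)[OF ob] yd_assoc_inverse(2)[OF aM aN ob(1)]
      using yd_braid_tensor_right[OF ob]
      by (auto simp: YD_simps i yd_tensor_space yd_phi_space yd_phi_tensor[OF ob(2,3) a] compose_eq
          intro!: extensionalityI[OF ext[of L "yd_tensor H M N", unfolded yd_tensor_space] compose_extensional])
  next
    fix b and M N :: "('k, 'h, 'a) yd_obj" assume b: "b \<in> carrier (aut_group H)" and "M \<in> Obj (YD H)" "N \<in> Obj (YD H)"
    then have M: "M \<in> yd_objects H" and N: "N \<in> yd_objects H" by (auto simp: YD_simps)
    \<comment> \<open>The codomains agree because \<open>N\<close> is twisted by \<open>b a\<close>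
      on one side and by \<open>(b a b^{-1}) b\<close> on the other, where \<open>a\<close> is the
      index of \<open>M\<close>.\<close>
    show "PhiA (YD H) b (Braid (YD H) M N) = Braid (YD H) (PhiO (YD H) b M) (PhiO (YD H) b N)"
      using yd_phi_comp[OF N b ix[OF M]] yd_phi_comp[OF N _ b, of "yd_index (yd_phi H b M)"] b ix[OF M] ix[OF N]
      by (simp add: YD_simps yd_phi_tensor[OF M N b] yd_phi_tensor[OF yd_phi_in[OF N ix[OF M]] M b] yd_braid_phi[OF M N b] yd_phi_index G.m_assoc)
  qed
qed

end

section \<open>Transport along an isomorphism\<close>

text \<open>Only \<open>C\<close> is assumed to satisfy the axioms; \<open>D\<close> acquires them
  because each of its objects and arrows is an image and all operations are respected.\<close>

locale braided_T_transfer = braided_T_category G C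
  for G :: "('g, 'y) monoid_scheme" and C :: "('g, 'o, 'm, 'z) T_cat_scheme" +
  fixes D :: "('g, 'p, 'n, 'x) T_cat_scheme" and FO :: "'o \<Rightarrow> 'p" and FA :: "'m \<Rightarrow> 'n"
  assumes iso: "braided_T_iso G C D FO FA"
begin

lemma bijO: "bij_betw FO (Obj C) (Obj D)" and bijA: "bij_betw FA (Arr C) (Arr D)"
  using iso by (auto simp: braided_T_iso_def invertible_strict_monoidal_functor_def)

lemma FO_inj [simp]: "a \<in> Obj C \<Longrightarrow> b \<in> Obj C \<Longrightarrow> FO a = FO b \<longleftrightarrow> a = b"
  using bijO by (auto simp: bij_betw_def inj_on_def)

lemma FA_inj [simp]: "f \<in> Arr C \<Longrightarrow> g \<in> Arr C \<Longrightarrow> FA f = FA g \<longleftrightarrow> f = g"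
  using bijA by (auto simp: bij_betw_def inj_on_def)

lemma ObjD: "Obj D = FO ` Obj C" and ArrD: "Arr D = FA ` Arr C"
  using bijO bijA by (auto simp: bij_betw_def)

lemma PartD: "a \<in> carrier G \<Longrightarrow> Part D a = FO ` Part C a"
  and part_arrowsD: "a \<in> carrier G \<Longrightarrow> part_arrows D a = FA ` part_arrows C a"
  using iso by (auto simp: braided_T_iso_def)

lemma Part_Obj: "a \<in> carrier G \<Longrightarrow> U \<in> Part C a \<Longrightarrow> U \<in> Obj C"
  using obj_union by blast

lemma C_simps [simp]:
  "f \<in> Arr C \<Longrightarrow> Dom C f \<in> Obj C" "f \<in> Arr C \<Longrightarrow> Cod C f \<in> Obj C"
  "a \<in> Obj C \<Longrightarrow> Ide C a \<in> Arr C" "a \<in> Obj C \<Longrightarrow> Dom C (Ide C a) = a" "a \<in> Obj C \<Longrightarrow> Cod C (Ide C a) = a"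
  "f \<in> Arr C \<Longrightarrow> g \<in> Arr C \<Longrightarrow> Dom C g = Cod C f \<Longrightarrow> Cmp C g f \<in> Arr C"
  "f \<in> Arr C \<Longrightarrow> g \<in> Arr C \<Longrightarrow> Dom C g = Cod C f \<Longrightarrow> Dom C (Cmp C g f) = Dom C f"
  "f \<in> Arr C \<Longrightarrow> g \<in> Arr C \<Longrightarrow> Dom C g = Cod C f \<Longrightarrow> Cod C (Cmp C g f) = Cod C g"
  "a \<in> Obj C \<Longrightarrow> b \<in> Obj C \<Longrightarrow> TenO C a b \<in> Obj C" "UnitO C \<in> Obj C"
  "f \<in> Arr C \<Longrightarrow> g \<in> Arr C \<Longrightarrow> TenA C f g \<in> Arr C"
  "f \<in> Arr C \<Longrightarrow> g \<in> Arr C \<Longrightarrow> Dom C (TenA C f g) = TenO C (Dom C f) (Dom C g)"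
  "f \<in> Arr C \<Longrightarrow> g \<in> Arr C \<Longrightarrow> Cod C (TenA C f g) = TenO C (Cod C f) (Cod C g)"
  using dom_cod[of f] ide[of a] cmp[of "Dom C f" "Cod C f" f "Cod C g" g] tenO[of a b] unitO
    tenA[of "Dom C f" "Cod C f" f "Dom C g" "Cod C g" g]
  by (auto simp: arrow_def)

lemma iso_arrowD:
  assumes "iso_arrow C a b f"
  shows "f \<in> Arr C" "Dom C f = a" "Cod C f = b" "inverse_arrows C f (inv_arrow C f)"
    "inv_arrow C f \<in> Arr C" "Dom C (inv_arrow C f) = b" "Cod C (inv_arrow C f) = a"
proof -
  obtain g where g: "inverse_arrows C f g" using assms by (auto simp: iso_arrow_def)
  then have *: "inv_arrow C f = g" by (rule inv_arrow_eq[OF category_axioms])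
  show "f \<in> Arr C" "Dom C f = a" "Cod C f = b" "inverse_arrows C f (inv_arrow C f)"
    "inv_arrow C f \<in> Arr C" "Dom C (inv_arrow C f) = b" "Cod C (inv_arrow C f) = a"
    using assms g unfolding * by (auto simp: iso_arrow_def arrow_def inverse_arrows_def)
qed

lemmas C_simps2 [simp] = iso_arrowD(1-3,5-7)[OF assoc_iso] iso_arrowD(1-3)[OF lunit_iso] iso_arrowD(1-3)[OF runit_iso]

lemma Phi_simps [simp]:
  assumes "a \<in> carrier G"
  shows "U \<in> Obj C \<Longrightarrow> PhiO C a U \<in> Obj C" "f \<in> Arr C \<Longrightarrow> PhiA C a f \<in> Arr C"
    "f \<in> Arr C \<Longrightarrow> Dom C (PhiA C a f) = PhiO C a (Dom C f)" "f \<in> Arr C \<Longrightarrow> Cod C (PhiA C a f) = PhiO C a (Cod C f)"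
  using phi_functor[OF assms]
  by (auto simp: invertible_strict_monoidal_functor_def strict_monoidal_functor_def is_functor_def arrow_def)

lemma Braid_simps [simp]:
  assumes "U \<in> Obj C" "V \<in> Obj C"
  shows "Braid C U V \<in> Arr C" "Dom C (Braid C U V) = TenO C U V"
    and "a \<in> carrier G \<Longrightarrow> U \<in> Part C a \<Longrightarrow> Cod C (Braid C U V) = TenO C (PhiO C a V) U"
proof -
  obtain c where c: "c \<in> carrier G" "U \<in> Part C c" using assms(1) obj_union by blast
  show "Braid C U V \<in> Arr C" "Dom C (Braid C U V) = TenO C U V"
    using iso_arrowD(1,2)[OF braid_iso[OF c assms(2)]] .
  show "a \<in> carrier G \<Longrightarrow> U \<in> Part C a \<Longrightarrow> Cod C (Braid C U V) = TenO C (PhiO C a V) U"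
    by (rule iso_arrowD(3)[OF braid_iso]) (use assms in auto)
qed

text \<open>Oriented so that operations of \<open>D\<close> on images become images of operations of
  \<open>C\<close>; an axiom for \<open>D\<close> is thereby rewritten to the image of the same
  axiom for \<open>C\<close>.\<close>

lemma F_simps [simp]:
  "f \<in> Arr C \<Longrightarrow> Dom D (FA f) = FO (Dom C f)" "f \<in> Arr C \<Longrightarrow> Cod D (FA f) = FO (Cod C f)"
  "a \<in> Obj C \<Longrightarrow> Ide D (FO a) = FA (Ide C a)"
  "f \<in> Arr C \<Longrightarrow> g \<in> Arr C \<Longrightarrow> Dom C g = Cod C f \<Longrightarrow> Cmp D (FA g) (FA f) = FA (Cmp C g f)"
  "a \<in> Obj C \<Longrightarrow> b \<in> Obj C \<Longrightarrow> TenO D (FO a) (FO b) = FO (TenO C a b)"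
  "f \<in> Arr C \<Longrightarrow> g \<in> Arr C \<Longrightarrow> TenA D (FA f) (FA g) = FA (TenA C f g)"
  "UnitO D = FO (UnitO C)"
  "a \<in> Obj C \<Longrightarrow> b \<in> Obj C \<Longrightarrow> c \<in> Obj C \<Longrightarrow> Assoc D (FO a) (FO b) (FO c) = FA (Assoc C a b c)"
  "a \<in> Obj C \<Longrightarrow> LUnit D (FO a) = FA (LUnit C a)" "a \<in> Obj C \<Longrightarrow> RUnit D (FO a) = FA (RUnit C a)"
  "x \<in> carrier G \<Longrightarrow> a \<in> Obj C \<Longrightarrow> PhiO D x (FO a) = FO (PhiO C x a)"
  "x \<in> carrier G \<Longrightarrow> f \<in> Arr C \<Longrightarrow> PhiA D x (FA f) = FA (PhiA C x f)"
  "a \<in> Obj C \<Longrightarrow> b \<in> Obj C \<Longrightarrow> Braid D (FO a) (FO b) = FA (Braid C a b)"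
proof -
  have *: "strict_monoidal_functor C D FO FA"
    "\<forall>b\<in>carrier G. (\<forall>U\<in>Obj C. FO (PhiO C b U) = PhiO D b (FO U)) \<and> (\<forall>f\<in>Arr C. FA (PhiA C b f) = PhiA D b (FA f))"
    "\<forall>U\<in>Obj C. \<forall>V\<in>Obj C. FA (Braid C U V) = Braid D (FO U) (FO V)"
    using iso unfolding braided_T_iso_def invertible_strict_monoidal_functor_def by blast+
  then have f: "is_functor C D FO FA" unfolding strict_monoidal_functor_def by blast
  show "f \<in> Arr C \<Longrightarrow> Dom D (FA f) = FO (Dom C f)" "f \<in> Arr C \<Longrightarrow> Cod D (FA f) = FO (Cod C f)"
    "a \<in> Obj C \<Longrightarrow> Ide D (FO a) = FA (Ide C a)"
    "f \<in> Arr C \<Longrightarrow> g \<in> Arr C \<Longrightarrow> Dom C g = Cod C f \<Longrightarrow> Cmp D (FA g) (FA f) = FA (Cmp C g f)"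
    using f unfolding is_functor_def arrow_def by metis+
  show "a \<in> Obj C \<Longrightarrow> b \<in> Obj C \<Longrightarrow> TenO D (FO a) (FO b) = FO (TenO C a b)"
    "f \<in> Arr C \<Longrightarrow> g \<in> Arr C \<Longrightarrow> TenA D (FA f) (FA g) = FA (TenA C f g)"
    "UnitO D = FO (UnitO C)"
    "a \<in> Obj C \<Longrightarrow> b \<in> Obj C \<Longrightarrow> c \<in> Obj C \<Longrightarrow> Assoc D (FO a) (FO b) (FO c) = FA (Assoc C a b c)"
    "a \<in> Obj C \<Longrightarrow> LUnit D (FO a) = FA (LUnit C a)" "a \<in> Obj C \<Longrightarrow> RUnit D (FO a) = FA (RUnit C a)"
    using *(1) unfolding strict_monoidal_functor_def by metis+
  show "x \<in> carrier G \<Longrightarrow> a \<in> Obj C \<Longrightarrow> PhiO D x (FO a) = FO (PhiO C x a)"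
    "x \<in> carrier G \<Longrightarrow> f \<in> Arr C \<Longrightarrow> PhiA D x (FA f) = FA (PhiA C x f)"
    "a \<in> Obj C \<Longrightarrow> b \<in> Obj C \<Longrightarrow> Braid D (FO a) (FO b) = FA (Braid C a b)"
    using *(2,3) by metis+
qed

lemma F_in [simp]: "a \<in> Obj C \<Longrightarrow> FO a \<in> Obj D" "f \<in> Arr C \<Longrightarrow> FA f \<in> Arr D"
  by (auto simp: ObjD ArrD)

lemma arrow_F: "arrow C a b f \<Longrightarrow> arrow D (FO a) (FO b) (FA f)"
  by (auto simp: arrow_def)

lemma arrow_DE:
  assumes "arrow D x y g"
  obtains f where "f \<in> Arr C" "g = FA f" "x = FO (Dom C f)" "y = FO (Cod C f)" "arrow C (Dom C f) (Cod C f) f"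
  using assms by (auto simp: arrow_def ArrD)

lemma category_D: "category D"
proof
  fix f assume "f \<in> Arr D"
  then show "Dom D f \<in> Obj D \<and> Cod D f \<in> Obj D" by (auto simp: ArrD)
next
  fix a assume "a \<in> Obj D"
  then show "arrow D a a (Ide D a)" by (auto simp: ObjD arrow_def)
next
  fix a b c f g assume "arrow D a b f" "arrow D b c g"
  then show "arrow D a c (Cmp D g f)"
    by (elim arrow_DE) (simp add: arrow_def)
next
  fix a b f assume "arrow D a b f"
  then show "Cmp D f (Ide D a) = f" "Cmp D (Ide D b) f = f"
    by (elim arrow_DE; simp add: cmp_ide ide_cmp)+
next
  fix a b c d f g h assume "arrow D a b f" "arrow D b c g" "arrow D c d h"
  then show "Cmp D h (Cmp D g f) = Cmp D (Cmp D h g) f"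
    by (elim arrow_DE) (simp add: cmp_assoc arrow_def)
qed

lemma inverse_arrows_F: "inverse_arrows C f g \<Longrightarrow> inverse_arrows D (FA f) (FA g)"
  by (auto simp: inverse_arrows_def)

lemma iso_arrow_F: "iso_arrow C a b f \<Longrightarrow> iso_arrow D (FO a) (FO b) (FA f)"
  using inverse_arrows_F arrow_F by (auto simp: iso_arrow_def)

lemma inv_arrow_F: "iso_arrow C a b f \<Longrightarrow> inv_arrow D (FA f) = FA (inv_arrow C f)"
  by (intro inv_arrow_eq category_D inverse_arrows_F iso_arrowD(4))

lemma monoidal_category_D: "monoidal_category D"
proof -
  interpret category D by (rule category_D)
  show ?thesis
  proof
    show "UnitO D \<in> Obj D" by simp
  next
    fix a b assume "a \<in> Obj D" "b \<in> Obj D"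
    then show "TenO D a b \<in> Obj D" "TenA D (Ide D a) (Ide D b) = Ide D (TenO D a b)"
      "Cmp D (TenA D (Ide D a) (LUnit D b)) (Assoc D a (UnitO D) b) = TenA D (RUnit D a) (Ide D b)"
      by (auto simp: ObjD tenA_ide triangle)
  next
    fix a b f a' b' f' assume "arrow D a b f" "arrow D a' b' f'"
    then show "arrow D (TenO D a a') (TenO D b b') (TenA D f f')"
      by (elim arrow_DE) (simp add: arrow_def)
  next
    fix a b f c g a' b' f' c' g'
    assume "arrow D a b f" "arrow D b c g" "arrow D a' b' f'" "arrow D b' c' g'"
    then show "TenA D (Cmp D g f) (Cmp D g' f') = Cmp D (TenA D g g') (TenA D f f')"
      by (elim arrow_DE) (simp add: tenA_cmp arrow_def)
  next
    fix a b c assume "a \<in> Obj D" "b \<in> Obj D" "c \<in> Obj D"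
    then show "iso_arrow D (TenO D (TenO D a b) c) (TenO D a (TenO D b c)) (Assoc D a b c)"
      by (auto simp: ObjD dest: iso_arrow_F[OF assoc_iso])
  next
    fix a a' f b b' g c c' h assume "arrow D a a' f" "arrow D b b' g" "arrow D c c' h"
    then show "Cmp D (Assoc D a' b' c') (TenA D (TenA D f g) h) = Cmp D (TenA D f (TenA D g h)) (Assoc D a b c)"
      by (elim arrow_DE) (simp add: assoc_natural)
  next
    fix a assume "a \<in> Obj D"
    then show "iso_arrow D (TenO D (UnitO D) a) a (LUnit D a)" "iso_arrow D (TenO D a (UnitO D)) a (RUnit D a)"
      by (auto simp: ObjD dest: iso_arrow_F[OF lunit_iso] iso_arrow_F[OF runit_iso])
  next
    fix a b f assume "arrow D a b f"
    then show "Cmp D (LUnit D b) (TenA D (Ide D (UnitO D)) f) = Cmp D f (LUnit D a)"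
      "Cmp D (RUnit D b) (TenA D f (Ide D (UnitO D))) = Cmp D f (RUnit D a)"
      by (elim arrow_DE; simp add: lunit_natural runit_natural)+
  next
    fix a b c d assume "a \<in> Obj D" "b \<in> Obj D" "c \<in> Obj D" "d \<in> Obj D"
    then show "Cmp D (Assoc D a b (TenO D c d)) (Assoc D (TenO D a b) c d) =
      Cmp D (TenA D (Ide D a) (Assoc D b c d))
        (Cmp D (Assoc D a (TenO D b c) d) (TenA D (Assoc D a b c) (Ide D d)))"
      by (auto simp: ObjD pentagon)
  qed
qed

lemma phi_functor_D:
  assumes b: "b \<in> carrier G"
  shows "invertible_strict_monoidal_functor D D (PhiO D b) (PhiA D b)"
proof -
  note ph = phi_functor[OF b, unfolded invertible_strict_monoidal_functor_def strict_monoidal_functor_def is_functor_def]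
  have 1: "PhiA D b (FA (Ide C a)) = FA (Ide C (PhiO C b a))" if "a \<in> Obj C" for a
    using that ph b by simp
  have "strict_monoidal_functor D D (PhiO D b) (PhiA D b)"
    using ph b unfolding strict_monoidal_functor_def is_functor_def
    by (auto simp: ObjD ArrD arrow_def)
  moreover have "bij_betw (PhiO D b) (Obj D) (Obj D)"
  proof -
    have p: "bij_betw (PhiO C b) (Obj C) (Obj C)" using ph by blast
    have "inj_on (PhiO D b) (Obj D)"
      using p b by (auto simp: ObjD inj_on_def bij_betw_def)
    moreover have "PhiO D b ` Obj D = FO ` PhiO C b ` Obj C"
      using b by (auto simp: ObjD image_image)
    ultimately show ?thesis using p by (simp add: bij_betw_def ObjD)
  qed
  moreover have "bij_betw (PhiA D b) (Arr D) (Arr D)"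
  proof -
    have p: "bij_betw (PhiA C b) (Arr C) (Arr C)" using ph by blast
    have "inj_on (PhiA D b) (Arr D)"
      using p b by (auto simp: ArrD inj_on_def bij_betw_def)
    moreover have "PhiA D b ` Arr D = FA ` PhiA C b ` Arr C"
      using b by (auto simp: ArrD image_image)
    ultimately show ?thesis using p by (simp add: bij_betw_def ArrD)
  qed
  ultimately show ?thesis by (simp add: invertible_strict_monoidal_functor_def)
qed

lemma braided_T_category_D: "braided_T_category G D"
proof -
  interpret D: monoidal_category D by (rule monoidal_category_D)
  show ?thesis
  proof
    show "Obj D = (\<Union>a\<in>carrier G. Part D a)"
      unfolding ObjD obj_union by (auto simp: PartD)
    show "Part D a \<inter> Part D b = {}" if "a \<in> carrier G" "b \<in> carrier G" "a \<noteq> b" for a b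
      using obj_disjoint[OF that] that Part_Obj by (fastforce simp: PartD)
    show "Arr D = (\<Union>a\<in>carrier G. part_arrows D a)"
      unfolding ArrD arr_union by (auto simp: part_arrowsD)
    show "UnitO D \<in> Part D \<one>\<^bsub>G\<^esub>"
      using part_unit by (simp add: PartD)
    fix a b assume a: "a \<in> carrier G" and b: "b \<in> carrier G"
    show "TenO D U V \<in> Part D (a \<otimes>\<^bsub>G\<^esub> b)" if "U \<in> Part D a" "V \<in> Part D b" for U V
      using that a b part_ten[OF a b] Part_Obj by (auto simp: PartD)
    show "PhiO D (a \<otimes>\<^bsub>G\<^esub> b) U = PhiO D a (PhiO D b U)" if "U \<in> Obj D" for U
      using that a b phi_hom_obj[OF a b] by (auto simp: ObjD)
    show "PhiA D (a \<otimes>\<^bsub>G\<^esub> b) f = PhiA D a (PhiA D b f)" if "f \<in> Arr D" for f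
      using that a b phi_hom_arr[OF a b] by (auto simp: ArrD)
    have "PhiO D b ` FO ` Part C a = FO ` PhiO C b ` Part C a"
      using a b Part_Obj by (auto simp: image_image intro!: image_cong)
    then show "PhiO D b ` Part D a = Part D (b \<otimes>\<^bsub>G\<^esub> a \<otimes>\<^bsub>G\<^esub> inv\<^bsub>G\<^esub> b)"
      using a b phi_part_obj[OF a b] by (simp add: PartD)
    have "PhiA D b ` FA ` part_arrows C a = FA ` PhiA C b ` part_arrows C a"
      unfolding image_image using b by (intro image_cong) (auto simp: part_arrows_def)
    then show "PhiA D b ` part_arrows D a = part_arrows D (b \<otimes>\<^bsub>G\<^esub> a \<otimes>\<^bsub>G\<^esub> inv\<^bsub>G\<^esub> b)"
      using a b phi_part_arr[OF a b] by (simp add: part_arrowsD)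
  next
    show "invertible_strict_monoidal_functor D D (PhiO D a) (PhiA D a)" if "a \<in> carrier G" for a
      using that by (rule phi_functor_D)
  next
    fix a U V assume a: "a \<in> carrier G" and "U \<in> Part D a" "V \<in> Obj D"
    then obtain u v where u: "u \<in> Part C a" "u \<in> Obj C" "U = FO u" and v: "v \<in> Obj C" "V = FO v"
      using Part_Obj by (auto simp: PartD ObjD)
    show "iso_arrow D (TenO D U V) (TenO D (PhiO D a V) U) (Braid D U V)"
      using iso_arrow_F[OF braid_iso[OF a u(1) v(1)]] a u v by simp
  next
    fix a U U' f V V' g assume a: "a \<in> carrier G" and U: "U \<in> Part D a" and "arrow D U U' f" "arrow D V V' g"
    then obtain f' g' where f: "f' \<in> Arr C" "f = FA f'" "U = FO (Dom C f')" "U' = FO (Cod C f')" "arrow C (Dom C f') (Cod C f') f'"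
      and g: "g' \<in> Arr C" "g = FA g'" "V = FO (Dom C g')" "V' = FO (Cod C g')" "arrow C (Dom C g') (Cod C g') g'"
      by (elim arrow_DE) blast
    have u: "Dom C f' \<in> Part C a"
      using U a f Part_Obj by (auto simp: PartD)
    \<comment> \<open>An arrow lies in a single component, so its codomain has index
      \<open>a\<close> as well; the codomain of the braiding at \<open>U'\<close> depends on that
      index.\<close>
    obtain c where "c \<in> carrier G" "f' \<in> part_arrows C c" using f(1) arr_union by blast
    then have u': "Cod C f' \<in> Part C a"
      using obj_disjoint[of c a] a u by (auto simp: part_arrows_def)
    show "Cmp D (Braid D U' V') (TenA D f g) = Cmp D (TenA D (PhiA D a g) f) (Braid D U V)"
      using braid_natural[OF a u f(5) g(5)] f(1-4) g(1-4) a u u' by simp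
  next
    fix a b U V W assume a: "a \<in> carrier G" and b: "b \<in> carrier G" and "U \<in> Part D a" "V \<in> Part D b" "W \<in> Obj D"
    then obtain u v w where u: "u \<in> Part C a" "u \<in> Obj C" "U = FO u" and v: "v \<in> Part C b" "v \<in> Obj C" "V = FO v"
      and w: "w \<in> Obj C" "W = FO w"
      using Part_Obj by (auto simp: PartD ObjD)
    show "Braid D (TenO D U V) W =
        Cmp D (Assoc D (PhiO D a (PhiO D b W)) U V)
        (Cmp D (TenA D (Braid D U (PhiO D b W)) (Ide D V))
        (Cmp D (inv_arrow D (Assoc D U (PhiO D b W) V))
        (Cmp D (TenA D (Ide D U) (Braid D V W))
          (Assoc D U V W))))"
      using a b u v w braid_ten_left[OF a b u(1) v(1) w(1)] by (simp add: inv_arrow_F[OF assoc_iso])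
  next
    fix a U V W assume a: "a \<in> carrier G" and "U \<in> Part D a" "V \<in> Obj D" "W \<in> Obj D"
    then obtain u v w where u: "u \<in> Part C a" "u \<in> Obj C" "U = FO u" and v: "v \<in> Obj C" "V = FO v"
      and w: "w \<in> Obj C" "W = FO w"
      using Part_Obj by (auto simp: PartD ObjD)
    show "Braid D U (TenO D V W) =
        Cmp D (inv_arrow D (Assoc D (PhiO D a V) (PhiO D a W) U))
        (Cmp D (TenA D (Ide D (PhiO D a V)) (Braid D U W))
        (Cmp D (Assoc D (PhiO D a V) U W)
        (Cmp D (TenA D (Braid D U V) (Ide D W))
          (inv_arrow D (Assoc D U V W)))))"
      using a u v w braid_ten_right[OF a u(1) v(1) w(1)] by (simp add: inv_arrow_F[OF assoc_iso])
  next
    fix b U V assume "b \<in> carrier G" "U \<in> Obj D" "V \<in> Obj D"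
    then show "PhiA D b (Braid D U V) = Braid D (PhiO D b U) (PhiO D b V)"
      by (auto simp: ObjD braid_phi)
  qed
qed

lemma braided_T_iso_inverse:
  "braided_T_iso G D C (inv_into (Obj C) FO) (inv_into (Arr C) FA)"
proof -
  let ?O = "inv_into (Obj C) FO" and ?A = "inv_into (Arr C) FA"
  have [simp]: "?O (FO a) = a" if "a \<in> Obj C" for a
    using that bijO by (simp add: bij_betw_def)
  have [simp]: "?A (FA f) = f" if "f \<in> Arr C" for f
    using that bijA by (simp add: bij_betw_def)
  have "strict_monoidal_functor D C ?O ?A"
    unfolding strict_monoidal_functor_def is_functor_def by (auto simp: ObjD ArrD arrow_def)
  moreover have "bij_betw ?O (Obj D) (Obj C)" "bij_betw ?A (Arr D) (Arr C)"
    using bijO bijA by (auto intro: bij_betw_inv_into)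
  moreover have "?O ` FO ` Part C a = Part C a" "?A ` FA ` part_arrows C a = part_arrows C a" if "a \<in> carrier G" for a
    unfolding image_image using that Part_Obj by (auto simp: part_arrows_def)
  ultimately show ?thesis
    unfolding braided_T_iso_def invertible_strict_monoidal_functor_def
    by (auto simp: ObjD ArrD PartD part_arrowsD)
qed

end

section \<open>Yetter-Drinfeld modules and representations of \<open>DT(H)\<close>\<close>

locale fd_hopf_algebra = hopf_algebra_bij H for H :: "('k::field, 'h::ring_1) hopf_data" +
  fixes B :: "'h set"
  assumes fd: "finite_dimensional_vector_space (scl H) B"
begin

abbreviation "H' \<equiv> dual H"
abbreviation "\<Delta> \<equiv> comul H"

lemma dual_simps [simp]:
  "p \<in> carrier H' \<longleftrightarrow> lform A p" "mult H' = convolution H" "one H' = counit H" "zero H' = (\<lambda>h. 0)"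
  "add H' p q = (\<lambda>h. p h + q h)" "smult H' c p = (\<lambda>h. c * p h)"
  by (simp_all add: dual_def lform_alg_iff)

lemma vsp_dual [simp, intro]: "vsp H'"
  by (rule vspI) (auto simp: lform_def algebra_simps fun_eq_iff)

lemma lform_eval: "lform H' (\<lambda>p. p a)"
  by (simp add: lform_def)

lemma lhom_dual_app: "e \<in> lhom X H' \<Longrightarrow> lform X (\<lambda>x. e x a)"
  by (rule lform_comp[OF lform_eval])

lemma lhom_dualI:
  assumes "\<And>x. x \<in> carrier X \<Longrightarrow> lform A (\<phi> x)" "\<And>a. lform X (\<lambda>x. \<phi> x a)"
  shows "\<phi> \<in> lhom X H'"
  using assms(1) lformD[OF assms(2)] by (auto simp: lhom_iff)

lemma convolution_eq: "convolution H p q h = tsum (\<Delta> h) (\<lambda>a b. p a * q b)"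
  by (simp add: convolution_def tsum_def)

lemma lform_convolution: "lform A p \<Longrightarrow> lform A q \<Longrightarrow> lform A (convolution H p q)"
  unfolding convolution_eq[abs_def] by (intro lin; simp)

lemma convolution_counit [simp]:
  "lform A p \<Longrightarrow> convolution H (counit H) p = p" "lform A p \<Longrightarrow> convolution H p (counit H) = p"
  using counit_left'[of p] counit_right'[of p] by (auto simp: convolution_eq fun_eq_iff mult.commute)

lemma twist_eq: "rharp (lharp a q) b l = q (b * l * a)"
  by (simp add: rharp_def lharp_def)

lemma lform_twist: "lform A q \<Longrightarrow> lform A (rharp (lharp a q) b)"
  unfolding twist_eq[abs_def] by (rule lform_comp[of A q], assumption, intro lin)

lemma lhom_dual_rules:
  "e \<in> lhom X H' \<Longrightarrow> lform A q \<Longrightarrow> (\<lambda>x. convolution H (e x) q) \<in> lhom X H'"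
  "e \<in> lhom X H' \<Longrightarrow> lform A q \<Longrightarrow> (\<lambda>x. convolution H q (e x)) \<in> lhom X H'"
  "e \<in> lhom X H' \<Longrightarrow> (\<lambda>x. rharp (lharp a (e x)) b) \<in> lhom X H'"
  "e' \<in> lhom X A \<Longrightarrow> lform A q \<Longrightarrow> (\<lambda>x. rharp (lharp (e' x) q) b) \<in> lhom X H'"
  "e' \<in> lhom X A \<Longrightarrow> lform A q \<Longrightarrow> (\<lambda>x. rharp (lharp a q) (e' x)) \<in> lhom X H'"
proof -
  assume e: "e \<in> lhom X H'"
  have e': "lform A (e x)" if "x \<in> carrier X" for x using lhomD(1)[OF e that] by simp
  show "(\<lambda>x. rharp (lharp a (e x)) b) \<in> lhom X H'"
    by (rule lhom_dualI) (simp_all add: lform_twist e' twist_eq lhom_dual_app[OF e])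
  assume q: "lform A q"
  show "(\<lambda>x. convolution H (e x) q) \<in> lhom X H'"
    by (rule lhom_dualI) (simp_all add: lform_convolution e' q convolution_eq lform_tsum_body lform_mult_left lform_mult_right lhom_dual_app[OF e])
  show "(\<lambda>x. convolution H q (e x)) \<in> lhom X H'"
    by (rule lhom_dualI) (simp_all add: lform_convolution e' q convolution_eq lform_tsum_body lform_mult_left lform_mult_right lhom_dual_app[OF e])
next
  show "e' \<in> lhom X A \<Longrightarrow> lform A q \<Longrightarrow> (\<lambda>x. rharp (lharp (e' x) q) b) \<in> lhom X H'"
    by (rule lhom_dualI, rule lform_twist) (auto simp: twist_eq intro!: lform_comp[of A q] lin)
  show "e' \<in> lhom X A \<Longrightarrow> lform A q \<Longrightarrow> (\<lambda>x. rharp (lharp a q) (e' x)) \<in> lhom X H'"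
    by (rule lhom_dualI, rule lform_twist) (auto simp: twist_eq intro!: lform_comp[of A q] lin)
qed

lemma finite_B: "finite B"
proof -
  interpret finite_dimensional_vector_space "scl H" B by (rule fd)
  show ?thesis by (rule finite_Basis)
qed

lemma lform_dual_basis: "lform A (dual_basis H B e)"
proof -
  interpret finite_dimensional_vector_space "scl H" B by (rule fd)
  show ?thesis
    unfolding lform_def dual_basis_def
    by (auto simp: representation_add representation_scale independent_Basis span_Basis)
qed

lemma lform_basis_expand:
  assumes f: "lform A f"
  shows "f x = (\<Sum>e\<in>B. dual_basis H B e x * f e)"
proof -
  interpret finite_dimensional_vector_space "scl H" B by (rule fd)
  have s: "f (\<Sum>e\<in>S. scl H (c e) e) = (\<Sum>e\<in>S. c e * f e)" if "finite S" for S c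
    using that lform_zero[OF vsp_alg f] lformD[OF f] by (induction S) auto
  have "x = (\<Sum>e\<in>B. scl H (dual_basis H B e x) e)"
    unfolding dual_basis_def
    by (rule sum_representation_eq[symmetric]) (auto simp: independent_Basis span_Basis finite_Basis)
  then show ?thesis using s[OF finite_B, of "\<lambda>e. dual_basis H B e x"] by simp
qed

text \<open>As \<open>B\<close> is finite, the coordinate functionals span the dual, and
  \<open>p\<close> has the coefficients \<open>p e\<close> with respect to them.\<close>

lemma lform_dual_expand:
  assumes g: "lform H' g" and p: "lform A p"
  shows "g p = (\<Sum>e\<in>B. p e * g (dual_basis H B e))"
proof -
  \<comment> \<open>Linearity of the partial sums is carried along in the induction because
    \<open>g\<close> is additive only on the carrier of the dual.\<close>
  have s: "g (\<lambda>h. \<Sum>e\<in>S. c e * dual_basis H B e h) = (\<Sum>e\<in>S. c e * g (dual_basis H B e)) \<and>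
    lform A (\<lambda>h. \<Sum>e\<in>S. c e * dual_basis H B e h)" if "finite S" for S c
    using that
  proof (induction S)
    case empty
    then show ?case using lform_zero[OF vsp_dual g] by (simp add: lform_def)
  next
    case (insert x S)
    have 1: "lform A (\<lambda>h. c x * dual_basis H B x h)" by (rule lform_mult_left[OF lform_dual_basis])
    then have "lform A (\<lambda>h. c x * dual_basis H B x h + (\<Sum>e\<in>S. c e * dual_basis H B e h))"
      using insert.IH by (auto simp: lform_def algebra_simps)
    moreover have "g (\<lambda>h. c x * dual_basis H B x h + (\<Sum>e\<in>S. c e * dual_basis H B e h)) =
      g (\<lambda>h. c x * dual_basis H B x h) + g (\<lambda>h. \<Sum>e\<in>S. c e * dual_basis H B e h)"
      using lformD(1)[OF g, of "\<lambda>h. c x * dual_basis H B x h" "\<lambda>h. \<Sum>e\<in>S. c e * dual_basis H B e h"] 1 insert.IH by simp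
    moreover have "g (\<lambda>h. c x * dual_basis H B x h) = c x * g (dual_basis H B x)"
      using lformD(2)[OF g, of "dual_basis H B x" "c x"] lform_dual_basis by simp
    ultimately show ?case using insert by simp
  qed
  have "p = (\<lambda>h. \<Sum>e\<in>B. p e * dual_basis H B e h)"
  proof
    fix h
    show "p h = (\<Sum>e\<in>B. p e * dual_basis H B e h)"
      using lform_basis_expand[OF p, of h] by (simp only: mult.commute)
  qed
  then show ?thesis using s[OF finite_B, of p] by metis
qed

lemma tsum_basis_expand:
  assumes V: "vsp V" and s: "s \<in> carrier (tensor V A)" and F: "bform V A F"
  shows "tsum s F = (\<Sum>e\<in>B. tsum s (\<lambda>m0 m1. dual_basis H B e m1 * F m0 e))"
proof -
  have "tsum s F = tsum s (\<lambda>m0 m1. \<Sum>e\<in>B. dual_basis H B e m1 * F m0 e)"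
    by (intro tsum_congI lform_basis_expand bformD(2)[OF F] tensor_memD(1)[OF V vsp_alg s])
  then show ?thesis by (simp add: tsum_sum)
qed

text \<open>Expanding the second slot in the basis writes \<open>F\<close> as a finite sum of
  products of a form on \<open>V\<close> and a coordinate functional. Hence a coaction is determined
  by the action of the dual that it induces.\<close>

lemma tsum_eq_dual:
  assumes V: "vsp V" and s: "s \<in> carrier (tensor V A)" and t: "t \<in> carrier (tensor V A)" and F: "bform V A F"
    and eq: "\<And>p f. lform A p \<Longrightarrow> lform V f \<Longrightarrow>
      tsum s (\<lambda>m0 m1. p m1 * f m0) = tsum t (\<lambda>m0 m1. p m1 * f m0)"
  shows "tsum s F = tsum t F"
  unfolding tsum_basis_expand[OF V s F] tsum_basis_expand[OF V t F]
  by (intro sum.cong HOL.refl eq lform_dual_basis bformD(1)[OF F]) simp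

section \<open>The component algebras of DT(H)\<close>

abbreviation "D \<equiv> dt_component H"
abbreviation "E \<equiv> tensor H' A"

lemma D_simps [simp]:
  "carrier (D i) = carrier E" "zero (D i) = zero E" "add (D i) = add E" "smult (D i) = smult E"
  "one (D i) = bow H (counit H) 1"
  by (cases i; simp add: dt_component_def)+

lemma vsp_E [simp]: "vsp E" by (rule vsp_tensor) auto

lemma lform_D [simp]: "lform (D i) f \<longleftrightarrow> lform E f"
  by (simp add: lform_def)

lemma vsp_D [simp]: "vsp (D i)"
  by (rule vspI) (use vspD[OF vsp_E] in auto)

lemma bow_in [simp]: "lform A p \<Longrightarrow> bow H p h \<in> carrier E"
  by (rule tcls_in) simp

lemma tsum_bow: "bform H' A G \<Longrightarrow> lform A p \<Longrightarrow> tsum (bow H p h) G = G p h"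
  by simp

lemma E_memD: "x \<in> carrier E \<Longrightarrow> (p, h) \<in> set x \<Longrightarrow> lform A p"
  using tensor_memD(1)[OF vsp_dual vsp_alg] by auto

lemma lform_E_expand:
  assumes f: "lform E f" and x: "x \<in> carrier E"
  shows "f x = tsum x (\<lambda>p h. f (bow H p h))"
  using lform_tensor_expand[OF vsp_dual vsp_alg f, of x] tensor_elemD[OF vsp_dual vsp_alg x] by simp

lemma D_mult:
  assumes x: "x \<in> carrier E" and y: "y \<in> carrier E"
  shows "x \<otimes>\<^bsub>D (\<alpha>, \<beta>)\<^esub> y \<in> carrier E"
    and "bform H' A G \<Longrightarrow> tsum (x \<otimes>\<^bsub>D (\<alpha>, \<beta>)\<^esub> y) G = tsum x (\<lambda>p h. tsum y (\<lambda>q l. tsum (\<Delta> h) (\<lambda>h1 h'. tsum (\<Delta> h') (\<lambda>h2 h3.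
      G (convolution H p (rharp (lharp (\<alpha> h1) q) (Sinv (\<beta> h3)))) (h2 * l)))))"
proof -
  let ?l = "[(convolution H p (rharp (lharp (\<alpha> h1) q) (Sinv (\<beta> h3))), h2 * l).
            (p, h) \<leftarrow> x, (q, l) \<leftarrow> y, (h1, h') \<leftarrow> \<Delta> h, (h2, h3) \<leftarrow> \<Delta> h']"
  have wf: "set ?l \<subseteq> carrier H' \<times> carrier A"
    by (intro wf_intros) (auto intro!: lform_convolution lform_twist dest: E_memD[OF x] E_memD[OF y])
  have eq: "x \<otimes>\<^bsub>D (\<alpha>, \<beta>)\<^esub> y = dcls H ?l" by (simp add: dt_component_def)
  show "x \<otimes>\<^bsub>D (\<alpha>, \<beta>)\<^esub> y \<in> carrier E" unfolding eq by (rule tcls_in[OF wf])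
  assume G: "bform H' A G"
  show "tsum (x \<otimes>\<^bsub>D (\<alpha>, \<beta>)\<^esub> y) G = tsum x (\<lambda>p h. tsum y (\<lambda>q l. tsum (\<Delta> h) (\<lambda>h1 h'. tsum (\<Delta> h') (\<lambda>h2 h3.
      G (convolution H p (rharp (lharp (\<alpha> h1) q) (Sinv (\<beta> h3)))) (h2 * l)))))"
    unfolding eq tsum_tcls[OF vsp_dual vsp_alg G wf] by simp
qed

section \<open>From Yetter-Drinfeld modules to representations\<close>

text \<open>The functor to representations lets \<open>p \<bowtie> h\<close> act by \<open>m \<mapsto> p ((h m)_(1)) (h m)_(0)\<close>.\<close>

definition to_rep :: "('k, 'h, 'a) yd_obj \<Rightarrow> ('h aut_pair, 'k, ('k, 'h) dt, 'a) rep_obj" where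
  "to_rep M = (let V = yd_space M in
    \<lparr>rep_index = yd_index M,
     rep_space = V,
     rep_act = (\<lambda>x\<in>carrier E. \<lambda>m\<in>carrier V. abelian_monoid.sumlist V
       [c \<odot>\<^bsub>V\<^esub> v. (v, c) \<leftarrow> [(m0, p m1). (p, h) \<leftarrow> x, (m0, m1) \<leftarrow> yd_coact M (yd_act M h m)]])\<rparr>)"

lemma to_rep_simps [simp]: "rep_index (to_rep M) = yd_index M" "rep_space (to_rep M) = yd_space M"
  by (simp_all add: to_rep_def Let_def)

lemma to_rep_act:
  assumes M: "M \<in> yd_objects H" and x: "x \<in> carrier E" and m: "m \<in> carrier (yd_space M)"
  shows "rep_act (to_rep M) x m \<in> carrier (yd_space M)"
    and "lform (yd_space M) f \<Longrightarrow> f (rep_act (to_rep M) x m) =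
      tsum x (\<lambda>p h. tsum (yd_coact M (yd_act M h m)) (\<lambda>m0 m1. p m1 * f m0))"
proof -
  let ?V = "yd_space M"
  let ?z = "[(m0, p m1). (p, h) \<leftarrow> x, (m0, m1) \<leftarrow> yd_coact M (yd_act M h m)]"
  have V: "vsp ?V" using yd_objectsD(3)[OF M] by auto
  have "set ?z \<subseteq> carrier ?V \<times> (UNIV :: 'k set)"
    by (intro wf_intros; (blast intro: yd_mem[OF M] m | simp))
  then have zc: "v \<in> carrier ?V" if "(v, c) \<in> set ?z" for v c using that by blast
  then have z: "c \<odot>\<^bsub>?V\<^esub> v \<in> carrier ?V" if "(v, c) \<in> set ?z" for v c using vspD(7)[OF V] that by blast
  have eq: "rep_act (to_rep M) x m = abelian_monoid.sumlist ?V [c \<odot>\<^bsub>?V\<^esub> v. (v, c) \<leftarrow> ?z]"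
    using x m by (simp add: to_rep_def Let_def)
  \<comment> \<open>The zero form is a dummy: the membership part of \<open>lform_sumlist\<close>
    does not mention the form.\<close>
  show "rep_act (to_rep M) x m \<in> carrier ?V"
    unfolding eq by (rule lform_sumlist(2)[where f = "\<lambda>_. 0", OF V _ z]) (simp add: lform_def)
  assume f: "lform ?V f"
  have "f (rep_act (to_rep M) x m) = tsum ?z (\<lambda>v c. f (c \<odot>\<^bsub>?V\<^esub> v))"
    unfolding eq by (rule lform_sumlist(1)[OF V f z])
  also have "\<dots> = tsum ?z (\<lambda>v c. c * f v)"
    by (intro tsum_congI lformD(2)[OF f] zc)
  finally show "f (rep_act (to_rep M) x m) =
      tsum x (\<lambda>p h. tsum (yd_coact M (yd_act M h m)) (\<lambda>m0 m1. p m1 * f m0))" by simp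
qed

lemma to_rep_bform:
  assumes M: "M \<in> yd_objects H" and m: "m \<in> carrier (yd_space M)" and f: "lform (yd_space M) f"
  shows "bform H' A (\<lambda>p h. tsum (yd_coact M (yd_act M h m)) (\<lambda>m0 m1. p m1 * f m0))"
  by (intro lin lform_eval yd_lin[OF M] m f; simp)

lemma to_rep_act_bow:
  assumes "M \<in> yd_objects H" "m \<in> carrier (yd_space M)" "lform (yd_space M) f" "lform A p"
  shows "f (rep_act (to_rep M) (bow H p h) m) = tsum (yd_coact M (yd_act M h m)) (\<lambda>m0 m1. p m1 * f m0)"
  using to_rep_act(2)[OF assms(1) bow_in[OF assms(4)] assms(2,3)] tsum_bow[OF to_rep_bform[OF assms(1-3)] assms(4)] by simp

text \<open>This is multiplicativity of the action on \<open>p \<bowtie> h\<close> and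
  \<open>q \<bowtie> 1\<close>. Coassociativity of the coaction separates \<open>p\<close> from the
  translate of \<open>q\<close>, the compatibility condition carries \<open>h\<close> past the
  coaction, and the factor \<open>S^{-1}(\<beta>(h_3)) \<beta>(h_2)\<close> that this creates inside
  \<open>q\<close> cancels.\<close>

lemma to_rep_mult:
  assumes M: "M \<in> yd_objects H" and i: "yd_index M = (\<alpha>, \<beta>)" and n: "n \<in> carrier (yd_space M)"
    and f: "lform (yd_space M) f" and p: "lform A p" and q: "lform A q"
  shows "tsum (\<Delta> h) (\<lambda>h1 h'. tsum (\<Delta> h') (\<lambda>h2 h3. tsum (yd_coact M (yd_act M h2 n)) (\<lambda>m0 m1.
      convolution H p (rharp (lharp (\<alpha> h1) q) (Sinv (\<beta> h3))) m1 * f m0))) =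
    tsum (yd_coact M n) (\<lambda>n0 n1. q n1 * tsum (yd_coact M (yd_act M h n0)) (\<lambda>m0 m1. p m1 * f m0))"
proof -
  have \<alpha>: "\<alpha> \<in> hopf_aut H" and \<beta>: "\<beta> \<in> hopf_aut H" using yd_objectsD(1,2)[OF M] i by auto
  let ?\<psi> = "\<lambda>v. tsum (yd_coact M v) (\<lambda>m0 m1. p m1 * f m0)"
  have \<psi>: "lform (yd_space M) ?\<psi>"
    by (intro lin yd_lin[OF M] f; simp add: p)
  note L = lin' lhom_comp[OF autD(2)[OF \<alpha>]] lhom_comp[OF autD(2)[OF \<beta>]] yd_lin[OF M] lform_comp[OF p] lform_comp[OF q]
    lform_comp[OF f] lform_comp[OF \<psi>]
  have "tsum (\<Delta> h) (\<lambda>h1 h'. tsum (\<Delta> h') (\<lambda>h2 h3. tsum (yd_coact M (yd_act M h2 n)) (\<lambda>m0 m1.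
      convolution H p (rharp (lharp (\<alpha> h1) q) (Sinv (\<beta> h3))) m1 * f m0))) =
    tsum (\<Delta> h) (\<lambda>h1 h'. tsum (\<Delta> h') (\<lambda>h2 h3. tsum (yd_coact M (yd_act M h2 n)) (\<lambda>m0 m1.
      q (Sinv (\<beta> h3) * (m1 * \<alpha> h1)) * ?\<psi> m0)))"
  proof (rule tsum_congI, rule tsum_congI)
    fix h1 h' h2 h3
    note n' = yd_mem(1)[OF M n]
    have "tsum (yd_coact M (yd_act M h2 n)) (\<lambda>m0 m1. convolution H p (rharp (lharp (\<alpha> h1) q) (Sinv (\<beta> h3))) m1 * f m0) =
      tsum (yd_coact M (yd_act M h2 n)) (\<lambda>m0 m1. tsum (\<Delta> m1) (\<lambda>a b. p a * (q (Sinv (\<beta> h3) * b * \<alpha> h1) * f m0)))"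
      by (simp add: convolution_eq twist_eq tsum_mult_right[symmetric] mult.assoc)
    also have "\<dots> = tsum (yd_coact M (yd_act M h2 n)) (\<lambda>m0 m1. tsum (yd_coact M m0) (\<lambda>m00 m01. p m01 * (q (Sinv (\<beta> h3) * m1 * \<alpha> h1) * f m00)))"
      by (rule yd_objectsD(11)[OF M n', symmetric]) (intro L)
    also have "\<dots> = tsum (yd_coact M (yd_act M h2 n)) (\<lambda>m0 m1. q (Sinv (\<beta> h3) * (m1 * \<alpha> h1)) * ?\<psi> m0)"
      by (simp add: tsum_mult_left[symmetric] mult.assoc mult.left_commute[of "p _"])
    finally show "tsum (yd_coact M (yd_act M h2 n)) (\<lambda>m0 m1. convolution H p (rharp (lharp (\<alpha> h1) q) (Sinv (\<beta> h3))) m1 * f m0) =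
      tsum (yd_coact M (yd_act M h2 n)) (\<lambda>m0 m1. q (Sinv (\<beta> h3) * (m1 * \<alpha> h1)) * ?\<psi> m0)" .
  qed
  also have "\<dots> = tsum (\<Delta> h) (\<lambda>y h3. tsum (\<Delta> y) (\<lambda>h1 h2. tsum (yd_coact M (yd_act M h2 n)) (\<lambda>m0 m1.
      q (Sinv (\<beta> h3) * (m1 * \<alpha> h1)) * ?\<psi> m0)))"
    by (intro comul_coassoc[symmetric] L n)
  also have "\<dots> = tsum (\<Delta> h) (\<lambda>y h3. tsum (\<Delta> y) (\<lambda>h1 h2. tsum (yd_coact M n) (\<lambda>m0 m1.
      q (Sinv (\<beta> h3) * (\<beta> h2 * m1)) * ?\<psi> (yd_act M h1 m0))))"
  proof (rule tsum_congI)
    fix y h3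
    have "bform (yd_space M) A (\<lambda>m0 k. q (Sinv (\<beta> h3) * k) * ?\<psi> m0)" by (intro L)
    from yd_objectsD(13)[OF M n this, of y]
    show "tsum (\<Delta> y) (\<lambda>h1 h2. tsum (yd_coact M (yd_act M h2 n)) (\<lambda>m0 m1. q (Sinv (\<beta> h3) * (m1 * \<alpha> h1)) * ?\<psi> m0)) =
      tsum (\<Delta> y) (\<lambda>h1 h2. tsum (yd_coact M n) (\<lambda>m0 m1. q (Sinv (\<beta> h3) * (\<beta> h2 * m1)) * ?\<psi> (yd_act M h1 m0)))"
      by (simp add: i)
  qed
  also have "\<dots> = tsum (\<Delta> h) (\<lambda>h1 h'. tsum (\<Delta> h') (\<lambda>h2 h3. tsum (yd_coact M n) (\<lambda>m0 m1.
      q (Sinv (\<beta> h3) * (\<beta> h2 * m1)) * ?\<psi> (yd_act M h1 m0))))"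
    by (intro comul_coassoc L; (blast intro: yd_mem[OF M] n | simp))
  also have "\<dots> = tsum (\<Delta> h) (\<lambda>h1 h'. counit H h' * tsum (yd_coact M n) (\<lambda>m0 m1. q m1 * ?\<psi> (yd_act M h1 m0)))"
  proof (rule tsum_congI)
    fix h1 h'
    have "lform A (\<lambda>z. tsum (yd_coact M n) (\<lambda>m0 m1. q (\<beta> z * m1) * ?\<psi> (yd_act M h1 m0)))" by (intro L)
    from Sinv_left[OF this, of h']
    show "tsum (\<Delta> h') (\<lambda>h2 h3. tsum (yd_coact M n) (\<lambda>m0 m1. q (Sinv (\<beta> h3) * (\<beta> h2 * m1)) * ?\<psi> (yd_act M h1 m0))) =
      counit H h' * tsum (yd_coact M n) (\<lambda>m0 m1. q m1 * ?\<psi> (yd_act M h1 m0))"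
      by (simp add: Sinv_aut[OF \<beta>] autD(3,4)[OF \<beta>] mult.assoc)
  qed
  also have "\<dots> = tsum (yd_coact M n) (\<lambda>m0 m1. q m1 * ?\<psi> (yd_act M h m0))"
    by (rule counit_right') (intro L; blast intro: yd_mem[OF M] n)
  finally show ?thesis .
qed

lemma to_rep_in:
  assumes M: "M \<in> yd_objects H"
  shows "to_rep M \<in> rep_objects (aut_group H) (DT H B)"
proof -
  obtain \<alpha> \<beta> where i: "yd_index M = (\<alpha>, \<beta>)" by (meson surj_pair)
  let ?V = "yd_space M" and ?act = "rep_act (to_rep M)"
  have V: "is_vspace ?V" using yd_objectsD(3)[OF M] .
  note act = to_rep_act[OF M] and vV = is_vspace_vsp[OF V]
  have lh: "?act x \<in> lhom ?V ?V" if x: "x \<in> carrier E" for x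
  proof (rule lhom_lformI[OF vV vV act(1)[OF x]])
    fix f assume f: "lform ?V f"
    show "lform ?V (\<lambda>m. f (?act x m))"
      by (rule lform_cong[OF _ vV act(2)[OF x _ f]]) (intro lin yd_lin[OF M] f; (blast intro: E_memD[OF x] | simp))
  qed
  have la: "(\<lambda>x. ?act x m) \<in> lhom E ?V" if m: "m \<in> carrier ?V" for m
  proof (rule lhom_lformI[OF vsp_E vV act(1)[OF _ m]])
    fix f assume f: "lform ?V f"
    show "lform E (\<lambda>x. f (?act x m))"
      by (rule lform_cong[OF _ vsp_E act(2)[OF _ m f]]) (intro lform_tsum vsp_dual vsp_alg to_rep_bform M m f)
  qed
  have mult: "?act (x \<otimes>\<^bsub>D (\<alpha>, \<beta>)\<^esub> y) m = ?act x (?act y m)" if x: "x \<in> carrier E" and y: "y \<in> carrier E" and m: "m \<in> carrier ?V" for x y m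
  proof (rule lform_eqI[OF vV act(1)[OF D_mult(1)[OF x y] m] act(1)[OF x act(1)[OF y m]]])
    fix f assume f: "lform ?V f"
    let ?\<psi> = "\<lambda>p h v. tsum (yd_coact M (yd_act M h v)) (\<lambda>m0 m1. p m1 * f m0)"
    have \<psi>: "lform ?V (?\<psi> p h)" if "lform A p" for p h
      by (intro lin yd_lin[OF M] f; simp add: that)
    have "f (?act (x \<otimes>\<^bsub>D (\<alpha>, \<beta>)\<^esub> y) m) = tsum x (\<lambda>p h. tsum y (\<lambda>q l. tsum (\<Delta> h) (\<lambda>h1 h'. tsum (\<Delta> h') (\<lambda>h2 h3.
      ?\<psi> (convolution H p (rharp (lharp (\<alpha> h1) q) (Sinv (\<beta> h3)))) (h2 * l) m))))"
      unfolding act(2)[OF D_mult(1)[OF x y] m f] by (rule D_mult(2)[OF x y to_rep_bform[OF M m f]])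
    also have "\<dots> = tsum x (\<lambda>p h. tsum y (\<lambda>q l. tsum (yd_coact M (yd_act M l m)) (\<lambda>n0 n1. q n1 * ?\<psi> p h n0)))"
    proof (intro tsum_congI)
      fix p h q l assume "(p, h) \<in> set x" "(q, l) \<in> set y"
      then have "lform A p" "lform A q" using E_memD[OF x] E_memD[OF y] by blast+
      \<comment> \<open>The lemma is used at the vector \<open>yd_act M l m\<close>, so that the
        H-part of \<open>q \<bowtie> l\<close> has already acted.\<close>
      from to_rep_mult[OF M i yd_mem(1)[OF M m] f this, of h l]
      show "tsum (\<Delta> h) (\<lambda>h1 h'. tsum (\<Delta> h') (\<lambda>h2 h3.
        ?\<psi> (convolution H p (rharp (lharp (\<alpha> h1) q) (Sinv (\<beta> h3)))) (h2 * l) m)) =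
        tsum (yd_coact M (yd_act M l m)) (\<lambda>n0 n1. q n1 * ?\<psi> p h n0)"
        by (simp add: yd_objectsD(7)[OF M m])
    qed
    also have "\<dots> = tsum x (\<lambda>p h. ?\<psi> p h (?act y m))"
      by (intro tsum_congI act(2)[OF y m, symmetric] \<psi> E_memD[OF x])
    also have "\<dots> = f (?act x (?act y m))"
      by (rule act(2)[OF x act(1)[OF y m] f, symmetric])
    finally show "f (?act (x \<otimes>\<^bsub>D (\<alpha>, \<beta>)\<^esub> y) m) = f (?act x (?act y m))" .
  qed
  have one: "?act (bow H (counit H) 1) m = m" if m: "m \<in> carrier ?V" for m
  proof (rule lform_eqI[OF vV act(1)[OF bow_in[OF lform_counit] m] m])
    fix f assume f: "lform ?V f"
    show "f (?act (bow H (counit H) 1) m) = f m"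
      using to_rep_act_bow[OF M m f lform_counit, of 1] yd_objectsD(8)[OF M m] yd_objectsD(12)[OF M m f] by simp
  qed
  have "left_module (D (\<alpha>, \<beta>)) ?V ?act"
    unfolding left_module_def D_simps
    using V lh lhomD[OF la] mult one by (auto simp: to_rep_def Let_def)
  then show ?thesis
    using yd_index_in[OF M] by (simp add: rep_objects_def DT_def i)
qed

end

section \<open>From representations back to Yetter-Drinfeld modules\<close>

locale dt_rep = fd_hopf_algebra H B for H :: "('k::field, 'h::ring_1) hopf_data" and B +
  fixes U :: "('h aut_pair, 'k, ('k, 'h) dt, 'a) rep_obj" and \<alpha> \<beta> :: "'h \<Rightarrow> 'h"
  assumes U: "U \<in> rep_objects (aut_group H) (DT H B)" and i: "rep_index U = (\<alpha>, \<beta>)"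
begin

abbreviation "V \<equiv> rep_space U"

definition r :: "('h \<Rightarrow> 'k) \<Rightarrow> 'h \<Rightarrow> ('k, 'a) vuniv \<Rightarrow> ('k, 'a) vuniv" where
  "r p h = rep_act U (bow H p h)"

lemma auts: "\<alpha> \<in> hopf_aut H" "\<beta> \<in> hopf_aut H"
  using U by (auto simp: rep_objects_def i aut_group_def)

lemma mod: "left_module (D (\<alpha>, \<beta>)) V (rep_act U)"
  using U by (auto simp: rep_objects_def i DT_def)

lemma V: "is_vspace V"
  using mod by (simp add: left_module_def)

lemma act_ext: "rep_act U \<in> extensional (carrier E)" "x \<in> carrier E \<Longrightarrow> rep_act U x \<in> extensional (carrier V)"
  using mod by (simp_all add: left_module_def)

lemma act_lhom: "x \<in> carrier E \<Longrightarrow> rep_act U x \<in> lhom V V" "m \<in> carrier V \<Longrightarrow> (\<lambda>x. rep_act U x m) \<in> lhom E V"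
  using mod unfolding left_module_def lhom_iff[of _ E] by (auto dest: lhomD)

lemma act_mult: "x \<in> carrier E \<Longrightarrow> y \<in> carrier E \<Longrightarrow> m \<in> carrier V \<Longrightarrow>
    rep_act U (x \<otimes>\<^bsub>D (\<alpha>, \<beta>)\<^esub> y) m = rep_act U x (rep_act U y m)"
  using mod by (simp add: left_module_def)

lemma r_in: "lform A p \<Longrightarrow> m \<in> carrier V \<Longrightarrow> r p h m \<in> carrier V"
  unfolding r_def by (rule lhomD(1)[OF act_lhom(1)[OF bow_in]])

lemma r_one: "m \<in> carrier V \<Longrightarrow> r (counit H) 1 m = m"
  using mod by (simp add: left_module_def r_def)

lemma r_lin:
  "e \<in> lhom X H' \<Longrightarrow> m \<in> carrier V \<Longrightarrow> (\<lambda>x. r (e x) h m) \<in> lhom X V"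
  "e' \<in> lhom X A \<Longrightarrow> lform A p \<Longrightarrow> m \<in> carrier V \<Longrightarrow> (\<lambda>x. r p (e' x) m) \<in> lhom X V"
  "e'' \<in> lhom X V \<Longrightarrow> lform A p \<Longrightarrow> (\<lambda>x. r p h (e'' x)) \<in> lhom X V"
  unfolding r_def
  using lhom_comp[OF act_lhom(2) lhom_comp[OF tcls_bilinear(1)[OF vsp_dual vsp_alg]], of m h e X]
    lhom_comp[OF act_lhom(2) lhom_comp[OF tcls_bilinear(2)[OF vsp_dual vsp_alg]], of m p e' X]
    lhom_comp[OF act_lhom(1)[OF bow_in], of p e'' X h]
  by simp_all

lemmas L = lin' lhom_comp[OF autD(2)[OF auts(1)]] lhom_comp[OF autD(2)[OF auts(2)]] r_lin

lemma r_bform: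
  assumes "lform V f" "m \<in> carrier V"
  shows "bform H' A (\<lambda>p h. f (r p h m))"
  by (rule bformI; intro lform_comp[OF assms(1)] r_lin assms(2) lhom_id; simp)

lemma act_expand:
  assumes f: "lform V f" and x: "x \<in> carrier E" and m: "m \<in> carrier V"
  shows "f (rep_act U x m) = tsum x (\<lambda>p h. f (r p h m))"
  unfolding r_def by (rule lform_E_expand[OF lform_comp[OF f act_lhom(2)[OF m]] x])

lemma r_mult:
  assumes f: "lform V f" and p: "lform A p" and q: "lform A q" and m: "m \<in> carrier V"
  shows "f (r p h (r q l m)) = tsum (\<Delta> h) (\<lambda>h1 h'. tsum (\<Delta> h') (\<lambda>h2 h3.
      f (r (convolution H p (rharp (lharp (\<alpha> h1) q) (Sinv (\<beta> h3)))) (h2 * l) m)))"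
proof -
  let ?G = "\<lambda>p h. f (r p h m)"
  let ?K = "\<lambda>p h q l. tsum (\<Delta> h) (\<lambda>h1 h'. tsum (\<Delta> h') (\<lambda>h2 h3.
      ?G (convolution H p (rharp (lharp (\<alpha> h1) q) (Sinv (\<beta> h3)))) (h2 * l)))"
  note LG = L lform_comp[OF f] lhom_dual_rules lform_convolution lform_twist
  have K1: "bform H' A (\<lambda>q l. ?K p h q l)"
    by (intro LG p m; (simp add: m | (intro lform_convolution lform_twist p; simp)))
  have K2: "bform H' A (\<lambda>p h. ?K p h q l)"
    by (intro LG q m; (simp add: m q | (intro lform_convolution lform_twist q; simp add: q)))
  have "f (r p h (r q l m)) = f (rep_act U (bow H p h \<otimes>\<^bsub>D (\<alpha>, \<beta>)\<^esub> bow H q l) m)"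
    using act_mult[OF bow_in[OF p] bow_in[OF q] m] by (simp add: r_def)
  also have "\<dots> = tsum (bow H p h) (\<lambda>p h. tsum (bow H q l) (\<lambda>q l. ?K p h q l))"
    unfolding act_expand[OF f D_mult(1)[OF bow_in[OF p] bow_in[OF q]] m]
    by (rule D_mult(2)[OF bow_in[OF p] bow_in[OF q] r_bform[OF f m]])
  \<comment> \<open>A \<open>bow\<close> is a chosen representative and not the singleton list it
    was formed from, so each of the two factors is collapsed through bilinearity of
    \<open>?K\<close>; the swap brings the first factor inside.\<close>
  also have "\<dots> = tsum (bow H q l) (\<lambda>q l. tsum (bow H p h) (\<lambda>p h. ?K p h q l))"
    by (rule tsum_swap)
  also have "\<dots> = tsum (bow H q l) (\<lambda>q l. ?K p h q l)"
  proof (rule tsum_congI)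
    fix q' l' assume "(q', l') \<in> set (bow H q l)"
    then have q': "lform A q'" by (rule E_memD[OF bow_in[OF q]])
    have "bform H' A (\<lambda>p h. ?K p h q' l')"
      by (intro LG q' m; (simp add: m q' | (intro lform_convolution lform_twist q'; simp add: q')))
    then show "tsum (bow H p h) (\<lambda>p h. ?K p h q' l') = ?K p h q' l'" by (rule tsum_bow[OF _ p])
  qed
  also have "\<dots> = ?K p h q l" by (rule tsum_bow[OF K1 q])
  finally show ?thesis .
qed

lemma twist_counit: "rharp (lharp a (counit H)) b = (\<lambda>l. (counit H b * counit H a) * counit H l)"
  by (simp add: twist_eq fun_eq_iff counit_mult)

lemma r_scale:
  assumes f: "lform V f" and p: "lform A p" and m: "m \<in> carrier V"
  shows "f (r (\<lambda>x. c * p x) h m) = c * f (r p h m)"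
  using lformD(2)[OF bformD(1)[OF r_bform[OF f m]], of h p c] p by simp

lemma twist_one [simp]: "rharp (lharp 1 q) 1 = q"
  by (simp add: twist_eq fun_eq_iff)

lemma Sinv_one [simp]: "Sinv 1 = 1"
  by (rule Sinv_eqI) (simp add: antipode_one)

lemma r_left_one:
  assumes f: "lform V f" and p: "lform A p" and q: "lform A q" and m: "m \<in> carrier V"
  shows "f (r p 1 (r q l m)) = f (r (convolution H p q) l m)"
proof -
  note LG = L lform_comp[OF f] lhom_dual_rules p q
  have 1: "bform A A (\<lambda>h1 h'. tsum (\<Delta> h') (\<lambda>h2 h3.
      f (r (convolution H p (rharp (lharp (\<alpha> h1) q) (Sinv (\<beta> h3)))) (h2 * l) m)))"
    by (intro LG; simp add: m p q lform_convolution lform_twist)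
  have 2: "bform A A (\<lambda>h2 h3. f (r (convolution H p (rharp (lharp (\<alpha> 1) q) (Sinv (\<beta> h3)))) (h2 * l) m))"
    by (intro LG; simp add: m p q lform_convolution lform_twist)
  show ?thesis
    unfolding r_mult[OF f p q m] comul_one'[OF 1] comul_one'[OF 2] by (simp add: autD(4)[OF auts(1)] autD(4)[OF auts(2)])
qed

lemma counit_Sinv: "counit H (Sinv x) = counit H x"
proof -
  have "counit H (antipode H y) = counit H y" for y
    using antipode_left'[OF lform_counit, of y] counit_right'[OF lform_comp[OF lform_counit lhom_antipode], of y]
    by (simp add: counit_mult counit_one mult.commute)
  from this[of "Sinv x"] show ?thesis by simp
qed

text \<open>For \<open>q = \<epsilon>\<close> the translation in the product only multiplies by the
  counits of \<open>h_1\<close> and \<open>h_3\<close>, which the counit laws absorb. Hence H acts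
  through the elements \<open>\<epsilon> \<bowtie> h\<close>.\<close>

lemma r_counit:
  assumes f: "lform V f" and m: "m \<in> carrier V"
  shows "f (r (counit H) h (r (counit H) l m)) = f (r (counit H) (h * l) m)"
proof -
  note LG = L lform_comp[OF f]
  have "f (r (counit H) h (r (counit H) l m)) = tsum (\<Delta> h) (\<lambda>h1 h'. tsum (\<Delta> h') (\<lambda>h2 h3.
      (counit H (Sinv (\<beta> h3)) * counit H (\<alpha> h1)) * f (r (counit H) (h2 * l) m)))"
    unfolding r_mult[OF f lform_counit lform_counit m]
    by (rule tsum_congI, rule tsum_congI) (simp add: lform_twist twist_counit r_scale[OF f lform_counit m] lform_mult_left[OF lform_counit])
  also have "\<dots> = tsum (\<Delta> h) (\<lambda>h1 h'. counit H h1 * tsum (\<Delta> h') (\<lambda>h2 h3. counit H h3 * f (r (counit H) (h2 * l) m)))"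
    by (simp add: autD(6)[OF auts(1)] autD(6)[OF auts(2)] counit_Sinv tsum_mult_left[symmetric] mult_ac)
  also have "\<dots> = tsum (\<Delta> h) (\<lambda>h1 h'. counit H h1 * f (r (counit H) (h' * l) m))"
    by (rule tsum_congI, rule arg_cong[of _ _ "(*) _"], rule counit_right') (intro LG; simp add: m)
  also have "\<dots> = f (r (counit H) (h * l) m)"
    by (rule counit_left') (intro LG; simp add: m)
  finally show ?thesis .
qed

text \<open>The inverse functor recovers the coaction from a basis and its dual basis:
  \<open>m \<mapsto> \<Sum>\<^sub>i (e\<^sup>i \<bowtie> 1) m \<otimes> e\<^sub>i\<close>.\<close>

definition of_rep :: "('k, 'h, 'a) yd_obj" where
  "of_rep = \<lparr>yd_index = rep_index U, yd_space = V,
     yd_act = (\<lambda>h. r (counit H) h),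
     yd_coact = (\<lambda>m\<in>carrier V. tcls V A [(r (dual_basis H B e) 1 m, e). e \<leftarrow> (SOME bs. distinct bs \<and> set bs = B)])\<rparr>"

lemma of_rep_simps [simp]: "yd_index of_rep = (\<alpha>, \<beta>)" "yd_space of_rep = V" "yd_act of_rep = (\<lambda>h. r (counit H) h)"
  by (simp_all add: of_rep_def i)

lemma of_rep_coact:
  assumes m: "m \<in> carrier V"
  shows "yd_coact of_rep m \<in> carrier (tensor V A)"
    and "bform V A F \<Longrightarrow> tsum (yd_coact of_rep m) F = (\<Sum>e\<in>B. F (r (dual_basis H B e) 1 m) e)"
proof -
  \<comment> \<open>An enumeration of the basis is needed because tensors are lists; its order
    leaves no trace in evaluations, which are sums over the set \<open>B\<close>.\<close>
  define bs where "bs = (SOME bs. distinct bs \<and> set bs = B)"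
  have bs: "distinct bs" "set bs = B"
    using someI_ex[of "\<lambda>bs. distinct bs \<and> set bs = B"] finite_distinct_list[OF finite_B] unfolding bs_def by blast+
  have eq: "yd_coact of_rep m = tcls V A [(r (dual_basis H B e) 1 m, e). e \<leftarrow> bs]"
    using m by (simp add: of_rep_def bs_def)
  have wf: "set [(r (dual_basis H B e) 1 m, e). e \<leftarrow> bs] \<subseteq> carrier V \<times> carrier A"
    using r_in[OF lform_dual_basis m] by auto
  show "yd_coact of_rep m \<in> carrier (tensor V A)" unfolding eq by (rule tcls_in[OF wf])
  assume F: "bform V A F"
  have "tsum (map (\<lambda>e. (\<phi> e, e)) xs) F = (\<Sum>e\<leftarrow>xs. F (\<phi> e) e)" for \<phi> xs by (induction xs) auto
  then show "tsum (yd_coact of_rep m) F = (\<Sum>e\<in>B. F (r (dual_basis H B e) 1 m) e)"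
    unfolding eq tsum_tcls[OF is_vspace_vsp[OF V] vsp_alg F wf] by (simp add: sum_list_distinct_conv_sum_set bs)
qed

lemma of_rep_mem: "m \<in> carrier V \<Longrightarrow> (a, b) \<in> set (yd_coact of_rep m) \<Longrightarrow> a \<in> carrier V"
  using tensor_memD(1)[OF is_vspace_vsp[OF V] vsp_alg of_rep_coact(1)] .

lemma pure_bform: "lform A p \<Longrightarrow> lform V f \<Longrightarrow> bform V A (\<lambda>m0 m1. p m1 * f m0)"
  by (intro bformI lform_mult_left lform_mult_right) auto

text \<open>Summing \<open>p(e_i) e^i\<close> over the basis gives back \<open>p\<close>, so
  contracting the reconstructed coaction with \<open>p\<close> returns the given action of
  \<open>p \<bowtie> 1\<close>.\<close>

lemma of_rep_pure:
  assumes m: "m \<in> carrier V" and p: "lform A p" and f: "lform V f"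
  shows "tsum (yd_coact of_rep m) (\<lambda>m0 m1. p m1 * f m0) = f (r p 1 m)"
  unfolding of_rep_coact(2)[OF m pure_bform[OF p f]]
  by (rule lform_dual_expand[OF bformD(1)[OF r_bform[OF f m]] p, symmetric]) simp

lemma of_rep_coact_lhom: "yd_coact of_rep \<in> lhom V (tensor V A)"
proof (rule lhom_tensorI[OF is_vspace_vsp[OF V] is_vspace_vsp[OF V] vsp_alg of_rep_coact(1)])
  fix F assume F: "bform V A F"
  show "lform V (\<lambda>x. tsum (yd_coact of_rep x) F)"
    by (rule lform_cong[OF _ is_vspace_vsp[OF V] of_rep_coact(2)[OF _ F]])
      (intro lform_sum bform_left[OF F] r_lin lhom_id lform_dual_basis; simp)
qed

text \<open>The multiplication rule of DT(H) expands the product of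
  \<open>\<epsilon> \<bowtie> h_1\<close> with a translate of \<open>p\<close>. The two translations
  on the left merge into \<open>\<beta>(h_4 S^{-1}(h_3))\<close>, which cancels, and what is left is
  again a product, with the factors in the other order.\<close>

lemma of_rep_compat:
  assumes m: "m \<in> carrier V" and p: "lform A p" and f: "lform V f"
  shows "tsum (\<Delta> h) (\<lambda>h1 h2. f (r (lharp (\<alpha> h1) p) 1 (r (counit H) h2 m))) =
    tsum (\<Delta> h) (\<lambda>h1 h2. f (r (counit H) h1 (r (rharp p (\<beta> h2)) 1 m)))"
proof -
  have lh: "(\<lambda>x. rharp p (e x)) \<in> lhom X H'" "(\<lambda>x. lharp (e x) p) \<in> lhom X H'" if "e \<in> lhom X A" for e and X :: "('k, 'x, 'y) module_scheme"
    by (rule lhom_dualI; (simp add: rharp_def lharp_def)?, intro lform_comp[OF p] lhom_mult lhom_id that)+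
  have lf: "lform A (lharp a p)" "lform A (rharp p a)" for a
    unfolding rharp_def lharp_def by (intro lform_comp[OF p] lhom_mult lhom_id)+
  note LG = L lform_comp[OF f] lhom_dual_rules lh
  let ?G = "\<lambda>h1 h2 h3 h4. f (r (rharp (lharp (\<alpha> h1) (rharp p (\<beta> h4))) (Sinv (\<beta> h3))) h2 m)"
  have eq: "?G h1 h2 h3 h4 = f (r (rharp (lharp (\<alpha> h1) p) (\<beta> (h4 * Sinv h3))) h2 m)" for h1 h2 h3 h4
    by (rule arg_cong[of _ _ "\<lambda>q. f (r q h2 m)"])
      (simp add: fun_eq_iff rharp_def lharp_def Sinv_aut[OF auts(2)] autD(3)[OF auts(2)] mult.assoc)
  have "tsum (\<Delta> h) (\<lambda>h1 h2. f (r (counit H) h1 (r (rharp p (\<beta> h2)) 1 m))) =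
    tsum (\<Delta> h) (\<lambda>y h4. tsum (\<Delta> y) (\<lambda>h1 y'. tsum (\<Delta> y') (\<lambda>h2 h3. ?G h1 h2 h3 h4)))"
    by (rule tsum_congI) (simp add: r_mult[OF f lform_counit lf(2) m] lform_twist lf)
  also have "\<dots> = tsum (\<Delta> h) (\<lambda>h1 z. tsum (\<Delta> z) (\<lambda>y' h4. tsum (\<Delta> y') (\<lambda>h2 h3. ?G h1 h2 h3 h4)))"
    by (rule comul_coassoc) (intro LG; simp add: m lf lform_twist)
  also have "\<dots> = tsum (\<Delta> h) (\<lambda>h1 z. tsum (\<Delta> z) (\<lambda>h2 w. tsum (\<Delta> w) (\<lambda>h3 h4. ?G h1 h2 h3 h4)))"
    by (rule tsum_congI, rule comul_coassoc) (intro LG; simp add: m lf lform_twist)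
  also have "\<dots> = tsum (\<Delta> h) (\<lambda>h1 z. tsum (\<Delta> z) (\<lambda>h2 w. counit H w * f (r (lharp (\<alpha> h1) p) 1 (r (counit H) h2 m))))"
  proof (rule tsum_congI, rule tsum_congI)
    fix h1 h2 w
    have "lform A (\<lambda>z. f (r (rharp (lharp (\<alpha> h1) p) (\<beta> z)) h2 m))"
      by (intro LG; simp add: m p)
    from Sinv_right[OF this, of w]
    show "tsum (\<Delta> w) (\<lambda>h3 h4. ?G h1 h2 h3 h4) = counit H w * f (r (lharp (\<alpha> h1) p) 1 (r (counit H) h2 m))"
      by (simp add: eq autD(4)[OF auts(2)] r_left_one[OF f lf(1) lform_counit m] lf) (simp add: rharp_def)
  qed
  also have "\<dots> = tsum (\<Delta> h) (\<lambda>h1 z. f (r (lharp (\<alpha> h1) p) 1 (r (counit H) z m)))"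
    by (rule tsum_congI, rule counit_right') (intro LG; simp add: m lf)
  finally show ?thesis by simp
qed

lemma of_rep_in: "of_rep \<in> yd_objects H"
proof (rule yd_objectsI[OF of_rep_simps(1) auts], unfold of_rep_simps)
  note vV = is_vspace_vsp[OF V]
  note LG = L lform_counit
  show "is_vspace V" by (rule V)
  show "r (counit H) h \<in> extensional (carrier V)" for h
    unfolding r_def by (rule act_ext(2)[OF bow_in[OF lform_counit]])
  show "r (counit H) h \<in> lhom V V" for h by (intro LG)
  show "(\<lambda>h. r (counit H) h m) \<in> lhom A V" if "m \<in> carrier V" for m by (intro LG that)
  show "r (counit H) (h * k) m = r (counit H) h (r (counit H) k m)" if m: "m \<in> carrier V" for h k m
    by (rule lform_eqI[OF vV]) (simp_all add: r_in m r_counit r_in[OF lform_counit])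
  show "r (counit H) 1 m = m" if "m \<in> carrier V" for m by (rule r_one[OF that])
  show "yd_coact of_rep \<in> extensional (carrier V)" by (simp add: of_rep_def)
  show "yd_coact of_rep \<in> lhom V (tensor V A)" by (rule of_rep_coact_lhom)
  show "tsum (yd_coact of_rep m) (\<lambda>m0 m1. counit H m1 * f m0) = f m" if "m \<in> carrier V" "lform V f" for m f
    using of_rep_pure[OF that(1) lform_counit that(2)] r_one[OF that(1)] by simp
  show "tsum (yd_coact of_rep m) (\<lambda>m0 m1. tsum (yd_coact of_rep m0) (\<lambda>m00 m01. F m00 m01 m1)) =
      tsum (yd_coact of_rep m) (\<lambda>m0 m1. tsum (\<Delta> m1) (F m0))" if m: "m \<in> carrier V" and F: "tform V A A F" for m F
  proof -
    let ?d = "dual_basis H B"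
    note Fl = lform_comp[OF tformD(1)[OF F]] lform_comp[OF tformD(2)[OF F]] lform_comp[OF tformD(3)[OF F]]
    \<comment> \<open>Expanding both slots in H writes a trilinear form as a finite combination of
      products of three linear forms, so coassociativity need only be tested on such
      products.\<close>
    have F1: "F a b c = (\<Sum>e\<in>B. \<Sum>e'\<in>B. (?d e b * ?d e' c) * F a e e')" if "a \<in> carrier V" for a b c
    proof -
      have "F a b c = (\<Sum>e\<in>B. ?d e b * F a e c)"
        by (rule lform_basis_expand[OF tformD(2)[OF F that]]) simp
      also have "\<dots> = (\<Sum>e\<in>B. ?d e b * (\<Sum>e'\<in>B. ?d e' c * F a e e'))"
        by (intro sum.cong HOL.refl arg_cong[of _ _ "(*) _"] lform_basis_expand[OF tformD(3)[OF F that]]) simp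
      finally show ?thesis by (simp add: sum_distrib_left mult.assoc)
    qed
    have Fe: "lform V (\<lambda>a. F a e e')" for e e' by (rule tformD(1)[OF F]) auto
    \<comment> \<open>On products of forms, coassociativity says that \<open>q \<bowtie> 1\<close>
      followed by \<open>p \<bowtie> 1\<close> acts as the convolution of \<open>p\<close> and
      \<open>q\<close>.\<close>
    have pure: "tsum (yd_coact of_rep m) (\<lambda>m0 m1. tsum (yd_coact of_rep m0) (\<lambda>m00 m01. (p m01 * q m1) * f m00)) =
        tsum (yd_coact of_rep m) (\<lambda>m0 m1. tsum (\<Delta> m1) (\<lambda>a b. (p a * q b) * f m0))"
      if p: "lform A p" and q: "lform A q" and f: "lform V f" for p q f
    proof -
      have "tsum (yd_coact of_rep m) (\<lambda>m0 m1. tsum (yd_coact of_rep m0) (\<lambda>m00 m01. (p m01 * q m1) * f m00)) =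
        tsum (yd_coact of_rep m) (\<lambda>m0 m1. q m1 * f (r p 1 m0))"
        by (rule tsum_congI)
          (simp add: of_rep_pure[OF of_rep_mem[OF m] p f, symmetric] tsum_mult_left[symmetric] mult_ac)
      also have "\<dots> = f (r p 1 (r q 1 m))"
        by (rule of_rep_pure[OF m q]) (intro lform_comp[OF f] LG p)
      also have "\<dots> = f (r (convolution H p q) 1 m)" by (rule r_left_one[OF f p q m])
      also have "\<dots> = tsum (yd_coact of_rep m) (\<lambda>m0 m1. convolution H p q m1 * f m0)"
        by (rule of_rep_pure[OF m lform_convolution[OF p q] f, symmetric])
      finally show ?thesis by (simp add: convolution_eq tsum_mult_right)
    qed
    have "tsum (yd_coact of_rep m) (\<lambda>m0 m1. tsum (yd_coact of_rep m0) (\<lambda>m00 m01. F m00 m01 m1)) =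
      tsum (yd_coact of_rep m) (\<lambda>m0 m1. tsum (yd_coact of_rep m0) (\<lambda>m00 m01. (\<Sum>e\<in>B. \<Sum>e'\<in>B. (?d e m01 * ?d e' m1) * F m00 e e')))"
      by (rule tsum_congI, rule tsum_congI, rule F1) (blast intro: of_rep_mem m)
    also have "\<dots> = (\<Sum>e\<in>B. \<Sum>e'\<in>B. tsum (yd_coact of_rep m) (\<lambda>m0 m1. tsum (\<Delta> m1) (\<lambda>a b. (?d e a * ?d e' b) * F m0 e e')))"
      unfolding tsum_sum pure[OF lform_dual_basis lform_dual_basis Fe] ..
    also have "\<dots> = tsum (yd_coact of_rep m) (\<lambda>m0 m1. tsum (\<Delta> m1) (\<lambda>a b. \<Sum>e\<in>B. \<Sum>e'\<in>B. (?d e a * ?d e' b) * F m0 e e'))"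
      unfolding tsum_sum ..
    also have "\<dots> = tsum (yd_coact of_rep m) (\<lambda>m0 m1. tsum (\<Delta> m1) (F m0))"
      by (rule tsum_congI, rule tsum_congI, rule F1[symmetric]) (blast intro: of_rep_mem m)
    finally show ?thesis .
  qed
  show "tsum (\<Delta> h) (\<lambda>h1 h2. tsum (yd_coact of_rep (r (counit H) h2 m)) (\<lambda>m0 m1. F m0 (m1 * \<alpha> h1))) =
      tsum (\<Delta> h) (\<lambda>h1 h2. tsum (yd_coact of_rep m) (\<lambda>m0 m1. F (r (counit H) h1 m0) (\<beta> h2 * m1)))"
    if m: "m \<in> carrier V" and F: "bform V A F" for m h F
  proof -
    let ?d = "dual_basis H B"
    have F1: "F a b = (\<Sum>e\<in>B. ?d e b * F a e)" if "a \<in> carrier V" for a b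
      by (rule lform_basis_expand[OF bformD(2)[OF F that]])
    have Fe: "lform V (\<lambda>a. F a e)" for e by (rule bformD(1)[OF F]) simp
    \<comment> \<open>Tested against \<open>p\<close>, right multiplication by
      \<open>\<alpha>(h_1)\<close> and left multiplication by \<open>\<beta>(h_2)\<close> become
      \<open>lharp\<close> and \<open>rharp\<close>, the situation of
      \<open>of_rep_compat\<close>.\<close>
    have pure: "tsum (\<Delta> h) (\<lambda>h1 h2. tsum (yd_coact of_rep (r (counit H) h2 m)) (\<lambda>m0 m1. p (m1 * \<alpha> h1) * f m0)) =
      tsum (\<Delta> h) (\<lambda>h1 h2. tsum (yd_coact of_rep m) (\<lambda>m0 m1. p (\<beta> h2 * m1) * f (r (counit H) h1 m0)))"
      if p: "lform A p" and f: "lform V f" for p f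
    proof -
      have lf: "lform A (lharp a p)" "lform A (rharp p a)" for a
        unfolding rharp_def lharp_def by (intro lform_comp[OF p] lhom_mult lhom_id)+
      have fr: "lform V (\<lambda>v. f (r (counit H) h1 v))" for h1 by (intro lform_comp[OF f] LG)
      show ?thesis
        using of_rep_compat[OF m p f, of h]
        unfolding of_rep_pure[OF r_in[OF lform_counit m] lf(1) f, symmetric] of_rep_pure[OF m lf(2) fr, symmetric]
        by (simp add: lharp_def rharp_def)
    qed
    have "tsum (\<Delta> h) (\<lambda>h1 h2. tsum (yd_coact of_rep (r (counit H) h2 m)) (\<lambda>m0 m1. F m0 (m1 * \<alpha> h1))) =
      tsum (\<Delta> h) (\<lambda>h1 h2. tsum (yd_coact of_rep (r (counit H) h2 m)) (\<lambda>m0 m1. \<Sum>e\<in>B. ?d e (m1 * \<alpha> h1) * F m0 e))"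
      by (rule tsum_congI, rule tsum_congI, rule F1) (blast intro: of_rep_mem r_in m lform_counit)
    also have "\<dots> = (\<Sum>e\<in>B. tsum (\<Delta> h) (\<lambda>h1 h2. tsum (yd_coact of_rep m) (\<lambda>m0 m1. ?d e (\<beta> h2 * m1) * F (r (counit H) h1 m0) e)))"
      unfolding tsum_sum pure[OF lform_dual_basis Fe] ..
    also have "\<dots> = tsum (\<Delta> h) (\<lambda>h1 h2. tsum (yd_coact of_rep m) (\<lambda>m0 m1. \<Sum>e\<in>B. ?d e (\<beta> h2 * m1) * F (r (counit H) h1 m0) e))"
      unfolding tsum_sum ..
    also have "\<dots> = tsum (\<Delta> h) (\<lambda>h1 h2. tsum (yd_coact of_rep m) (\<lambda>m0 m1. F (r (counit H) h1 m0) (\<beta> h2 * m1)))"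
      by (rule tsum_congI, rule tsum_congI, rule F1[symmetric]) (blast intro: of_rep_mem r_in m lform_counit)
    finally show ?thesis .
  qed
qed

lemma to_rep_of_rep: "to_rep of_rep = U"
proof -
  have "rep_act (to_rep of_rep) x m = rep_act U x m" if x: "x \<in> carrier E" and m: "m \<in> carrier V" for x m
  proof (rule lform_eqI[OF is_vspace_vsp[OF V]])
    show "rep_act (to_rep of_rep) x m \<in> carrier V" using to_rep_act(1)[OF of_rep_in x] m by simp
    show "rep_act U x m \<in> carrier V" by (rule lhomD(1)[OF act_lhom(1)[OF x] m])
    fix f assume f: "lform V f"
    have "f (rep_act (to_rep of_rep) x m) = tsum x (\<lambda>p h. tsum (yd_coact of_rep (r (counit H) h m)) (\<lambda>m0 m1. p m1 * f m0))"
      using to_rep_act(2)[OF of_rep_in x, of m f] m f by simp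
    also have "\<dots> = tsum x (\<lambda>p h. f (r p 1 (r (counit H) h m)))"
      by (intro tsum_congI of_rep_pure r_in lform_counit m f E_memD[OF x])
    \<comment> \<open>\<open>p \<bowtie> h\<close> is the product of \<open>p \<bowtie> 1\<close>
      and \<open>\<epsilon> \<bowtie> h\<close>, so a representation is determined by these two
      kinds of elements.\<close>
    also have "\<dots> = tsum x (\<lambda>p h. f (r p h m))"
      using E_memD[OF x] by (intro tsum_congI) (simp add: r_left_one[OF f _ lform_counit m])
    also have "\<dots> = f (rep_act U x m)" by (rule act_expand[OF f x m, symmetric])
    finally show "f (rep_act (to_rep of_rep) x m) = f (rep_act U x m)" .
  qed
  moreover have "rep_act (to_rep of_rep) x \<in> extensional (carrier V)" if "x \<in> carrier E" for x
    using that by (simp add: to_rep_def Let_def)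
  ultimately have "rep_act (to_rep of_rep) x = rep_act U x" if "x \<in> carrier E" for x
    using that act_ext(2)[OF that] by (blast intro: extensionalityI)
  moreover have "rep_act (to_rep of_rep) \<in> extensional (carrier E)" by (simp add: to_rep_def Let_def)
  ultimately have "rep_act (to_rep of_rep) = rep_act U"
    using act_ext(1) by (blast intro: extensionalityI)
  then show ?thesis by (simp add: i)
qed

end

section \<open>Bijectivity on objects and on morphisms\<close>

lemma lform_finsum:
  assumes V: "vsp V" and f: "lform V f" and "finite S" and g: "\<And>e. e \<in> S \<Longrightarrow> g e \<in> carrier V"
  shows "f (finsum V g S) = (\<Sum>e\<in>S. f (g e)) \<and> finsum V g S \<in> carrier V"
proof -
  interpret vectorspace class_ring V by (rule V)
  show ?thesis
    using assms(3) g
  proof (induction S)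
    case empty
    then show ?case using lform_zero[OF V f] by simp
  next
    case (insert e S)
    have "finsum V g (insert e S) = g e \<oplus>\<^bsub>V\<^esub> finsum V g S"
      by (rule M.finsum_insert) (use insert in auto)
    then show ?case using insert lformD(1)[OF f] by simp
  qed
qed

context fd_hopf_algebra
begin

abbreviation "G \<equiv> aut_group H"
abbreviation "DTH \<equiv> DT H B"

lemma DT_simps [simp]: "component DTH = D" "coproduct DTH = dt_coproduct H" "T_counit DTH = dt_counit H"
  "crossing DTH = dt_crossing H" "R_matrix DTH = dt_R H B"
  by (simp_all add: DT_def)

lemma to_rep_counit:
  fixes M :: "('k, 'h, 'a) yd_obj"
  assumes M: "M \<in> yd_objects H" and m: "m \<in> carrier (yd_space M)"
  shows "rep_act (to_rep M) (bow H (counit H) h) m = yd_act M h m"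
proof (rule lform_eqI[OF is_vspace_vsp[OF yd_objectsD(3)[OF M]]])
  show "rep_act (to_rep M) (bow H (counit H) h) m \<in> carrier (yd_space M)"
    by (rule to_rep_act(1)[OF M bow_in[OF lform_counit] m])
  show "yd_act M h m \<in> carrier (yd_space M)" by (rule yd_mem(1)[OF M m])
  fix f assume f: "lform (yd_space M) f"
  show "f (rep_act (to_rep M) (bow H (counit H) h) m) = f (yd_act M h m)"
    unfolding to_rep_act_bow[OF M m f lform_counit] by (rule yd_objectsD(12)[OF M yd_mem(1)[OF M m] f])
qed

lemma to_rep_lhom:
  fixes M :: "('k, 'h, 'a) yd_obj"
  assumes M: "M \<in> yd_objects H" and m: "m \<in> carrier (yd_space M)"
  shows "(\<lambda>x. rep_act (to_rep M) x m) \<in> lhom E (yd_space M)"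
  using to_rep_in[OF M] m yd_index_in[OF M]
  by (cases "yd_index M") (auto simp: rep_objects_def left_module_def lhom_iff[of _ E] dest: lhomD)

lemma to_rep_one:
  fixes M :: "('k, 'h, 'a) yd_obj"
  assumes M: "M \<in> yd_objects H" and m: "m \<in> carrier (yd_space M)" and f: "lform (yd_space M) f" and p: "lform A p"
  shows "f (rep_act (to_rep M) (bow H p 1) m) = tsum (yd_coact M m) (\<lambda>m0 m1. p m1 * f m0)"
  unfolding to_rep_act_bow[OF assms] yd_objectsD(8)[OF M m] ..

text \<open>The elements \<open>\<epsilon> \<bowtie> h\<close> recover the action, and the elements
  \<open>p \<bowtie> 1\<close> recover the coaction by \<open>tsum_eq_dual\<close>.\<close>

lemma to_rep_inj: "inj_on to_rep (yd_objects H :: ('k, 'h, 'a) yd_obj set)"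
proof (rule inj_onI)
  fix M N :: "('k, 'h, 'a) yd_obj"
  assume M: "M \<in> yd_objects H" and N: "N \<in> yd_objects H" and eq: "to_rep M = to_rep N"
  have i: "yd_index M = yd_index N" and s: "yd_space M = yd_space N"
    using arg_cong[OF eq, of rep_index] arg_cong[OF eq, of rep_space] by simp_all
  show "M = N"
  proof (rule yd_obj_eqI[OF M N i s])
    show "yd_act M h m = yd_act N h m" if m: "m \<in> carrier (yd_space M)" for h m
      using to_rep_counit[OF M m, of h] to_rep_counit[OF N m[unfolded s], of h] by (simp add: eq)
    show "tsum (yd_coact M m) F = tsum (yd_coact N m) F" if m: "m \<in> carrier (yd_space M)" and F: "bform (yd_space M) A F" for m F
    proof (rule tsum_eq_dual[OF is_vspace_vsp[OF yd_objectsD(3)[OF M]] yd_mem(2)[OF M m] _ F])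
      show "yd_coact N m \<in> carrier (tensor (yd_space M) A)" using yd_mem(2)[OF N m[unfolded s]] by (simp add: s)
      show "tsum (yd_coact M m) (\<lambda>m0 m1. p m1 * f m0) = tsum (yd_coact N m) (\<lambda>m0 m1. p m1 * f m0)"
        if p: "lform A p" and f: "lform (yd_space M) f" for p f
        using to_rep_one[OF M m f p] to_rep_one[OF N m[unfolded s] f[unfolded s] p] by (simp add: eq)
    qed
  qed
qed

lemma to_rep_bij: "bij_betw to_rep (yd_objects H :: ('k, 'h, 'a) yd_obj set) (rep_objects G DTH)"
proof (rule bij_betw_imageI[OF to_rep_inj], intro equalityI subsetI)
  fix U assume "U \<in> to_rep ` (yd_objects H :: ('k, 'h, 'a) yd_obj set)"
  then show "U \<in> rep_objects G DTH" using to_rep_in by blast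
next
  fix U :: "('h aut_pair, 'k, ('k, 'h) dt, 'a) rep_obj"
  assume U: "U \<in> rep_objects G DTH"
  then interpret dt_rep H B U "fst (rep_index U)" "snd (rep_index U)" by unfold_locales auto
  show "U \<in> to_rep ` (yd_objects H :: ('k, 'h, 'a) yd_obj set)"
    using to_rep_of_rep of_rep_in by (metis image_eqI)
qed

text \<open>H-linearity is linearity over the elements \<open>\<epsilon> \<bowtie> h\<close>, and
  H-colinearity is linearity over the elements \<open>p \<bowtie> 1\<close>. The functor can
  therefore be the identity on underlying maps.\<close>

lemma to_rep_homs:
  fixes M N :: "('k, 'h, 'a) yd_obj"
  assumes M: "M \<in> yd_objects H" and N: "N \<in> yd_objects H"
  shows "rep_homs DTH (to_rep M) (to_rep N) = yd_homs H M N"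
proof (intro equalityI subsetI)
  note vN = is_vspace_vsp[OF yd_objectsD(3)[OF N]]
  fix f
  {
    assume f: "f \<in> yd_homs H M N"
    note D = yd_homsD[OF f M N]
    have "f (rep_act (to_rep M) x m) = rep_act (to_rep N) x (f m)"
      if x: "x \<in> carrier E" and m: "m \<in> carrier (yd_space M)" for x m
    proof (rule lform_eqI[OF vN lhomD(1)[OF D(3) to_rep_act(1)[OF M x m]] to_rep_act(1)[OF N x lhomD(1)[OF D(3) m]]])
      fix g assume g: "lform (yd_space N) g"
      have "g (f (rep_act (to_rep M) x m)) = tsum x (\<lambda>p h. tsum (yd_coact M (yd_act M h m)) (\<lambda>m0 m1. p m1 * g (f m0)))"
        by (rule to_rep_act(2)[OF M x m lform_comp[OF g D(3)]])
      also have "\<dots> = tsum x (\<lambda>p h. tsum (yd_coact N (yd_act N h (f m))) (\<lambda>m0 m1. p m1 * g m0))"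
      proof (rule tsum_congI)
        fix p h assume "(p, h) \<in> set x"
        then have "lform A p" by (rule E_memD[OF x])
        then have "bform (yd_space N) A (\<lambda>m0 m1. p m1 * g m0)"
          using g by (intro bformI lform_mult_left lform_mult_right)
        from D(5)[OF yd_mem(1)[OF M m] this, of h]
        show "tsum (yd_coact M (yd_act M h m)) (\<lambda>m0 m1. p m1 * g (f m0)) =
          tsum (yd_coact N (yd_act N h (f m))) (\<lambda>m0 m1. p m1 * g m0)"
          by (simp add: D(4)[OF m])
      qed
      also have "\<dots> = g (rep_act (to_rep N) x (f m))"
        by (rule to_rep_act(2)[OF N x lhomD(1)[OF D(3) m] g, symmetric])
      finally show "g (f (rep_act (to_rep M) x m)) = g (rep_act (to_rep N) x (f m))" .
    qed
    then show "f \<in> rep_homs DTH (to_rep M) (to_rep N)"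
      using D(1-3) by (simp add: rep_homs_def)
  next
    assume f: "f \<in> rep_homs DTH (to_rep M) (to_rep N)"
    then have f': "yd_index M = yd_index N" "f \<in> extensional (carrier (yd_space M))" "f \<in> lhom (yd_space M) (yd_space N)"
      "\<And>x m. x \<in> carrier E \<Longrightarrow> m \<in> carrier (yd_space M) \<Longrightarrow> f (rep_act (to_rep M) x m) = rep_act (to_rep N) x (f m)"
      by (simp_all add: rep_homs_def)
    note fm = lhomD(1)[OF f'(3)]
    show "f \<in> yd_homs H M N"
    proof (rule yd_homsI[OF M N f'(1-3)])
      fix m assume m: "m \<in> carrier (yd_space M)"
      show "f (yd_act M h m) = yd_act N h (f m)" for h
        using f'(4)[OF bow_in[OF lform_counit] m, of h] by (simp add: to_rep_counit[OF M m] to_rep_counit[OF N fm[OF m]])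
      fix F assume F: "bform (yd_space N) A F"
      let ?t = "tcls (yd_space N) A [(f m0, m1). (m0, m1) \<leftarrow> yd_coact M m]"
      have wf: "set [(f m0, m1). (m0, m1) \<leftarrow> yd_coact M m] \<subseteq> carrier (yd_space N) \<times> carrier A"
        by (intro wf_intros; (blast intro: fm yd_mem[OF M m] | simp))
      have t: "tsum ?t F' = tsum (yd_coact M m) (\<lambda>m0 m1. F' (f m0) m1)" if "bform (yd_space N) A F'" for F'
        using tsum_tcls[OF vN vsp_alg that wf] by simp
      have "tsum (yd_coact N (f m)) F = tsum ?t F"
      proof (rule tsum_eq_dual[OF vN yd_mem(2)[OF N fm[OF m]] tcls_in[OF wf] F])
        fix p g assume p: "lform A p" and g: "lform (yd_space N) g"
        have "bform (yd_space N) A (\<lambda>m0 m1. p m1 * g m0)"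
          using p g by (intro bformI lform_mult_left lform_mult_right)
        then show "tsum (yd_coact N (f m)) (\<lambda>m0 m1. p m1 * g m0) = tsum ?t (\<lambda>m0 m1. p m1 * g m0)"
          using to_rep_one[OF M m lform_comp[OF g f'(3)] p] to_rep_one[OF N fm[OF m] g p]
          by (simp add: t f'(4)[OF bow_in[OF p] m])
      qed
      then show "tsum (yd_coact N (f m)) F = tsum (yd_coact M m) (\<lambda>m0 m1. F (f m0) m1)" by (simp add: t[OF F])
    qed
  }
qed

lemma rep_obj_eqI:
  fixes M :: "('k, 'h, 'a) yd_obj" and U :: "('h aut_pair, 'k, ('k, 'h) dt, 'a) rep_obj"
  assumes "M \<in> yd_objects H" "rep_index U = yd_index M" and s: "rep_space U = yd_space M"
    and e: "rep_act U \<in> extensional (carrier E)" "\<And>x. x \<in> carrier E \<Longrightarrow> rep_act U x \<in> extensional (carrier (yd_space M))"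
    and c: "\<And>x m. x \<in> carrier E \<Longrightarrow> m \<in> carrier (yd_space M) \<Longrightarrow> rep_act U x m \<in> carrier (yd_space M)"
    and f: "\<And>x m f. x \<in> carrier E \<Longrightarrow> m \<in> carrier (yd_space M) \<Longrightarrow> lform (yd_space M) f \<Longrightarrow>
      f (rep_act U x m) = tsum x (\<lambda>p h. tsum (yd_coact M (yd_act M h m)) (\<lambda>m0 m1. p m1 * f m0))"
  shows "to_rep M = U"
proof -
  note V = is_vspace_vsp[OF yd_objectsD(3)[OF assms(1)]]
  have "rep_act (to_rep M) x m = rep_act U x m" if "x \<in> carrier E" "m \<in> carrier (yd_space M)" for x m
    by (rule lform_eqI[OF V]) (use that to_rep_act[OF assms(1)] c f in auto)
  moreover have "rep_act (to_rep M) x \<in> extensional (carrier (yd_space M))" if "x \<in> carrier E" for x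
    using that by (simp add: to_rep_def Let_def)
  ultimately have "rep_act (to_rep M) x = rep_act U x" if "x \<in> carrier E" for x
    using that e(2)[OF that] by (blast intro: extensionalityI)
  moreover have "rep_act (to_rep M) \<in> extensional (carrier E)" by (simp add: to_rep_def Let_def)
  ultimately have "rep_act (to_rep M) = rep_act U"
    using e(1) by (blast intro: extensionalityI)
  then show ?thesis using assms(2,3) by simp
qed

text \<open>The description by \<open>THE\<close> calls for existence and uniqueness of the tensor.
  Both come from the finite basis: the first by expanding \<open>p(hl)\<close> in \<open>l\<close>,
  the second because a tensor of two functionals is determined by its values on pairs of basis
  elements.\<close>

lemma dual_comul:
  assumes p: "lform A p"
  shows "dual_comul H p \<in> carrier (tensor H' H')"
    and "tsum (dual_comul H p) (\<lambda>p1 p2. p1 h * p2 l) = p (h * l)"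
proof -
  let ?d = "dual_basis H B"
  let ?P = "\<lambda>t. t \<in> carrier (tensor H' H') \<and> (\<forall>h l. p (h * l) = (\<Sum>(p1, p2)\<leftarrow>t. p1 h * p2 l))"
  have ev: "bform H' H' (\<lambda>p1 p2. p1 h * p2 l)" for h l
    by (intro bformI lform_mult_left lform_mult_right lform_eval)
  obtain bs where bs: "distinct bs" "set bs = B" using finite_distinct_list[OF finite_B] by blast
  \<comment> \<open>The coefficient of the coordinate functional of \<open>e\<close> in
    \<open>p(hl)\<close>, as a function of \<open>l\<close>, is \<open>p(he)\<close>, which is
    \<open>lharp e p\<close> at \<open>h\<close>.\<close>
  let ?t = "tcls H' H' [(lharp e p, ?d e). e \<leftarrow> bs]"
  have l: "lform A (lharp e p)" for e
    unfolding lharp_def by (intro lform_comp[OF p] lin)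
  have wf: "set [(lharp e p, ?d e). e \<leftarrow> bs] \<subseteq> carrier H' \<times> carrier H'"
    using l lform_dual_basis by auto
  have "p (h * l) = (\<Sum>(p1, p2)\<leftarrow>?t. p1 h * p2 l)" for h l
  proof -
    have "lform A (\<lambda>x. p (h * x))" by (intro lform_comp[OF p] lin)
    then have "p (h * l) = (\<Sum>e\<in>B. ?d e l * p (h * e))" by (rule lform_basis_expand)
    moreover have "tsum ?t (\<lambda>p1 p2. p1 h * p2 l) = tsum [(lharp e p, ?d e). e \<leftarrow> bs] (\<lambda>p1 p2. p1 h * p2 l)"
      by (rule tsum_tcls[OF vsp_dual vsp_dual ev wf])
    moreover have "\<dots> = (\<Sum>e\<leftarrow>bs. ?d e l * p (h * e))"
      by (simp add: tsum_def comp_def lharp_def mult.commute)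
    ultimately show ?thesis by (simp add: tsum_def[symmetric] sum_list_distinct_conv_sum_set bs)
  qed
  then have ex: "?P ?t" using wf by blast
  have "t = t'" if t: "?P t" and t': "?P t'" for t t'
  proof (rule tensor_eqI[OF vsp_dual vsp_dual])
    fix F assume F: "bform H' H' F"
    \<comment> \<open>Expanding both legs in the dual basis leaves only the values of
      \<open>p\<close> on products of basis elements, which no longer depend on
      \<open>s\<close>.\<close>
    have "tsum s F = (\<Sum>e\<in>B. \<Sum>e'\<in>B. p (e * e') * F (?d e) (?d e'))" if s: "?P s" for s
    proof -
      have "tsum s F = tsum s (\<lambda>p1 p2. \<Sum>e\<in>B. \<Sum>e'\<in>B. (p1 e * p2 e') * F (?d e) (?d e'))"
      proof (rule tsum_congI)
        fix p1 p2 assume "(p1, p2) \<in> set s"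
        then have p1: "lform A p1" and p2: "lform A p2" using tensor_memD[OF vsp_dual vsp_dual] s by auto
        have "F p1 p2 = (\<Sum>e\<in>B. p1 e * F (?d e) p2)"
          by (rule lform_dual_expand[OF bformD(1)[OF F] p1]) (simp add: p2)
        also have "\<dots> = (\<Sum>e\<in>B. p1 e * (\<Sum>e'\<in>B. p2 e' * F (?d e) (?d e')))"
          by (intro sum.cong HOL.refl arg_cong[of _ _ "(*) _"] lform_dual_expand[OF bformD(2)[OF F] p2]) (simp add: lform_dual_basis)
        finally show "F p1 p2 = (\<Sum>e\<in>B. \<Sum>e'\<in>B. (p1 e * p2 e') * F (?d e) (?d e'))"
          by (simp add: sum_distrib_left mult.assoc)
      qed
      also have "\<dots> = (\<Sum>e\<in>B. \<Sum>e'\<in>B. tsum s (\<lambda>p1 p2. p1 e * p2 e') * F (?d e) (?d e'))"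
        by (simp add: tsum_sum tsum_mult_right)
      also have "\<dots> = (\<Sum>e\<in>B. \<Sum>e'\<in>B. p (e * e') * F (?d e) (?d e'))"
        using s by (simp add: tsum_def)
      finally show ?thesis .
    qed
    from this[OF t] this[OF t'] show "tsum t F = tsum t' F" by simp
  qed (use t t' in auto)
  then have "?P (THE t. ?P t)"
    using ex by (intro theI[of ?P, OF ex]) blast
  then have "?P (dual_comul H p)" unfolding dual_comul_def .
  then show "dual_comul H p \<in> carrier (tensor H' H')" "tsum (dual_comul H p) (\<lambda>p1 p2. p1 h * p2 l) = p (h * l)"
    by (auto simp: tsum_def)
qed

lemma dual_comul_mem: "lform A p \<Longrightarrow> (p1, p2) \<in> set (dual_comul H p) \<Longrightarrow> lform A p1 \<and> lform A p2"
  using tensor_memD(1)[OF vsp_dual vsp_dual dual_comul(1)] tensor_memD(2)[OF vsp_dual vsp_dual dual_comul(1)] unfolding dual_simps by blast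

lemma bform_D [simp]: "bform (D i) (D j) F \<longleftrightarrow> bform E E F"
  by (simp add: bform_def)

lemma coproduct_wf:
  assumes x: "x \<in> carrier E"
  shows "set [(bow H p2 (\<gamma> h1), bow H p1 (finv \<gamma> (\<beta> (\<gamma> h2)))).
          (p, h) \<leftarrow> x, (p1, p2) \<leftarrow> dual_comul H p, (h1, h2) \<leftarrow> \<Delta> h] \<subseteq> carrier (D i) \<times> carrier (D j)"
  unfolding D_simps
  by (intro wf_intros; (blast intro: bow_in dest: E_memD[OF x] dual_comul_mem))

lemma tsum_coproduct:
  assumes x: "x \<in> carrier E" and F: "bform E E F"
  shows "tsum (dt_coproduct H (\<alpha>, \<beta>) (\<gamma>, \<delta>) x) F = tsum x (\<lambda>p h. tsum (dual_comul H p) (\<lambda>p1 p2. tsum (\<Delta> h) (\<lambda>h1 h2.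
      F (bow H p2 (\<gamma> h1)) (bow H p1 (finv \<gamma> (\<beta> (\<gamma> h2)))))))"
  using tsum_tcls[OF vsp_D vsp_D _ coproduct_wf[OF x], of "(\<alpha>, \<beta>)" "(\<gamma>, \<delta>)" F] F by (simp add: dt_coproduct_def)

lemma coproduct_mem:
  assumes x: "x \<in> carrier E" and "(x1, x2) \<in> set (dt_coproduct H i j x)"
  shows "x1 \<in> carrier E" "x2 \<in> carrier E"
proof -
  have "dt_coproduct H i j x \<in> carrier (tensor (D i) (D j))"
    unfolding dt_coproduct_def by (cases i, cases j) (simp only: prod.case, rule tcls_in[OF coproduct_wf[OF x]])
  then show "x1 \<in> carrier E" "x2 \<in> carrier E"
    using tensor_memD[OF vsp_D vsp_D _ assms(2)] by auto
qed

end

section \<open>Preservation of the tensor product and of the braiding\<close>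

locale dt_pair = fd_hopf_algebra H B + yd_pair H M N \<alpha> \<beta> \<gamma> \<delta>
  for H :: "('k::field, 'h::ring_1) hopf_data" and B and M N :: "('k, 'h, 'a) yd_obj" and \<alpha> \<beta> \<gamma> \<delta>
begin

text \<open>The legs of the coproduct of \<open>p\<close> meet as
  \<open>p_1(n_1) p_2(m_1) = p(n_1 m_1)\<close>. This is why the coproduct of DT(H) puts
  \<open>p_2\<close> on the first factor while the coaction of a tensor product multiplies
  \<open>n_1\<close> before \<open>m_1\<close>.\<close>

lemma to_rep_tensor: "to_rep MN = rep_tensor G DTH (to_rep M) (to_rep N)"
proof (rule rep_obj_eqI[OF yd_tensor_in[OF M N]], unfold MN_simps(2))
  let ?R = "rep_tensor G DTH (to_rep M) (to_rep N)"
  show "rep_index ?R = yd_index MN" by (simp add: rep_tensor_def Let_def MN_simps iM iN aut_group_def \<sigma>_def comp_assoc)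
  show "rep_space ?R = T" by (simp add: rep_tensor_def Let_def)
  show "rep_act ?R \<in> extensional (carrier E)" by (simp add: rep_tensor_def Let_def)
  show "rep_act ?R x \<in> extensional (carrier T)" if "x \<in> carrier E" for x
    using that by (simp add: rep_tensor_def Let_def)
  fix x t assume x: "x \<in> carrier E" and t: "t \<in> carrier T"
  let ?l = "[(rep_act (to_rep M) x1 u, rep_act (to_rep N) x2 v).
    (u, v) \<leftarrow> summands t, (x1, x2) \<leftarrow> dt_coproduct H (\<alpha>, \<beta>) (\<gamma>, \<delta>) x]"
  have act: "rep_act ?R x t = utens V W ?l"
    using x t by (simp add: rep_tensor_def Let_def iM iN)
  have wf: "set ?l \<subseteq> carrier V \<times> carrier W"
    by (intro wf_intros; blast intro: to_rep_act(1)[OF M] to_rep_act(1)[OF N] dest: coproduct_mem[OF x] intro: mem t)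
  show "rep_act ?R x t \<in> carrier T" unfolding act by (rule utens_in[OF wf])
  fix f assume f: "lform T f"
  let ?K = "\<lambda>p m n. tsum (yd_coact M m) (\<lambda>m0 m1. tsum (yd_coact N n) (\<lambda>n0 n1. p (n1 * m1) * f (utens V W [(m0, n0)])))"
  have pure: "tsum (dual_comul H p) (\<lambda>p1 p2. f (utens V W [(rep_act (to_rep M) (bow H p2 a) m, rep_act (to_rep N) (bow H p1 b) n)])) =
    ?K p (yd_act M a m) (yd_act N b n)"
    if p: "lform A p" and m: "m \<in> carrier V" and n: "n \<in> carrier W" for p a b m n
  proof -
    have "tsum (dual_comul H p) (\<lambda>p1 p2. f (utens V W [(rep_act (to_rep M) (bow H p2 a) m, rep_act (to_rep N) (bow H p1 b) n)])) =
      tsum (dual_comul H p) (\<lambda>p1 p2. tsum (yd_coact M (yd_act M a m)) (\<lambda>m0 m1. tsum (yd_coact N (yd_act N b n)) (\<lambda>n0 n1.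
        (p1 n1 * p2 m1) * f (utens V W [(m0, n0)]))))"
    proof (rule tsum_congI)
      fix p1 p2 assume "(p1, p2) \<in> set (dual_comul H p)"
      then have p12: "lform A p1" "lform A p2" using dual_comul_mem[OF p] by blast+
      note n' = to_rep_act(1)[OF N bow_in[OF p12(1), of b] n]
      have "f (utens V W [(rep_act (to_rep M) (bow H p2 a) m, rep_act (to_rep N) (bow H p1 b) n)]) =
        tsum (yd_coact M (yd_act M a m)) (\<lambda>m0 m1. p2 m1 * f (utens V W [(m0, rep_act (to_rep N) (bow H p1 b) n)]))"
        by (rule to_rep_act_bow[OF M m _ p12(2)]) (intro lform_comp[OF f] L n')
      also have "\<dots> = tsum (yd_coact M (yd_act M a m)) (\<lambda>m0 m1. p2 m1 * tsum (yd_coact N (yd_act N b n)) (\<lambda>n0 n1. p1 n1 * f (utens V W [(m0, n0)])))"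
        by (intro tsum_congI arg_cong[of _ _ "(*) _"] to_rep_act_bow[OF N n _ p12(1)] lform_comp[OF f] L; blast intro: mem m)
      finally show "f (utens V W [(rep_act (to_rep M) (bow H p2 a) m, rep_act (to_rep N) (bow H p1 b) n)]) =
        tsum (yd_coact M (yd_act M a m)) (\<lambda>m0 m1. tsum (yd_coact N (yd_act N b n)) (\<lambda>n0 n1. (p1 n1 * p2 m1) * f (utens V W [(m0, n0)])))"
        by (simp add: tsum_mult_left[symmetric] mult_ac)
    qed
    also have "\<dots> = tsum (yd_coact M (yd_act M a m)) (\<lambda>m0 m1. tsum (dual_comul H p) (\<lambda>p1 p2. tsum (yd_coact N (yd_act N b n)) (\<lambda>n0 n1.
        (p1 n1 * p2 m1) * f (utens V W [(m0, n0)]))))"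
      by (rule tsum_swap)
    also have "\<dots> = tsum (yd_coact M (yd_act M a m)) (\<lambda>m0 m1. tsum (yd_coact N (yd_act N b n)) (\<lambda>n0 n1. tsum (dual_comul H p) (\<lambda>p1 p2.
        (p1 n1 * p2 m1) * f (utens V W [(m0, n0)]))))"
      by (rule tsum_congI, rule tsum_swap)
    also have "\<dots> = ?K p (yd_act M a m) (yd_act N b n)"
      by (simp add: tsum_mult_right dual_comul(2)[OF p])
    finally show ?thesis .
  qed
  have F: "bform E E (\<lambda>x1 x2. f (utens V W [(rep_act (to_rep M) x1 m, rep_act (to_rep N) x2 n)]))"
    if m: "m \<in> carrier V" and n: "n \<in> carrier W" for m n
    by (intro bformI lform_comp[OF f] utens_bilinear[OF V W] to_rep_lhom[OF M m] to_rep_lhom[OF N n]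
      to_rep_act(1)[OF M _ m] to_rep_act(1)[OF N _ n])
  have "f (rep_act ?R x t) = tsum (summands t) (\<lambda>m n. tsum (dt_coproduct H (\<alpha>, \<beta>) (\<gamma>, \<delta>) x) (\<lambda>x1 x2.
      f (utens V W [(rep_act (to_rep M) x1 m, rep_act (to_rep N) x2 n)])))"
    unfolding act lform_utens[OF V W f wf] by simp
  also have "\<dots> = tsum (summands t) (\<lambda>m n. tsum x (\<lambda>p h. tsum (\<Delta> h) (\<lambda>h1 h2. ?K p (yd_act M (\<gamma> h1) m) (yd_act N (\<sigma> h2) n))))"
  proof (rule tsum_congI)
    fix m n assume "(m, n) \<in> set (summands t)"
    then have m: "m \<in> carrier V" and n: "n \<in> carrier W" using summands_memD[OF V W t] by blast+
    show "tsum (dt_coproduct H (\<alpha>, \<beta>) (\<gamma>, \<delta>) x) (\<lambda>x1 x2. f (utens V W [(rep_act (to_rep M) x1 m, rep_act (to_rep N) x2 n)])) =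
      tsum x (\<lambda>p h. tsum (\<Delta> h) (\<lambda>h1 h2. ?K p (yd_act M (\<gamma> h1) m) (yd_act N (\<sigma> h2) n)))"
      unfolding tsum_coproduct[OF x F[OF m n]]
    proof (rule tsum_congI)
      fix p h assume "(p, h) \<in> set x"
      then have p: "lform A p" by (rule E_memD[OF x])
      show "tsum (dual_comul H p) (\<lambda>p1 p2. tsum (\<Delta> h) (\<lambda>h1 h2. f (utens V W [(rep_act (to_rep M) (bow H p2 (\<gamma> h1)) m,
          rep_act (to_rep N) (bow H p1 (finv \<gamma> (\<beta> (\<gamma> h2)))) n)]))) =
        tsum (\<Delta> h) (\<lambda>h1 h2. ?K p (yd_act M (\<gamma> h1) m) (yd_act N (\<sigma> h2) n))"
        by (subst tsum_swap) (rule tsum_congI, simp only: pure[OF p m n] \<sigma>_def comp_apply)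
    qed
  qed
  also have "\<dots> = tsum x (\<lambda>p h. tsum (summands t) (\<lambda>m n. tsum (\<Delta> h) (\<lambda>h1 h2. ?K p (yd_act M (\<gamma> h1) m) (yd_act N (\<sigma> h2) n))))"
    by (rule tsum_swap)
  also have "\<dots> = tsum x (\<lambda>p h. tsum (yd_coact MN (yd_act MN h t)) (\<lambda>m0 m1. p m1 * f m0))"
  proof (rule tsum_congI)
    fix p h assume "(p, h) \<in> set x"
    then have p: "lform A p" by (rule E_memD[OF x])
    have F: "bform T A (\<lambda>m0 m1. p m1 * f m0)" using p f by (intro bformI lform_mult_left lform_mult_right)
    show "tsum (summands t) (\<lambda>m n. tsum (\<Delta> h) (\<lambda>h1 h2. ?K p (yd_act M (\<gamma> h1) m) (yd_act N (\<sigma> h2) n))) =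
      tsum (yd_coact MN (yd_act MN h t)) (\<lambda>m0 m1. p m1 * f m0)"
      unfolding coact_tsum[OF F act_in[OF t]] by (rule act_tsum[OF coact_bform[OF F] t, symmetric])
  qed
  finally show "f (rep_act ?R x t) = tsum x (\<lambda>p h. tsum (yd_coact MN (yd_act MN h t)) (\<lambda>m0 m1. p m1 * f m0))" .
qed

text \<open>The leg \<open>e^i \<bowtie> 1\<close> of the \<open>R\<close>-matrix reads off a
  coordinate of \<open>n_1\<close> and the other leg acts by \<open>\<beta>^{-1}(e_i)\<close>;
  summing over the basis reassembles \<open>\<beta>^{-1}(n_1)\<close>.\<close>

lemma to_rep_braid: "rep_braid DTH (to_rep M) (to_rep N) = yd_braid H M N"
proof (rule extensionalityI)
  let ?T' = "tensor_space W V" and ?R = "dt_R H B (\<alpha>, \<beta>) (\<gamma>, \<delta>)" and ?d = "dual_basis H B"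
  show "rep_braid DTH (to_rep M) (to_rep N) \<in> extensional (carrier T)" by (simp add: rep_braid_def)
  show "yd_braid H M N \<in> extensional (carrier T)" by (simp add: yd_braid_def iM)
  fix t assume t: "t \<in> carrier T"
  let ?g = "\<lambda>e. tcls (D (\<alpha>, \<beta>)) (D (\<gamma>, \<delta>)) [(bow H (counit H) (finv \<beta> e), bow H (?d e) 1)]"
  have wg: "set [(bow H (counit H) (finv \<beta> e), bow H (?d e) 1)] \<subseteq> carrier (D (\<alpha>, \<beta>)) \<times> carrier (D (\<gamma>, \<delta>))" for e
    by (simp add: bow_in[OF lform_counit] bow_in[OF lform_dual_basis])
  have vT: "vsp (tensor (D (\<alpha>, \<beta>)) (D (\<gamma>, \<delta>)))" by (rule vsp_tensor) simp_all
  have R: "?R = finsum (tensor (D (\<alpha>, \<beta>)) (D (\<gamma>, \<delta>))) ?g B" by (simp add: dt_R_def Let_def)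
  \<comment> \<open>The zero form serves only to extract from \<open>lform_finsum\<close> that the
    sum over the basis lies in the carrier.\<close>
  have "lform (tensor (D (\<alpha>, \<beta>)) (D (\<gamma>, \<delta>))) (\<lambda>_. 0)" by (simp add: lform_def)
  then have Rin: "?R \<in> carrier (tensor (D (\<alpha>, \<beta>)) (D (\<gamma>, \<delta>)))"
    using lform_finsum[OF vT _ finite_B, of _ ?g] tcls_in[OF wg] unfolding R by blast
  have Rmem: "r1 \<in> carrier E \<and> r2 \<in> carrier E" if "(r1, r2) \<in> set ?R" for r1 r2
    using tensor_memD[OF vsp_D vsp_D Rin that] by simp
  have Rsum: "tsum ?R F = (\<Sum>e\<in>B. F (bow H (counit H) (finv \<beta> e)) (bow H (?d e) 1))" if F: "bform E E F" for F
  proof -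
    have F': "bform (D (\<alpha>, \<beta>)) (D (\<gamma>, \<delta>)) F" using F by simp
    have "tsum ?R F = (\<Sum>e\<in>B. tsum (?g e) F)"
      unfolding R by (rule conjunct1[OF lform_finsum[OF vT lform_tsum[OF vsp_D vsp_D F'] finite_B, of ?g]]) (rule tcls_in[OF wg])
    also have "\<dots> = (\<Sum>e\<in>B. F (bow H (counit H) (finv \<beta> e)) (bow H (?d e) 1))"
      unfolding tsum_tcls[OF vsp_D vsp_D F' wg] by simp
    finally show ?thesis .
  qed
  let ?l = "[(rep_act (to_rep N) r2 v, rep_act (to_rep M) r1 u). (u, v) \<leftarrow> summands t, (r1, r2) \<leftarrow> ?R]"
  have wf: "set ?l \<subseteq> carrier W \<times> carrier V"
    by (intro wf_intros; blast intro: to_rep_act(1)[OF M] to_rep_act(1)[OF N] dest: Rmem intro: mem t)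
  have eq: "rep_braid DTH (to_rep M) (to_rep N) t = utens W V ?l"
    using t by (simp add: rep_braid_def iM iN)
  have vT': "vsp ?T'" using V W by simp
  show "rep_braid DTH (to_rep M) (to_rep N) t = yd_braid H M N t"
  proof (rule lform_eqI[OF vT'])
    show "rep_braid DTH (to_rep M) (to_rep N) t \<in> carrier ?T'" unfolding eq by (rule utens_in[OF wf])
    show "yd_braid H M N t \<in> carrier ?T'" by (rule lhomD(1)[OF braid_lhom t])
    fix f assume f: "lform ?T' f"
    have "f (rep_braid DTH (to_rep M) (to_rep N) t) = tsum (summands t) (\<lambda>m n. tsum ?R (\<lambda>r1 r2.
        f (utens W V [(rep_act (to_rep N) r2 n, rep_act (to_rep M) r1 m)])))"
      unfolding eq lform_utens[OF W V f wf] by simp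
    also have "\<dots> = tsum (summands t) (\<lambda>m n. tsum (yd_coact N n) (\<lambda>n0 n1. f (utens W V [(n0, yd_act M (finv \<beta> n1) m)])))"
    proof (rule tsum_congI)
      fix m n assume "(m, n) \<in> set (summands t)"
      then have m: "m \<in> carrier V" and n: "n \<in> carrier W" using summands_memD[OF V W t] by blast+
      have F: "bform E E (\<lambda>x1 x2. f (utens W V [(rep_act (to_rep N) x2 n, rep_act (to_rep M) x1 m)]))"
        by (intro bformI lform_comp[OF f] utens_bilinear[OF W V] to_rep_lhom[OF M m] to_rep_lhom[OF N n]
          to_rep_act(1)[OF M _ m] to_rep_act(1)[OF N _ n])
      have K: "bform W A (\<lambda>n0 n1. f (utens W V [(n0, yd_act M (finv \<beta> n1) m)]))"
        by (intro lform_comp[OF f] LB; (blast intro: mem m | simp))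
      have "tsum ?R (\<lambda>r1 r2. f (utens W V [(rep_act (to_rep N) r2 n, rep_act (to_rep M) r1 m)])) =
        (\<Sum>e\<in>B. f (utens W V [(rep_act (to_rep N) (bow H (?d e) 1) n, yd_act M (finv \<beta> e) m)]))"
        unfolding Rsum[OF F] to_rep_counit[OF M m] ..
      also have "\<dots> = (\<Sum>e\<in>B. tsum (yd_coact N n) (\<lambda>n0 n1. ?d e n1 * f (utens W V [(n0, yd_act M (finv \<beta> e) m)])))"
        by (intro sum.cong HOL.refl to_rep_one[OF N n _ lform_dual_basis] lform_comp[OF f] LB) (blast intro: mem m)
      also have "\<dots> = tsum (yd_coact N n) (\<lambda>n0 n1. f (utens W V [(n0, yd_act M (finv \<beta> n1) m)]))"
        by (rule tsum_basis_expand[OF is_vspace_vsp[OF W] yd_mem(2)[OF N n] K, symmetric])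
      finally show "tsum ?R (\<lambda>r1 r2. f (utens W V [(rep_act (to_rep N) r2 n, rep_act (to_rep M) r1 m)])) =
        tsum (yd_coact N n) (\<lambda>n0 n1. f (utens W V [(n0, yd_act M (finv \<beta> n1) m)]))" .
    qed
    also have "\<dots> = f (yd_braid H M N t)"
      by (rule evaluatesD(3)[OF braid_evaluates f t, symmetric])
    finally show "f (rep_braid DTH (to_rep M) (to_rep N) t) = f (yd_braid H M N t)" .
  qed
qed

end

section \<open>Preservation of conjugation\<close>

locale dt_twist = fd_hopf_algebra H B + yd_twist H N \<alpha> \<beta> \<gamma> \<delta>
  for H :: "('k::field, 'h::ring_1) hopf_data" and B and N :: "('k, 'h, 'a) yd_obj" and \<alpha> \<beta> \<gamma> \<delta>
begin

lemma to_rep_phi: "to_rep PN = rep_phi G DTH (\<alpha>, \<beta>) (to_rep N)"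
proof (rule rep_obj_eqI[OF PN_in], unfold PN_simps(2))
  let ?R = "rep_phi G DTH (\<alpha>, \<beta>) (to_rep N)"
  define c where "c = (\<alpha>, \<beta>) \<otimes>\<^bsub>G\<^esub> (\<gamma>, \<delta>) \<otimes>\<^bsub>G\<^esub> inv\<^bsub>G\<^esub> (\<alpha>, \<beta>)"
  show iR: "rep_index ?R = yd_index PN" by (simp add: rep_phi_def Let_def yd_phi_def iN)
  have c: "c = (\<alpha> \<circ> \<gamma> \<circ> finv \<alpha>, \<kappa> \<circ> \<delta> \<circ> \<tau>)"
    using iR unfolding PN_simps(1) by (simp add: rep_phi_def Let_def iN c_def)
  have ib: "inv\<^bsub>G\<^esub> (\<alpha>, \<beta>) = (finv \<alpha>, \<alpha> \<circ> finv \<beta> \<circ> finv \<alpha>)" by (rule aut_group_inv[OF \<alpha> \<beta>])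
  show "rep_space ?R = W" by (simp add: rep_phi_def Let_def)
  note inv = autD(8,9)[OF \<alpha>] autD(8,9)[OF \<beta>] autD(8,9)[OF auts(1)]
  \<comment> \<open>An element of the conjugated component acts through the crossing for
    \<open>(\<alpha>, \<beta>)^{-1} = (\<alpha>^{-1}, \<alpha>\<beta>^{-1}\<alpha>^{-1})\<close>. At
    this pair the crossing formula simplifies to composition with \<open>\<kappa>\<close> on
    functionals and to \<open>\<tau>\<close> on H, the twists of the conjugated module.\<close>
  have k: "p \<circ> (\<alpha> \<circ> finv \<beta> \<circ> finv \<alpha>) \<circ> finv (finv \<alpha>) = p \<circ> \<kappa>" for p :: "'h \<Rightarrow> 'k"
    by (simp add: finv_finv[OF \<alpha>] \<kappa>_def fun_eq_iff inv)
  have fi: "finv (\<alpha> \<circ> \<gamma> \<circ> finv \<alpha>) x = \<alpha> (finv \<gamma> (finv \<alpha> x))" for x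
    by (rule inv_into_f_eq) (auto simp: inv intro!: bij_is_inj bij_comp autD(1) \<alpha> auts(1) aut_finv aut_comp)
  have fj: "finv (\<alpha> \<circ> finv \<beta> \<circ> finv \<alpha>) x = \<alpha> (\<beta> (finv \<alpha> x))" for x
    by (rule inv_into_f_eq) (auto simp: inv intro!: bij_is_inj bij_comp autD(1) \<alpha> \<beta> aut_finv aut_comp)
  have tt: "finv \<alpha> (finv (\<alpha> \<circ> \<gamma> \<circ> finv \<alpha>) (finv (\<alpha> \<circ> finv \<beta> \<circ> finv \<alpha>) ((\<alpha> \<circ> \<gamma> \<circ> finv \<alpha>) h))) = \<tau> h" for h
    unfolding fi fj by (simp add: \<tau>_def inv)
  let ?l = "\<lambda>x. [(p \<circ> \<kappa>, \<tau> h). (p, h) \<leftarrow> x]"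
  have cr: "dt_crossing H (inv\<^bsub>G\<^esub> (\<alpha>, \<beta>)) c x = dcls H (?l x)" for x
    unfolding ib c dt_crossing_def prod.case tt k ..
  have lk: "lform A (p \<circ> \<kappa>)" if "lform A p" for p
    unfolding comp_def by (rule lform_comp[OF that autD(2)[OF auts(4)]])
  have wf: "set (?l x) \<subseteq> carrier H' \<times> carrier A" if "x \<in> carrier E" for x
    using lk E_memD[OF that] by auto
  have act: "rep_act ?R x = rep_act (to_rep N) (dcls H (?l x))" if "x \<in> carrier E" for x
    using that cr[of x] by (simp add: rep_phi_def Let_def iN c_def)
  show "rep_act ?R \<in> extensional (carrier E)" by (simp add: rep_phi_def Let_def)
  show "rep_act ?R x \<in> extensional (carrier W)" if x: "x \<in> carrier E" for x
    unfolding act[OF x] using tcls_in[OF wf[OF x]] by (simp add: to_rep_def Let_def)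
  fix x n assume x: "x \<in> carrier E" and n: "n \<in> carrier W"
  show "rep_act ?R x n \<in> carrier W"
    unfolding act[OF x] by (rule to_rep_act(1)[OF N tcls_in[OF wf[OF x]] n])
  fix f assume f: "lform W f"
  have "f (rep_act ?R x n) = tsum x (\<lambda>p h. tsum (yd_coact N (yd_act N (\<tau> h) n)) (\<lambda>m0 m1. (p \<circ> \<kappa>) m1 * f m0))"
    unfolding act[OF x] to_rep_act(2)[OF N tcls_in[OF wf[OF x]] n f]
      tsum_tcls[OF vsp_dual vsp_alg to_rep_bform[OF N n f] wf[OF x]] by simp
  also have "\<dots> = tsum x (\<lambda>p h. tsum (yd_coact PN (yd_act PN h n)) (\<lambda>m0 m1. p m1 * f m0))"
  proof (rule tsum_congI)
    fix p h assume "(p, h) \<in> set x"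
    then have p: "lform A p" by (rule E_memD[OF x])
    have "bform W A (\<lambda>m0 m1. p m1 * f m0)" using p f by (intro bformI lform_mult_left lform_mult_right)
    from coact_tsum[OF this yd_mem(1)[OF N n, of "\<tau> h"]]
    show "tsum (yd_coact N (yd_act N (\<tau> h) n)) (\<lambda>m0 m1. (p \<circ> \<kappa>) m1 * f m0) =
      tsum (yd_coact PN (yd_act PN h n)) (\<lambda>m0 m1. p m1 * f m0)"
      by (simp add: act_eq[OF n])
  qed
  finally show "f (rep_act ?R x n) = tsum x (\<lambda>p h. tsum (yd_coact PN (yd_act PN h n)) (\<lambda>m0 m1. p m1 * f m0))" .
qed

end

context fd_hopf_algebra
begin

lemma to_rep_unit: "to_rep (yd_unit H :: ('k, 'h, 'a) yd_obj) = rep_unit G DTH"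
proof (rule rep_obj_eqI[OF yd_unit_in], unfold yd_unit_simps(2))
  let ?U = "yd_unit H :: ('k, 'h, 'a) yd_obj" and ?R = "rep_unit G DTH :: ('h aut_pair, 'k, ('k, 'h) dt, 'a) rep_obj"
  show "rep_index ?R = yd_index ?U" "rep_space ?R = unit_space"
    by (simp_all add: rep_unit_def yd_unit_simps aut_group_def)
  show "rep_act ?R \<in> extensional (carrier E)" by (simp add: rep_unit_def del: unit_space_simps)
  show "rep_act ?R x \<in> extensional (carrier unit_space)" if "x \<in> carrier E" for x
    using that by (simp add: rep_unit_def del: unit_space_simps)
  fix x m assume x: "x \<in> carrier E" and m: "m \<in> carrier (unit_space :: ('k, 'a) vspace)"
  have act: "rep_act ?R x m = dt_counit H x \<odot>\<^bsub>unit_space\<^esub> m"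
    using x m by (simp add: rep_unit_def del: unit_space_simps)
  note vU = is_vspace_vsp[OF is_vspace_unit_space]
  show "rep_act ?R x m \<in> carrier unit_space" unfolding act by (rule vspD(7)[OF vU m])
  fix f :: "('k, 'a) vuniv \<Rightarrow> 'k" assume f: "lform unit_space f"
  have "f (rep_act ?R x m) = tsum x (\<lambda>p h. p 1 * (counit H h * f m))"
    unfolding act lformD(2)[OF f m] by (simp add: dt_counit_def tsum_def[symmetric] tsum_mult_right mult.assoc[symmetric])
  also have "\<dots> = tsum x (\<lambda>p h. tsum (yd_coact ?U (yd_act ?U h m)) (\<lambda>m0 m1. p m1 * f m0))"
  proof (rule tsum_congI)
    fix p h assume "(p, h) \<in> set x"
    then have p: "lform A p" by (rule E_memD[OF x])
    have F: "bform unit_space A (\<lambda>m0 m1. p m1 * f m0)" using p f by (intro bformI lform_mult_left lform_mult_right)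
    have c: "yd_act ?U h m \<in> carrier unit_space" using yd_mem(1)[OF yd_unit_in] m unfolding yd_unit_simps(2) by blast
    show "p 1 * (counit H h * f m) = tsum (yd_coact ?U (yd_act ?U h m)) (\<lambda>m0 m1. p m1 * f m0)"
      unfolding yd_unit_coact_tsum[OF F c] yd_unit_act_lform[OF f m] ..
  qed
  finally show "f (rep_act ?R x m) = tsum x (\<lambda>p h. tsum (yd_coact ?U (yd_act ?U h m)) (\<lambda>m0 m1. p m1 * f m0))" .
qed

lemma to_rep_preserves:
  fixes M N :: "('k, 'h, 'a) yd_obj"
  assumes N: "N \<in> yd_objects H"
  shows "M \<in> yd_objects H \<Longrightarrow> to_rep (yd_tensor H M N) = rep_tensor G DTH (to_rep M) (to_rep N)"
    and "M \<in> yd_objects H \<Longrightarrow> yd_braid H M N = rep_braid DTH (to_rep M) (to_rep N)"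
    and "b \<in> carrier G \<Longrightarrow> to_rep (yd_phi H b N) = rep_phi G DTH b (to_rep N)"
proof -
  show "to_rep (yd_tensor H M N) = rep_tensor G DTH (to_rep M) (to_rep N)"
    "yd_braid H M N = rep_braid DTH (to_rep M) (to_rep N)" if M: "M \<in> yd_objects H"
  proof -
    interpret dt_pair H B M N "fst (yd_index M)" "snd (yd_index M)" "fst (yd_index N)" "snd (yd_index N)"
      by (intro dt_pair.intro fd_hopf_algebra_axioms yd_pairI M N)
    show "to_rep (yd_tensor H M N) = rep_tensor G DTH (to_rep M) (to_rep N)"
      "yd_braid H M N = rep_braid DTH (to_rep M) (to_rep N)" by (rule to_rep_tensor to_rep_braid[symmetric])+
  qed
  assume b: "b \<in> carrier G"
  interpret dt_twist H B N "fst b" "snd b" "fst (yd_index N)" "snd (yd_index N)"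
    by (intro dt_twist.intro fd_hopf_algebra_axioms yd_twistI N b)
  show "to_rep (yd_phi H b N) = rep_phi G DTH b (to_rep N)" using to_rep_phi by simp
qed

section \<open>The isomorphism of braided T-categories\<close>

lemma Rep_simps:
  "Obj (Rep G DTH) = rep_objects G DTH"
  "Arr (Rep G DTH) = {(M, f, N). M \<in> rep_objects G DTH \<and> N \<in> rep_objects G DTH \<and> f \<in> rep_homs DTH M N}"
  "Dom (Rep G DTH) (M, f, N) = M" "Cod (Rep G DTH) (M, f, N) = N"
  "Ide (Rep G DTH) M = (M, \<lambda>x\<in>carrier (rep_space M). x, M)"
  "Cmp (Rep G DTH) (M', g, N') (M, f, N) = (M, compose (carrier (rep_space M)) g f, N')"
  "TenO (Rep G DTH) = rep_tensor G DTH"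
  "TenA (Rep G DTH) (M, f, N) (M', f', N') = (rep_tensor G DTH M M',
     tensor_map (rep_space M) (rep_space M') (rep_space N) (rep_space N') f f', rep_tensor G DTH N N')"
  "UnitO (Rep G DTH) = rep_unit G DTH"
  "Assoc (Rep G DTH) L M N = (rep_tensor G DTH (rep_tensor G DTH L M) N,
     assoc_map (rep_space L) (rep_space M) (rep_space N), rep_tensor G DTH L (rep_tensor G DTH M N))"
  "LUnit (Rep G DTH) M = (rep_tensor G DTH (rep_unit G DTH) M, lunit_map (rep_space M), M)"
  "RUnit (Rep G DTH) M = (rep_tensor G DTH M (rep_unit G DTH), runit_map (rep_space M), M)"
  "Part (Rep G DTH) a = {M \<in> rep_objects G DTH. rep_index M = a}"
  "PhiO (Rep G DTH) = rep_phi G DTH"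
  "PhiA (Rep G DTH) b (M, f, N) = (rep_phi G DTH b M, f, rep_phi G DTH b N)"
  "Braid (Rep G DTH) M N = (rep_tensor G DTH M N, rep_braid DTH M N, rep_tensor G DTH (rep_phi G DTH (rep_index M) N) M)"
  by (simp_all add: Rep_def T_cat_over_vspaces_def)

definition to_rep_arr where "to_rep_arr = (\<lambda>(M, f, N). (to_rep M, f, to_rep N))"

lemma to_rep_arr_simp: "to_rep_arr (M, f, N) = (to_rep M, f, to_rep N)"
  by (simp add: to_rep_arr_def)

lemma to_rep_iso:
  "braided_T_iso G (YD H) (Rep G DTH) (to_rep :: ('k, 'h, 'a) yd_obj \<Rightarrow> _) to_rep_arr"
  (is "braided_T_iso _ ?C ?R ?FO ?FA")
proof -
  note [simp] = YD_simps Rep_simps to_rep_arr_simp to_rep_preserves to_rep_unit to_rep_homs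
    yd_tensor_in yd_unit_in yd_phi_in yd_tensor_space yd_phi_space yd_unit_simps(2)
  note [simp del] = aut_group_simps carrier_aut_group
  have in_rep [simp]: "to_rep M \<in> rep_objects G DTH" if "M \<in> yd_objects H" for M :: "('k, 'h, 'a) yd_obj"
    using to_rep_in[OF that] .
  have inj [simp]: "to_rep M = to_rep N \<longleftrightarrow> M = N" if "M \<in> yd_objects H" "N \<in> yd_objects H" for M N :: "('k, 'h, 'a) yd_obj"
    using to_rep_inj that by (auto simp: inj_on_def)
  have surj: "\<exists>M\<in>yd_objects H. U = to_rep M" if "U \<in> rep_objects G DTH" for U :: "('h aut_pair, 'k, ('k, 'h) dt, 'a) rep_obj"
    using to_rep_bij that by (auto simp: bij_betw_def)
  have index: "yd_index M \<in> carrier G" if "M \<in> yd_objects H" for M :: "('k, 'h, 'a) yd_obj"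
    using yd_index_in[OF that] .
  \<comment> \<open>The predicates \<open>P\<close> and \<open>Q\<close> make one argument serve
    both for all arrows and for the arrows of a single component.\<close>
  have arr: "to_rep_arr ` {(M, f, N). M \<in> yd_objects H \<and> N \<in> yd_objects H \<and> f \<in> yd_homs H M N \<and> P M \<and> P N} =
      {(U, f, W). U \<in> rep_objects G DTH \<and> W \<in> rep_objects G DTH \<and> f \<in> rep_homs DTH U W \<and> Q U \<and> Q W}"
    if PQ: "\<And>M. M \<in> yd_objects H \<Longrightarrow> Q (to_rep M) \<longleftrightarrow> P M" for P :: "('k, 'h, 'a) yd_obj \<Rightarrow> bool" and Q
  proof (intro equalityI subsetI)
    show "F \<in> {(U, f, W). U \<in> rep_objects G DTH \<and> W \<in> rep_objects G DTH \<and> f \<in> rep_homs DTH U W \<and> Q U \<and> Q W}"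
      if "F \<in> to_rep_arr ` {(M, f, N). M \<in> yd_objects H \<and> N \<in> yd_objects H \<and> f \<in> yd_homs H M N \<and> P M \<and> P N}" for F
      using that PQ by auto
    fix F assume "F \<in> {(U, f, W). U \<in> rep_objects G DTH \<and> W \<in> rep_objects G DTH \<and> f \<in> rep_homs DTH U W \<and> Q U \<and> Q W}"
    then obtain U f W where *: "F = (U, f, W)" "U \<in> rep_objects G DTH" "W \<in> rep_objects G DTH" "f \<in> rep_homs DTH U W" "Q U" "Q W"
      by blast
    obtain M N where "M \<in> yd_objects H" "U = to_rep M" "N \<in> yd_objects H" "W = to_rep N"
      using surj[OF *(2)] surj[OF *(3)] by blast
    then show "F \<in> to_rep_arr ` {(M, f, N). M \<in> yd_objects H \<and> N \<in> yd_objects H \<and> f \<in> yd_homs H M N \<and> P M \<and> P N}"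
      using * PQ by (intro image_eqI[of _ _ "(M, f, N)"]) auto
  qed
  have "is_functor ?C ?R to_rep to_rep_arr"
    unfolding is_functor_def arrow_def by auto
  moreover have "strict_monoidal_functor ?C ?R to_rep to_rep_arr"
    unfolding strict_monoidal_functor_def using calculation by auto
  moreover have "bij_betw to_rep (Obj ?C) (Obj ?R)" using to_rep_bij by simp
  moreover have "bij_betw to_rep_arr (Arr ?C) (Arr ?R)"
    using arr[of "\<lambda>_. True" "\<lambda>_. True", simplified] by (auto simp: bij_betw_def inj_on_def)
  moreover have "to_rep ` Part ?C a = Part ?R a" for a
    using surj by fastforce
  moreover have "to_rep_arr ` part_arrows ?C a = part_arrows ?R a" for a
  proof -
    have "part_arrows ?C a = {(M, f, N). M \<in> yd_objects H \<and> N \<in> yd_objects H \<and> f \<in> yd_homs H M N \<and> yd_index M = a \<and> yd_index N = a}"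
      "part_arrows ?R a = {(U, f, W). U \<in> rep_objects G DTH \<and> W \<in> rep_objects G DTH \<and> f \<in> rep_homs DTH U W \<and> rep_index U = a \<and> rep_index W = a}"
      by (auto simp: part_arrows_def)
    then show ?thesis using arr[of "\<lambda>U. rep_index U = a" "\<lambda>M. yd_index M = a"] by simp
  qed
  moreover have "to_rep_arr (Braid ?C M N) = Braid ?R (to_rep M) (to_rep N)" if "M \<in> Obj ?C" "N \<in> Obj ?C" for M N
    using that index by simp
  ultimately show ?thesis
    unfolding braided_T_iso_def invertible_strict_monoidal_functor_def by auto
qed

text \<open>The isomorphism was built out of \<open>YD\<close>, whose axioms are known. Transport
  along it gives the axioms for \<open>Rep\<close>, and its inverse has the direction asked
  for.\<close>

lemma isomorphic: "isomorphic_braided_T_categories G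
    (Rep G DTH ::
      ('h aut_pair, ('h aut_pair, 'k, ('k, 'h) dt, 'a) rep_obj,
       ('h aut_pair, 'k, ('k, 'h) dt, 'a) rep_obj \<times> (('k, 'a) vuniv \<Rightarrow> ('k, 'a) vuniv) \<times>
       ('h aut_pair, 'k, ('k, 'h) dt, 'a) rep_obj) T_cat)
    (YD H ::
      ('h aut_pair, ('k, 'h, 'a) yd_obj,
       ('k, 'h, 'a) yd_obj \<times> (('k, 'a) vuniv \<Rightarrow> ('k, 'a) vuniv) \<times> ('k, 'h, 'a) yd_obj) T_cat)"
  (is "isomorphic_braided_T_categories _ ?R ?C")
proof -
  interpret braided_T_transfer G ?C ?R to_rep to_rep_arr
    by (intro braided_T_transfer.intro braided_T_category_YD braided_T_transfer_axioms.intro to_rep_iso)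
  show ?thesis
    unfolding isomorphic_braided_T_categories_def
    using braided_T_category_D braided_T_category_axioms braided_T_iso_inverse by blast
qed

end

text \<open>The basis \<open>B\<close> witnesses finite dimension and is at the same time the one
  from which the \<open>R\<close>-matrix is computed; bijectivity of the antipode makes
  \<open>finv (antipode H)\<close> a genuine inverse. The type \<open>'a\<close> of atoms in the
  universe of vector spaces is arbitrary.\<close>

theorem theorem3p10:
  fixes H :: "('k::field, 'h::ring_1) hopf_data" and B :: "'h set"
  assumes "hopf_algebra H"
    and "finite_dimensional_vector_space (scl H) B"
    and "bij (antipode H)"
  shows "isomorphic_braided_T_categories (aut_group H)
    (Rep (aut_group H) (DT H B) ::
      ('h aut_pair, ('h aut_pair, 'k, ('k, 'h) dt, 'a) rep_obj,
       ('h aut_pair, 'k, ('k, 'h) dt, 'a) rep_obj \<times> (('k, 'a) vuniv \<Rightarrow> ('k, 'a) vuniv) \<times>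
       ('h aut_pair, 'k, ('k, 'h) dt, 'a) rep_obj) T_cat)
    (YD H ::
      ('h aut_pair, ('k, 'h, 'a) yd_obj,
       ('k, 'h, 'a) yd_obj \<times> (('k, 'a) vuniv \<Rightarrow> ('k, 'a) vuniv) \<times> ('k, 'h, 'a) yd_obj) T_cat)"
proof -
  interpret fd_hopf_algebra H B
    by (intro fd_hopf_algebra.intro hopf_algebra_bij.intro hopf_algebra_bij_axioms.intro
      fd_hopf_algebra_axioms.intro assms)
  show ?thesis by (rule isomorphic)
qed

end
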